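(* In the polynomial ring $\mathbb{C}[x_1,\ldots,x_n]$, consider bases $\{B_\alpha\}$ indexed by weak compositions $\alpha\in\mathbb{N}^n$, with structure constants $c(\alpha,\beta,\gamma)$ defined by $B_\alpha B_\beta=\sum_\gamma c(\alpha,\beta,\gamma)B_\gamma$, viewed as a function of $(\alpha,\beta,\gamma)$. Then the monomial slide polynomials $\{\mathfrak{M}_\alpha\}$ and the fundamental slide polynomials $\{\mathfrak{F}_\alpha\}$ have structure constants in $\#\mathsf{P}$; and the Demazure atoms $\{\mathrm{atom}_\alpha\}$, key polynomials $\{\kappa_\alpha\}$, Schubert polynomials $\{\mathfrak{S}_\alpha\}$, Lascoux polynomials $\{\mathfrak{L}_\alpha\}$, and Grothendieck polynomials $\{\mathfrak{G}_\alpha\}$ have structure constants in $\mathsf{GapP}$.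
   Context: Complexity: compositions are encoded in unary; $f\in\#\mathsf{P}$ if $f(w)=\#\{u:(w,u)\in B\}$ for a polynomial-time decidable $B$ with polynomially bounded witnesses; $\mathsf{GapP}=\#\mathsf{P}-\#\mathsf{P}$. Dominance on weak compositions of the same size: $\beta\unlhd\alpha$ iff $\beta_1+\cdots+\beta_i\ge\alpha_1+\cdots+\alpha_i$ for all $i$. $\mathrm{flat}(\alpha)$ is the strong composition obtained by deleting zeros; for strong compositions, $\gamma\preccurlyeq\delta$ means $\gamma$ refines $\delta$ (i.e. $\delta$ is obtained by adding consecutive parts of $\gamma$). Write $x^\beta=x_1^{\beta_1}\cdots x_n^{\beta_n}$. - $\mathfrak{M}_\alpha=\sum_{\beta\unlhd\alpha,\ \mathrm{flat}(\beta)=\mathrm{flat}(\alpha)}x^\beta$; $\mathfrak{F}_\alpha=\sum_{\beta\unlhd\alpha,\ \mathrm{flat}(\beta)\preccurlyeq\mathrm{flat}(\alpha)}x^\beta$. - Let $\partial_i f=(f-s_if)/(x_i-x_{i+1})$, where $s_i$ swaps $x_i,x_{i+1}$; $s_i\alpha$ swaps $\alpha_i,\alpha_{i+1}$. For $\alpha$ weakly decreasing, $\kappa_\alpha=\mathrm{atom}_\alpha=\mathfrak{L}_\alpha=x^\alpha$; and if $\alpha_i>\alpha_{i+1}$ then $\kappa_{s_i\alpha}=\partial_i(x_i\kappa_\alpha)$, $\mathrm{atom}_{s_i\alpha}=\partial_i(x_i\,\mathrm{atom}_\alpha)-\mathrm{atom}_\alpha$, $\mathfrak{L}_{s_i\alpha}=\partial_i(x_i(1-x_{i+1})\mathfrak{L}_\alpha)$.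 - For $w\in S_m$, Schubert polynomials: $\mathfrak{S}_{w_0}=x_1^{m-1}x_2^{m-2}\cdots x_{m-1}$ ($w_0$ the longest element) and $\mathfrak{S}_{ws_i}=\partial_i\mathfrak{S}_w$ when $w(i)>w(i+1)$; Grothendieck polynomials: $\mathfrak{G}_{w_0}=x_1^{m-1}\cdots x_{m-1}$ and $\mathfrak{G}_{ws_i}=\partial_i((1-x_{i+1})\mathfrak{G}_w)$ when $w(i)>w(i+1)$; these are independent of $m$ and hence defined for $w\in S_\infty$. The Lehmer code of $w$ is $c_i(w)=\#\{j>i:w(j)<w(i)\}$; it is a bijection from $S_\infty$ to finitely supported sequences in $\mathbb{N}$, and $\mathfrak{S}_\alpha:=\mathfrak{S}_w$, $\mathfrak{G}_\alpha:=\mathfrak{G}_w$ where $w$ has code $\alpha$. *)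

theory Defs
  imports
    Complex_Main
    "HOL-Library.Poly_Mapping"
    "HOL-Combinatorics.Permutations"
    "HOL-Computational_Algebra.Polynomial"
begin

section \<open>Polynomials\<close>

text \<open>
  Polynomials in countably many variables over the complex numbers. Variables, parts of
  compositions, and the points on which permutations act are numbered from 0, so the variable
  \<open>x_i\<close> of the literature is \<open>var (i - 1)\<close> here.
\<close>

type_synonym cpoly = "(nat \<Rightarrow>\<^sub>0 nat) \<Rightarrow>\<^sub>0 complex"

definition scale :: "complex \<Rightarrow> cpoly \<Rightarrow> cpoly" where
  "scale c p = Poly_Mapping.single 0 c * p"

interpretation cpoly: vector_space scale
  by unfold_locales
    (simp_all add: scale_def distrib_left distrib_right single_add mult_single flip: mult.assoc)

definition polys :: "nat \<Rightarrow> cpoly set" where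
  "polys n = {p. \<forall>m \<in> Poly_Mapping.keys p. Poly_Mapping.keys m \<subseteq> {..<n}}"

definition var :: "nat \<Rightarrow> cpoly" where
  "var i = Poly_Mapping.single (Poly_Mapping.single i 1) 1"

definition xpow :: "nat list \<Rightarrow> cpoly" where
  "xpow \<beta> = Poly_Mapping.single (Poly_Mapping.nth \<beta>) 1"

definition swap_vars :: "nat \<Rightarrow> cpoly \<Rightarrow> cpoly" where
  "swap_vars i = Poly_Mapping.map_key (Poly_Mapping.map_key (transpose i (Suc i)))"

definition divdiff :: "nat \<Rightarrow> cpoly \<Rightarrow> cpoly" where
  "divdiff i f = (THE g. (var i - var (Suc i)) * g = f - swap_vars i f)"

section \<open>Weak compositions and slide polynomials\<close>

definition comps :: "nat \<Rightarrow> nat list set" where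
  "comps n = {\<alpha>. length \<alpha> = n}"

definition dominated :: "nat list \<Rightarrow> nat list \<Rightarrow> bool" where
  "dominated \<beta> \<alpha> \<longleftrightarrow> length \<beta> = length \<alpha> \<and> sum_list \<beta> = sum_list \<alpha> \<and>
     (\<forall>i \<le> length \<alpha>. sum_list (take i \<beta>) \<ge> sum_list (take i \<alpha>))"

definition flat :: "nat list \<Rightarrow> nat list" where
  "flat \<alpha> = filter (\<lambda>a. a \<noteq> 0) \<alpha>"

definition refines :: "nat list \<Rightarrow> nat list \<Rightarrow> bool" where
  "refines \<gamma> \<delta> \<longleftrightarrow>
     (\<exists>blocks. [] \<notin> set blocks \<and> concat blocks = \<gamma> \<and> map sum_list blocks = \<delta>)"

definition monomial_slide :: "nat list \<Rightarrow> cpoly" where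
  "monomial_slide \<alpha> = (\<Sum>\<beta> | dominated \<beta> \<alpha> \<and> flat \<beta> = flat \<alpha>. xpow \<beta>)"

definition fundamental_slide :: "nat list \<Rightarrow> cpoly" where
  "fundamental_slide \<alpha> = (\<Sum>\<beta> | dominated \<beta> \<alpha> \<and> refines (flat \<beta>) (flat \<alpha>). xpow \<beta>)"

section \<open>Key polynomials, Demazure atoms, Lascoux polynomials\<close>

definition swap_parts :: "nat \<Rightarrow> nat list \<Rightarrow> nat list" where
  "swap_parts i \<alpha> = \<alpha>[i := \<alpha> ! Suc i, Suc i := \<alpha> ! i]"

text \<open>
  \<open>from_decreasing D \<alpha> p\<close>: the polynomial \<open>p\<close> is obtained for \<open>\<alpha>\<close> by some chain of recursion
  steps \<open>f_{s_i \<alpha>} = D i f_\<alpha>\<close> with \<open>\<alpha>_i > \<alpha>_{i+1}\<close>, starting from a weakly decreasing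
  composition. The result does not depend on the chain for the operators used below.
\<close>

inductive from_decreasing ::
  "(nat \<Rightarrow> cpoly \<Rightarrow> cpoly) \<Rightarrow> nat list \<Rightarrow> cpoly \<Rightarrow> bool" for D where
  base: "sorted_wrt (\<ge>) \<alpha> \<Longrightarrow> from_decreasing D \<alpha> (xpow \<alpha>)"
| step: "\<lbrakk>from_decreasing D \<alpha> p; Suc i < length \<alpha>; \<alpha> ! i > \<alpha> ! Suc i\<rbrakk>
    \<Longrightarrow> from_decreasing D (swap_parts i \<alpha>) (D i p)"

definition key_poly :: "nat list \<Rightarrow> cpoly" where
  "key_poly \<alpha> = (THE p. from_decreasing (\<lambda>i f. divdiff i (var i * f)) \<alpha> p)"

definition demazure_atom :: "nat list \<Rightarrow> cpoly" where
  "demazure_atom \<alpha> = (THE p. from_decreasing (\<lambda>i f. divdiff i (var i * f) - f) \<alpha> p)"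

definition lascoux_poly :: "nat list \<Rightarrow> cpoly" where
  "lascoux_poly \<alpha> =
     (THE p. from_decreasing (\<lambda>i f. divdiff i (var i * (1 - var (Suc i)) * f)) \<alpha> p)"

section \<open>Schubert and Grothendieck polynomials\<close>

definition longest_perm :: "nat \<Rightarrow> nat \<Rightarrow> nat" where
  "longest_perm m i = (if i < m then m - Suc i else i)"

text \<open>The list \<open>rev [0..<m]\<close> is the staircase \<open>(m-1, ..., 1, 0)\<close>.\<close>

inductive from_longest ::
  "(nat \<Rightarrow> cpoly \<Rightarrow> cpoly) \<Rightarrow> nat \<Rightarrow> (nat \<Rightarrow> nat) \<Rightarrow> cpoly \<Rightarrow> bool" for D m where
  base: "from_longest D m (longest_perm m) (xpow (rev [0..<m]))"
| step: "\<lbrakk>from_longest D m w p; Suc i < m; w i > w (Suc i)\<rbrakk>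
    \<Longrightarrow> from_longest D m (w \<circ> transpose i (Suc i)) (D i p)"

definition schubert_perm :: "(nat \<Rightarrow> nat) \<Rightarrow> cpoly" where
  "schubert_perm w = (THE p. \<exists>m. w permutes {..<m} \<and> from_longest divdiff m w p)"

definition grothendieck_perm :: "(nat \<Rightarrow> nat) \<Rightarrow> cpoly" where
  "grothendieck_perm w = (THE p. \<exists>m. w permutes {..<m} \<and>
     from_longest (\<lambda>i f. divdiff i ((1 - var (Suc i)) * f)) m w p)"

definition lehmer_code :: "(nat \<Rightarrow> nat) \<Rightarrow> nat \<Rightarrow> nat" where
  "lehmer_code w i = card {j. i < j \<and> w j < w i}"

definition perm_of_code :: "nat list \<Rightarrow> nat \<Rightarrow> nat" where
  "perm_of_code \<alpha> =
     (THE w. (\<exists>m. w permutes {..<m}) \<and> (\<forall>i. lehmer_code w i = nth_default 0 \<alpha> i))"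

definition schubert_poly :: "nat list \<Rightarrow> cpoly" where
  "schubert_poly \<alpha> = schubert_perm (perm_of_code \<alpha>)"

definition grothendieck_poly :: "nat list \<Rightarrow> cpoly" where
  "grothendieck_poly \<alpha> = grothendieck_perm (perm_of_code \<alpha>)"

section \<open>Bases and structure constants\<close>

definition poly_basis :: "nat \<Rightarrow> (nat list \<Rightarrow> cpoly) \<Rightarrow> bool" where
  "poly_basis n B \<longleftrightarrow> inj_on B (comps n) \<and> cpoly.independent (B ` comps n) \<and>
     cpoly.span (B ` comps n) = polys n"

text \<open>Meaningful when \<open>poly_basis (length \<alpha>) B\<close> and all three compositions have the same length.\<close>

definition structure_const ::
  "(nat list \<Rightarrow> cpoly) \<Rightarrow> nat list \<Rightarrow> nat list \<Rightarrow> nat list \<Rightarrow> complex" where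
  "structure_const B \<alpha> \<beta> \<gamma> =
     cpoly.representation (B ` comps (length \<alpha>)) (B \<alpha> * B \<beta>) (B \<gamma>)"

section \<open>Turing machines\<close>

text \<open>
  Deterministic multi-tape machines with two-way infinite tapes. States and tape symbols are
  initial segments of the naturals. State 0 is initial, state 1 accepting, state 2 rejecting;
  symbol 0 is the blank, and the bits \<open>False\<close>, \<open>True\<close> are the symbols 1, 2.
\<close>

datatype dir = GoLeft | GoRight | Stay

record tm =
  tapes :: nat
  states :: nat
  symbols :: nat
  trans :: "nat \<Rightarrow> nat list \<Rightarrow> nat \<times> (nat \<times> dir) list"

definition wf_tm :: "tm \<Rightarrow> bool" where
  "wf_tm M \<longleftrightarrow> tapes M \<ge> 2 \<and> states M \<ge> 3 \<and> symbols M \<ge> 3 \<and>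
     (\<forall>q < states M. \<forall>ss. length ss = tapes M \<and> set ss \<subseteq> {..<symbols M} \<longrightarrow>
        (case trans M q ss of (q', acts) \<Rightarrow>
           q' < states M \<and> length acts = tapes M \<and> fst ` set acts \<subseteq> {..<symbols M}))"

text \<open>A tape is its contents together with the head position.\<close>

type_synonym tape = "(int \<Rightarrow> nat) \<times> int"
type_synonym config = "nat \<times> tape list"

fun read_tape :: "tape \<Rightarrow> nat" where
  "read_tape (t, h) = t h"

fun act_tape :: "nat \<times> dir \<Rightarrow> tape \<Rightarrow> tape" where
  "act_tape (s, d) (t, h) =
     (t(h := s), case d of GoLeft \<Rightarrow> h - 1 | GoRight \<Rightarrow> h + 1 | Stay \<Rightarrow> h)"

fun tm_step :: "tm \<Rightarrow> config \<Rightarrow> config" where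
  "tm_step M (q, ts) =
     (if q = 1 \<or> q = 2 then (q, ts)
      else case trans M q (map read_tape ts) of (q', acts) \<Rightarrow> (q', map2 act_tape acts ts))"

definition input_tape :: "bool list \<Rightarrow> tape" where
  "input_tape w =
     (\<lambda>i. if 0 \<le> i \<and> i < int (length w) then (if w ! nat i then 2 else 1) else 0, 0)"

text \<open>The two components of the input pair are written on the first two tapes.\<close>

definition init_config :: "tm \<Rightarrow> bool list \<Rightarrow> bool list \<Rightarrow> config" where
  "init_config M w u =
     (0, input_tape w # input_tape u # replicate (tapes M - 2) (input_tape []))"

text \<open>
  States 1 and 2 are absorbing, so being in one of them after \<open>t\<close> steps means having halted
  within \<open>t\<close> steps.
\<close>

definition poly_time_decidable :: "(bool list \<times> bool list) set \<Rightarrow> bool" where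
  "poly_time_decidable B \<longleftrightarrow> (\<exists>M (p :: nat poly). wf_tm M \<and>
     (\<forall>w u. fst ((tm_step M ^^ poly p (length w + length u)) (init_config M w u)) =
        (if (w, u) \<in> B then 1 else 2)))"

section \<open>Counting classes\<close>

definition sharpP :: "(bool list \<Rightarrow> nat) set" where
  "sharpP = {f. \<exists>B (q :: nat poly). poly_time_decidable B \<and>
     (\<forall>(w, u) \<in> B. length u \<le> poly q (length w)) \<and>
     (\<forall>w. f w = card {u. (w, u) \<in> B})}"

definition GapP :: "(bool list \<Rightarrow> int) set" where
  "GapP = {\<lambda>w. int (f w) - int (g w) | f g. f \<in> sharpP \<and> g \<in> sharpP}"

text \<open>
  Unary encoding: a part \<open>a\<close> becomes \<open>1^{a+1} 0\<close>, and a further \<open>0\<close> terminates the composition,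
  so that concatenated encodings can be separated.
\<close>

definition unary :: "nat list \<Rightarrow> bool list" where
  "unary \<alpha> = concat (map (\<lambda>a. replicate (Suc a) True @ [False]) \<alpha>) @ [False]"

definition encode3 :: "nat list \<Rightarrow> nat list \<Rightarrow> nat list \<Rightarrow> bool list" where
  "encode3 \<alpha> \<beta> \<gamma> = unary \<alpha> @ unary \<beta> @ unary \<gamma>"

definition constants_in_sharpP :: "(nat list \<Rightarrow> cpoly) \<Rightarrow> bool" where
  "constants_in_sharpP B \<longleftrightarrow> (\<exists>f \<in> sharpP. \<forall>n. \<forall>\<alpha> \<in> comps n. \<forall>\<beta> \<in> comps n. \<forall>\<gamma> \<in> comps n.
     structure_const B \<alpha> \<beta> \<gamma> = of_nat (f (encode3 \<alpha> \<beta> \<gamma>)))"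

definition constants_in_GapP :: "(nat list \<Rightarrow> cpoly) \<Rightarrow> bool" where
  "constants_in_GapP B \<longleftrightarrow> (\<exists>f \<in> GapP. \<forall>n. \<forall>\<alpha> \<in> comps n. \<forall>\<beta> \<in> comps n. \<forall>\<gamma> \<in> comps n.
     structure_const B \<alpha> \<beta> \<gamma> = of_int (f (encode3 \<alpha> \<beta> \<gamma>)))"

end

theory Submission
  imports Defs
begin

text \<open>
  All five operator families arise from the operators \<open>E i = T s t i + c\<close>, where \<open>T s t i\<close> is a divided
  difference followed by multiplication with \<open>x_{i+1}^s (1 - t x_i)\<close>. These operators satisfy the
  braid relations, and the complementary operators \<open>F i\<close> satisfy \<open>F i (E i f) = 0\<close>; applying a chain of
  operators \<open>F i\<close> and reading off one coefficient (after multiplication with a Vandermonde-like weight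
  in the case of keys, atoms and Lascoux polynomials) gives functionals dual to the family. Hence the
  family is a basis, and a structure constant is one coefficient of the result of polynomially many
  elementary linear operators applied to a monomial. The matrix of each elementary operator on
  monomials has entries in \<open>{-1, 0, 1}\<close> that are decidable in polynomial time, so the coefficient is a
  signed count of paths, that is, a function in GapP.

  The products of slide polynomials are sorted into classes of monomials. Each class consists of the
  monomials given by bounded sequences with prescribed gaps, has a unique tight (that is, maximal)
  sequence, and sums to the slide polynomial of that sequence; so a structure constant counts the
  tight sequences, which are polynomially checkable witnesses.

  Polynomial-time decidability is obtained by compiling a small language of counter programs to
  Turing machines; a function is \<open>pc\<close> if such a program computes it with polynomial values and
  running time.
\<close>

section \<open>Counter programs and Turing machines\<close>

text \<open>Multiplication is not linear, so both factors are built side by side in disjoint sets of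
  variables, where the operators of one set are linear over the other; then the second set is
  substituted by the first. Only thus a structure constant becomes an entry of a product of
  matrices. The Lascoux and Grothendieck families are inhomogeneous: neither degree nor
  rearrangement class separates their members, so the base functional has to vanish on every
  competitor of the same length. For keys, atoms and Lascoux polynomials the weight is a Vandermonde
  product times truncated powers of \<open>1/(1 - t x_i)\<close>; it makes \<open>T\<close>
  self-adjoint, the operators move to the other factor, and a degree bound in the last variable
  excludes the competitor. Spanning is a dimension count in a box of exponents that the operators
  respect. In one-line notation the longest permutation is the decreasing list
  \<open>(m-1, ..., 0)\<close> and its monomial is the staircase, so the key recursion also covers
  the Schubert side. The unary encoding keeps all numbers polynomial in the input. Hence counters
  suffice, and a counter can be a head position on a tape with fixed contents.\<close>

datatype com = Skip | Inc nat | Dec nat | Seq com com | Branch nat nat com com | Until nat nat com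

definition bit_sym :: "bool list => nat => nat" where
  "bit_sym w i = (if i < length w then (if w ! i then 2 else 1) else 0)"

text \<open>Registers are head positions. Tapes 0 and 1 hold the input; each further tape carries a
  single marker 1 in cell 0 and blanks elsewhere, so reading 1 is the zero test of a
  counter.\<close>

definition head_sym :: "bool list => bool list => (nat => nat) => nat => nat" where
  "head_sym w u s j =
     (if j = 0 then bit_sym w (s 0) else if j = 1 then bit_sym u (s 1) else if s j = 0 then 1 else 0)"

text \<open>The step counts are exactly those of the machine built below: the extra
  \<open>Suc\<close> in \<open>Seq\<close> pays for discarding a finished \<open>Skip\<close>, the
  one in \<open>Branch\<close> for the test. \<open>Dec\<close> has no rule at 0, so heads never
  leave the nonnegative cells.\<close>

inductive exec :: "bool list => bool list => com => (nat => nat) => nat => (nat => nat) => bool"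
  for w u where
  Skip: "exec w u Skip s 0 s"
| Inc: "exec w u (Inc j) s 1 (s(j := Suc (s j)))"
| Dec: "s j > 0 ==> exec w u (Dec j) s 1 (s(j := s j - 1))"
| Seq: "exec w u a s t s' ==> exec w u b s' t' s'' ==> exec w u (Seq a b) s (t + Suc t') s''"
| BranchT: "head_sym w u s j = x ==> exec w u a s t s' ==> exec w u (Branch j x a b) s (Suc t) s'"
| BranchF: "head_sym w u s j ~= x ==> exec w u b s t s' ==> exec w u (Branch j x a b) s (Suc t) s'"
| UntilT: "head_sym w u s j = x ==> exec w u (Until j x a) s 1 s"
| UntilF: "head_sym w u s j ~= x ==> exec w u a s t s' ==> exec w u (Until j x a) s' t' s'' ==>
    exec w u (Until j x a) s (Suc (t + Suc t')) s''"

text \<open>The residual command serves as program counter: \<open>ctrl\<close> gives its successor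
  from the symbols read, \<open>moves\<close> the head movements of the same step.\<close>

fun ctrl :: "com => (nat => nat) => com" where
  "ctrl (Seq a b) y = (if a = Skip then b else Seq (ctrl a y) b)"
| "ctrl (Branch j x a b) y = (if y j = x then a else b)"
| "ctrl (Until j x a) y = (if y j = x then Skip else Seq a (Until j x a))"
| "ctrl c y = Skip"

fun moves :: "com => nat => dir" where
  "moves (Inc j) = (%_. Stay)(j := GoRight)"
| "moves (Dec j) = (%_. Stay)(j := GoLeft)"
| "moves (Seq a b) = moves a"
| "moves c = (%_. Stay)"

fun shift_head :: "dir => nat => nat" where
  "shift_head GoLeft h = h - 1"
| "shift_head GoRight h = Suc h"
| "shift_head Stay h = h"

definition small :: "bool list => bool list => com \<times> (nat => nat) => com \<times> (nat => nat) => bool" where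
  "small w u = (%(c, s) (c', s'). c ~= Skip & c' = ctrl c (head_sym w u s) \<and>
     s' = (%j. shift_head (moves c j) (s j)) & (\<forall>j. moves c j = GoLeft --> s j > 0))"

lemma small_Seq: "small w u (a, s) (a', s') ==> small w u (Seq a b, s) (Seq a' b, s')"
  by (auto simp: small_def)

lemma small_steps_Seq:
  "(small w u ^^ t) (a, s) (a', s') ==> (small w u ^^ t) (Seq a b, s) (Seq a' b, s')"
proof (induction t arbitrary: a s)
  case (Suc t)
  from Suc.prems obtain a1 s1 where 1: "small w u (a, s) (a1, s1)" "(small w u ^^ t) (a1, s1) (a', s')"
    by (metis relpowp_Suc_E2 surj_pair)
  show ?case using small_Seq[OF 1(1)] Suc.IH[OF 1(2)] by (rule relpowp_Suc_I2)
qed auto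

lemma exec_small: "exec w u c s t s' ==> (small w u ^^ t) (c, s) (Skip, s')"
proof (induction rule: exec.induct)
  case (Seq a s t s' b t' s'')
  have "(small w u ^^ t) (Seq a b, s) (Seq Skip b, s')" using Seq small_steps_Seq by blast
  moreover have "small w u (Seq Skip b, s') (b, s')" by (simp add: small_def)
  then have "(small w u ^^ Suc t') (Seq Skip b, s') (Skip, s'')" using Seq.IH(2) by (rule relpowp_Suc_I2)
  ultimately show ?case by (rule relpowp_trans)
next
  case (UntilF s j x a t s' t' s'')
  let ?b = "Until j x a"
  have 1: "small w u (?b, s) (Seq a ?b, s)" using UntilF by (simp add: small_def)
  have 2: "(small w u ^^ t) (Seq a ?b, s) (Seq Skip ?b, s')" using UntilF small_steps_Seq by blast
  have "small w u (Seq Skip ?b, s') (?b, s')" by (simp add: small_def)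
  then have "(small w u ^^ Suc t') (Seq Skip ?b, s') (Skip, s'')" using UntilF.IH(2) by (rule relpowp_Suc_I2)
  with 2 have "(small w u ^^ (t + Suc t')) (Seq a ?b, s) (Skip, s'')" by (rule relpowp_trans)
  with 1 show ?case by (rule relpowp_Suc_I2)
next
  case (BranchT s j x a t s' b)
  then have "small w u (Branch j x a b, s) (a, s)" by (simp add: small_def)
  then show ?case using BranchT.IH by (rule relpowp_Suc_I2)
next
  case (BranchF s j x b t s' a)
  then have "small w u (Branch j x a b, s) (b, s)" by (simp add: small_def)
  then show ?case using BranchF.IH by (rule relpowp_Suc_I2)
qed (auto simp: small_def fun_eq_iff relcompp_apply)

text \<open>A finite set of residual commands closed under \<open>ctrl\<close>. Loops cause no
  growth because the residual of a loop body is always followed by the same \<open>Until\<close>.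
  These become the control states of the machine.\<close>

fun points :: "com => com set" where
  "points Skip = {Skip}"
| "points (Inc j) = {Inc j, Skip}"
| "points (Dec j) = {Dec j, Skip}"
| "points (Seq a b) = (%c. Seq c b) ` points a \<union> points b"
| "points (Branch j x a b) = {Branch j x a b} \<union> points a \<union> points b"
| "points (Until j x a) = {Until j x a, Skip} \<union> (%c. Seq c (Until j x a)) ` points a"

lemma finite_points: "finite (points c)"
  by (induction c) auto

lemma self_in_points: "c \<in> points c"
  by (induction c) auto

lemma ctrl_points: "c' \<in> points c ==> ctrl c' y \<in> points c"
  by (induction c arbitrary: c') (auto simp: self_in_points split: if_splits)

fun tape_bound :: "com => nat" where
  "tape_bound Skip = 0"
| "tape_bound (Inc j) = Suc j"
| "tape_bound (Dec j) = Suc j"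
| "tape_bound (Seq a b) = max (tape_bound a) (tape_bound b)"
| "tape_bound (Branch j x a b) = max (Suc j) (max (tape_bound a) (tape_bound b))"
| "tape_bound (Until j x a) = max (Suc j) (tape_bound a)"

lemma tape_bound_points: "c' \<in> points c ==> tape_bound c' <= tape_bound c"
proof (induction c arbitrary: c')
  case (Seq a b)
  then show ?case by (fastforce simp: le_max_iff_disj)
next
  case (Branch j x a b)
  then show ?case by (fastforce simp: le_max_iff_disj)
qed fastforce+

lemma ctrl_cong: "(\<And>j. j < tape_bound c ==> y j = z j) ==> ctrl c y = ctrl c z"
  by (induction c) auto

text \<open>State 0 writes the markers on the counter tapes; afterwards every cell is rewritten with
  the symbol just read, so the tapes stay fixed. When the residual is \<open>Skip\<close>, tape 2
  decides: a marker under its head, that is register 2 being 0, means rejection.\<close>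

definition machine_trans ::
  "com => nat => (com => nat) => nat => nat list => nat \<times> (nat \<times> dir) list" where
  "machine_trans c k num q ss =
     (if q = 0 then (num c, map (%j. (if j < 2 then ss ! j else 1, Stay)) [0..<k])
      else if q < 3 then (q, map (%j. (ss ! j, Stay)) [0..<k])
      else let c' = inv_into (points c) num q in
        if c' = Skip then (if ss ! 2 = 1 then 2 else 1, map (%j. (ss ! j, Stay)) [0..<k])
        else (num (ctrl c' (%j. ss ! j)), map (%j. (ss ! j, moves c' j)) [0..<k]))"

definition machine :: "com => nat => (com => nat) => tm" where
  "machine c k num = \<lparr>tapes = k, states = 3 + card (points c), symbols = 3,
     trans = machine_trans c k num\<rparr>"

definition tape_of :: "bool list => bool list => (nat => nat) => nat => tape" where
  "tape_of w u s j = ((if j = 0 then fst (input_tape w) else if j = 1 then fst (input_tape u)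
      else (%i. if i = 0 then 1 else 0)), int (s j))"

lemma read_tape_of: "read_tape (tape_of w u s j) = head_sym w u s j"
  by (auto simp: tape_of_def head_sym_def input_tape_def bit_sym_def)

lemma act_tape_of:
  assumes "x = head_sym w u s j" "d = GoLeft --> s j > 0" "s' j = shift_head d (s j)"
  shows "act_tape (x, d) (tape_of w u s j) = tape_of w u s' j"
proof -
  have "fst (tape_of w u s j) (int (s j)) = x"
    using assms(1) read_tape_of[of w u s j] by (simp add: tape_of_def)
  then show ?thesis using assms(2,3)
    by (cases d) (auto simp: tape_of_def fun_eq_iff)
qed

locale simulation =
  fixes c :: com and k :: nat and num :: "com => nat" and w u :: "bool list"
  assumes k: "k \<ge> 3" "tape_bound c <= k"
    and num: "bij_betw num (points c) {3..<3 + card (points c)}"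
begin

definition conf :: "com => (nat => nat) => config" where
  "conf c' s = (num c', map (tape_of w u s) [0..<k])"

lemma num_ge: "c' \<in> points c ==> num c' \<ge> 3"
  using num by (auto simp: bij_betw_def)

lemma inv_num: "c' \<in> points c ==> inv_into (points c) num (num c') = c'"
  using num by (auto simp: bij_betw_def)

lemma wf: "wf_tm (machine c k num)"
proof -
  have "ctrl (inv_into (points c) num q) y \<in> points c" if "q < 3 + card (points c)" "\<not> q < 3" for q y
    using that num by (intro ctrl_points inv_into_into) (auto simp: bij_betw_def)
  then have "num (ctrl (inv_into (points c) num q) y) < 3 + card (points c)"
    if "q < 3 + card (points c)" "\<not> q < 3" for q y
    using that num unfolding bij_betw_def by fastforce
  moreover have "num c < 3 + card (points c)"
    using num self_in_points[of c] unfolding bij_betw_def by fastforce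
  moreover have okj: "case machine_trans c k num q ss of (q', acts) =>
      q' < 3 + card (points c) & length acts = k & fst ` set acts \<subseteq> {..<3}"
    if "q < 3 + card (points c)" "length ss = k" "\<forall>j<k. ss ! j < 3" for q ss
    using that calculation by (auto simp: machine_trans_def Let_def)
  then have ok: "case machine_trans c k num q ss of (q', acts) =>
      q' < 3 + card (points c) & length acts = k & fst ` set acts \<subseteq> {..<3}"
    if "q < 3 + card (points c)" "length ss = k" "set ss \<subseteq> {..<3}" for q ss
  proof -
    have "\<forall>j<k. ss ! j < 3" using that by (auto simp: set_conv_nth)
    then show ?thesis by (rule okj[OF that(1,2)])
  qed
  then show ?thesis using k by (simp add: wf_tm_def machine_def)
qed

lemma nth_reads: "j < k ==> map read_tape (map (tape_of w u s) [0..<k]) ! j = head_sym w u s j"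
  by (simp add: read_tape_of)

lemma map2_acts:
  assumes "\<And>j. j < k ==> act_tape (f j) (tape_of w u s j) = tape_of w u s' j"
  shows "map2 act_tape (map f [0..<k]) (map (tape_of w u s) [0..<k]) = map (tape_of w u s') [0..<k]"
  using assms by (intro nth_equalityI) auto

lemma step:
  assumes "small w u (c', s) (c'', s')" "c' \<in> points c"
  shows "tm_step (machine c k num) (conf c' s) = conf c'' s' & c'' \<in> points c"
proof -
  let ?ss = "map read_tape (map (tape_of w u s) [0..<k])"
  have ge: "num c' \<ge> 3" using assms num_ge by blast
  have c'': "c'' = ctrl c' (head_sym w u s)" "c' ~= Skip" using assms by (auto simp: small_def)
  have b: "tape_bound c' <= k" using tape_bound_points[OF assms(2)] k by linarith
  have "ctrl c' (%j. ?ss ! j) = c''"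
    unfolding c'' using b nth_reads by (intro ctrl_cong) (simp add: less_le_trans)
  moreover have "map2 act_tape (map (%j. (?ss ! j, moves c' j)) [0..<k]) (map (tape_of w u s) [0..<k])
      = map (tape_of w u s') [0..<k]"
    using assms(1) by (intro map2_acts act_tape_of) (auto simp: small_def read_tape_of)
  ultimately have "tm_step (machine c k num) (conf c' s) = conf c'' s'"
    using ge c'' inv_num[OF assms(2)]
    by (simp add: conf_def machine_def machine_trans_def Let_def)
  then show ?thesis using ctrl_points assms(2) c'' by blast
qed

lemma steps:
  "(small w u ^^ t) (c', s) (c'', s') ==> c' \<in> points c ==>
     (tm_step (machine c k num) ^^ t) (conf c' s) = conf c'' s' & c'' \<in> points c"
proof (induction t arbitrary: c'' s')
  case (Suc t)
  from Suc.prems(1) obtain c1 s1 where "(small w u ^^ t) (c', s) (c1, s1)" "small w u (c1, s1) (c'', s')"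
    by auto
  with Suc step show ?case by fastforce
qed auto

lemma halt:
  assumes "Skip \<in> points c"
  shows "fst (tm_step (machine c k num) (conf Skip s)) = (if s 2 = 0 then 2 else 1)"
proof -
  have "num Skip \<ge> 3" using assms num_ge by blast
  moreover have "map read_tape (map (tape_of w u s) [0..<k]) ! 2 = (if s 2 = 0 then 1 else 0)"
    using k by (simp add: read_tape_of head_sym_def numeral_2_eq_2)
  ultimately show ?thesis using inv_num[OF assms]
    by (simp add: conf_def machine_def machine_trans_def Let_def)
qed

lemma start: "tm_step (machine c k num) (init_config (machine c k num) w u) = conf c (%_. 0)"
proof -
  have eq: "input_tape w # input_tape u # replicate (k - 2) (input_tape [])
      = map (%j. if j = 0 then input_tape w else if j = 1 then input_tape u else input_tape []) [0..<k]"
    using k by (intro nth_equalityI) (auto simp: nth_Cons split: nat.splits)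
  have "map2 act_tape (map (%j. (if j < 2 then map read_tape (map (%j. if j = 0 then input_tape w
      else if j = 1 then input_tape u else input_tape []) [0..<k]) ! j else 1, Stay)) [0..<k])
      (map (%j. if j = 0 then input_tape w else if j = 1 then input_tape u else input_tape []) [0..<k])
      = map (tape_of w u (%_. 0)) [0..<k]"
    using k by (intro nth_equalityI) (auto simp: tape_of_def input_tape_def fun_eq_iff)
  then show ?thesis
    unfolding init_config_def using eq by (simp add: conf_def machine_def machine_trans_def del: map_map)
qed

end

lemma halted_steps: "q = 1 | q = 2 ==> fst ((tm_step M ^^ t) (q, ts)) = q"
  by (induction t arbitrary: ts) (auto simp: funpow_swap1)

text \<open>A decider only has to leave a nonzero value in register 2. The simulation is step by
  step, so the machine needs just two more steps: one for the markers and one to enter a halting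
  state.\<close>

lemma poly_time_decidableI:
  fixes p :: "nat poly"
  assumes "\<And>w u. \<exists>t s. exec w u c (%_. 0) t s & t <= poly p (length w + length u) \<and>
     ((w, u) \<in> B \<longleftrightarrow> s 2 ~= 0)"
  shows "poly_time_decidable B"
proof -
  obtain f where "bij_betw f (points c) {0..<card (points c)}"
    using ex_bij_betw_finite_nat[OF finite_points] by blast
  moreover have "bij_betw (%x. x + 3) {0..<card (points c)} {3..<3 + card (points c)}"
    by (rule bij_betwI[where g = "%x. x - 3"]) auto
  ultimately have num: "bij_betw ((%x. x + 3) \<circ> f) (points c) {3..<3 + card (points c)}"
    by (rule bij_betw_trans)
  define num where "num = (%x. x + 3) \<circ> f"
  define k where "k = max 3 (tape_bound c)"
  define M where "M = machine c k num"
  have sim: "simulation c k num" using num by unfold_locales (auto simp: k_def num_def)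
  have "fst ((tm_step M ^^ poly (p + [:2:]) (length w + length u)) (init_config M w u)) =
        (if (w, u) \<in> B then 1 else 2)" for w u
  proof -
    obtain t s where t: "exec w u c (%_. 0) t s" "t <= poly p (length w + length u)"
      "(w, u) \<in> B \<longleftrightarrow> s 2 ~= 0" using assms by blast
    let ?conf = "simulation.conf k num w u"
    have 1: "(tm_step M ^^ t) (?conf c (%_. 0)) = ?conf Skip s" "Skip \<in> points c"
      using simulation.steps[OF sim exec_small[OF t(1)] self_in_points] by (auto simp: M_def)
    have 2: "fst (tm_step M (?conf Skip s)) = (if s 2 = 0 then 2 else 1)"
      using simulation.halt[OF sim 1(2)] by (simp add: M_def)
    \<comment> \<open>Surplus steps up to the polynomial bound are harmless, since halting states
      are absorbing.\<close>
    define r where "r = poly p (length w + length u) - t"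
    have "poly (p + [:2:]) (length w + length u) = r + (Suc (t + 1))" using t(2) by (simp add: r_def)
    then have "(tm_step M ^^ poly (p + [:2:]) (length w + length u)) (init_config M w u) =
        (tm_step M ^^ r) ((tm_step M ^^ Suc (t + 1)) (init_config M w u))"
      by (simp only: funpow_add o_apply)
    also have "(tm_step M ^^ Suc (t + 1)) (init_config M w u) =
        (tm_step M ^^ Suc t) (tm_step M (init_config M w u))"
      by (simp add: funpow_swap1)
    also have "tm_step M (init_config M w u) = ?conf c (%_. 0)"
      using simulation.start[OF sim] by (simp add: M_def)
    also have "(tm_step M ^^ Suc t) (?conf c (%_. 0)) = tm_step M (?conf Skip s)" using 1 by simp
    finally have "(tm_step M ^^ poly (p + [:2:]) (length w + length u)) (init_config M w u) =
        (tm_step M ^^ r) (tm_step M (?conf Skip s))" .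
    moreover obtain q ts where "tm_step M (?conf Skip s) = (q, ts)" by fastforce
    ultimately show ?thesis using 2 t(3) halted_steps[of q r M ts] by (auto split: if_splits)
  qed
  moreover have "wf_tm M" using simulation.wf[OF sim] by (simp add: M_def)
  ultimately show ?thesis unfolding poly_time_decidable_def by blast
qed

section \<open>Polynomial-time functions\<close>

lemma poly_nat_mono: "x <= y ==> poly (p :: nat poly) x <= poly p y"
  by (induction p) (auto intro: add_mono mult_mono)

datatype inp = Inp (Wof: "bool list") (Uof: "bool list")

text \<open>Environments are iterated products of \<open>nat\<close> ending in \<open>inp\<close>.
  Bound variables are pushed in front, as with de Bruijn indices, so that functions with any number
  of bound variables share one notion of polynomial time.\<close>

class env =
  fixes inp :: "'a => inp" and vals :: "'a => nat list"
  assumes length_vals: "length (vals x) = length (vals y)"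

instantiation inp :: env
begin
definition "inp (x :: inp) = x"
definition "vals (x :: inp) = []"
instance by standard (simp add: vals_inp_def)
end

text \<open>A type class cannot be instantiated at products whose first factor is the fixed type
  \<open>nat\<close>; this class, with the single instance \<open>nat\<close>, expresses that
  restriction.\<close>

class nat_like =
  fixes to_nat_like :: "'a => nat"

instantiation nat :: nat_like
begin
definition "to_nat_like (x :: nat) = x"
instance ..
end

instantiation prod :: (nat_like, env) env
begin
definition "inp x = inp (snd x)"
definition "vals x = to_nat_like (fst x) # vals (snd x)"
instance by standard (simp add: vals_prod_def length_vals)
end

definition env_size :: "'e::env => nat" where
  "env_size e = length (Wof (inp e)) + length (Uof (inp e)) + sum_list (vals e)"

lemma env_size_pair [simp]: "env_size (i :: nat, e) = i + env_size e"
  by (simp add: env_size_def inp_prod_def vals_prod_def to_nat_like_nat_def)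

definition runs :: "'e::env => com => (nat => nat) => nat => (nat => nat) => bool" where
  "runs e c s T s' \<longleftrightarrow> (\<exists>t\<le>T. exec (Wof (inp e)) (Uof (inp e)) c s t s')"

text \<open>The calling convention: \<open>rs\<close> are the registers of the variables, registers
  from \<open>b\<close> on are free and hold 0, and both input heads are at the left end. Compiled
  programs restore all of it except for the result in \<open>b\<close>.\<close>

definition layout :: "'e::env => nat list => nat => (nat => nat) => bool" where
  "layout e rs b s \<longleftrightarrow> 2 <= b & (\<forall>r\<in>set rs. 2 <= r & r < b) & map s rs = vals e \<and>
     (\<forall>j\<ge>b. s j = 0) & s 0 = 0 & s 1 = 0"

text \<open>One program per allocation of registers, the same for all environments. Values are held
  in unary, so a polynomial bound on the value belongs to the notion itself; it bounds the
  environments in which later code runs.\<close>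

definition pc :: "('e::env => nat) => bool" where
  "pc f \<longleftrightarrow> (\<exists>C (p :: nat poly). \<forall>e rs b s. layout e rs b s -->
     f e <= poly p (env_size e) & runs e (C rs b) s (poly p (env_size e)) (s(b := f e)))"

lemma runs_mono: "runs e c s T s' ==> T <= T' ==> runs e c s T' s'"
  unfolding runs_def using le_trans by blast

lemma runs_Seq: "runs e a s T s' ==> runs e b s' T' s'' ==> runs e (Seq a b) s (T + Suc T') s''"
  unfolding runs_def by (meson add_le_mono Suc_le_mono exec.Seq)

lemma runs_Inc: "runs e (Inc j) s 1 (s(j := Suc (s j)))"
  unfolding runs_def using exec.Inc by blast

lemma runs_Inc': "s(j := Suc (s j)) = s' ==> runs e (Inc j) s 1 s'"
  using runs_Inc by blast

lemma runs_Dec: "s j > 0 ==> runs e (Dec j) s 1 (s(j := s j - 1))"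
  unfolding runs_def using exec.Dec by blast

lemma runs_Until_stop:
  "head_sym (Wof (inp e)) (Uof (inp e)) s j = x ==> runs e (Until j x a) s 1 s"
  unfolding runs_def using exec.UntilT by blast

lemma runs_Until_go:
  assumes "head_sym (Wof (inp e)) (Uof (inp e)) s j ~= x"
    "runs e a s T s'" "runs e (Until j x a) s' T' s''"
  shows "runs e (Until j x a) s (T + T' + 2) s''"
proof -
  obtain t t' where "t <= T" "t' <= T'" "exec (Wof (inp e)) (Uof (inp e)) a s t s'"
    "exec (Wof (inp e)) (Uof (inp e)) (Until j x a) s' t' s''" using assms by (auto simp: runs_def)
  then show ?thesis unfolding runs_def using exec.UntilF[OF assms(1)]
    by (intro exI[of _ "Suc (t + Suc t')"]) auto
qed

lemma runs_Branch:
  "head_sym (Wof (inp e)) (Uof (inp e)) s j = x ==> runs e a s T s' ==> runs e (Branch j x a b) s (Suc T) s'"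
  "head_sym (Wof (inp e)) (Uof (inp e)) s j ~= x ==> runs e b s T s' ==> runs e (Branch j x a b) s (Suc T) s'"
  unfolding runs_def by (meson Suc_le_mono exec.BranchT exec.BranchF)+

lemma head_sym_reg [simp]: "2 <= j ==> head_sym w u s j = Suc 0 \<longleftrightarrow> s j = 0"
  by (auto simp: head_sym_def)

text \<open>\<open>S i\<close> is the state when the loop counter \<open>r\<close> holds
  \<open>i\<close>. Each round costs two further steps, for the test and for returning to the loop
  head.\<close>

lemma runs_countdown:
  assumes "2 <= r" "\<And>i. i <= n ==> S i r = i"
    "\<And>i. i < n ==> runs e a (S (Suc i)) T (S i)"
  shows "runs e (Until r 1 a) (S n) (n * (T + 2) + 1) (S 0)"
  using assms(2,3)
proof (induction n)
  case 0
  then show ?case using assms(1) runs_Until_stop[of e "S 0" r 1 a] by simp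
next
  case (Suc n)
  have "runs e (Until r 1 a) (S (Suc n)) (T + (n * (T + 2) + 1) + 2) (S 0)"
    using Suc assms(1) by (intro runs_Until_go[where s' = "S n"]) (auto simp: Suc.prems(1)[of "Suc n"])
  then show ?case by (rule runs_mono) auto
qed

section \<open>Elementary register programs\<close>

definition clear :: "nat => com" where
  "clear r = Until r 1 (Dec r)"

definition transfer :: "nat => nat => com" where
  "transfer r a = Until r 1 (Seq (Dec r) (Inc a))"

text \<open>Reading a counter destroys it, so copying uses two targets, one of which later restores
  the source.\<close>

definition transfer2 :: "nat => nat => nat => com" where
  "transfer2 r a b = Until r 1 (Seq (Dec r) (Seq (Inc a) (Inc b)))"

definition rewind :: "nat => nat => com" where
  "rewind r a = Until r 1 (Seq (Dec r) (Dec a))"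

lemma runs_clear: "2 <= r ==> runs e (clear r) s (s r * 3 + 1) (s(r := 0))"
proof -
  assume "2 <= r"
  then have "runs e (Until r 1 (Dec r)) (s(r := s r)) (s r * (1 + 2) + 1) (s(r := 0))"
    using runs_Dec[of "s(r := Suc i)" r e for i] by (intro runs_countdown[where S = "%i. s(r := i)"]) auto
  then show ?thesis unfolding clear_def fun_upd_triv by (rule runs_mono) simp
qed

lemma runs_transfer:
  assumes "2 <= r" "a ~= r"
  shows "runs e (transfer r a) s (s r * 5 + 1) (s(r := 0, a := s a + s r))"
proof -
  let ?S = "%i. s(r := i, a := s a + (s r - i))"
  have "runs e (Seq (Dec r) (Inc a)) (?S (Suc i)) (1 + Suc 1) (?S i)" if "i < s r" for i
  proof -
    have "runs e (Dec r) (?S (Suc i)) 1 ((?S (Suc i))(r := i))"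
      using runs_Dec[of "?S (Suc i)" r e] assms by simp
    moreover have "((?S (Suc i))(r := i))(a := Suc (((?S (Suc i))(r := i)) a)) = ?S i"
      using that assms by (auto simp: fun_eq_iff)
    then have "runs e (Inc a) ((?S (Suc i))(r := i)) 1 (?S i)" by (rule runs_Inc')
    ultimately show ?thesis by (rule runs_Seq)
  qed
  from runs_countdown[where S = ?S and n = "s r", OF assms(1) _ this]
  have "runs e (Until r 1 (Seq (Dec r) (Inc a))) (?S (s r)) (s r * ((1 + Suc 1) + 2) + 1) (?S 0)"
    using assms by simp
  then show ?thesis by (simp add: transfer_def eval_nat_numeral)
qed

lemma runs_transfer2:
  assumes "2 <= r" "a ~= r" "b ~= r" "a ~= b"
  shows "runs e (transfer2 r a b) s (s r * 7 + 1) (s(r := 0, a := s a + s r, b := s b + s r))"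
proof -
  let ?S = "%i. s(r := i, a := s a + (s r - i), b := s b + (s r - i))"
  have "runs e (Seq (Dec r) (Seq (Inc a) (Inc b))) (?S (Suc i)) (1 + Suc (1 + Suc 1)) (?S i)" if "i < s r" for i
  proof -
    let ?s1 = "(?S (Suc i))(r := i)"
    let ?s2 = "?s1(a := Suc (?s1 a))"
    have "runs e (Dec r) (?S (Suc i)) 1 ?s1"
      using runs_Dec[of "?S (Suc i)" r e] assms by simp
    moreover have "?s2(b := Suc (?s2 b)) = ?S i"
      using that assms by (auto simp: fun_eq_iff)
    then have "runs e (Seq (Inc a) (Inc b)) ?s1 (1 + Suc 1) (?S i)"
      by (rule runs_Seq[OF runs_Inc runs_Inc'])
    ultimately show ?thesis by (rule runs_Seq)
  qed
  from runs_countdown[where S = ?S and n = "s r", OF assms(1) _ this]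
  have "runs e (Until r 1 (Seq (Dec r) (Seq (Inc a) (Inc b)))) (?S (s r))
      (s r * ((1 + Suc (1 + Suc 1)) + 2) + 1) (?S 0)"
    using assms by simp
  then show ?thesis by (simp add: transfer2_def eval_nat_numeral)
qed

lemma runs_rewind:
  assumes "2 <= r" "a ~= r" "s r <= s a"
  shows "runs e (rewind r a) s (s r * 5 + 1) (s(r := 0, a := s a - s r))"
proof -
  let ?S = "%i. s(r := i, a := s a - (s r - i))"
  have "runs e (Seq (Dec r) (Dec a)) (?S (Suc i)) (1 + Suc 1) (?S i)" if "i < s r" for i
  proof -
    have "runs e (Dec r) (?S (Suc i)) 1 ((?S (Suc i))(r := i))"
      using runs_Dec[of "?S (Suc i)" r e] assms by simp
    moreover have "((?S (Suc i))(r := i))(a := ((?S (Suc i))(r := i)) a - 1) = ?S i"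
      "((?S (Suc i))(r := i)) a > 0"
      using that assms by (auto simp: fun_eq_iff)
    then have "runs e (Dec a) ((?S (Suc i))(r := i)) 1 (?S i)"
      using runs_Dec[of "(?S (Suc i))(r := i)" a e] by (simp only:)
    ultimately show ?thesis by (rule runs_Seq)
  qed
  from runs_countdown[where S = ?S and n = "s r", OF assms(1) _ this]
  have "runs e (Until r 1 (Seq (Dec r) (Dec a))) (?S (s r)) (s r * ((1 + Suc 1) + 2) + 1) (?S 0)"
    using assms by simp
  then show ?thesis by (simp add: rewind_def eval_nat_numeral)
qed

lemma pcI:
  fixes p q :: "nat poly" and f :: "'e::env => nat"
  assumes "\<And>(e :: 'e) rs b s. layout e rs b s ==> f e <= poly p (env_size e)"
    "\<And>(e :: 'e) rs b s. layout e rs b s ==> runs e (C rs b) s (poly q (env_size e)) (s(b := f e))"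
  shows "pc f"
  unfolding pc_def
proof (intro exI[of _ C] exI[of _ "p + q"] allI impI conjI)
  fix e :: 'e and rs b s assume "layout e rs b s"
  then show "f e <= poly (p + q) (env_size e)" "runs e (C rs b) s (poly (p + q) (env_size e)) (s(b := f e))"
    using assms by (auto intro: trans_le_add1 runs_mono[OF assms(2)])
qed

text \<open>Every environment is realised by some register layout, so the bound that
  \<open>pc\<close> states under \<open>layout\<close> holds outright.\<close>

lemma pc_bounded:
  assumes "pc f"
  obtains p :: "nat poly" where "\<And>e. f e <= poly p (env_size e)"
proof -
  obtain C and p :: "nat poly" where *: "\<And>e rs b s. layout e rs b s ==> f e <= poly p (env_size e)"
    using assms unfolding pc_def by blast
  have "f e <= poly p (env_size e)" for e
  proof (rule *)
    let ?n = "length (vals e)"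
    show "layout e (map (%j. j + 2) [0..<?n]) (?n + 2)
        (%j. if 2 <= j & j < ?n + 2 then vals e ! (j - 2) else 0)"
      by (auto simp: layout_def intro!: nth_equalityI)
  qed
  then show ?thesis using that by blast
qed

lemma layout_upd: "layout e rs b s ==> layout e rs (Suc b) (s(b := x))"
  by (auto simp: layout_def intro!: map_cong split: if_splits)

lemma layout_pair: "layout e rs b s ==> r < b ==> 2 <= r ==> layout (s r, e) (r # rs) b s"
  by (auto simp: layout_def vals_prod_def to_nat_like_nat_def)

lemma layout_snd: "layout (i :: nat, e) rs b s ==> layout e (tl rs) b s"
  by (cases rs) (auto simp: layout_def vals_prod_def)

lemma runs_pair [simp]: "runs (i :: nat, e) = runs e"
  by (intro ext) (simp add: runs_def inp_prod_def)

lemma pc_zero: "pc (%e. 0)"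
proof (rule pcI[where C = "%_ _. Skip" and p = 0 and q = 0])
  fix e :: 'a and rs b s assume "layout e rs b s"
  then have "s(b := 0) = s" by (auto simp: layout_def fun_eq_iff)
  then show "runs e Skip s (poly 0 (env_size e)) (s(b := 0))" using exec.Skip by (auto simp: runs_def)
qed auto

lemma pc_Suc:
  assumes "pc f"
  shows "pc (%e. Suc (f e))"
proof -
  obtain C and p :: "nat poly" where *: "\<And>e rs b s. layout e rs b s ==>
     f e <= poly p (env_size e) & runs e (C rs b) s (poly p (env_size e)) (s(b := f e))"
    using assms unfolding pc_def by blast
  show ?thesis
  proof (rule pcI[where C = "%rs b. Seq (C rs b) (Inc b)" and p = "p + 1" and q = "p + 2"])
    fix e :: 'a and rs b s assume l: "layout e rs b s"
    have "runs e (Inc b) (s(b := f e)) 1 (s(b := Suc (f e)))" using runs_Inc[of e b "s(b := f e)"] by simp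
    with *[OF l] show "runs e (Seq (C rs b) (Inc b)) s (poly (p + 2) (env_size e)) (s(b := Suc (f e)))"
      using runs_Seq by fastforce
  qed (use * in auto)
qed

lemma pc_fst: "pc (%e :: nat \<times> 'e::env. fst e)"
proof (rule pcI[where C = "%rs b. Seq (transfer2 (hd rs) b (Suc b)) (transfer (Suc b) (hd rs))"
      and p = "[:0, 1:]" and q = "[:3, 12:]"])
  fix e :: "nat \<times> 'e" and rs b s assume l: "layout e rs b s"
  then obtain r rs' where rs: "rs = r # rs'" by (cases rs) (auto simp: layout_def vals_prod_def)
  have s: "s r = fst e" "2 <= r" "r < b" "s b = 0" "s (Suc b) = 0" using l rs
    by (auto simp: layout_def vals_prod_def to_nat_like_nat_def)
  have le: "s r <= env_size e" unfolding s by (cases e) simp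
  let ?s1 = "s(r := 0, b := s b + s r, Suc b := s (Suc b) + s r)"
  have 1: "runs e (transfer2 r b (Suc b)) s (s r * 7 + 1) ?s1" using s by (intro runs_transfer2) auto
  have 2: "runs e (transfer (Suc b) r) ?s1 (?s1 (Suc b) * 5 + 1) (?s1(Suc b := 0, r := ?s1 r + ?s1 (Suc b)))"
    using s by (intro runs_transfer) auto
  have 3: "?s1(Suc b := 0, r := ?s1 r + ?s1 (Suc b)) = s(b := fst e)"
    using s by (auto simp: fun_eq_iff)
  have "runs e (Seq (transfer2 r b (Suc b)) (transfer (Suc b) r)) s
      ((s r * 7 + 1) + Suc (?s1 (Suc b) * 5 + 1)) (s(b := fst e))"
    by (rule runs_Seq[OF 1 2[unfolded 3]])
  then show "runs e (Seq (transfer2 (hd rs) b (Suc b)) (transfer (Suc b) (hd rs))) s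
      (poly [:3, 12:] (env_size e)) (s(b := fst e))"
    unfolding rs list.sel by (rule runs_mono) (use le s in simp)
  show "fst e <= poly [:0, 1:] (env_size e)" using le s by simp
qed

lemma pc_snd:
  assumes "pc f"
  shows "pc (%e :: nat \<times> 'e::env. f (snd e))"
proof -
  obtain C and p :: "nat poly" where *: "\<And>e rs b s. layout e rs b s ==>
     f e <= poly p (env_size e) & runs e (C rs b) s (poly p (env_size e)) (s(b := f e))"
    using assms unfolding pc_def by blast
  have m: "poly p (env_size (snd e)) <= poly p (env_size e)" for e :: "nat \<times> 'e"
    by (cases e) (simp add: poly_nat_mono)
  show ?thesis
  proof (rule pcI[where C = "%rs b. C (tl rs) b" and p = p and q = p])
    fix e :: "nat \<times> 'e" and rs b s assume l: "layout e rs b s"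
    then have "layout (snd e) (tl rs) b s" by (cases e) (auto dest: layout_snd)
    note * = *[OF this]
    show "f (snd e) <= poly p (env_size e)" using * m le_trans by blast
    show "runs e (C (tl rs) b) s (poly p (env_size e)) (s(b := f (snd e)))"
      using * m by (cases e) (auto intro: runs_mono)
  qed
qed

definition at_W :: "('e::env => bool list) => bool" where
  "at_W g \<longleftrightarrow> (\<forall>e. g e = Wof (inp e))"

definition at_U :: "('e::env => bool list) => bool" where
  "at_U g \<longleftrightarrow> (\<forall>e. g e = Uof (inp e))"

lemma at_W_intros: "at_W Wof" "at_W g ==> at_W (%e :: nat \<times> 'e::env. g (snd e))"
  by (simp_all add: at_W_def inp_prod_def inp_inp_def)

lemma at_U_intros: "at_U Uof" "at_U g ==> at_U (%e :: nat \<times> 'e::env. g (snd e))"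
  by (simp_all add: at_U_def inp_prod_def inp_inp_def)

definition input_of :: "nat => 'e::env => bool list" where
  "input_of j e = (if j = 0 then Wof (inp e) else Uof (inp e))"

lemma head_sym_input: "j < 2 ==> head_sym (Wof (inp e)) (Uof (inp e)) s j = bit_sym (input_of j e) (s j)"
  by (cases "j = 0") (auto simp: head_sym_def input_of_def less_2_cases_iff)

lemma length_input_le: "length (input_of j e) <= env_size e"
  by (simp add: input_of_def env_size_def)

text \<open>The head runs to the first blank while two counters keep pace: one is the result, the
  other brings the head back.\<close>

lemma pc_length_input:
  assumes j: "j < 2"
  shows "pc (%e. length (input_of j e))"
proof (rule pcI[where C = "%rs b. Seq (Until j 0 (Seq (Inc j) (Seq (Inc b) (Inc (Suc b))))) (rewind (Suc b) j)"
      and p = "[:0, 1:]" and q = "[:3, 12:]"])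
  fix e :: 'a and rs b s assume l: "layout e rs b s"
  let ?n = "length (input_of j e)"
  define S where "S i = s(j := ?n - i, b := ?n - i, Suc b := ?n - i)" for i
  let ?body = "Seq (Inc j) (Seq (Inc b) (Inc (Suc b)))"
  have b: "2 <= b" and s: "s j = 0" "s b = 0" "s (Suc b) = 0"
    using l j by (auto simp: layout_def less_2_cases_iff)
  have step: "runs e ?body (S (Suc i)) 5 (S i)" if "Suc i <= ?n" for i
  proof -
    let ?s1 = "(S (Suc i))(j := Suc ((S (Suc i)) j))"
    let ?s2 = "?s1(b := Suc (?s1 b))"
    have "?s2(Suc b := Suc (?s2 (Suc b))) = S i" using that b j by (auto simp: S_def fun_eq_iff)
    then have "runs e ?body (S (Suc i)) (1 + Suc (1 + Suc 1)) (S i)"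
      by (rule runs_Seq[OF runs_Inc runs_Seq[OF runs_Inc runs_Inc']])
    then show ?thesis by (rule runs_mono) simp
  qed
  have loop: "runs e (Until j 0 ?body) (S i) (i * 7 + 1) (S 0)" if "i <= ?n" for i
    using that
  proof (induction i)
    case 0
    have "head_sym (Wof (inp e)) (Uof (inp e)) (S 0) j = 0"
      using b j by (simp add: head_sym_input bit_sym_def S_def)
    from runs_Until_stop[OF this] show ?case by simp
  next
    case (Suc i)
    have "runs e (Until j 0 ?body) (S (Suc i)) (5 + (i * 7 + 1) + 2) (S 0)"
    proof (rule runs_Until_go[OF _ step])
      show "head_sym (Wof (inp e)) (Uof (inp e)) (S (Suc i)) j ~= 0"
        using Suc.prems b j by (simp add: head_sym_input bit_sym_def S_def)
    qed (use Suc in auto)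
    then show ?case by (rule runs_mono) simp
  qed
  have "S ?n = s" using s by (auto simp: S_def fun_eq_iff)
  then have 1: "runs e (Until j 0 ?body) s (?n * 7 + 1) (S 0)" using loop[of ?n] by simp
  have 2: "runs e (rewind (Suc b) j) (S 0) (S 0 (Suc b) * 5 + 1) ((S 0)(Suc b := 0, j := S 0 j - S 0 (Suc b)))"
    using b j by (intro runs_rewind) (auto simp: S_def)
  have 3: "(S 0)(Suc b := 0, j := S 0 j - S 0 (Suc b)) = s(b := ?n)"
    using b j s by (auto simp: S_def fun_eq_iff)
  have "runs e (Seq (Until j 0 ?body) (rewind (Suc b) j)) s ((?n * 7 + 1) + Suc (S 0 (Suc b) * 5 + 1)) (s(b := ?n))"
    by (rule runs_Seq[OF 1 2[unfolded 3]])
  then show "runs e (Seq (Until j 0 ?body) (rewind (Suc b) j)) s (poly [:3, 12:] (env_size e)) (s(b := ?n))"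
    by (rule runs_mono) (use length_input_le[of j e] in \<open>simp add: S_def\<close>)
  show "?n <= poly [:0, 1:] (env_size e)" using length_input_le by simp
qed

text \<open>The symbol is out of sight once the head moves, so rewinding is done separately in each
  branch, where the control state remembers it.\<close>

lemma pc_bit_input:
  assumes j: "j < 2" and f: "pc f"
  shows "pc (%e. bit_sym (input_of j e) (f e))"
proof -
  obtain C and p :: "nat poly" where *: "\<And>e rs b s. layout e rs b s ==>
     f e <= poly p (env_size e) & runs e (C rs b) s (poly p (env_size e)) (s(b := f e))"
    using assms unfolding pc_def by blast
  define rest where "rest b = Seq (transfer2 b j (Suc b)) (Branch j 0 (rewind (Suc b) j)
     (Branch j 1 (Seq (rewind (Suc b) j) (Inc b)) (Seq (rewind (Suc b) j) (Seq (Inc b) (Inc b)))))" for b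
  show ?thesis
  proof (rule pcI[where C = "%rs b. Seq (C rs b) (rest b)" and p = "[:2:]" and q = "p * [:13:] + [:12:]"])
    fix e :: 'a and rs b s assume l: "layout e rs b s"
    let ?x = "f e"
    let ?s1 = "s(b := ?x)"
    let ?s2 = "?s1(b := 0, j := ?s1 j + ?s1 b, Suc b := ?s1 (Suc b) + ?s1 b)"
    let ?s3 = "s(b := 0)"
    have b: "2 <= b" and s: "s j = 0" "s b = 0" "s (Suc b) = 0"
      using l j by (auto simp: layout_def less_2_cases_iff)
    have r1: "runs e (transfer2 b j (Suc b)) ?s1 (?s1 b * 7 + 1) ?s2" using b j by (intro runs_transfer2) auto
    have "runs e (rewind (Suc b) j) ?s2 (?s2 (Suc b) * 5 + 1) (?s2(Suc b := 0, j := ?s2 j - ?s2 (Suc b)))"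
      using b j s by (intro runs_rewind) auto
    moreover have "?s2(Suc b := 0, j := ?s2 j - ?s2 (Suc b)) = ?s3" using b j s by (auto simp: fun_eq_iff)
    ultimately have r2: "runs e (rewind (Suc b) j) ?s2 (?x * 5 + 1) ?s3" using b j s by simp
    have i1: "runs e (Inc b) ?s3 1 (s(b := 1))" using runs_Inc[of e b ?s3] by simp
    have i2: "runs e (Inc b) (s(b := 1)) 1 (s(b := 2))" using runs_Inc[of e b "s(b := 1)"] by (simp add: numeral_2_eq_2)
    have h: "head_sym (Wof (inp e)) (Uof (inp e)) ?s2 j = bit_sym (input_of j e) ?x"
      using b j s by (simp add: head_sym_input)
    have c1: "runs e (Seq (rewind (Suc b) j) (Inc b)) ?s2 ((?x * 5 + 1) + Suc 1) (s(b := 1))"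
      using r2 i1 by (rule runs_Seq)
    have c2: "runs e (Seq (rewind (Suc b) j) (Seq (Inc b) (Inc b))) ?s2 ((?x * 5 + 1) + Suc (1 + Suc 1)) (s(b := 2))"
      using r2 runs_Seq[OF i1 i2] by (rule runs_Seq)
    let ?br = "Branch j 0 (rewind (Suc b) j)
     (Branch j 1 (Seq (rewind (Suc b) j) (Inc b)) (Seq (rewind (Suc b) j) (Seq (Inc b) (Inc b))))"
    consider "bit_sym (input_of j e) ?x = 0" | "bit_sym (input_of j e) ?x = 1" | "bit_sym (input_of j e) ?x = 2"
      unfolding bit_sym_def by presburger
    then have "runs e ?br ?s2 (?x * 5 + 7) (s(b := bit_sym (input_of j e) ?x))"
    proof cases
      case 1
      then have "runs e ?br ?s2 (Suc (?x * 5 + 1)) ?s3" using r2 h by (intro runs_Branch(1)) auto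
      then show ?thesis using 1 by (auto intro: runs_mono)
    next
      case 2
      then have "runs e ?br ?s2 (Suc (Suc ((?x * 5 + 1) + Suc 1))) (s(b := 1))"
        using c1 h by (intro runs_Branch(2) runs_Branch(1)) auto
      then show ?thesis using 2 by (auto intro: runs_mono)
    next
      case 3
      then have "runs e ?br ?s2 (Suc (Suc ((?x * 5 + 1) + Suc (1 + Suc 1)))) (s(b := 2))"
        using c2 h by (intro runs_Branch(2)) auto
      then show ?thesis using 3 by (auto intro: runs_mono)
    qed
    from runs_Seq[OF r1 this] have "runs e (rest b) ?s1 (?x * 12 + 9) (s(b := bit_sym (input_of j e) ?x))"
      unfolding rest_def by (rule runs_mono) simp
    from runs_Seq[OF conjunct2[OF *[OF l]] this]
    show "runs e (Seq (C rs b) (rest b)) s (poly (p * [:13:] + [:12:]) (env_size e)) (s(b := bit_sym (input_of j e) ?x))"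
      by (rule runs_mono) (use conjunct1[OF *[OF l]] in simp)
  qed (auto simp: bit_sym_def)
qed

lemma pc_length:
  assumes "at_W g | at_U g"
  shows "pc (%e. length (g e))"
  using assms pc_length_input[where 'a = 'a, of 0] pc_length_input[where 'a = 'a, of 1]
  by (auto simp: at_W_def at_U_def input_of_def)

lemma pc_bit:
  assumes "at_W g | at_U g" "pc f"
  shows "pc (%e. bit_sym (g e) (f e))"
  using assms pc_bit_input[of 0 f] pc_bit_input[of 1 f] by (auto simp: at_W_def at_U_def input_of_def)

text \<open>Recursion stays polynomial only if all intermediate values do; this is hypothesis
  \<open>q\<close>. In the loop register \<open>b\<close> counts down, \<open>b + 1\<close>
  accumulates, \<open>b + 2\<close> is the index and \<open>b + 3\<close> receives the new
  value.\<close>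

lemma pc_rec:
  fixes q :: "nat poly"
  assumes "pc a" "pc n" "pc (%x. h (fst x) (fst (snd x)) (snd (snd x)))"
    and q: "\<And>e i. i <= n e ==> rec_nat (a e) (%i r. h i r e) i <= poly q (env_size e)"
  shows "pc (%e. rec_nat (a e) (%i r. h i r e) (n e))"
proof -
  obtain Ca and pa :: "nat poly" where a: "\<And>e rs b s. layout e rs b s ==>
     a e <= poly pa (env_size e) & runs e (Ca rs b) s (poly pa (env_size e)) (s(b := a e))"
    using assms(1) unfolding pc_def by blast
  obtain Cn and pn :: "nat poly" where n: "\<And>e rs b s. layout e rs b s ==>
     n e <= poly pn (env_size e) & runs e (Cn rs b) s (poly pn (env_size e)) (s(b := n e))"
    using assms(2) unfolding pc_def by blast
  obtain Ch and ph :: "nat poly" where h: "\<And>e rs b s. layout e rs b s ==>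
     runs e (Ch rs b) s (poly ph (env_size e)) (s(b := h (fst e) (fst (snd e)) (snd (snd e))))"
    using assms(3) unfolding pc_def by blast
  define body where "body rs b = Seq (Dec b) (Seq (Ch ((b + 2) # (b + 1) # rs) (b + 3))
     (Seq (clear (b + 1)) (Seq (transfer (b + 3) (b + 1)) (Inc (b + 2)))))" for rs b
  define prog where "prog rs b = Seq (Cn rs b) (Seq (Ca rs (b + 1)) (Seq (Until b 1 (body rs b))
     (Seq (clear (b + 2)) (transfer (b + 1) b))))" for rs b
  \<comment> \<open>The body runs in an environment enlarged by the index, at most
    \<open>pn\<close>, and by the accumulator, at most \<open>q\<close>.\<close>
  define pt where "pt = pcompose ph (pn + q + [:0, 1:])"
  define pb where "pb = pt + 8 * q + 12"
  define P where "P = pn + pa + pn * (pb + 2) + 3 * pn + 5 * q + 10"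
  show ?thesis
  proof (rule pcI[where C = prog and p = q and q = P])
    fix e :: 'a and rs b s assume l: "layout e rs b s"
    let ?R = "rec_nat (a e) (%i r. h i r e)" and ?N = "n e" and ?z = "env_size e"
    have b: "2 <= b" and s0: "\<And>j. b <= j ==> s j = 0" using l by (auto simp: layout_def)
    define S where "S i = s(b := i, b + 1 := ?R (?N - i), b + 2 := ?N - i)" for i
    have len: "layout e rs (b + 3) (S i)" for i
      using layout_upd[OF layout_upd[OF layout_upd[OF l]]] by (simp add: S_def numeral_3_eq_3)
    have lS: "layout (m, r, e) ((b + 2) # (b + 1) # rs) (b + 3) (s(b := i, b + 1 := r, b + 2 := m))" for m r i
    proof -
      have "layout e rs (b + 3) (s(b := i, b + 1 := r, b + 2 := m))"
        using layout_upd[OF layout_upd[OF layout_upd[OF l]]] by (simp add: numeral_3_eq_3)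
      from layout_pair[OF layout_pair[OF this, of "b + 1"], of "b + 2"] show ?thesis using b by simp
    qed
    have step: "runs e (body rs b) (S (Suc i)) (poly pb ?z) (S i)" if i: "i < ?N" for i
    proof -
      let ?m = "?N - Suc i"
      let ?r = "?R ?m" and ?r' = "?R (?N - i)"
      have Nm: "?N - i = Suc ?m" using i by simp
      have r': "?r' = h ?m ?r e" by (simp add: Nm)
      have qr: "?r <= poly q ?z" "?r' <= poly q ?z" using q by simp_all
      let ?s1 = "s(b := i, b + 1 := ?r, b + 2 := ?m)"
      let ?s2 = "?s1(b + 3 := ?r')"
      let ?s3 = "?s2(b + 1 := 0)"
      let ?s4 = "?s3(b + 3 := 0, b + 1 := ?r')"
      have 1: "runs e (Dec b) (S (Suc i)) 1 ?s1"
        using runs_Dec[of "S (Suc i)" b e] by (simp add: S_def fun_upd_twist)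
      have "runs e (Ch ((b + 2) # (b + 1) # rs) (b + 3)) ?s1 (poly ph (env_size (?m, ?r, e))) ?s2"
        using h[OF lS[of ?m ?r i]] r' by simp
      moreover have "poly ph (env_size (?m, ?r, e)) <= poly pt ?z"
        unfolding pt_def poly_pcompose
        using conjunct1[OF n[OF l]] qr by (intro poly_nat_mono) simp
      ultimately have 2: "runs e (Ch ((b + 2) # (b + 1) # rs) (b + 3)) ?s1 (poly pt ?z) ?s2" by (rule runs_mono)
      have 3: "runs e (clear (b + 1)) ?s2 (?r * 3 + 1) ?s3"
        using runs_clear[of "b + 1" e ?s2] b by simp
      have "runs e (transfer (b + 3) (b + 1)) ?s3 (?s3 (b + 3) * 5 + 1)
          (?s3(b + 3 := 0, b + 1 := ?s3 (b + 1) + ?s3 (b + 3)))"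
        using b by (intro runs_transfer) auto
      then have 4: "runs e (transfer (b + 3) (b + 1)) ?s3 (?r' * 5 + 1) ?s4" by simp
      have "?s4(b + 2 := Suc (?s4 (b + 2))) = S i" using s0 Nm by (auto simp: S_def fun_eq_iff)
      then have 5: "runs e (Inc (b + 2)) ?s4 1 (S i)" by (rule runs_Inc')
      from runs_Seq[OF 1 runs_Seq[OF 2 runs_Seq[OF 3 runs_Seq[OF 4 5]]]]
      show ?thesis unfolding body_def by (rule runs_mono) (use qr in \<open>simp add: pb_def\<close>)
    qed
    have loop: "runs e (Until b 1 (body rs b)) (S ?N) (?N * (poly pb ?z + 2) + 1) (S 0)"
    proof (rule runs_countdown[OF b])
      show "S i b = i" for i by (simp add: S_def)
    qed (rule step)
    have 1: "runs e (Cn rs b) s (poly pn ?z) (s(b := ?N))" using n[OF l] by blast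
    have "(s(b := ?N))(b + 1 := a e) = S ?N" using s0 by (auto simp: S_def fun_eq_iff)
    then have 2: "runs e (Ca rs (b + 1)) (s(b := ?N)) (poly pa ?z) (S ?N)"
      using conjunct2[OF a[OF layout_upd[OF l, of ?N]]] by simp
    have "runs e (clear (b + 2)) (S 0) (?N * 3 + 1) ((S 0)(b + 2 := 0))"
      using runs_clear[of "b + 2" e "S 0"] b by (simp add: S_def)
    moreover have "runs e (transfer (b + 1) b) ((S 0)(b + 2 := 0)) (?R ?N * 5 + 1) (s(b := ?R ?N))"
    proof -
      let ?s = "(S 0)(b + 2 := 0)"
      have "runs e (transfer (b + 1) b) ?s (?s (b + 1) * 5 + 1) (?s(b + 1 := 0, b := ?s b + ?s (b + 1)))"
        using b by (intro runs_transfer) auto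
      moreover have "?s(b + 1 := 0, b := ?s b + ?s (b + 1)) = s(b := ?R ?N)"
        using s0 by (auto simp: S_def fun_eq_iff)
      ultimately show ?thesis by (simp add: S_def)
    qed
    ultimately have 3: "runs e (Seq (clear (b + 2)) (transfer (b + 1) b)) (S 0)
        ((?N * 3 + 1) + Suc (?R ?N * 5 + 1)) (s(b := ?R ?N))" by (rule runs_Seq)
    have "?R ?N <= poly q ?z" using q by simp
    moreover have "?N <= poly pn ?z" using n[OF l] by blast
    moreover have "?N * (poly pb ?z + 2) <= poly pn ?z * (poly pb ?z + 2)"
      using n[OF l] by (intro mult_right_mono) auto
    ultimately show "runs e (prog rs b) s (poly P ?z) (s(b := ?R ?N))"
      using runs_mono[OF runs_Seq[OF 1 runs_Seq[OF 2 runs_Seq[OF loop 3]]], of "poly P ?z"]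
      unfolding prog_def by (simp add: P_def)
  qed (use q in auto)
qed

text \<open>With no variables the first free register is 2, the one that decides acceptance.\<close>

lemma pc_decidable:
  assumes "pc f"
  shows "poly_time_decidable {(w, u). f (Inp w u) ~= 0}"
proof -
  obtain C and p :: "nat poly" where *: "\<And>e rs b s. layout e rs b s ==>
     f e <= poly p (env_size e) & runs e (C rs b) s (poly p (env_size e)) (s(b := f e))"
    using assms unfolding pc_def by blast
  have "layout (Inp w u) [] 2 (%_. 0)" for w u by (auto simp: layout_def vals_inp_def)
  from *[OF this] have "\<exists>t\<le>poly p (length w + length u). exec w u (C [] 2) (%_. 0) t ((%_. 0)(2 := f (Inp w u)))" for w u
    by (simp add: runs_def inp_inp_def env_size_def vals_inp_def)
  then show ?thesis by (intro poly_time_decidableI[of "C [] 2" p]) fastforce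
qed

text \<open>Weakening below one binder: the code is compiled without the register of the second
  variable.\<close>

lemma pc_skip:
  assumes "pc (%x :: nat \<times> 'e::env. g (fst x) (snd x))"
  shows "pc (%x :: nat \<times> nat \<times> 'e. g (fst x) (snd (snd x)))"
proof -
  obtain C and p :: "nat poly" where *: "\<And>(e :: nat \<times> 'e) rs b s. layout e rs b s ==>
     g (fst e) (snd e) <= poly p (env_size e) \<and>
     runs e (C rs b) s (poly p (env_size e)) (s(b := g (fst e) (snd e)))"
    using assms unfolding pc_def by blast
  show ?thesis
  proof (rule pcI[where C = "%rs b. C (hd rs # tl (tl rs)) b" and p = p and q = p])
    fix e :: "nat \<times> nat \<times> 'e" and rs b s assume l: "layout e rs b s"
    obtain i r e' where e: "e = (i, r, e')" by (cases e) auto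
    from l obtain a a' rs' where rs: "rs = a # a' # rs'"
      unfolding e layout_def vals_prod_def by (cases rs; cases "tl rs") auto
    have "layout (i, e') (hd rs # tl (tl rs)) b s"
      using l unfolding e rs by (auto simp: layout_def vals_prod_def)
    note * = *[OF this]
    have m: "poly p (env_size (i, e')) <= poly p (env_size e)" by (simp add: e poly_nat_mono)
    show "g (fst e) (snd (snd e)) <= poly p (env_size e)" using * m by (simp add: e)
    show "runs e (C (hd rs # tl (tl rs)) b) s (poly p (env_size e)) (s(b := g (fst e) (snd (snd e))))"
      using * m unfolding e by (auto intro: runs_mono)
  qed
qed

section \<open>Closure properties of polynomial-time functions\<close>

lemma pc_const: "pc (%e. c)"
  by (induction c) (auto intro: pc_zero pc_Suc)

lemma pc_var:
  "pc (%e :: nat \<times> 'e::env. fst e)"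
  "pc (%e :: nat \<times> nat \<times> 'e::env. fst (snd e))"
  "pc (%e :: nat \<times> nat \<times> nat \<times> 'e::env. fst (snd (snd e)))"
  "pc (%e :: nat \<times> nat \<times> nat \<times> nat \<times> 'e::env. fst (snd (snd (snd e))))"
  "pc (%e :: nat \<times> nat \<times> nat \<times> nat \<times> nat \<times> 'e::env. fst (snd (snd (snd (snd e)))))"
  by (intro pc_snd pc_fst)+

lemma pc_add:
  assumes "pc f" "pc g"
  shows "pc (%e. f e + g e)"
proof -
  obtain p q :: "nat poly" where b: "\<And>e. f e <= poly p (env_size e)" "\<And>e. g e <= poly q (env_size e)"
    using assms pc_bounded by metis
  have eq: "rec_nat a (%i r. Suc r) n = a + n" for a n by (induction n) auto
  have "pc (%e. rec_nat (f e) (%i r. Suc r) (g e))"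
    using b by (intro pc_rec[where q = "p + q"] assms pc_Suc pc_var) (auto simp: eq intro: add_mono le_trans)
  then show ?thesis by (simp add: eq)
qed

lemma pc_pred:
  assumes "pc f"
  shows "pc (%e. f e - 1)"
proof -
  obtain p :: "nat poly" where b: "\<And>e. f e <= poly p (env_size e)"
    using assms pc_bounded by metis
  have eq: "rec_nat 0 (%i r. i) n = n - 1" for n by (cases n) auto
  have "pc (%e. rec_nat 0 (%i r. i) (f e))"
    using b by (intro pc_rec[where q = p] assms pc_zero pc_var) (auto simp: eq intro: le_trans diff_le_self)
  then show ?thesis by (simp add: eq)
qed

lemma pc_diff:
  assumes "pc f" "pc g"
  shows "pc (%e. f e - g e)"
proof -
  obtain p :: "nat poly" where b: "\<And>e. f e <= poly p (env_size e)"
    using assms pc_bounded by metis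
  have eq: "rec_nat a (%i r. r - 1) n = a - n" for a n by (induction n) auto
  have "pc (%e. rec_nat (f e) (%i r. r - 1) (g e))"
  proof (intro pc_rec[where q = p] assms pc_pred pc_var)
    show "rec_nat (f e) (%i r. r - 1) i <= poly p (env_size e)" for e i
      unfolding eq using b[of e] by linarith
  qed
  then show ?thesis by (simp only: eq)
qed

lemma pc_sum:
  assumes "pc n" "pc (%x. g (fst x) (snd x))"
  shows "pc (%e. \<Sum>i<n e. g i e)"
proof -
  obtain p :: "nat poly" where p: "\<And>e. n e <= poly p (env_size e)"
    using assms(1) pc_bounded by metis
  obtain q :: "nat poly" where q: "\<And>x. g (fst x) (snd x) <= poly q (env_size x)"
    using pc_bounded[OF assms(2)] by blast
  have eq: "rec_nat 0 (%i r. r + g i e) m = (\<Sum>i<m. g i e)" for m e by (induction m) auto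
  have bd: "(\<Sum>i<m. g i e) <= poly (p * pcompose q (p + [:0, 1:])) (env_size e)" if "m <= n e" for m e
  proof -
    have "g i e <= poly q (poly p (env_size e) + env_size e)" if "i < m" for i
    proof -
      have "g i e <= poly q (env_size (i, e))" using q[of "(i, e)"] by simp
      also have "\<dots> <= poly q (poly p (env_size e) + env_size e)"
        using that \<open>m <= n e\<close> p[of e] by (intro poly_nat_mono) simp
      finally show ?thesis .
    qed
    then have "(\<Sum>i<m. g i e) <= m * poly q (poly p (env_size e) + env_size e)"
      using sum_bounded_above[of "{..<m}" "%i. g i e"] by simp
    also have "\<dots> <= poly p (env_size e) * poly q (poly p (env_size e) + env_size e)"
      using that p[of e] by (intro mult_right_mono) auto
    finally show ?thesis by (simp add: poly_pcompose)
  qed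
  have "pc (%e. rec_nat 0 (%i r. r + g i e) (n e))"
    using bd by (intro pc_rec[where q = "p * pcompose q (p + [:0, 1:])"] assms pc_zero pc_add pc_var pc_skip)
      (simp_all add: eq)
  then show ?thesis by (simp add: eq)
qed

lemma pc_mult:
  assumes "pc f" "pc g"
  shows "pc (%e. f e * g e)"
proof -
  have "pc (%e. \<Sum>i<f e. g e)" using assms by (intro pc_sum pc_snd)
  then show ?thesis by simp
qed

text \<open>Substitution is a recursion of length 1 that starts at \<open>f e\<close> and applies
  \<open>g\<close> once, with the accumulator as the substituted variable.\<close>

lemma pc_let:
  assumes "pc f" "pc (%x. g (fst x) (snd x))"
  shows "pc (%e. g (f e) e)"
proof -
  obtain p :: "nat poly" where p: "\<And>e. f e <= poly p (env_size e)"
    using assms(1) pc_bounded by metis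
  obtain q :: "nat poly" where q: "\<And>x. g (fst x) (snd x) <= poly q (env_size x)"
    using pc_bounded[OF assms(2)] by blast
  have "pc (%e. rec_nat (f e) (%i r. g r e) 1)"
  proof (rule pc_rec[where q = "p + pcompose q (p + [:0, 1:])"])
    fix e and i :: nat assume "i <= 1"
    moreover have "g (f e) e <= poly q (env_size (f e, e))" using q[of "(f e, e)"] by simp
    moreover have "poly q (env_size (f e, e)) <= poly q (poly p (env_size e) + env_size e)"
      using p by (intro poly_nat_mono) simp
    ultimately show "rec_nat (f e) (%i r. g r e) i <= poly (p + pcompose q (p + [:0, 1:])) (env_size e)"
      using p[of e] by (cases i) (auto simp: poly_pcompose)
  qed (use assms pc_const pc_snd[OF assms(2)] in auto)
  then show ?thesis by simp
qed

definition pcb :: "('e::env => bool) => bool" where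
  "pcb P \<longleftrightarrow> pc (%e. of_bool (P e))"

lemma pc_of_bool: "pcb P ==> pc (%e. of_bool (P e))"
  by (simp add: pcb_def)

lemma pcb_zero: "pc f ==> pcb (%e. f e = 0)"
proof -
  assume "pc f"
  then have "pc (%e. 1 - f e)" by (intro pc_diff pc_const)
  moreover have "(1 :: nat) - x = of_bool (x = 0)" for x by auto
  ultimately show ?thesis unfolding pcb_def by (simp cong: if_cong)
qed

lemma pcb_not: "pcb P ==> pcb (%e. \<not> P e)"
  using pcb_zero[of "%e. of_bool (P e)"] by (simp add: pcb_def)

lemma pcb_conj: "pcb P ==> pcb Q ==> pcb (%e. P e & Q e)"
  unfolding pcb_def by (simp only: of_bool_conj pc_mult)

lemma pcb_disj: "pcb P ==> pcb Q ==> pcb (%e. P e | Q e)"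
  using pcb_not[OF pcb_conj[OF pcb_not pcb_not]] by simp

lemma pcb_imp: "pcb P ==> pcb Q ==> pcb (%e. P e --> Q e)"
  unfolding imp_conv_disj by (intro pcb_disj pcb_not)

lemma pcb_le: "pc f ==> pc g ==> pcb (%e. f e <= g e)"
  using pcb_zero[OF pc_diff, of f g] by simp

lemma pcb_less: "pc f ==> pc g ==> pcb (%e. f e < g e)"
  using pcb_not[OF pcb_le, of g f] by (simp add: not_le)

lemma pcb_eq: "pc f ==> pc g ==> pcb (%e. f e = g e)"
  using pcb_conj[OF pcb_le pcb_le, of f g g f] by (simp add: eq_iff)

lemma pcb_const: "pcb (%e. c)"
  by (simp add: pcb_def pc_const)

lemma pc_if: "pcb P ==> pc f ==> pc g ==> pc (%e. if P e then f e else g e)"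
proof -
  assume "pcb P" "pc f" "pc g"
  then have "pc (%e. of_bool (P e) * f e + of_bool (\<not> P e) * g e)"
    by (intro pc_add pc_mult pc_of_bool pcb_not)
  moreover have "of_bool b * x + of_bool (\<not> b) * y = (if b then x else y)" for b and x y :: nat by simp
  ultimately show ?thesis by simp
qed

lemma pcb_if: "pcb P ==> pcb Q ==> pcb R ==> pcb (%e. if P e then Q e else R e)"
  unfolding if_bool_eq_conj by (intro pcb_conj pcb_imp pcb_not)

lemma pcb_all: "pc n ==> pcb (%x. P (fst x) (snd x)) ==> pcb (%e. \<forall>i<n e. P i e)"
proof -
  assume "pc n" "pcb (%x. P (fst x) (snd x))"
  then have "pcb (%e. (\<Sum>i<n e. of_bool (\<not> P i e) :: nat) = 0)"
    by (intro pcb_zero pc_sum pc_of_bool pcb_not)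
  moreover have "(\<Sum>i<m. of_bool (\<not> Q i) :: nat) = 0 \<longleftrightarrow> (\<forall>i<m. Q i)" for m and Q :: "nat => bool"
    by (auto simp: sum_eq_0_iff simp del: sum_of_bool_eq)
  ultimately show ?thesis by simp
qed

lemma pcb_ex: "pc n ==> pcb (%x. P (fst x) (snd x)) ==> pcb (%e. \<exists>i<n e. P i e)"
  using pcb_not[OF pcb_all[OF _ pcb_not], of n P] by simp

lemma pc_min: "pc f ==> pc g ==> pc (%e. min (f e) (g e))"
  using pc_if[OF pcb_le, of f g f g] by (simp add: min_def)

lemma pc_max: "pc f ==> pc g ==> pc (%e. max (f e) (g e))"
  using pc_if[OF pcb_le, of f g g f] by (simp add: max_def)

text \<open>The quotient counts the positive multiples of the divisor that fit into the dividend;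
  the test \<open>0 < b\<close> reproduces \<open>a div 0 = 0\<close>.\<close>

lemma pc_div:
  assumes "pc f" "pc g"
  shows "pc (%e. f e div g e)"
proof -
  have eq: "a div b = (\<Sum>j<a. of_bool (0 < b & Suc j * b <= a))" for a b :: nat
  proof (cases "b = 0")
    case False
    have 1: "Suc j * b <= a \<longleftrightarrow> j < a div b" for j
      using False less_eq_div_iff_mult_less_eq[of b "Suc j" a] by (simp add: Suc_le_eq del: mult_Suc)
    have "{..<a} \<inter> {j. j < a div b} = {..<a div b}" by (auto intro: less_le_trans[OF _ div_le_dividend])
    then have "a div b = (\<Sum>j<a. of_bool (j < a div b))" by simp
    also have "\<dots> = (\<Sum>j<a. of_bool (0 < b & Suc j * b <= a))" using 1 False by simp
    finally show ?thesis .
  qed simp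
  have "pc (%e. \<Sum>j<f e. of_bool (0 < g e & Suc j * g e <= f e))"
    by (intro pc_sum pc_of_bool pcb_conj pcb_less pcb_le pc_mult pc_Suc pc_var pc_const pc_snd assms)
  then show ?thesis by (simp only: eq[symmetric])
qed

lemma pc_mod: "pc f ==> pc g ==> pc (%e. f e mod g e)"
  using pc_diff[OF _ pc_mult[OF pc_div, of f g g], of f] by (simp add: minus_div_mult_eq_mod)

lemmas pc_intros = pc_var pc_zero pc_const pc_Suc pc_add pc_mult pc_diff pc_if pc_sum pc_min pc_max pc_div
  pc_mod pc_of_bool pcb_const pcb_not pcb_conj pcb_disj pcb_imp pcb_le pcb_less pcb_eq pcb_if pcb_all pcb_ex
  pc_bit[OF disjI1] pc_bit[OF disjI2] pc_length[OF disjI1] pc_length[OF disjI2] at_W_intros at_U_intros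

section \<open>Witnesses that are tables of numbers\<close>

definition table_entry :: "nat => bool list => nat => nat" where
  "table_entry M u j = (\<Sum>k<M. of_bool (bit_sym u (j * M + k) = 2))"

text \<open>Each entry is a block of exactly \<open>M\<close> bits, ones first. The padding gives
  every table exactly one string, so that counting witnesses is counting tables.\<close>

definition table_code :: "nat => nat list => bool list" where
  "table_code M t = concat (map (%a. replicate a True @ replicate (M - a) False) t)"

definition tables :: "nat => nat => nat list set" where
  "tables l M = {t. length t = l & set t \<subseteq> {..M}}"

definition table_string :: "nat => nat => bool list => bool" where
  "table_string l M u \<longleftrightarrow> length u = l * M \<and>
     (\<forall>j<l. \<forall>k<M. Suc k < M --> bit_sym u (j * M + Suc k) = 2 --> bit_sym u (j * M + k) = 2)"

lemma pc_table_entry: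
  assumes "at_U u" "pc M" "pc j"
  shows "pc (%e. table_entry (M e) (u e) (j e))"
  unfolding table_entry_def using assms by (intro pc_intros pc_snd)

lemma length_table_code: "set t \<subseteq> {..M} ==> length (table_code M t) = length t * M"
  by (induction t) (auto simp: table_code_def)

lemma nth_table_code:
  "set t \<subseteq> {..M} ==> j < length t ==> k < M ==> table_code M t ! (j * M + k) \<longleftrightarrow> k < t ! j"
proof (induction t arbitrary: j)
  case (Cons a t)
  then show ?case
    by (cases j) (auto simp: table_code_def nth_append add.assoc)
qed simp

lemma bit_sym_table_code:
  assumes "set t \<subseteq> {..M}" "j < length t" "k < M"
  shows "bit_sym (table_code M t) (j * M + k) = 2 \<longleftrightarrow> k < t ! j"
proof -
  have "Suc j * M <= length t * M" using assms(2) by (intro mult_right_mono) auto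
  then have "j * M + k < length t * M" using assms(3) by simp
  then show ?thesis using assms by (simp add: bit_sym_def length_table_code nth_table_code)
qed

lemma table_entry_code:
  assumes "set t \<subseteq> {..M}" "j < length t"
  shows "table_entry M (table_code M t) j = t ! j"
proof -
  have "t ! j <= M" using assms nth_mem by blast
  then have "{..<M} \<inter> {k. k < t ! j} = {..<t ! j}" by auto
  moreover have "table_entry M (table_code M t) j = (\<Sum>k<M. of_bool (k < t ! j))"
    unfolding table_entry_def using bit_sym_table_code[OF assms] by (intro sum.cong) auto
  ultimately show ?thesis by simp
qed

text \<open>A downward closed subset of \<open>{..<M}\<close> is an initial segment, so its
  cardinality is its threshold. This recovers a block from the number of its ones.\<close>

lemma card_downward_closed:
  assumes "\<And>k. Suc k < M ==> P (Suc k) ==> P k" "k < M"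
  shows "k < card {i. i < M & P i} \<longleftrightarrow> P k"
proof -
  have down: "P j" if "P i" "j <= i" "i < M" for i j
    using that by (induction i) (auto simp: le_Suc_eq assms(1))
  show ?thesis
  proof
    assume "P k"
    then have "{..k} \<subseteq> {i. i < M & P i}" using down assms(2) by auto
    from card_mono[OF _ this] show "k < card {i. i < M & P i}" by simp
  next
    assume *: "k < card {i. i < M & P i}"
    show "P k"
    proof (rule ccontr)
      assume "\<not> P k"
      then have "{i. i < M & P i} \<subseteq> {..<k}" using down by (auto simp: not_less[symmetric])
      from card_mono[OF _ this] * show False by simp
    qed
  qed
qed

lemma bij_table_code: "bij_betw (table_code M) (tables l M) {u. table_string l M u}"
proof (rule bij_betwI[where g = "%u. map (table_entry M u) [0..<l]"])
  show "table_code M \<in> tables l M \<rightarrow> {u. table_string l M u}"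
    using bit_sym_table_code
    by (fastforce simp: tables_def table_string_def length_table_code simp del: add_Suc_right)
  show "(%u. map (table_entry M u) [0..<l]) \<in> {u. table_string l M u} \<rightarrow> tables l M"
  proof -
    have "table_entry M u j <= M" for u j
      unfolding table_entry_def using sum_bounded_above[of "{..<M}" "%k. of_bool (bit_sym u (j * M + k) = 2)" "1 :: nat"]
      by auto
    then show ?thesis by (auto simp: tables_def)
  qed
  show "map (table_entry M (table_code M t)) [0..<l] = t" if "t \<in> tables l M" for t
    using that by (intro nth_equalityI) (auto simp: tables_def table_entry_code)
  show "table_code M (map (table_entry M u) [0..<l]) = u" if "u \<in> {u. table_string l M u}" for u
  proof -
    let ?t = "map (table_entry M u) [0..<l]"
    have t: "set ?t \<subseteq> {..M}"
    proof -
      have "table_entry M u j <= M" for j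
        unfolding table_entry_def using sum_bounded_above[of "{..<M}" "%k. of_bool (bit_sym u (j * M + k) = 2)" "1 :: nat"]
        by auto
      then show ?thesis by auto
    qed
    have len: "length u = l * M" using that by (simp add: table_string_def)
    show ?thesis
    proof (rule nth_equalityI)
      show "length (table_code M ?t) = length u" using length_table_code[OF t] len by simp
      fix i assume "i < length (table_code M ?t)"
      then have i: "i < l * M" using length_table_code[OF t] by simp
      then have M: "M > 0" by (cases M) auto
      define j k where "j = i div M" and "k = i mod M"
      have jk: "j < l" "k < M" "i = j * M + k" using i M by (auto simp: j_def k_def less_mult_imp_div_less)
      have "table_code M ?t ! i \<longleftrightarrow> k < table_entry M u j"
        using nth_table_code[OF t, of j k] jk by simp
      also have "table_entry M u j = card {k. k < M & bit_sym u (j * M + k) = 2}"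
        by (simp add: table_entry_def lessThan_def Int_def)
      also have "k < \<dots> \<longleftrightarrow> bit_sym u (j * M + k) = 2"
        using that jk by (intro card_downward_closed) (auto simp: table_string_def)
      also have "\<dots> \<longleftrightarrow> u ! i" using i jk len by (simp add: bit_sym_def)
      finally show "table_code M ?t ! i = u ! i" by simp
    qed
  qed
qed

text \<open>The hypothesis \<open>cong\<close> bridges positions outside the table, where
  \<open>table_entry\<close> and list indexing need not agree.\<close>

lemma tables_in_sharpP:
  fixes l M :: "bool list => nat" and P :: "bool list => (nat => nat) => bool"
  assumes l: "pc (%e :: inp. l (Wof e))" and M: "pc (%e :: inp. M (Wof e))"
    and P: "pcb (%e :: inp. P (Wof e) (table_entry (M (Wof e)) (Uof e)))"
    and cong: "\<And>w t t'. (\<And>j. j < l w ==> t j = t' j) ==> P w t = P w t'"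
  shows "(%w. card {t \<in> tables (l w) (M w). P w (%j. t ! j)}) \<in> sharpP"
proof -
  define B where "B = {(w, u). table_string (l w) (M w) u & P w (table_entry (M w) u)}"
  have "pcb (%e :: inp. table_string (l (Wof e)) (M (Wof e)) (Uof e) & P (Wof e) (table_entry (M (Wof e)) (Uof e)))"
    unfolding table_string_def by (intro pcb_conj P pc_intros pc_snd l M)
  then have "poly_time_decidable B"
    using pc_decidable[OF pc_of_bool] unfolding B_def by fastforce
  moreover
  obtain p :: "nat poly" where p: "\<And>e :: inp. l (Wof e) * M (Wof e) <= poly p (env_size e)"
    using pc_bounded[OF pc_mult[OF l M]] by blast
  have "length u <= poly p (length w)" if "(w, u) \<in> B" for w u
    using that p[of "Inp w []"] by (simp add: B_def table_string_def env_size_def inp_inp_def vals_inp_def)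
  moreover have "card {t \<in> tables (l w) (M w). P w (%j. t ! j)} = card {u. (w, u) \<in> B}" for w
  proof (rule bij_betw_same_card)
    have "P w (table_entry (M w) (table_code (M w) t)) \<longleftrightarrow> P w (%j. t ! j)" if "t \<in> tables (l w) (M w)" for t
      using that by (intro cong) (auto simp: tables_def table_entry_code)
    then show "bij_betw (table_code (M w)) {t \<in> tables (l w) (M w). P w (%j. t ! j)} {u. (w, u) \<in> B}"
      using bij_betw_Collect[OF bij_table_code, of "l w" "M w" "%u. P w (table_entry (M w) u)" "%t. P w (%j. t ! j)"]
      by (simp add: B_def)
  qed
  ultimately show ?thesis unfolding sharpP_def by blast
qed

section \<open>Decoding compositions\<close>

definition zeros_before :: "bool list => nat => nat" where
  "zeros_before w p = (\<Sum>i<p. of_bool (bit_sym w i = 1))"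

text \<open>A block is a run of \<open>True\<close> closed by a \<open>False\<close>. Its letters
  are those with exactly \<open>k\<close> zeros before them, which is a sum and needs no scanning
  state.\<close>

definition block :: "bool list => nat => nat" where
  "block w k = (\<Sum>p<length w. of_bool (bit_sym w p = 2 & zeros_before w p = k))"

text \<open>Every part and every terminator ends with one zero, so three compositions of length
  \<open>n\<close> produce \<open>3 * (n + 1)\<close> zeros.\<close>

definition num_parts :: "bool list => nat" where
  "num_parts w = zeros_before w (length w) div 3 - 1"

text \<open>A composition takes \<open>num_parts w + 1\<close> blocks, the last being the empty one
  of its terminator; the final \<open>- 1\<close> undoes the \<open>a + 1\<close> of the unary
  code.\<close>

definition part :: "bool list => nat => nat => nat" where
  "part w c i = block w (c * Suc (num_parts w) + i) - 1"

lemma pc_num_parts: "at_W g ==> pc (%e. num_parts (g e))"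
  unfolding num_parts_def zeros_before_def by (intro pc_intros)

lemma pc_part: "at_W g ==> pc c ==> pc i ==> pc (%e. part (g e) (c e) (i e))"
  unfolding part_def block_def zeros_before_def by (intro pc_intros pc_num_parts pc_snd)

definition blocks_word :: "nat list => bool list" where
  "blocks_word bs = concat (map (%a. replicate a True @ [False]) bs)"

lemma sum_lessThan_plus:
  fixes a m :: nat
  shows "(\<Sum>i<a + m. f i) = (\<Sum>i<a. f i) + (\<Sum>i<m. f (a + i) :: nat)"
  by (induction m) auto

lemma bit_sym_block:
  "bit_sym (replicate a True @ False # v) (a + Suc i) = bit_sym v i"
  "i < a ==> bit_sym (replicate a True @ False # v) i = 2"
  "bit_sym (replicate a True @ False # v) a = 1"
  by (auto simp: bit_sym_def nth_append)

lemma zeros_before_block: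
  "zeros_before (replicate a True @ False # v) (a + Suc p) = Suc (zeros_before v p)"
  "i <= a ==> zeros_before (replicate a True @ False # v) i = 0"
proof -
  show "zeros_before (replicate a True @ False # v) (a + Suc p) = Suc (zeros_before v p)"
    unfolding zeros_before_def sum_lessThan_plus sum.lessThan_Suc_shift
    by (simp add: bit_sym_block del: add_Suc_right sum_of_bool_eq)
  show "i <= a ==> zeros_before (replicate a True @ False # v) i = 0"
    unfolding zeros_before_def by (intro sum.neutral) (auto simp: bit_sym_block)
qed

lemma block_Cons: "block (replicate a True @ False # v) k = (case k of 0 => a | Suc k => block v k)"
proof -
  let ?w = "replicate a True @ False # v"
  have "block ?w k = (\<Sum>p<a + Suc (length v). of_bool (bit_sym ?w p = 2 & zeros_before ?w p = k))"
    by (simp add: block_def del: sum_of_bool_eq)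
  also have "\<dots> = (\<Sum>p<a. of_bool (k = 0)) + (\<Sum>p<length v. of_bool (bit_sym v p = 2 & Suc (zeros_before v p) = k))"
    unfolding sum_lessThan_plus sum.lessThan_Suc_shift
    by (intro arg_cong2[where f = "(+)"] sum.cong)
      (auto simp: bit_sym_block zeros_before_block simp del: add_Suc_right sum_of_bool_eq)
  also have "\<dots> = (case k of 0 => a | Suc k => block v k)"
    by (cases k) (auto simp: block_def simp del: sum_of_bool_eq)
  finally show ?thesis .
qed

lemma block_word: "k < length bs ==> block (blocks_word bs) k = bs ! k"
  by (induction bs arbitrary: k) (auto simp: blocks_word_def block_Cons nth_Cons split: nat.splits)

lemma zeros_blocks_word: "zeros_before (blocks_word bs) (length (blocks_word bs)) = length bs"
proof (induction bs)
  case (Cons a bs)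
  then show ?case using zeros_before_block(1)[of a "blocks_word bs" "length (blocks_word bs)"]
    by (simp add: blocks_word_def)
qed (simp add: blocks_word_def zeros_before_def)

lemma encode3_blocks:
  "encode3 \<alpha> \<beta> \<gamma> = blocks_word (map Suc \<alpha> @ 0 # map Suc \<beta> @ 0 # map Suc \<gamma> @ [0])"
  by (simp add: encode3_def unary_def blocks_word_def comp_def del: replicate_Suc)

context
  fixes \<alpha> \<beta> \<gamma> :: "nat list" and n :: nat
  assumes len: "length \<alpha> = n" "length \<beta> = n" "length \<gamma> = n"
begin

lemma num_parts_encode3: "num_parts (encode3 \<alpha> \<beta> \<gamma>) = n"
  unfolding num_parts_def encode3_blocks zeros_blocks_word by (simp add: len)

lemma part_encode3:
  assumes "i < n"
  shows "part (encode3 \<alpha> \<beta> \<gamma>) 0 i = \<alpha> ! i" "part (encode3 \<alpha> \<beta> \<gamma>) 1 i = \<beta> ! i" "part (encode3 \<alpha> \<beta> \<gamma>) 2 i = \<gamma> ! i"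
  unfolding part_def num_parts_encode3 using assms len
  by (simp_all add: encode3_blocks block_word nth_append nth_Cons' not_less)

lemma length_encode3_ge:
  "sum_list \<alpha> + sum_list \<beta> + sum_list \<gamma> + 6 * n + 3 <= length (encode3 \<alpha> \<beta> \<gamma>)"
proof -
  have "length (unary \<delta>) = sum_list \<delta> + 2 * length \<delta> + 1" for \<delta>
    by (induction \<delta>) (auto simp: unary_def)
  then show ?thesis by (simp add: encode3_def len)
qed

end

section \<open>Linear maps and substitutions on polynomials\<close>

abbreviation look :: "('a \<Rightarrow>\<^sub>0 'b::zero) => 'a => 'b" where "look \<equiv> Poly_Mapping.lookup"
abbreviation sing :: "'a => 'b::zero => 'a \<Rightarrow>\<^sub>0 'b" where "sing \<equiv> Poly_Mapping.single"
abbreviation supp :: "('a \<Rightarrow>\<^sub>0 'b::zero) => 'a set" where "supp \<equiv> Poly_Mapping.keys"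

type_synonym mono = "nat \<Rightarrow>\<^sub>0 nat"

definition mon :: "mono => cpoly" where
  "mon \<eta> = sing \<eta> 1"

definition linmap :: "(cpoly => cpoly) => bool" where
  "linmap F \<longleftrightarrow> (\<forall>p q. F (p + q) = F p + F q) & (\<forall>c p. F (scale c p) = scale c (F p))"

lemma look_scale: "look (scale c p) \<eta> = c * look p \<eta>"
proof -
  have "Poly_Mapping.map ((*) c) p = scale c p"
    unfolding scale_def by (rule mult_map_scale_conv_mult)
  moreover have "look (Poly_Mapping.map ((*) c) p) \<eta> = c * look p \<eta>"
    by (simp add: Poly_Mapping.map.rep_eq when_def)
  ultimately show ?thesis by simp
qed

lemma scale_mon: "scale c (mon \<eta>) = sing \<eta> c"
  by (simp add: scale_def mon_def mult_single)

lemma scale_mult_left: "scale c p * q = scale c (p * q)"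
  and scale_mult_right: "p * scale c q = scale c (p * q)"
  by (simp_all add: scale_def mult_ac)

lemma mon_add: "mon (\<eta> + \<theta>) = mon \<eta> * mon \<theta>"
  by (simp add: mon_def mult_single)

lemma mon_0: "mon 0 = 1"
  by (simp add: mon_def)

lemma look_mon: "look (mon \<eta>) \<theta> = (if \<eta> = \<theta> then 1 else 0)"
  by (simp add: mon_def lookup_single when_def)

lemma poly_expand: "p = (\<Sum>\<eta>\<in>supp p. scale (look p \<eta>) (mon \<eta>))"
  by (rule poly_mapping_eqI) (auto simp: scale_mon lookup_sum lookup_single when_def in_keys_iff)

lemma linmap_add: "linmap F ==> F (p + q) = F p + F q"
  and linmap_scale: "linmap F ==> F (scale c p) = scale c (F p)"
  by (auto simp: linmap_def)

lemma linmap_0: "linmap F ==> F 0 = 0"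
  using linmap_scale[of F 0 0] by simp

lemma linmap_minus: "linmap F ==> F (- p) = - F p"
  using linmap_add[of F p "- p"] linmap_0[of F] by (simp add: eq_neg_iff_add_eq_0 add.commute)

lemma linmap_diff: "linmap F ==> F (p - q) = F p - F q"
  using linmap_add[of F p "- q"] linmap_minus[of F q] by simp

lemma linmap_sum: "linmap F ==> F (sum g A) = (\<Sum>x\<in>A. F (g x))"
  by (induction A rule: infinite_finite_induct) (auto simp: linmap_0 linmap_add)

lemma linmap_expand: "linmap F ==> F p = (\<Sum>\<eta>\<in>supp p. scale (look p \<eta>) (F (mon \<eta>)))"
  by (subst poly_expand[of p]) (simp add: linmap_sum linmap_scale)

lemma linmap_eqI:
  assumes "linmap F" "linmap G" "\<And>\<eta>. F (mon \<eta>) = G (mon \<eta>)"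
  shows "F p = G p"
  unfolding linmap_expand[OF assms(1), of p] linmap_expand[OF assms(2), of p] by (simp add: assms(3))

lemma linmap_mult: "linmap (%p. q * p)" "linmap (%p. p * q)"
  by (auto simp: linmap_def algebra_simps scale_mult_left scale_mult_right)

lemma linmap_comp: "linmap F ==> linmap G ==> linmap (%p. F (G p))"
  by (auto simp: linmap_def)

lemma linmap_plus: "linmap F ==> linmap G ==> linmap (%p. F p + G p)"
  by (auto simp: linmap_def cpoly.scale_right_distrib)

lemma linmap_id: "linmap (%p. p)"
  by (auto simp: linmap_def)

definition extend :: "(mono => cpoly) => cpoly => cpoly" where
  "extend g p = (\<Sum>\<eta>\<in>supp p. scale (look p \<eta>) (g \<eta>))"

lemma extend_superset:
  assumes "finite A" "supp p \<subseteq> A"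
  shows "extend g p = (\<Sum>\<eta>\<in>A. scale (look p \<eta>) (g \<eta>))"
  unfolding extend_def by (intro sum.mono_neutral_left assms) (auto simp: in_keys_iff)

lemma linmap_extend: "linmap (extend g)"
  unfolding linmap_def
proof (intro conjI allI)
  fix p q c
  have "extend g r = (\<Sum>\<eta>\<in>supp p \<union> supp q. scale (look r \<eta>) (g \<eta>))" if "r \<in> {p, q, p + q}" for r
    using that keys_add[of p q] by (intro extend_superset) auto
  then show "extend g (p + q) = extend g p + extend g q"
    by (simp add: lookup_add cpoly.scale_left_distrib sum.distrib)
  have "supp (scale c p) \<subseteq> supp p" by (auto simp: in_keys_iff look_scale)
  then show "extend g (scale c p) = scale c (extend g p)"
    by (simp add: extend_superset[of "supp p"] look_scale cpoly.scale_sum_right)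
qed

lemma extend_mon: "extend g (mon \<eta>) = g \<eta>"
  unfolding extend_def by (simp add: mon_def)

lemma supp_linmap:
  assumes "linmap F" "\<theta> \<in> supp (F p)"
  shows "\<exists>\<eta>\<in>supp p. \<theta> \<in> supp (F (mon \<eta>))"
proof (rule ccontr)
  assume "\<not> ?thesis"
  then have "look (F p) \<theta> = 0"
    by (subst linmap_expand[OF assms(1)]) (auto simp: lookup_sum look_scale in_keys_iff intro!: sum.neutral)
  with assms(2) show False by (simp add: in_keys_iff)
qed

section \<open>Algebra homomorphisms and substitutions\<close>

definition ahom :: "(cpoly => cpoly) => bool" where
  "ahom F \<longleftrightarrow> linmap F & F 1 = 1 & (\<forall>p q. F (p * q) = F p * F q)"

lemma ahom_linmap: "ahom F ==> linmap F"
  and ahom_1: "ahom F ==> F 1 = 1"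
  and ahom_mult: "ahom F ==> F (p * q) = F p * F q"
  by (auto simp: ahom_def)

lemma ahom_simps:
  assumes "ahom F"
  shows "F 0 = 0" "F 1 = 1" "F (p + q) = F p + F q" "F (p - q) = F p - F q" "F (- p) = - F p"
    "F (p * q) = F p * F q" "F (p ^ n) = F p ^ n" "F (of_nat n) = of_nat n"
proof -
  show "F 0 = 0" "F 1 = 1" "F (p + q) = F p + F q" "F (p - q) = F p - F q" "F (- p) = - F p"
    "F (p * q) = F p * F q" for p q
    using assms by (auto simp: ahom_def linmap_0 linmap_add linmap_diff linmap_minus)
  then show "F (p ^ n) = F p ^ n" "F (of_nat n) = of_nat n" by (induction n) auto
qed

lemma ahom_prod: "ahom F ==> F (prod g A) = (\<Prod>x\<in>A. F (g x))"
  by (induction A rule: infinite_finite_induct) (auto simp: ahom_simps)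

lemma ahom_sum: "ahom F ==> F (sum g A) = (\<Sum>x\<in>A. F (g x))"
  by (simp add: ahom_linmap linmap_sum)

lemma ahom_comp: "ahom F ==> ahom G ==> ahom (%p. F (G p))"
  by (auto simp: ahom_def linmap_def)

lemma ahom_id: "ahom (%p. p)"
  by (auto simp: ahom_def linmap_def)

lemma ahomI:
  assumes "linmap F" "F 1 = 1" "\<And>\<eta> \<theta>. F (mon \<eta> * mon \<theta>) = F (mon \<eta>) * F (mon \<theta>)"
  shows "ahom F"
proof -
  have step: "F (p * mon \<theta>) = F p * F (mon \<theta>)" for p \<theta>
    by (rule linmap_eqI[where F = "%p. F (p * mon \<theta>)" and G = "%p. F p * F (mon \<theta>)",
      OF linmap_comp[OF assms(1) linmap_mult(2)] linmap_comp[OF linmap_mult(2) assms(1)] assms(3)])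
  have "F (p * q) = F p * F q" for p q
    by (rule linmap_eqI[where F = "%q. F (p * q)" and G = "%q. F p * F q",
      OF linmap_comp[OF assms(1) linmap_mult(1)] linmap_comp[OF linmap_mult(1) assms(1)] step])
  then show ?thesis using assms by (simp add: ahom_def)
qed

lemma mon_sum: "finite A ==> mon (sum f A) = (\<Prod>x\<in>A. mon (f x))"
  by (induction A rule: finite_induct) (auto simp: mon_0 mon_add)

lemma mon_sing: "mon (sing i k) = var i ^ k"
proof (induction k)
  case (Suc k)
  have "sing i (Suc k) = sing i 1 + sing i k" by (simp flip: single_add)
  then show ?case using Suc by (simp add: mon_add) (simp add: mon_def var_def)
qed (simp add: mon_0)

lemma mono_expand: "(\<eta> :: mono) = (\<Sum>i\<in>supp \<eta>. sing i (look \<eta> i))"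
  by (rule poly_mapping_eqI) (auto simp: lookup_sum lookup_single when_def in_keys_iff)

lemma mon_prod: "mon \<eta> = (\<Prod>i\<in>supp \<eta>. var i ^ look \<eta> i)"
  by (subst mono_expand[of \<eta>], subst mon_sum) (simp_all add: mon_sing)

lemma ahom_eqI:
  assumes "ahom F" "ahom G" "\<And>i. F (var i) = G (var i)"
  shows "F p = G p"
proof (rule linmap_eqI[where F = F and G = G])
  fix \<eta> show "F (mon \<eta>) = G (mon \<eta>)"
    unfolding mon_prod using assms by (simp add: ahom_prod ahom_simps)
qed (use assms ahom_linmap in auto)

definition subst :: "(nat => cpoly) => cpoly => cpoly" where
  "subst \<phi> = extend (%\<eta>. \<Prod>i\<in>supp \<eta>. \<phi> i ^ look \<eta> i)"

lemma subst_mon: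
  assumes "finite A" "supp \<eta> \<subseteq> A"
  shows "subst \<phi> (mon \<eta>) = (\<Prod>i\<in>A. \<phi> i ^ look \<eta> i)"
  unfolding subst_def extend_mon by (intro prod.mono_neutral_left assms) (auto simp: in_keys_iff)

lemma ahom_subst: "ahom (subst \<phi>)"
proof (rule ahomI)
  show "linmap (subst \<phi>)" unfolding subst_def by (rule linmap_extend)
  show "subst \<phi> 1 = 1" using subst_mon[of "{}" 0 \<phi>] by (simp add: mon_0)
  fix \<eta> \<theta>
  have "subst \<phi> (mon \<tau>) = (\<Prod>i\<in>supp \<eta> \<union> supp \<theta>. \<phi> i ^ look \<tau> i)" if "\<tau> \<in> {\<eta>, \<theta>, \<eta> + \<theta>}" for \<tau>
    using that keys_add[of \<eta> \<theta>] by (intro subst_mon) auto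
  then show "subst \<phi> (mon \<eta> * mon \<theta>) = subst \<phi> (mon \<eta>) * subst \<phi> (mon \<theta>)"
    by (simp add: lookup_add power_add prod.distrib flip: mon_add)
qed

lemma subst_var: "subst \<phi> (var i) = \<phi> i"
  using subst_mon[of "{i}" "sing i 1" \<phi>] mon_sing[of i 1] by simp

lemma inj_map_key_transpose: "inj (Poly_Mapping.map_key (transpose a b) :: mono => mono)"
proof (rule injI)
  fix \<eta> \<theta> :: mono
  assume "Poly_Mapping.map_key (transpose a b) \<eta> = Poly_Mapping.map_key (transpose a b) \<theta>"
  then have "look \<eta> (transpose a b (transpose a b i)) = look \<theta> (transpose a b (transpose a b i))" for i
    by (metis comp_apply inj_transpose map_key.rep_eq)
  then show "\<eta> = \<theta>" by (intro poly_mapping_eqI) simp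
qed

section \<open>Exchange of two adjacent variables\<close>

definition swap_mono :: "nat => mono => mono" where
  "swap_mono i = Poly_Mapping.map_key (transpose i (Suc i))"

lemma look_swap_mono: "look (swap_mono i \<eta>) j = look \<eta> (transpose i (Suc i) j)"
  by (simp add: swap_mono_def map_key.rep_eq)

lemma swap_mono_swap [simp]: "swap_mono i (swap_mono i \<eta>) = \<eta>"
  by (rule poly_mapping_eqI) (simp add: look_swap_mono)

lemma look_swap_vars: "look (swap_vars i f) \<eta> = look f (swap_mono i \<eta>)"
  by (simp add: swap_vars_def map_key.rep_eq inj_map_key_transpose swap_mono_def)

lemma swap_vars_mon: "swap_vars i (mon \<eta>) = mon (swap_mono i \<eta>)"
  by (rule poly_mapping_eqI) (auto simp: look_swap_vars look_mon)

lemma swap_vars_var: "swap_vars i (var j) = var (transpose i (Suc i) j)"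
proof -
  have "swap_mono i (sing j 1) = sing (transpose i (Suc i) j) 1"
    by (rule poly_mapping_eqI) (auto simp: look_swap_mono lookup_single when_def transpose_def)
  then show ?thesis using swap_vars_mon[of i "sing j 1"] by (simp add: mon_def var_def)
qed

lemma ahom_swap: "ahom (swap_vars i)"
proof (rule ahomI)
  show "linmap (swap_vars i)"
    by (auto simp: linmap_def look_swap_vars lookup_add look_scale intro!: poly_mapping_eqI)
  have "swap_mono i 0 = 0" by (simp add: swap_mono_def)
  then show "swap_vars i 1 = 1" using swap_vars_mon[of i 0] by (simp add: mon_0)
  have "swap_mono i (\<eta> + \<theta>) = swap_mono i \<eta> + swap_mono i \<theta>" for \<eta> \<theta>
    by (rule poly_mapping_eqI) (simp add: look_swap_mono lookup_add)
  then show "swap_vars i (mon \<eta> * mon \<theta>) = swap_vars i (mon \<eta>) * swap_vars i (mon \<theta>)" for \<eta> \<theta>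
    by (simp add: swap_vars_mon flip: mon_add)
qed

lemmas swap_simps = ahom_simps[OF ahom_swap] swap_vars_var

lemma swap_swap [simp]: "swap_vars i (swap_vars i f) = f"
  by (rule ahom_eqI[OF ahom_comp[OF ahom_swap ahom_swap] ahom_id]) (simp add: swap_vars_var)

lemma swap_far:
  "Suc i < j | Suc j < i ==> swap_vars i (swap_vars j f) = swap_vars j (swap_vars i f)"
  by (rule ahom_eqI[OF ahom_comp ahom_comp]) (auto simp: ahom_swap swap_vars_var transpose_def)

lemma swap_braid: "swap_vars i (swap_vars (Suc i) (swap_vars i f)) =
    swap_vars (Suc i) (swap_vars i (swap_vars (Suc i) f))"
  by (rule ahom_eqI[OF ahom_comp[OF _ ahom_comp] ahom_comp[OF _ ahom_comp]])
    (auto simp: ahom_swap swap_vars_var transpose_def)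

section \<open>Divided differences\<close>

definition xdiff :: "nat => cpoly" where
  "xdiff i = var i - var (Suc i)"

lemma var_eq_iff: "var i = var j \<longleftrightarrow> i = j"
proof
  assume "var i = var j"
  then have "look (var i) (sing j 1) = 1" by (simp add: var_def)
  then have "sing i (1 :: nat) = sing j 1" by (simp add: var_def lookup_single when_def split: if_splits)
  then have "look (sing i (1 :: nat)) j = 1" by simp
  then show "i = j" by (simp add: lookup_single when_def split: if_splits)
qed simp

lemma xdiff_neq_0: "xdiff i ~= 0"
  by (simp add: xdiff_def var_eq_iff)

lemma swap_xdiff: "swap_vars i (xdiff i) = - xdiff i"
  by (simp add: xdiff_def swap_simps)

definition set2 :: "nat => mono => nat => nat => mono" where
  "set2 i \<eta> p q = Poly_Mapping.update i p (Poly_Mapping.update (Suc i) q \<eta>)"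

lemma look_set2: "look (set2 i \<eta> p q) j = (if j = i then p else if j = Suc i then q else look \<eta> j)"
  by (simp add: set2_def lookup_update)

lemma mon_set2: "mon (set2 i \<eta> p q) = mon (set2 i \<eta> 0 0) * (var i ^ p * var (Suc i) ^ q)"
proof -
  have "set2 i \<eta> p q = set2 i \<eta> 0 0 + (sing i p + sing (Suc i) q)"
    by (rule poly_mapping_eqI) (auto simp: look_set2 lookup_add lookup_single when_def)
  then show ?thesis by (simp add: mon_add mon_sing)
qed

text \<open>The quotient of \<open>x^a y^b - x^b y^a\<close> by \<open>x - y\<close> written out:
  all monomials of degree \<open>a + b - 1\<close> whose exponents are at least
  \<open>min a b\<close>, with a minus sign if \<open>a < b\<close>.\<close>

definition divdiff_mon :: "nat => mono => cpoly" where
  "divdiff_mon i \<eta> = (let a = look \<eta> i; b = look \<eta> (Suc i); m = min a b; d = max a b - m;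
     p = (\<Sum>k<d. mon (set2 i \<eta> (m + k) (m + (d - Suc k)))) in if b <= a then p else - p)"

lemma xdiff_sum_mon:
  "xdiff i * (\<Sum>k<d. mon (set2 i \<eta> (m + k) (m + (d - Suc k)))) =
     mon (set2 i \<eta> (m + d) m) - mon (set2 i \<eta> m (m + d))"
proof -
  let ?R = "mon (set2 i \<eta> 0 0)" and ?x = "var i" and ?y = "var (Suc i)"
  have "xdiff i * (\<Sum>k<d. mon (set2 i \<eta> (m + k) (m + (d - Suc k)))) =
      ?R * (?x * ?y) ^ m * (xdiff i * (\<Sum>k<d. ?y ^ (d - Suc k) * ?x ^ k))"
    unfolding sum_distrib_left
  proof (rule sum.cong[OF refl])
    fix k
    show "xdiff i * mon (set2 i \<eta> (m + k) (m + (d - Suc k))) =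
        ?R * (?x * ?y) ^ m * (xdiff i * (?y ^ (d - Suc k) * ?x ^ k))"
      by (subst mon_set2) (simp only: power_add power_mult_distrib mult_ac)
  qed
  also have "xdiff i * (\<Sum>k<d. ?y ^ (d - Suc k) * ?x ^ k) = ?x ^ d - ?y ^ d"
    unfolding xdiff_def by (rule power_diff_sumr2[symmetric])
  also have "?R * (?x * ?y) ^ m * (?x ^ d - ?y ^ d) = mon (set2 i \<eta> (m + d) m) - mon (set2 i \<eta> m (m + d))"
    by (subst (2 3) mon_set2) (simp add: power_add power_mult_distrib algebra_simps)
  finally show ?thesis .
qed

lemma xdiff_divdiff_mon: "xdiff i * divdiff_mon i \<eta> = mon \<eta> - mon (swap_mono i \<eta>)"
proof -
  let ?a = "look \<eta> i" and ?b = "look \<eta> (Suc i)"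
  have s: "set2 i \<eta> ?a ?b = \<eta>" "set2 i \<eta> ?b ?a = swap_mono i \<eta>"
    by (auto intro!: poly_mapping_eqI simp: look_set2 look_swap_mono transpose_def)
  show ?thesis
  proof (cases "?b <= ?a")
    case True
    then show ?thesis using xdiff_sum_mon[of i \<eta> ?b "?a - ?b"] s by (simp add: divdiff_mon_def Let_def min_absorb1 min_absorb2 max_absorb1 max_absorb2)
  next
    case False
    then show ?thesis using xdiff_sum_mon[of i \<eta> ?a "?b - ?a"] s by (simp add: divdiff_mon_def Let_def min_absorb1 min_absorb2 max_absorb1 max_absorb2)
  qed
qed

lemma xdiff_extend_divdiff: "xdiff i * extend (divdiff_mon i) f = f - swap_vars i f"
proof (rule linmap_eqI[where F = "%f. xdiff i * extend (divdiff_mon i) f"])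
  show "linmap (%f. f - swap_vars i f)"
    using linmap_plus[OF linmap_id, of "%f. - swap_vars i f"] ahom_linmap[OF ahom_swap, of i]
    by (simp add: linmap_def)
qed (auto intro: linmap_comp linmap_mult linmap_extend simp: extend_mon xdiff_divdiff_mon swap_vars_mon)

text \<open>The polynomial ring has no zero divisors, so \<open>xdiff i\<close> cancels and the
  definite description has a unique solution.\<close>

lemma divdiff_extend: "divdiff i f = extend (divdiff_mon i) f"
  unfolding divdiff_def
proof (rule the_equality)
  show "(var i - var (Suc i)) * extend (divdiff_mon i) f = f - swap_vars i f"
    using xdiff_extend_divdiff by (simp add: xdiff_def)
  fix g assume "(var i - var (Suc i)) * g = f - swap_vars i f"
  then have "xdiff i * g = xdiff i * extend (divdiff_mon i) f"
    by (simp add: xdiff_extend_divdiff) (simp add: xdiff_def)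
  then show "g = extend (divdiff_mon i) f" using xdiff_neq_0 by simp
qed

lemma xdiff_divdiff: "xdiff i * divdiff i f = f - swap_vars i f"
  by (simp add: divdiff_extend xdiff_extend_divdiff)

lemma divdiff_eqI: "xdiff i * g = f - swap_vars i f ==> divdiff i f = g"
  by (metis xdiff_divdiff xdiff_neq_0 mult_left_cancel)

lemma linmap_divdiff: "linmap (divdiff i)"
  using linmap_extend divdiff_extend by (metis (no_types, lifting) linmap_def)

lemma divdiff_mon_eq: "divdiff i (mon \<eta>) = divdiff_mon i \<eta>"
  by (simp add: divdiff_extend extend_mon)

lemma swap_divdiff: "swap_vars i (divdiff i f) = divdiff i f"
proof -
  have "- xdiff i * swap_vars i (divdiff i f) = swap_vars i f - f"
    using arg_cong[OF xdiff_divdiff, of "swap_vars i" i f] by (simp add: swap_simps swap_xdiff)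
  then have "xdiff i * swap_vars i (divdiff i f) = f - swap_vars i f"
    by (metis minus_diff_eq minus_minus mult_minus_left)
  then have "divdiff i f = swap_vars i (divdiff i f)" by (rule divdiff_eqI)
  then show ?thesis by simp
qed

lemma divdiff_mult: "divdiff i (f * g) = divdiff i f * g + swap_vars i f * divdiff i g"
proof (rule divdiff_eqI)
  have "xdiff i * (divdiff i f * g + swap_vars i f * divdiff i g) =
      (xdiff i * divdiff i f) * g + swap_vars i f * (xdiff i * divdiff i g)" by (simp add: algebra_simps)
  then show "xdiff i * (divdiff i f * g + swap_vars i f * divdiff i g) = f * g - swap_vars i (f * g)"
    by (simp add: xdiff_divdiff swap_simps algebra_simps)
qed

lemma divdiff_symmetric: "swap_vars i f = f ==> divdiff i f = 0"
  by (rule divdiff_eqI) simp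

lemma divdiff_0_iff: "divdiff i f = 0 \<longleftrightarrow> swap_vars i f = f"
  using divdiff_symmetric xdiff_divdiff[of i f] by auto

lemma supp_divdiff:
  assumes "\<theta> \<in> supp (divdiff i f)"
  obtains \<eta> where "\<eta> \<in> supp f" "\<And>l. l ~= i ==> l ~= Suc i ==> look \<theta> l = look \<eta> l"
    "Suc (look \<theta> i + look \<theta> (Suc i)) = look \<eta> i + look \<eta> (Suc i)"
    "min (look \<eta> i) (look \<eta> (Suc i)) <= look \<theta> i" "min (look \<eta> i) (look \<eta> (Suc i)) <= look \<theta> (Suc i)"
    "look \<theta> i < max (look \<eta> i) (look \<eta> (Suc i))" "look \<theta> (Suc i) < max (look \<eta> i) (look \<eta> (Suc i))"
proof -
  obtain \<eta> where \<eta>: "\<eta> \<in> supp f" "\<theta> \<in> supp (divdiff_mon i \<eta>)"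
    using supp_linmap[OF linmap_divdiff assms] by (auto simp: divdiff_mon_eq)
  let ?a = "look \<eta> i" and ?b = "look \<eta> (Suc i)"
  have supp_sum: "\<theta> \<in> supp (\<Sum>k<d. mon (h k)) ==> \<exists>k<d. \<theta> = h k" for d h
    using keys_sum[of "%k. mon (h k)" "{..<d}"] by (auto simp: mon_def)
  define m where "m = min ?a ?b"
  define d where "d = max ?a ?b - m"
  have "\<theta> \<in> supp (\<Sum>k<d. mon (set2 i \<eta> (m + k) (m + (d - Suc k))))"
    using \<eta>(2) unfolding divdiff_mon_def Let_def m_def[symmetric] d_def[symmetric]
    by (auto simp: keys_minus split: if_splits)
  from supp_sum[OF this] have "\<exists>k<d. \<theta> = set2 i \<eta> (m + k) (m + (d - Suc k))" .
  then obtain k where k: "k < d" "\<theta> = set2 i \<eta> (m + k) (m + (d - Suc k))" by blast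
  then show ?thesis by (intro that[OF \<eta>(1)]) (auto simp: look_set2 m_def d_def)
qed

section \<open>The operators\<close>

text \<open>
  With \<open>s = 1\<close> the operator \<open>T s t i\<close> is the isobaric divided difference minus the identity, for keys
  (\<open>t = 0\<close>) or Lascoux polynomials (\<open>t = 1\<close>); with \<open>s = 0\<close> it is the divided difference (\<open>t = 0\<close>) or
  the Grothendieck operator minus the identity (\<open>t = 1\<close>).
\<close>

definition bfac :: "nat => nat => nat => nat => cpoly" where
  "bfac s t i j = var j ^ s * (1 - of_nat t * var i)"

definition T :: "nat => nat => nat => cpoly => cpoly" where
  "T s t i f = bfac s t i (Suc i) * divdiff i f"

text \<open>The constant in the quadratic relation \<open>T^2 = - tau T\<close>.\<close>

definition tau :: "nat => nat => nat" where
  "tau s t = (if s = 0 then t else 1)"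

lemma linmap_T: "linmap (T s t i)"
  unfolding T_def by (rule linmap_comp[OF linmap_mult(1) linmap_divdiff])

lemma xdiff_T: "xdiff i * T s t i f = bfac s t i (Suc i) * (f - swap_vars i f)"
  using xdiff_divdiff[of i f] by (simp add: T_def mult.left_commute)

lemma T_symmetric_mult: "swap_vars i h = h ==> T s t i (h * f) = h * T s t i f"
  by (simp add: T_def divdiff_mult divdiff_symmetric mult_ac)

lemma swap_bfac: "swap_vars k (bfac s t i j) = bfac s t (transpose k (Suc k) i) (transpose k (Suc k) j)"
  by (simp add: bfac_def swap_simps)

lemma divdiff_var: "divdiff i (var i) = 1" "divdiff i (var (Suc i)) = -1"
  by (rule divdiff_eqI; simp add: swap_simps xdiff_def)+

lemma divdiff_1: "divdiff i 1 = 0" "divdiff i (of_nat n) = 0"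
  by (auto intro!: divdiff_symmetric simp: swap_simps)

lemma divdiff_bfac: "s <= 1 ==> divdiff i (bfac s t i (Suc i)) = - of_nat (tau s t)"
  by (cases s) (auto simp: bfac_def tau_def divdiff_mult divdiff_var divdiff_1 linmap_diff[OF linmap_divdiff]
    swap_simps algebra_simps)

text \<open>The inner divided difference is symmetric in the two variables, so the outer one acts
  only on \<open>bfac\<close>, which it turns into the constant \<open>- tau\<close>.\<close>

lemma T_T: "s <= 1 ==> T s t i (T s t i f) = - of_nat (tau s t) * T s t i f"
  unfolding T_def
  by (subst divdiff_mult) (simp add: divdiff_bfac divdiff_symmetric[OF swap_divdiff])

lemma T_eq_0_iff: "t <= 1 ==> T s t i f = 0 \<longleftrightarrow> swap_vars i f = f"
proof -
  assume "t <= 1"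
  have "sing i (1 :: nat) ~= 0" by (metis lookup_single_eq lookup_zero zero_neq_one)
  then have "look (1 - of_nat t * var i) 0 = 1"
    using \<open>t <= 1\<close> by (cases t) (auto simp: lookup_minus var_def lookup_single when_def)
  then have "bfac s t i (Suc i) ~= 0"
    unfolding bfac_def by (metis lookup_zero mult_eq_0_iff power_eq_0_iff zero_neq_one mon_sing look_mon power_one_right)
  then show ?thesis by (simp add: T_def divdiff_0_iff)
qed

lemma swap_T_far: "Suc i < j | Suc j < i ==> swap_vars i (T s t j f) = T s t j (swap_vars i f)"
proof -
  assume far: "Suc i < j | Suc j < i"
  have tr: "transpose i (Suc i) j = j" "transpose i (Suc i) (Suc j) = Suc j"
    using far by (auto simp: transpose_def)
  have "xdiff j * swap_vars i (T s t j f) = swap_vars i (xdiff j * T s t j f)"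
    by (simp add: swap_simps xdiff_def tr)
  also have "\<dots> = xdiff j * T s t j (swap_vars i f)"
    unfolding xdiff_T by (simp add: swap_simps swap_bfac swap_far[OF far] tr)
  finally show ?thesis using xdiff_neq_0 by simp
qed

text \<open>Multiplied by both differences, either composition becomes the same expression,
  symmetric in \<open>i\<close> and \<open>j\<close>.\<close>

lemma T_far:
  assumes "Suc i < j | Suc j < i"
  shows "T s t i (T s t j f) = T s t j (T s t i f)"
proof -
  have eq: "xdiff j * (xdiff i * T s t i (T s t j f)) = bfac s t i (Suc i) * bfac s t j (Suc j) *
      (f - swap_vars i f - swap_vars j f + swap_vars i (swap_vars j f))"
    if far: "Suc i < j | Suc j < i" for i j
  proof -
    have "xdiff j * (xdiff i * T s t i (T s t j f)) =
        bfac s t i (Suc i) * (xdiff j * T s t j f - xdiff j * T s t j (swap_vars i f))"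
      unfolding xdiff_T[of i] swap_T_far[OF far] by (simp add: algebra_simps)
    also have "\<dots> = bfac s t i (Suc i) * bfac s t j (Suc j) *
      (f - swap_vars i f - swap_vars j f + swap_vars i (swap_vars j f))"
      unfolding xdiff_T swap_far[OF far] by (simp add: algebra_simps)
    finally show ?thesis .
  qed
  have "xdiff j * (xdiff i * T s t i (T s t j f)) = bfac s t j (Suc j) * bfac s t i (Suc i) *
      (f - swap_vars j f - swap_vars i f + swap_vars j (swap_vars i f))"
    unfolding eq[OF assms] swap_far[OF assms] by (simp add: algebra_simps)
  also have "\<dots> = xdiff i * (xdiff j * T s t j (T s t i f))"
    by (rule eq[symmetric]) (use assms in blast)
  finally have "xdiff j * xdiff i * T s t i (T s t j f) = xdiff j * xdiff i * T s t j (T s t i f)"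
    by (simp add: mult_ac)
  then show ?thesis using xdiff_neq_0 by simp
qed

text \<open>The identities to which the two sides of the braid relation reduce; the first two serve
  \<open>s = 0\<close>, the last two \<open>s = 1\<close>.\<close>

lemma bfac_identity:
  fixes x y z t :: cpoly
  shows "(x - z) * ((1 - t * y) * (1 - t * x)) - (y - z) * ((1 - t * x) * (1 - t * y)) =
      (1 - t * y) * (1 - t * x) * (x - y)"
    "(x - z) * ((1 - t * x) * (1 - t * y)) - (x - y) * ((1 - t * x) * (1 - t * z)) =
      (1 - t * x) * (1 - t * x) * (y - z)"
    "(x - z) * ((z * (1 - t * y)) * (y * (1 - t * x))) - (y - z) * ((z * (1 - t * x)) * (x * (1 - t * y))) =
      (z * (1 - t * y)) * (z * (1 - t * x)) * (x - y)"
    "(x - z) * ((y * (1 - t * x)) * (z * (1 - t * y))) - (x - y) * ((z * (1 - t * x)) * (y * (1 - t * z))) =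
      (y * (1 - t * x)) * (z * (1 - t * x)) * (y - z)"
  by algebra+

text \<open>Cleared of denominators, both triple products are the same multiple of an alternating
  sum over the six permutations of three variables. They differ only in the reduced word of the
  longest permutation, so \<open>swap_braid\<close> yields the braid relation.\<close>

lemma T_T_T:
  assumes "s <= 1"
  shows "(var i - var (Suc i)) * (var i - var (Suc (Suc i))) * (var (Suc i) - var (Suc (Suc i))) * T s t i (T s t (Suc i) (T s t i f)) =
    bfac s t i (Suc i) * bfac s t i (Suc (Suc i)) * bfac s t (Suc i) (Suc (Suc i)) *
    (f - swap_vars i f - swap_vars (Suc i) f + swap_vars (Suc i) (swap_vars i f) + swap_vars i (swap_vars (Suc i) f)
     - swap_vars i (swap_vars (Suc i) (swap_vars i f)))"
    (is "?d01 * ?d02 * ?d12 * ?k = ?b01 * ?b02 * ?b12 * _")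
    and "(var i - var (Suc i)) * (var i - var (Suc (Suc i))) * (var (Suc i) - var (Suc (Suc i))) * T s t (Suc i) (T s t i (T s t (Suc i) f)) =
    bfac s t i (Suc i) * bfac s t i (Suc (Suc i)) * bfac s t (Suc i) (Suc (Suc i)) *
    (f - swap_vars i f - swap_vars (Suc i) f + swap_vars (Suc i) (swap_vars i f) + swap_vars i (swap_vars (Suc i) f)
     - swap_vars (Suc i) (swap_vars i (swap_vars (Suc i) f)))"
    (is "_ * ?k' = _")
proof -
  let ?s0 = "swap_vars i" and ?s1 = "swap_vars (Suc i)"
  let ?b10 = "bfac s t (Suc i) i" and ?b21 = "bfac s t (Suc (Suc i)) (Suc i)"
  have r: "xdiff i = ?d01" "xdiff (Suc i) = ?d12" by (simp_all add: xdiff_def)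
  have sw: "?s0 ?d12 = ?d02" "?s0 ?d02 = ?d12" "?s1 ?d01 = ?d02" "?s1 ?d02 = ?d01"
     "?s0 ?b12 = ?b02" "?s0 ?b02 = ?b12" "?s0 ?b01 = ?b10" "?s1 ?b01 = ?b02" "?s1 ?b02 = ?b01" "?s1 ?b12 = ?b21"
    by (simp_all add: swap_bfac swap_simps transpose_def)
  have id1: "?d02 * (?b12 * ?b01) - ?d12 * (?b02 * ?b10) = ?b12 * ?b02 * ?d01"
    and id2: "?d02 * (?b01 * ?b12) - ?d01 * (?b02 * ?b21) = ?b01 * ?b02 * ?d12"
    using assms(1) bfac_identity unfolding bfac_def by (cases s; simp)+
  define q where "q = divdiff i f"
  have q: "?d01 * q = f - ?s0 f" "?s0 q = q" using xdiff_divdiff[of i f] r by (auto simp: q_def swap_divdiff)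
  have q1: "?d02 * ?s1 q = ?s1 f - ?s1 (?s0 f)"
    using arg_cong[OF q(1), of ?s1] sw by (simp add: swap_simps(1-8))
  have q01: "?d12 * ?s0 (?s1 q) = ?s0 (?s1 f) - ?s0 (?s1 (?s0 f))"
    using arg_cong[OF q1, of ?s0] sw by (simp add: swap_simps(1-8))
  define g where "g = T s t i f"
  define h where "h = T s t (Suc i) g"
  have g: "g = ?b01 * q" "?s0 g = ?b10 * q" "?s1 g = ?b02 * ?s1 q" "?s0 (?s1 g) = ?b12 * ?s0 (?s1 q)"
    unfolding g_def T_def q_def[symmetric] using sw q(2) by (simp_all add: swap_simps(1-8))
  have h: "?d12 * h = ?b12 * (g - ?s1 g)" using xdiff_T[of "Suc i" s t g] r by (simp add: h_def)
  have h0: "?d02 * ?s0 h = ?b02 * (?s0 g - ?s0 (?s1 g))"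
    using arg_cong[OF h, of ?s0] sw by (simp add: swap_simps(1-8))
  have "?d01 * ?d02 * ?d12 * ?k = ?d02 * ?d12 * (xdiff i * T s t i h)"
    unfolding r h_def g_def by (simp add: mult_ac)
  also have "\<dots> = ?b01 * (?d02 * (?d12 * h) - ?d12 * (?d02 * ?s0 h))"
    unfolding xdiff_T by (simp add: algebra_simps)
  also have "\<dots> = ?b01 * ((?d02 * (?b12 * ?b01) - ?d12 * (?b02 * ?b10)) * q
      - ?b12 * ?b02 * (?d02 * ?s1 q) + ?b02 * ?b12 * (?d12 * ?s0 (?s1 q)))"
    unfolding h h0 g(4) unfolding g(2,3) unfolding g(1) by (simp only: algebra_simps)
  also have "\<dots> = ?b01 * ?b02 * ?b12 * (?d01 * q - ?d02 * ?s1 q + ?d12 * ?s0 (?s1 q))"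
    unfolding id1 by (simp only: algebra_simps)
  finally show "?d01 * ?d02 * ?d12 * ?k = ?b01 * ?b02 * ?b12 *
    (f - ?s0 f - ?s1 f + ?s1 (?s0 f) + ?s0 (?s1 f) - ?s0 (?s1 (?s0 f)))"
    unfolding q(1) q1 q01 by (simp add: algebra_simps)
  define q' where "q' = divdiff (Suc i) f"
  have q': "?d12 * q' = f - ?s1 f" "?s1 q' = q'" using xdiff_divdiff[of "Suc i" f] r by (auto simp: q'_def swap_divdiff)
  have q0': "?d02 * ?s0 q' = ?s0 f - ?s0 (?s1 f)"
    using arg_cong[OF q'(1), of ?s0] sw by (simp add: swap_simps(1-8))
  have q10': "?d01 * ?s1 (?s0 q') = ?s1 (?s0 f) - ?s1 (?s0 (?s1 f))"
    using arg_cong[OF q0', of ?s1] sw by (simp add: swap_simps(1-8))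
  define g' where "g' = T s t (Suc i) f"
  define h' where "h' = T s t i g'"
  have g': "g' = ?b12 * q'" "?s1 g' = ?b21 * q'" "?s0 g' = ?b02 * ?s0 q'" "?s1 (?s0 g') = ?b01 * ?s1 (?s0 q')"
    unfolding g'_def T_def q'_def[symmetric] using sw q'(2) by (simp_all add: swap_simps(1-8))
  have h': "?d01 * h' = ?b01 * (g' - ?s0 g')" using xdiff_T[of i s t g'] r by (simp add: h'_def)
  have h1': "?d02 * ?s1 h' = ?b02 * (?s1 g' - ?s1 (?s0 g'))"
    using arg_cong[OF h', of ?s1] sw by (simp add: swap_simps(1-8))
  have "?d01 * ?d02 * ?d12 * ?k' = ?d02 * ?d01 * (xdiff (Suc i) * T s t (Suc i) h')"
    unfolding r h'_def g'_def by (simp add: mult_ac)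
  also have "\<dots> = ?b12 * (?d02 * (?d01 * h') - ?d01 * (?d02 * ?s1 h'))"
    unfolding xdiff_T by (simp add: algebra_simps)
  also have "\<dots> = ?b12 * ((?d02 * (?b01 * ?b12) - ?d01 * (?b02 * ?b21)) * q'
      - ?b01 * ?b02 * (?d02 * ?s0 q') + ?b02 * ?b01 * (?d01 * ?s1 (?s0 q')))"
    unfolding h' h1' g'(4) unfolding g'(2,3) unfolding g'(1) by (simp only: algebra_simps)
  also have "\<dots> = ?b01 * ?b02 * ?b12 * (?d12 * q' - ?d02 * ?s0 q' + ?d01 * ?s1 (?s0 q'))"
    unfolding id2 by (simp only: algebra_simps)
  finally show "?d01 * ?d02 * ?d12 * ?k' = ?b01 * ?b02 * ?b12 *
    (f - ?s0 f - ?s1 f + ?s1 (?s0 f) + ?s0 (?s1 f) - ?s1 (?s0 (?s1 f)))"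
    unfolding q'(1) q0' q10' by (simp add: algebra_simps)
qed

lemma T_braid: "s <= 1 ==> T s t i (T s t (Suc i) (T s t i f)) = T s t (Suc i) (T s t i (T s t (Suc i) f))"
proof -
  assume "s <= 1"
  let ?D = "(var i - var (Suc i)) * (var i - var (Suc (Suc i))) * (var (Suc i) - var (Suc (Suc i)))"
  have "?D ~= 0" by (simp add: var_eq_iff)
  moreover have "?D * T s t i (T s t (Suc i) (T s t i f)) = ?D * T s t (Suc i) (T s t i (T s t (Suc i) f))"
    unfolding T_T_T[OF \<open>s <= 1\<close>] swap_braid ..
  ultimately show ?thesis by simp
qed

section \<open>Chains of adjacent swaps\<close>

lemma length_swap_parts [simp]: "length (swap_parts i \<alpha>) = length \<alpha>"
  by (simp add: swap_parts_def)

lemma nth_swap_parts: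
  "Suc i < length \<alpha> ==> j < length \<alpha> ==> swap_parts i \<alpha> ! j = (if j = i then \<alpha> ! Suc i else if j = Suc i then \<alpha> ! i else \<alpha> ! j)"
  by (simp add: swap_parts_def nth_list_update)

lemma swap_parts_swap_parts: "Suc i < length \<alpha> ==> swap_parts i (swap_parts i \<alpha>) = \<alpha>"
  by (rule nth_equalityI) (auto simp: nth_swap_parts)

lemma mset_swap_parts: "Suc i < length \<alpha> ==> mset (swap_parts i \<alpha>) = mset \<alpha>"
  by (simp add: swap_parts_def mset_swap)

text \<open>Moving a larger part to the left lowers it, so it measures the distance to a decreasing
  composition in the inductions below.\<close>

definition weight :: "nat list => nat" where
  "weight \<alpha> = (\<Sum>k<length \<alpha>. k * \<alpha> ! k)"

lemma weight_swap_parts: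
  assumes "Suc i < length \<alpha>" "\<alpha> ! i < \<alpha> ! Suc i"
  shows "weight (swap_parts i \<alpha>) < weight \<alpha>"
proof -
  let ?n = "length \<alpha>"
  have split: "(\<Sum>k<?n. g k) = (\<Sum>k\<in>{..<?n} - {i, Suc i}. g k) + (g i + g (Suc i))" for g :: "nat => nat"
    using assms(1) sum.subset_diff[of "{i, Suc i}" "{..<?n}" g] by auto
  have "(\<Sum>k\<in>{..<?n} - {i, Suc i}. k * swap_parts i \<alpha> ! k) = (\<Sum>k\<in>{..<?n} - {i, Suc i}. k * \<alpha> ! k)"
    using assms(1) by (intro sum.cong) (auto simp: nth_swap_parts)
  then show ?thesis
    unfolding weight_def length_swap_parts split using assms by (simp add: nth_swap_parts)
qed

lemma decreasing_iff_nth: "sorted_wrt (\<ge>) (\<alpha> :: nat list) \<longleftrightarrow> (\<forall>i. Suc i < length \<alpha> --> \<alpha> ! i \<ge> \<alpha> ! Suc i)"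
  by (rule sorted_wrt_iff_nth_Suc_transp) (auto simp: transp_def)

fun chain :: "(nat => nat => bool) => nat list => nat list => bool" where
  "chain r \<alpha> [] \<longleftrightarrow> True"
| "chain r \<alpha> (i # ws) \<longleftrightarrow> Suc i < length \<alpha> & r (\<alpha> ! i) (\<alpha> ! Suc i) & chain r (swap_parts i \<alpha>) ws"

lemma chain_append: "chain r \<alpha> (ws @ vs) \<longleftrightarrow> chain r \<alpha> ws & chain r (fold swap_parts ws \<alpha>) vs"
  by (induction ws arbitrary: \<alpha>) auto

lemma swap_parts_Cons: "Suc i < length \<alpha> ==> swap_parts (Suc i) (b # \<alpha>) = b # swap_parts i \<alpha>"
  by (simp add: swap_parts_def)

lemma chain_map_Suc:
  "chain r \<alpha> ws ==> chain r (b # \<alpha>) (map Suc ws) & fold swap_parts (map Suc ws) (b # \<alpha>) = b # fold swap_parts ws \<alpha>"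
  by (induction ws arbitrary: \<alpha>) (auto simp: swap_parts_Cons)

lemma chain_to_front:
  "\<forall>y\<in>set ys. r y b ==> chain r (ys @ b # zs) (rev [0..<length ys]) \<and>
     fold swap_parts (rev [0..<length ys]) (ys @ b # zs) = b # ys @ zs"
proof (induction ys arbitrary: zs rule: rev_induct)
  case (snoc y ys)
  have "swap_parts (length ys) ((ys @ [y]) @ b # zs) = ys @ b # y # zs"
    by (simp add: swap_parts_def nth_append list_update_append)
  then show ?case using snoc.IH[of "y # zs"] snoc.prems by (simp add: nth_append)
qed simp

definition rank :: "(nat => nat => bool) => nat list => nat => nat" where
  "rank r \<beta> k = card {j. k < j & j < length \<beta> & r (\<beta> ! j) (\<beta> ! k)}"

text \<open>The word of an insertion sort: in round \<open>k\<close> the swaps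
  \<open>k + q k - 1, ..., k\<close> carry one entry from place \<open>k + q k\<close> to place
  \<open>k\<close>. If \<open>q\<close> is a Lehmer code this is the usual reduced word, and its
  letters can be computed place by place.\<close>

definition rank_word :: "nat => (nat => nat) => nat list" where
  "rank_word n q = concat (map (%k. map (%j. k + j) (rev [0..<q k])) [0..<n])"

lemma rank_word_Suc: "rank_word (Suc n) q = rev [0..<q 0] @ map Suc (rank_word n (%k. q (Suc k)))"
proof -
  have "[0..<Suc n] = 0 # map Suc [0..<n]" by (simp add: map_Suc_upt upt_conv_Cons del: upt_Suc)
  then show ?thesis unfolding rank_word_def
    by (auto simp: map_concat simp del: upt_Suc intro!: map_idI arg_cong[where f = concat] map_cong)
qed

lemma rank_Cons_Suc: "rank r (b # \<beta>) (Suc k) = rank r \<beta> k"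
proof -
  have "{j. Suc k < j & j < length (b # \<beta>) & r ((b # \<beta>) ! j) ((b # \<beta>) ! Suc k)} =
      Suc ` {j. k < j & j < length \<beta> & r (\<beta> ! j) (\<beta> ! k)}"
    by (auto simp: image_iff nth_Cons' gr0_conv_Suc)
  then show ?thesis by (simp add: rank_def card_image)
qed

lemma rank_Cons_0: "rank r (b # \<beta>) 0 = length (filter (%x. r x b) \<beta>)"
proof -
  have "{j. 0 < j & j < length (b # \<beta>) & r ((b # \<beta>) ! j) ((b # \<beta>) ! 0)} =
      Suc ` {j. j < length \<beta> & r (\<beta> ! j) b}"
    by (auto simp: image_iff gr0_conv_Suc)
  then show ?thesis by (simp add: rank_def card_image length_filter_conv_card)
qed

lemma rank_word_cong: "(\<And>k. k < n ==> q k = q' k) ==> rank_word n q = rank_word n q'"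
  unfolding rank_word_def by (intro arg_cong[where f = concat] map_cong) auto

text \<open>Moving an entry to the front keeps the others in sorted order, so in each round the
  entry due next stands behind exactly those that precede it under \<open>r\<close>. These are still
  to be placed, hence are the later entries counted by \<open>rank\<close>.\<close>

lemma chain_rank_word:
  assumes r: "transp r" "asymp r" "totalp r"
  shows "sorted_wrt (%a b. \<not> r b a) \<sigma> ==> mset \<sigma> = mset \<beta> ==>
    chain r \<sigma> (rank_word (length \<beta>) (rank r \<beta>)) & fold swap_parts (rank_word (length \<beta>) (rank r \<beta>)) \<sigma> = \<beta>"
proof (induction \<beta> arbitrary: \<sigma>)
  case Nil
  then show ?case by (simp add: rank_word_def)
next
  case (Cons b \<beta>)
  define ys where "ys = filter (%x. r x b) \<sigma>"
  define zs' where "zs' = filter (%x. \<not> r x b) \<sigma>"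
  have split: "\<sigma> = ys @ zs'" using Cons.prems(1) unfolding ys_def zs'_def
  proof (induction \<sigma>)
    case (Cons a \<sigma>)
    show ?case
    proof (cases "r a b")
      case False
      have "\<not> r x b" if "x \<in> set \<sigma>" for x
      proof
        assume "r x b"
        have "\<not> r x a" using Cons.prems that by auto
        then have "x = a | r a x" using r(3) by (auto simp: totalp_on_def)
        then show False using \<open>r x b\<close> False r(1) by (auto dest: transpD)
      qed
      then show ?thesis using False by (auto simp: filter_empty_conv filter_id_conv)
    qed (use Cons in auto)
  qed simp
  have "b \<in> set \<sigma>" using Cons.prems(2) by (metis list.set_intros(1) mset_eq_setD)
  then have bz: "b \<in> set zs'" using r(2) by (auto simp: zs'_def dest: asympD)
  then obtain z zs where zs: "zs' = z # zs" by (cases zs') auto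
  have "sorted_wrt (%a b. \<not> r b a) (z # zs)"
    using Cons.prems(1) unfolding zs[symmetric] zs'_def by (rule sorted_wrt_filter)
  moreover have "z \<in> set zs'" using zs by simp
  then have "\<not> r z b" by (simp add: zs'_def)
  ultimately have "z = b" using bz r(3) unfolding zs by (auto dest: totalpD)
  with zs split have \<sigma>: "\<sigma> = ys @ b # zs" by simp
  let ?q = "rank r (b # \<beta>)"
  have len: "?q 0 = length ys"
  proof -
    have "length ys = size (filter_mset (%x. r x b) (mset \<sigma>))" by (simp add: ys_def flip: mset_filter)
    also have "\<dots> = length (filter (%x. r x b) (b # \<beta>))"
      unfolding Cons.prems(2) by (metis mset_filter size_mset)
    also have "\<dots> = ?q 0" using r(2) by (auto simp: rank_Cons_0 dest: asympD)
    finally show ?thesis by simp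
  qed
  have 1: "chain r \<sigma> (rev [0..<?q 0])" "fold swap_parts (rev [0..<?q 0]) \<sigma> = b # ys @ zs"
    using chain_to_front[of ys r b zs] unfolding \<sigma> len by (auto simp: ys_def)
  have "sorted_wrt (%a b. \<not> r b a) (ys @ zs)" using Cons.prems(1) unfolding \<sigma> by (auto simp: sorted_wrt_append)
  moreover have "mset (ys @ zs) = mset \<beta>" using Cons.prems(2) unfolding \<sigma> by simp
  ultimately have 2: "chain r (ys @ zs) (rank_word (length \<beta>) (rank r \<beta>))"
    "fold swap_parts (rank_word (length \<beta>) (rank r \<beta>)) (ys @ zs) = \<beta>" using Cons.IH by auto
  have w: "rank_word (length (b # \<beta>)) ?q = rev [0..<?q 0] @ map Suc (rank_word (length \<beta>) (rank r \<beta>))"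
    by (simp add: rank_word_Suc rank_Cons_Suc)
  show ?case unfolding w chain_append fold_append comp_apply
    using 1 2 chain_map_Suc[OF 2(1), of b] by simp
qed

section \<open>Linear functionals\<close>

definition linfun :: "(cpoly => complex) => bool" where
  "linfun \<phi> \<longleftrightarrow> (\<forall>p q. \<phi> (p + q) = \<phi> p + \<phi> q) & (\<forall>c p. \<phi> (scale c p) = c * \<phi> p)"

lemma linfun_of_nat: "linfun \<phi> ==> \<phi> (of_nat n * p) = of_nat n * \<phi> p"
proof -
  have "of_nat n * p = scale (of_nat n) p" by (simp add: scale_def flip: single_of_nat)
  then show "linfun \<phi> ==> \<phi> (of_nat n * p) = of_nat n * \<phi> p" by (simp add: linfun_def)
qed

lemma linfun_diff: "linfun \<phi> ==> \<phi> (p - q) = \<phi> p - \<phi> q"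
proof -
  assume l: "linfun \<phi>"
  then have "\<phi> (p - q + q) = \<phi> (p - q) + \<phi> q" unfolding linfun_def by blast
  then show ?thesis by simp
qed

lemma linfun_0: "linfun \<phi> ==> \<phi> 0 = 0"
  using linfun_diff[of \<phi> 0 0] by simp

lemma linfun_comp: "linfun \<phi> ==> linmap G ==> linfun (%p. \<phi> (G p))"
  by (auto simp: linfun_def linmap_def)

section \<open>The polynomials generated by a system of operators\<close>

locale ops =
  fixes s t c :: nat
  assumes s: "s <= 1" and t: "t <= 1" and c: "c = 0 | c = tau s t"
begin

definition E :: "nat => cpoly => cpoly" where
  "E i f = T s t i f + of_nat c * f"

definition F :: "nat => cpoly => cpoly" where
  "F i f = T s t i f + of_nat (tau s t - c) * f"

lemma c_cases: "c = 0 | c = 1 & tau s t = 1"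
  using c t by (auto simp: tau_def split: if_splits)

lemma tau_cases: "tau s t = 0 | tau s t = 1"
  using t by (auto simp: tau_def)

lemmas T_add = linmap_add[OF linmap_T] and T_diff = linmap_diff[OF linmap_T]
  and T_minus = linmap_minus[OF linmap_T] and T_0 = linmap_0[OF linmap_T]

lemma linmap_E: "linmap (E i)" and linmap_F: "linmap (F i)"
  unfolding E_def F_def by (intro linmap_plus linmap_T linmap_mult)+

lemma TT: "T s t i (T s t i f) = - of_nat (tau s t) * T s t i f"
  using T_T s by blast

text \<open>\<open>E\<close> and \<open>F\<close> are \<open>T\<close> and \<open>T + tau\<close> in
  one order or the other, and the product of these vanishes by the quadratic relation.\<close>

lemma F_E: "F i (E i f) = 0"
  using c_cases tau_cases TT[of i f]
  by (auto simp: E_def F_def T_add T_0)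

lemma E_far: "Suc i < j | Suc j < i ==> E i (E j f) = E j (E i f)"
  using c_cases T_far[of i j s t f] by (auto simp: E_def T_add T_0)

lemma T_E_far: "Suc i < j | Suc j < i ==> T s t i (E j f) = E j (T s t i f)"
  using c_cases T_far[of i j s t f] by (auto simp: E_def T_add T_0)

lemma T_braid': "T s t i (T s t (Suc i) (T s t i f)) = T s t (Suc i) (T s t i (T s t (Suc i) f))"
  using T_braid s by blast

text \<open>In the expansion of the shifted operators the squares of \<open>T\<close> collapse to
  linear terms, and what remains besides the braid relation of \<open>T\<close> is symmetric in
  \<open>i\<close> and \<open>Suc i\<close>.\<close>

lemma E_braid: "E i (E (Suc i) (E i f)) = E (Suc i) (E i (E (Suc i) f))"
  using c_cases T_braid'[of i f] TT[of i] TT[of "Suc i"]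
  by (auto simp: E_def T_add T_minus T_0)

text \<open>The intertwining form of the braid relation: a symmetry in one pair of variables passes
  through two operators to the neighbouring pair.\<close>

lemma T_E_E:
  "T s t i (E (Suc i) (E i f)) = E (Suc i) (E i (T s t (Suc i) f))"
  "T s t (Suc i) (E i (E (Suc i) f)) = E i (E (Suc i) (T s t i f))"
  using c_cases T_braid'[of i f] TT[of i] TT[of "Suc i"]
  by (auto simp: E_def T_add T_minus T_0)

lemma E_symmetric_mult: "swap_vars i h = h ==> E i (h * f) = h * E i f"
  by (simp add: E_def T_symmetric_mult distrib_left mult.left_commute)

lemma from_decreasing_exists: "\<exists>p. from_decreasing E \<alpha> p"
proof (induction "weight \<alpha>" arbitrary: \<alpha> rule: less_induct)
  case less
  show ?case
  proof (cases "sorted_wrt (\<ge>) \<alpha>")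
    case False
    then obtain i where i: "Suc i < length \<alpha>" "\<alpha> ! i < \<alpha> ! Suc i"
      unfolding decreasing_iff_nth by (auto simp: not_le)
    obtain p where "from_decreasing E (swap_parts i \<alpha>) p"
      using less[OF weight_swap_parts[OF i]] by blast
    from from_decreasing.step[OF this, of i] i show ?thesis
      by (auto simp: nth_swap_parts swap_parts_swap_parts)
  qed (auto intro: from_decreasing.base)
qed

lemma from_decreasing_cases:
  assumes "from_decreasing E \<alpha> p"
  shows "(sorted_wrt (\<ge>) \<alpha> & p = xpow \<alpha>) | (\<exists>i p'. Suc i < length \<alpha> & \<alpha> ! i < \<alpha> ! Suc i \<and>
      from_decreasing E (swap_parts i \<alpha>) p' & p = E i p')"
  using assms
proof (cases rule: from_decreasing.cases)
  case (step \<alpha>' p' i)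
  then have "Suc i < length \<alpha>" "\<alpha> ! i < \<alpha> ! Suc i" "swap_parts i \<alpha> = \<alpha>'"
    by (auto simp: nth_swap_parts swap_parts_swap_parts)
  with step show ?thesis by (intro disjI2 exI[of _ i] exI[of _ p']) simp
qed auto

text \<open>A diamond argument: two different last steps at \<open>i\<close> and \<open>j\<close>
  are joined at a composition of smaller weight, by commutation if they are far apart and by the
  braid relation if they are adjacent.\<close>

lemma from_decreasing_unique: "from_decreasing E \<alpha> p ==> from_decreasing E \<alpha> q ==> p = q"
proof (induction "weight \<alpha>" arbitrary: \<alpha> p q rule: less_induct)
  case less
  have main: "p = q" if "i <= j" "Suc i < length \<alpha>" "\<alpha> ! i < \<alpha> ! Suc i" "from_decreasing E (swap_parts i \<alpha>) p'" "p = E i p'"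
    "Suc j < length \<alpha>" "\<alpha> ! j < \<alpha> ! Suc j" "from_decreasing E (swap_parts j \<alpha>) q'" "q = E j q'" for i j p q p' q'
  proof -
    note IHi = less.hyps[OF weight_swap_parts[OF that(2,3)]] and IHj = less.hyps[OF weight_swap_parts[OF that(6,7)]]
    consider "i = j" | "Suc i < j" | "j = Suc i" using \<open>i <= j\<close> by linarith
    then show ?thesis
    proof cases
      case 1
      then show ?thesis using that IHi by blast
    next
      case 2
      let ?\<alpha> = "swap_parts i (swap_parts j \<alpha>)"
      obtain r where r: "from_decreasing E ?\<alpha> r" using from_decreasing_exists by blast
      have e: "swap_parts j ?\<alpha> = swap_parts i \<alpha>" "swap_parts i ?\<alpha> = swap_parts j \<alpha>"
        using 2 that(2,6) by (auto intro!: nth_equalityI simp: nth_swap_parts)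
      have "from_decreasing E (swap_parts i \<alpha>) (E j r)" "from_decreasing E (swap_parts j \<alpha>) (E i r)"
        using from_decreasing.step[OF r, of j] from_decreasing.step[OF r, of i] 2 that(2,3,6,7)
        unfolding e by (auto simp: nth_swap_parts)
      then have "p' = E j r" "q' = E i r" using IHi[OF that(4)] IHj[OF that(8)] by blast+
      then show ?thesis using that E_far[of i j r] 2 by simp
    next
      case 3
      \<comment> \<open>Here \<open>\<alpha>\<close> increases strictly at \<open>i\<close>,
        \<open>i + 1\<close>, \<open>i + 2\<close>, and \<open>?\<alpha>\<close> has these three
        parts reversed.\<close>
      let ?a = "swap_parts (Suc i) (swap_parts i \<alpha>)"
      let ?a' = "swap_parts i (swap_parts (Suc i) \<alpha>)"
      let ?\<alpha> = "swap_parts i ?a"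
      obtain r where r: "from_decreasing E ?\<alpha> r" using from_decreasing_exists by blast
      have e: "swap_parts i ?\<alpha> = ?a" "swap_parts (Suc i) ?\<alpha> = ?a'"
        using that(2,6) 3 by (auto intro!: nth_equalityI simp: nth_swap_parts)
      have "from_decreasing E ?a (E i r)" "from_decreasing E ?a' (E (Suc i) r)"
        using from_decreasing.step[OF r, of i] from_decreasing.step[OF r, of "Suc i"] that(2,3,6,7) 3
        unfolding e by (auto simp: nth_swap_parts)
      from from_decreasing.step[OF this(1), of "Suc i"] from_decreasing.step[OF this(2), of i]
      have "from_decreasing E (swap_parts i \<alpha>) (E (Suc i) (E i r))"
        "from_decreasing E (swap_parts (Suc i) \<alpha>) (E i (E (Suc i) r))"
        using that(2,3,6,7) 3 by (auto simp: nth_swap_parts swap_parts_swap_parts)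
      then have "p' = E (Suc i) (E i r)" "q' = E i (E (Suc i) r)"
        using IHi[OF that(4)] IHj[OF that(8)] 3 by blast+
      then show ?thesis using that E_braid[of i r] 3 by simp
    qed
  qed
  show ?case
    using from_decreasing_cases[OF less.prems(1)] from_decreasing_cases[OF less.prems(2)] main nat_le_linear
    by (metis decreasing_iff_nth not_le)
qed

definition X :: "nat list => cpoly" where
  "X \<alpha> = (THE p. from_decreasing E \<alpha> p)"

lemma X_eqI: "from_decreasing E \<alpha> p ==> X \<alpha> = p"
  unfolding X_def using from_decreasing_unique by blast

lemma from_decreasing_X: "from_decreasing E \<alpha> (X \<alpha>)"
  using from_decreasing_exists X_eqI by metis

lemma X_sorted: "sorted_wrt (\<ge>) \<alpha> ==> X \<alpha> = xpow \<alpha>"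
  by (intro X_eqI from_decreasing.base)

lemma X_step: "Suc i < length \<alpha> ==> \<alpha> ! Suc i < \<alpha> ! i ==> X (swap_parts i \<alpha>) = E i (X \<alpha>)"
  by (intro X_eqI from_decreasing.step from_decreasing_X)

lemma X_asc: "Suc i < length \<alpha> ==> \<alpha> ! i < \<alpha> ! Suc i ==> X \<alpha> = E i (X (swap_parts i \<alpha>))"
  using X_step[of i "swap_parts i \<alpha>"] by (simp add: nth_swap_parts swap_parts_swap_parts)

text \<open>Clear for monomials, and inherited along the recursion: a step far from the equal pair
  commutes with \<open>T\<close>, while a step that overlaps it is preceded by a second one, and
  \<open>T_E_E\<close> carries the symmetry over from the neighbouring pair of a composition of
  smaller weight.\<close>

lemma T_X_equal: "Suc i < length \<alpha> ==> \<alpha> ! i = \<alpha> ! Suc i ==> T s t i (X \<alpha>) = 0"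
proof (induction "weight \<alpha>" arbitrary: \<alpha> i rule: less_induct)
  case less
  show ?case
  proof (cases "sorted_wrt (\<ge>) \<alpha>")
    case True
    have "swap_mono i (Poly_Mapping.nth \<alpha>) = Poly_Mapping.nth \<alpha>"
      using less.prems by (intro poly_mapping_eqI) (auto simp: look_swap_mono transpose_def nth_default_def)
    then have "swap_vars i (xpow \<alpha>) = xpow \<alpha>" using swap_vars_mon[of i "Poly_Mapping.nth \<alpha>"]
      by (simp add: xpow_def mon_def)
    then show ?thesis using True t by (simp add: X_sorted T_eq_0_iff)
  next
    case False
    then obtain j where j: "Suc j < length \<alpha>" "\<alpha> ! j < \<alpha> ! Suc j"
      unfolding decreasing_iff_nth by (auto simp: not_le)
    let ?\<alpha> = "swap_parts j \<alpha>"
    have w: "weight ?\<alpha> < weight \<alpha>" using weight_swap_parts[OF j] .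
    have X: "X \<alpha> = E j (X ?\<alpha>)" using X_asc[OF j] .
    consider "Suc i < j | Suc j < i" | "j = Suc i" | "i = Suc j" using j less.prems by (cases i j rule: linorder_cases) force+
    then show ?thesis
    proof cases
      case 1
      then have "T s t i (X ?\<alpha>) = 0" using less.hyps[OF w, of i] less.prems j by (auto simp: nth_swap_parts)
      then show ?thesis using 1 linmap_0[OF linmap_E] by (simp add: X T_E_far)
    next
      case 2
      have i2: "Suc i < length ?\<alpha>" "?\<alpha> ! i < ?\<alpha> ! Suc i" using less.prems j 2 by (auto simp: nth_swap_parts)
      let ?\<beta> = "swap_parts i ?\<alpha>"
      have "T s t j (X ?\<beta>) = 0"
        using less.hyps[OF less_trans[OF weight_swap_parts[OF i2] w], of j] less.prems j 2 by (auto simp: nth_swap_parts)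
      then show ?thesis
        using T_E_E(1)[of i "X ?\<beta>"] X X_asc[OF i2] linmap_0[OF linmap_E] unfolding 2 by metis
    next
      case 3
      have i2: "Suc i < length ?\<alpha>" "?\<alpha> ! i < ?\<alpha> ! Suc i" using less.prems j 3 by (auto simp: nth_swap_parts)
      let ?\<beta> = "swap_parts i ?\<alpha>"
      have "T s t j (X ?\<beta>) = 0"
        using less.hyps[OF less_trans[OF weight_swap_parts[OF i2] w], of j] less.prems j 3 by (auto simp: nth_swap_parts)
      then show ?thesis
        using T_E_E(2)[of j "X ?\<beta>"] X X_asc[OF i2] linmap_0[OF linmap_E] unfolding 3 by metis
    qed
  qed
qed

lemma F_X_asc: "Suc i < length \<alpha> ==> \<alpha> ! i < \<alpha> ! Suc i ==> F i (X \<alpha>) = 0"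
  by (simp add: X_asc F_E)

lemma F_X_equal: "Suc i < length \<alpha> ==> \<alpha> ! i = \<alpha> ! Suc i ==> F i (X \<alpha>) = of_nat (tau s t - c) * X \<alpha>"
  by (simp add: F_def T_X_equal)

lemma F_X_desc:
  "Suc i < length \<alpha> ==> \<alpha> ! Suc i < \<alpha> ! i ==>
    F i (X \<alpha>) = X (swap_parts i \<alpha>) + (of_nat (tau s t - c) - of_nat c) * X \<alpha>"
  by (simp add: X_step F_def E_def algebra_simps)

lemma X_chain: "chain (>) \<sigma> ws ==> X (fold swap_parts ws \<sigma>) = fold E ws (X \<sigma>)"
  by (induction ws arbitrary: \<sigma>) (auto simp: X_step)

lemma X_rank_word: "X \<beta> = fold E (rank_word (length \<beta>) (rank (>) \<beta>)) (xpow (rev (sort \<beta>)))"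
proof -
  have "sorted_wrt (\<ge>) (rev (sort \<beta>))" by (simp add: sorted_wrt_rev)
  moreover from this have "sorted_wrt (%a b. \<not> b > a) (rev (sort \<beta>))" by (simp add: not_less)
  then have "chain (>) (rev (sort \<beta>)) (rank_word (length \<beta>) (rank (>) \<beta>)) \<and>
      fold swap_parts (rank_word (length \<beta>) (rank (>) \<beta>)) (rev (sort \<beta>)) = \<beta>"
    by (intro chain_rank_word) (auto simp: transp_def asymp_on_def totalp_on_def)
  ultimately show ?thesis using X_chain X_sorted by metis
qed

text \<open>\<open>F i\<close> acts in a simple way on the family: it kills ascents, scales ties and
  sends a descent to its swap plus a multiple of itself. Precomposing with it therefore moves a dual
  functional from \<open>\<alpha>\<close> to \<open>swap_parts i \<alpha>\<close>.\<close>

lemma dual_step: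
  assumes \<phi>: "linfun \<phi>" and d: "\<And>\<beta>. mset \<beta> = M ==> \<phi> (X \<beta>) = of_bool (\<beta> = \<alpha>)"
    and i: "Suc i < length \<alpha>" "\<alpha> ! i < \<alpha> ! Suc i" "mset \<beta> = M" "length \<beta> = length \<alpha>"
  shows "\<phi> (F i (X \<beta>)) = of_bool (\<beta> = swap_parts i \<alpha>)"
proof -
  have \<beta>i: "Suc i < length \<beta>" using i by simp
  have add: "\<phi> (p + q) = \<phi> p + \<phi> q" for p q using \<phi> by (simp add: linfun_def)
  consider "\<beta> ! i < \<beta> ! Suc i" | "\<beta> ! i = \<beta> ! Suc i" | "\<beta> ! Suc i < \<beta> ! i" by linarith
  then show ?thesis
  proof cases
    case 1
    then have "\<beta> ~= swap_parts i \<alpha>" using i by (auto simp: nth_swap_parts)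
    then show ?thesis using 1 \<beta>i \<phi> by (simp add: F_X_asc linfun_0)
  next
    case 2
    then have "\<beta> ~= swap_parts i \<alpha>" "\<beta> ~= \<alpha>" using i by (auto simp: nth_swap_parts)
    then show ?thesis using 2 \<beta>i \<phi> d[OF i(3)] by (simp add: F_X_equal linfun_of_nat)
  next
    case 3
    then have "\<beta> ~= \<alpha>" using i by auto
    have "swap_parts i \<beta> = \<alpha> \<longleftrightarrow> \<beta> = swap_parts i \<alpha>"
      using swap_parts_swap_parts \<beta>i i(1) by metis
    moreover have "mset (swap_parts i \<beta>) = M" using mset_swap_parts[OF \<beta>i] i by simp
    ultimately show ?thesis using 3 \<beta>i \<phi> d[OF i(3)] d \<open>\<beta> ~= \<alpha>\<close>
      by (simp add: F_X_desc add left_diff_distrib linfun_diff linfun_of_nat)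
  qed
qed

text \<open>Only sizes are compared, so \<open>M\<close> may be a rearrangement class other than
  that of \<open>v\<close>; then the functional is 0 on it throughout. Inhomogeneous families call
  for this generality.\<close>

lemma dual_chain:
  assumes "linfun \<phi>" "\<And>\<beta>. mset \<beta> = M ==> \<phi> (X \<beta>) = of_bool (\<beta> = v)"
    "chain (<) v ws" "mset \<beta> = M" "size M = length v"
  shows "\<phi> (foldr F ws (X \<beta>)) = of_bool (\<beta> = fold swap_parts ws v)"
  using assms
proof (induction ws arbitrary: \<phi> v)
  case (Cons i ws)
  have "(%f. \<phi> (F i f)) (foldr F ws (X \<beta>)) = of_bool (\<beta> = fold swap_parts ws (swap_parts i v))"
  proof (rule Cons.IH)
    show "linfun (%f. \<phi> (F i f))" using Cons.prems(1) linmap_F by (rule linfun_comp)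
    fix \<gamma> :: "nat list" assume "mset \<gamma> = M"
    moreover from this have "length \<gamma> = length v" using Cons.prems(5) by (metis size_mset)
    ultimately show "\<phi> (F i (X \<gamma>)) = of_bool (\<gamma> = swap_parts i v)"
      using Cons.prems by (intro dual_step) auto
  qed (use Cons.prems in auto)
  then show ?case by simp
qed auto

lemma linmap_foldr_F: "linmap (foldr F ws)"
proof (induction ws)
  case Nil
  then show ?case by (simp add: linmap_def)
next
  case (Cons i ws)
  then show ?case using linmap_comp[OF linmap_F[of i]] by (simp add: comp_def)
qed

end

section \<open>Bases and dual functionals\<close>

lemma linfun_look: "linfun (%f. look f u)"
  by (simp add: linfun_def lookup_add look_scale)

lemma linfun_sum: "linfun \<phi> ==> \<phi> (sum g A) = (\<Sum>x\<in>A. \<phi> (g x))"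
  by (induction A rule: infinite_finite_induct) (auto simp: linfun_0 linfun_def[of \<phi>])

lemma linfun_eqI:
  assumes "linfun \<phi>" "linfun \<psi>" "\<And>\<eta>. \<phi> (mon \<eta>) = \<psi> (mon \<eta>)"
  shows "\<phi> p = \<psi> p"
proof -
  have "\<phi> p = (\<Sum>\<eta>\<in>supp p. look p \<eta> * \<phi> (mon \<eta>))" if "linfun \<phi>" for \<phi>
    using that by (subst poly_expand[of p]) (simp add: linfun_sum linfun_def[of \<phi>])
  from this[OF assms(1)] this[OF assms(2)] show ?thesis by (simp add: assms(3))
qed

lemma xpow_mon: "xpow \<alpha> = mon (Poly_Mapping.nth \<alpha>)"
  by (simp add: xpow_def mon_def)

lemma look_nth: "look (Poly_Mapping.nth \<alpha>) i = (if i < length \<alpha> then \<alpha> ! i else 0)"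
  by (simp add: nth_default_def)

declare lookup_nth [simp del] keys_nth [simp del]

lemma polys_eq_span: "polys n = cpoly.span (xpow ` comps n)"
proof
  show "polys n \<subseteq> cpoly.span (xpow ` comps n)"
  proof
    fix p assume p: "p \<in> polys n"
    have "mon \<eta> \<in> xpow ` comps n" if "\<eta> \<in> supp p" for \<eta>
    proof
      show "map (look \<eta>) [0..<n] \<in> comps n" by (simp add: comps_def)
      have "supp \<eta> \<subseteq> {..<n}" using p that by (auto simp: polys_def)
      then have "\<eta> = Poly_Mapping.nth (map (look \<eta>) [0..<n])"
        by (intro poly_mapping_eqI) (auto simp: look_nth in_keys_iff)
      then show "mon \<eta> = xpow (map (look \<eta>) [0..<n])" by (simp add: xpow_mon)
    qed
    then show "p \<in> cpoly.span (xpow ` comps n)"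
      by (subst poly_expand[of p]) (intro cpoly.span_sum cpoly.span_scale cpoly.span_base)
  qed
  have "cpoly.subspace (polys n)"
  proof (rule cpoly.subspaceI)
    show "0 \<in> polys n" by (simp add: polys_def)
    show "x + y \<in> polys n" if "x \<in> polys n" "y \<in> polys n" for x y
      using that keys_add[of x y] by (fastforce simp: polys_def)
    show "scale c x \<in> polys n" if "x \<in> polys n" for c x
      using that by (auto simp: polys_def in_keys_iff look_scale)
  qed
  moreover have "xpow ` comps n \<subseteq> polys n"
    by (auto simp: polys_def comps_def xpow_mon mon_def in_keys_iff look_nth split: if_splits)
  ultimately show "cpoly.span (xpow ` comps n) \<subseteq> polys n" by (rule cpoly.span_minimal[rotated])
qed

lemma polys_mult: "p \<in> polys n ==> q \<in> polys n ==> p * q \<in> polys n"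
proof -
  assume pq: "p \<in> polys n" "q \<in> polys n"
  have "supp m \<subseteq> {..<n}" if "m \<in> supp (p * q)" for m
  proof -
    obtain a b where ab: "m = a + b" "a \<in> supp p" "b \<in> supp q" using \<open>m \<in> supp (p * q)\<close> keys_mult[of p q] by blast
    then have "supp a \<subseteq> {..<n}" "supp b \<subseteq> {..<n}" using pq by (auto simp: polys_def)
    then show ?thesis using ab(1) keys_add[of a b] by blast
  qed
  then show ?thesis by (simp add: polys_def)
qed

lemma inj_xpow: "inj_on xpow (comps n)"
proof (rule inj_onI)
  fix \<alpha> \<beta> assume *: "\<alpha> \<in> comps n" "\<beta> \<in> comps n" "xpow \<alpha> = xpow \<beta>"
  then have "look (xpow \<alpha>) (Poly_Mapping.nth \<beta>) = 1" by (simp add: xpow_mon look_mon)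
  then have "Poly_Mapping.nth \<alpha> = Poly_Mapping.nth \<beta>" by (simp add: xpow_mon look_mon split: if_splits)
  then have eq: "look (Poly_Mapping.nth \<alpha>) i = look (Poly_Mapping.nth \<beta>) i" for i by simp
  show "\<alpha> = \<beta>"
  proof (rule nth_equalityI)
    fix i assume "i < length \<alpha>"
    with eq[of i] show "\<alpha> ! i = \<beta> ! i" using * by (simp add: look_nth comps_def)
  qed (use * in \<open>simp add: comps_def\<close>)
qed

text \<open>\<open>box\<close> takes the place of triangularity: independent vectors that lie in the
  span of the monomials of a finite set \<open>S\<close>, and are as many as these, must span
  it.\<close>

locale dual_family =
  fixes n :: nat and B :: "nat list => cpoly" and \<phi> :: "nat list => cpoly => complex"
  assumes linfun: "\<gamma> \<in> comps n ==> linfun (\<phi> \<gamma>)"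
    and dual: "\<beta> \<in> comps n ==> \<gamma> \<in> comps n ==> \<phi> \<gamma> (B \<beta>) = of_bool (\<beta> = \<gamma>)"
    and box: "\<alpha> \<in> comps n ==>
      \<exists>S. finite S & \<alpha> \<in> S & S \<subseteq> comps n & B ` S \<subseteq> cpoly.span (xpow ` S)"
begin

lemma inj: "inj_on B (comps n)"
  using dual by (intro inj_onI) (metis of_bool_eq_1_iff)

lemma independent: "cpoly.independent (B ` comps n)"
  unfolding cpoly.dependent_explicit
proof (intro notI, elim exE conjE bexE)
  fix t u v assume t: "finite t" "t \<subseteq> B ` comps n" "(\<Sum>v\<in>t. scale (u v) v) = 0" "v \<in> t" "u v ~= 0"
  then obtain \<gamma> where \<gamma>: "\<gamma> \<in> comps n" "v = B \<gamma>" by blast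
  have "\<phi> \<gamma> (scale (u x) x) = (if x = v then u x else 0)" if x: "x \<in> t" for x
  proof -
    obtain \<beta> where "\<beta> \<in> comps n" "x = B \<beta>" using x t(2) by blast
    then show ?thesis using dual[of \<beta> \<gamma>] linfun[OF \<gamma>(1)] inj \<gamma> by (auto simp: linfun_def inj_on_eq_iff)
  qed
  then have "\<phi> \<gamma> (\<Sum>v\<in>t. scale (u v) v) = u v"
    using t(1,4) by (simp add: linfun_sum[OF linfun[OF \<gamma>(1)]] cong: sum.cong)
  then show False using t(3,5) linfun_0[OF linfun[OF \<gamma>(1)]] by simp
qed

lemma span: "cpoly.span (B ` comps n) = polys n"
proof -
  have "B \<alpha> \<in> polys n & xpow \<alpha> \<in> cpoly.span (B ` comps n)" if \<alpha>: "\<alpha> \<in> comps n" for \<alpha>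
  proof -
    obtain S where S: "finite S" "\<alpha> \<in> S" "S \<subseteq> comps n" "B ` S \<subseteq> cpoly.span (xpow ` S)"
      using box[OF \<alpha>] by blast
    have "cpoly.independent (B ` S)" by (rule cpoly.independent_mono[OF independent image_mono[OF S(3)]])
    have cards: "card (B ` S) = card S" "card (xpow ` S) = card S"
      using inj inj_xpow S(3) by (auto intro!: card_image intro: inj_on_subset)
    have "xpow \<alpha> \<in> cpoly.span (B ` S)"
    proof (rule ccontr)
      assume *: "xpow \<alpha> \<notin> cpoly.span (B ` S)"
      then have "xpow \<alpha> \<notin> B ` S" using cpoly.span_base by blast
      have "cpoly.independent (insert (xpow \<alpha>) (B ` S))"
        using * \<open>cpoly.independent (B ` S)\<close> \<open>xpow \<alpha> \<notin> B ` S\<close> by (simp add: cpoly.independent_insert)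
      moreover have "insert (xpow \<alpha>) (B ` S) \<subseteq> cpoly.span (xpow ` S)"
        using S(2,4) by (auto intro: cpoly.span_base)
      ultimately have "card (insert (xpow \<alpha>) (B ` S)) <= card (xpow ` S)"
        using cpoly.independent_span_bound[of "xpow ` S"] S(1) by blast
      then show False using cards S(1) \<open>xpow \<alpha> \<notin> B ` S\<close> by simp
    qed
    moreover have "B \<alpha> \<in> cpoly.span (xpow ` S)" using S by blast
    ultimately show ?thesis unfolding polys_eq_span using S(3) cpoly.span_mono by (meson image_mono subsetD)
  qed
  then have "B ` comps n \<subseteq> polys n" "xpow ` comps n \<subseteq> cpoly.span (B ` comps n)" by auto
  then show ?thesis unfolding polys_eq_span by (meson cpoly.span_minimal cpoly.subspace_span subset_antisym)
qed

lemma poly_basis: "poly_basis n B"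
  using inj independent span by (simp add: poly_basis_def)

lemma in_polys: "\<alpha> \<in> comps n ==> B \<alpha> \<in> polys n"
  using span cpoly.span_base by blast

lemma structure_const:
  assumes "\<alpha> \<in> comps n" "\<beta> \<in> comps n" "\<gamma> \<in> comps n"
  shows "structure_const B \<alpha> \<beta> \<gamma> = \<phi> \<gamma> (B \<alpha> * B \<beta>)"
proof -
  let ?V = "B ` comps n" and ?f = "B \<alpha> * B \<beta>"
  let ?r = "cpoly.representation ?V ?f"
  have f: "?f \<in> cpoly.span ?V" unfolding span by (intro polys_mult in_polys assms)
  have lf: "linfun (\<phi> \<gamma>)" using linfun assms by blast
  have fin: "finite {b. ?r b ~= 0}" by (rule cpoly.finite_representation)
  have "\<phi> \<gamma> ?f = \<phi> \<gamma> (\<Sum>b | ?r b ~= 0. scale (?r b) b)"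
    using cpoly.sum_nonzero_representation_eq[OF independent f] by simp
  also have "\<dots> = (\<Sum>b | ?r b ~= 0. ?r b * \<phi> \<gamma> b)"
    using lf by (simp add: linfun_sum linfun_def[of "\<phi> \<gamma>"])
  also have "\<dots> = (\<Sum>b | ?r b ~= 0. if b = B \<gamma> then ?r b else 0)"
  proof (rule sum.cong[OF refl])
    fix b assume "b \<in> {b. ?r b ~= 0}"
    then have "b \<in> ?V" using cpoly.representation_ne_zero by blast
    then obtain \<delta> where "\<delta> \<in> comps n" "b = B \<delta>" by blast
    then show "?r b * \<phi> \<gamma> b = (if b = B \<gamma> then ?r b else 0)"
      using dual[of \<delta> \<gamma>] assms(3) inj by (auto simp: inj_on_eq_iff)
  qed
  also have "\<dots> = ?r (B \<gamma>)" using fin by simp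
  finally show ?thesis using assms by (simp add: structure_const_def comps_def)
qed

end

section \<open>Supports\<close>

lemma of_nat_mult_scale: "of_nat n * (p :: cpoly) = scale (of_nat n) p"
  by (simp add: scale_def flip: single_of_nat)

lemma look_of_nat_mult: "look (of_nat n * (p :: cpoly)) \<eta> = of_nat n * look p \<eta>"
  by (simp add: of_nat_mult_scale look_scale)

lemma supp_bfac: "\<mu> \<in> supp (bfac s t i j) ==> \<mu> = sing j s | \<mu> = sing j s + sing i 1"
proof -
  assume \<mu>: "\<mu> \<in> supp (bfac s t i j)"
  have "bfac s t i j = mon (sing j s) - scale (of_nat t) (mon (sing j s + sing i 1))"
    by (simp add: bfac_def mon_add mon_sing scale_def algebra_simps flip: single_of_nat)
  then show ?thesis using \<mu> by (auto simp: in_keys_iff lookup_minus look_scale look_mon split: if_splits)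
qed

context ops
begin

text \<open>The unchanged case comes from the multiple of \<open>f\<close> in \<open>E\<close>. In
  the other one a divided difference leaves both exponents between the old minimum and the old
  maximum minus one, and \<open>bfac\<close> then raises that of \<open>x_i\<close> by at most one
  and that of its neighbour by exactly \<open>s\<close>.\<close>

lemma supp_E:
  assumes "\<theta> \<in> supp (E i f)"
  obtains "\<theta> \<in> supp f" | \<eta> where "\<eta> \<in> supp f" "\<And>l. l ~= i ==> l ~= Suc i ==> look \<theta> l = look \<eta> l"
    "min (look \<eta> i) (look \<eta> (Suc i)) <= look \<theta> i" "min (look \<eta> i) (look \<eta> (Suc i)) <= look \<theta> (Suc i)"
    "look \<theta> i <= max (look \<eta> i) (look \<eta> (Suc i))" "Suc (look \<theta> (Suc i)) <= max (look \<eta> i) (look \<eta> (Suc i)) + s"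
    "look \<eta> i + look \<eta> (Suc i) + s <= Suc (look \<theta> i + look \<theta> (Suc i))"
proof -
  consider "\<theta> \<in> supp f" | "\<theta> \<in> supp (T s t i f)"
    using assms by (cases "look f \<theta> = 0") (auto simp: E_def in_keys_iff lookup_add look_of_nat_mult)
  then show ?thesis
  proof cases
    case 2
    then obtain \<mu> \<nu> where *: "\<mu> \<in> supp (bfac s t i (Suc i))" "\<nu> \<in> supp (divdiff i f)" "\<theta> = \<mu> + \<nu>"
      unfolding T_def using keys_mult by blast
    obtain \<eta> where \<eta>: "\<eta> \<in> supp f" "\<And>l. l ~= i ==> l ~= Suc i ==> look \<nu> l = look \<eta> l"
      "Suc (look \<nu> i + look \<nu> (Suc i)) = look \<eta> i + look \<eta> (Suc i)"
      "min (look \<eta> i) (look \<eta> (Suc i)) <= look \<nu> i" "min (look \<eta> i) (look \<eta> (Suc i)) <= look \<nu> (Suc i)"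
      "look \<nu> i < max (look \<eta> i) (look \<eta> (Suc i))" "look \<nu> (Suc i) < max (look \<eta> i) (look \<eta> (Suc i))"
      using supp_divdiff[OF *(2)] by metis
    have l: "look \<theta> l = look \<mu> l + look \<nu> l" for l by (simp add: *(3) lookup_add)
    have m: "look \<mu> (Suc i) = s" "look \<mu> i <= 1" "\<And>l. l ~= i ==> l ~= Suc i ==> look \<mu> l = 0"
      using supp_bfac[OF *(1)] by (auto simp: lookup_add lookup_single when_def)
    show ?thesis by (rule that(2)[OF \<eta>(1)]) (use \<eta> m l in auto)
  qed (use that in blast)
qed

definition bounded_by :: "(nat => nat) => cpoly => bool" where
  "bounded_by B f \<longleftrightarrow> (\<forall>\<eta>\<in>supp f. \<forall>l. look \<eta> l <= B l)"

text \<open>For \<open>s = 1\<close> the inequalities force \<open>B\<close> to be constant on the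
  pair. For \<open>s = 0\<close> they admit a staircase dropping by one, because the second exponent
  of the new terms falls strictly below the old maximum.\<close>

lemma bounded_by_E:
  assumes "bounded_by B f" "B (Suc i) <= B i" "B i + s <= Suc (B (Suc i))"
  shows "bounded_by B (E i f)"
  unfolding bounded_by_def
proof (intro ballI allI)
  fix \<theta> l assume "\<theta> \<in> supp (E i f)"
  then show "look \<theta> l <= B l"
  proof (cases rule: supp_E)
    case 1
    then show ?thesis using assms by (auto simp: bounded_by_def)
  next
    case (2 \<eta>)
    then have \<eta>: "look \<eta> l <= B l" for l using assms(1) by (auto simp: bounded_by_def)
    have "max (look \<eta> i) (look \<eta> (Suc i)) <= B i" using \<eta>[of i] \<eta>[of "Suc i"] assms(2) by auto
    then show ?thesis using 2(2,5,6) \<eta>[of l] assms(3) by (cases "l = i | l = Suc i") auto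
  qed
qed

lemma rank_word_index: "i \<in> set (rank_word (length \<beta>) (rank (>) \<beta>)) ==> Suc i < length \<beta>"
  "i \<in> set (rank_word (length \<beta>) (rank (<) \<beta>)) ==> Suc i < length \<beta>"
proof -
  have "rank r \<beta> k <= length \<beta> - Suc k" for r k
  proof -
    have "{j. k < j & j < length \<beta> & r (\<beta> ! j) (\<beta> ! k)} \<subseteq> {Suc k..<length \<beta>}" by auto
    from card_mono[OF _ this] show ?thesis by (simp add: rank_def)
  qed
  then have le: "k < length \<beta> ==> j < rank r \<beta> k ==> Suc (k + j) < length \<beta>" for r k j
    by (metis add.commute add_Suc_right less_diff_conv less_le_trans)
  have "Suc i < length \<beta>" if i: "i \<in> set (rank_word (length \<beta>) (rank r \<beta>))" for r
  proof -
    obtain k where k: "k < length \<beta>" "k <= i" "i < rank r \<beta> k + k" using i by (auto simp: rank_word_def)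
    then have "i - k < rank r \<beta> k" "i = k + (i - k)" by auto
    then show ?thesis using le[OF k(1), of "i - k" r] by simp
  qed
  then show "i \<in> set (rank_word (length \<beta>) (rank (>) \<beta>)) ==> Suc i < length \<beta>"
    "i \<in> set (rank_word (length \<beta>) (rank (<) \<beta>)) ==> Suc i < length \<beta>" by blast+
qed

lemma bounded_by_X:
  assumes "bounded_by B (xpow (rev (sort \<beta>)))"
    "\<And>i. Suc i < length \<beta> ==> B (Suc i) <= B i & B i + s <= Suc (B (Suc i))"
  shows "bounded_by B (X \<beta>)"
proof -
  have "bounded_by B (fold E ws f)" if "bounded_by B f" "\<And>i. i \<in> set ws ==> Suc i < length \<beta>" for ws f
    using that assms(2) by (induction ws arbitrary: f) (auto simp: bounded_by_E)
  then show ?thesis using assms(1) rank_word_index(1) by (subst X_rank_word) blast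
qed

lemma bounded_by_span:
  assumes "bounded_by B p" "\<And>l. l \<ge> n ==> B l = 0"
  shows "p \<in> cpoly.span (xpow ` {\<alpha> \<in> comps n. \<forall>l<n. \<alpha> ! l <= B l})"
proof -
  have "mon \<eta> \<in> xpow ` {\<alpha> \<in> comps n. \<forall>l<n. \<alpha> ! l <= B l}" if "\<eta> \<in> supp p" for \<eta>
  proof
    have \<eta>: "look \<eta> l <= B l" for l using assms(1) that by (auto simp: bounded_by_def)
    show "map (look \<eta>) [0..<n] \<in> {\<alpha> \<in> comps n. \<forall>l<n. \<alpha> ! l <= B l}" using \<eta> by (simp add: comps_def)
    have "look \<eta> l = 0" if "l \<ge> n" for l using \<eta>[of l] assms(2)[OF that] by simp
    then have "\<eta> = Poly_Mapping.nth (map (look \<eta>) [0..<n])"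
      by (intro poly_mapping_eqI) (auto simp: look_nth not_less)
    then show "mon \<eta> = xpow (map (look \<eta>) [0..<n])" by (simp add: xpow_mon)
  qed
  then show ?thesis
    by (subst poly_expand[of p]) (intro cpoly.span_sum cpoly.span_scale cpoly.span_base)
qed

lemma finite_box: "finite {\<alpha> \<in> comps n. \<forall>l<n. \<alpha> ! l <= (B l :: nat)}"
proof -
  have "{\<alpha> \<in> comps n. \<forall>l<n. \<alpha> ! l <= B l} \<subseteq> {\<alpha>. set \<alpha> \<subseteq> {..Max (insert 0 (B ` {..<n}))} & length \<alpha> = n}"
    by (force simp: comps_def in_set_conv_nth Max_ge_iff)
  then show ?thesis using finite_lists_length_eq[of "{..Max (insert 0 (B ` {..<n}))}" n] finite_subset by auto
qed

end

section \<open>Deleting a variable\<close>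

definition del :: "nat => cpoly => cpoly" where
  "del k = subst (%i. if i < k then var i else if i = k then 0 else var (i - 1))"

lemma ahom_del: "ahom (del k)"
  unfolding del_def by (rule ahom_subst)

lemma del_var: "del k (var i) = (if i < k then var i else if i = k then 0 else var (i - 1))"
  unfolding del_def by (rule subst_var)

lemmas del_simps = ahom_simps[OF ahom_del] del_var

lemma del_swap: "del k (swap_vars k f) = del (Suc k) f"
  by (rule ahom_eqI[OF ahom_comp[OF ahom_del ahom_swap] ahom_del]) (auto simp: swap_vars_var del_var transpose_def)

lemma del_0_swap: "del 0 (swap_vars (Suc i) f) = swap_vars i (del 0 f)"
  by (rule ahom_eqI[OF ahom_comp[OF ahom_del ahom_swap] ahom_comp[OF ahom_swap ahom_del]])
    (auto simp: swap_simps del_var transpose_def)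

lemma del_0_divdiff: "del 0 (divdiff (Suc i) f) = divdiff i (del 0 f)"
proof (rule divdiff_eqI[symmetric])
  have "del 0 (xdiff (Suc i)) = xdiff i" by (simp add: xdiff_def del_simps)
  then show "xdiff i * del 0 (divdiff (Suc i) f) = del 0 f - swap_vars i (del 0 f)"
    using arg_cong[OF xdiff_divdiff[of "Suc i" f], of "del 0"] by (simp add: del_simps del_0_swap)
qed

lemma del_0_T: "del 0 (T s t (Suc i) f) = T s t i (del 0 f)"
  by (simp add: T_def del_simps del_0_divdiff bfac_def)

text \<open>At \<open>x_k = 0\<close> the denominator becomes minus the next variable, which cancels
  the factor that \<open>s = 1\<close> provides, and \<open>1 - t x_k\<close> becomes 1. The swapped
  polynomial turns into a deletion at \<open>Suc k\<close>.\<close>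

lemma del_T: "del k (T 1 t k f) = del (Suc k) f - del k f"
proof -
  have "- var k * del k (divdiff k f) = del k f - del (Suc k) f"
    using arg_cong[OF xdiff_divdiff[of k f], of "del k"] by (simp add: del_simps del_swap xdiff_def)
  moreover have "del k (T 1 t k f) = var k * del k (divdiff k f)"
    by (simp add: T_def bfac_def del_simps)
  ultimately show ?thesis by (metis minus_diff_eq minus_minus mult_minus_left)
qed

lemma del_mon_pos: "look \<eta> k > 0 ==> del k (mon \<eta>) = 0"
  unfolding mon_prod ahom_prod[OF ahom_del]
  by (rule prod_zero) (auto simp: del_simps in_keys_iff intro!: bexI[of _ k])

lemma del_pos:
  assumes "\<And>\<eta>. \<eta> \<in> supp f ==> look \<eta> k > 0"
  shows "del k f = 0"
  unfolding linmap_expand[OF ahom_linmap[OF ahom_del], of k f] using assms by (simp add: del_mon_pos)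

lemma del_0_mon: "look \<eta> 0 = 0 ==> del 0 (mon \<eta>) = mon (Poly_Mapping.map_key Suc \<eta>)"
proof -
  assume 0: "look \<eta> 0 = 0"
  let ?\<theta> = "Poly_Mapping.map_key Suc \<eta>"
  have l: "look ?\<theta> i = look \<eta> (Suc i)" for i by (simp add: map_key.rep_eq)
  have "supp \<eta> = Suc ` supp ?\<theta>"
  proof (intro set_eqI iffI)
    fix i assume "i \<in> supp \<eta>"
    then show "i \<in> Suc ` supp ?\<theta>" using 0 by (cases i) (auto simp: in_keys_iff l)
  qed (auto simp: in_keys_iff l)
  then show ?thesis
    unfolding mon_prod ahom_prod[OF ahom_del] by (simp add: prod.reindex del_simps l)
qed

lemma look_del_0:
  assumes "look u 0 = 0"
  shows "look f u = look (del 0 f) (Poly_Mapping.map_key Suc u)"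
proof (rule linfun_eqI[where \<phi> = "%f. look f u"])
  show "linfun (%f. look (del 0 f) (Poly_Mapping.map_key Suc u))"
    by (rule linfun_comp[OF linfun_look ahom_linmap[OF ahom_del]])
  fix \<eta>
  show "look (mon \<eta>) u = look (del 0 (mon \<eta>)) (Poly_Mapping.map_key Suc u)"
  proof (cases "look \<eta> 0 = 0")
    case True
    have "\<eta> = u \<longleftrightarrow> Poly_Mapping.map_key Suc \<eta> = Poly_Mapping.map_key Suc u"
    proof
      assume *: "Poly_Mapping.map_key Suc \<eta> = Poly_Mapping.map_key Suc u"
      show "\<eta> = u"
      proof (rule poly_mapping_eqI)
        fix i show "look \<eta> i = look u i"
          using True assms arg_cong[OF *, of "%p. look p (i - 1)"] by (cases i) (auto simp: map_key.rep_eq)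
      qed
    qed simp
    then show ?thesis using True by (simp add: del_0_mon look_mon)
  next
    case False
    then show ?thesis using assms by (auto simp: del_mon_pos look_mon)
  qed
qed (rule linfun_look)

lemma look_mon_mult: "look (mon \<theta> * p) (\<theta> + \<eta>) = look p \<eta>"
proof (rule linfun_eqI[where \<phi> = "%p. look (mon \<theta> * p) (\<theta> + \<eta>)"])
  show "linfun (%p. look (mon \<theta> * p) (\<theta> + \<eta>))" by (rule linfun_comp[OF linfun_look linmap_mult(1)])
qed (auto simp: linfun_look look_mon simp flip: mon_add)

lemma look_var_power_mult: "look u i < k ==> look (var i ^ k * p) u = 0"
proof (rule linfun_eqI[where \<phi> = "%p. look (var i ^ k * p) u" and \<psi> = "%p. 0"])
  show "linfun (%p. look (var i ^ k * p) u)" by (rule linfun_comp[OF linfun_look linmap_mult(1)])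
  fix \<eta> assume "look u i < k"
  then have "sing i k + \<eta> ~= u" by (metis add_lessD1 lookup_add lookup_single_eq less_irrefl)
  then show "look (var i ^ k * mon \<eta>) u = 0" by (simp add: look_mon flip: mon_add mon_sing)
qed (auto simp: linfun_def)

section \<open>The dual functionals of keys, atoms and Lascoux polynomials\<close>

lemmas del_T_Suc = del_T[unfolded One_nat_def]

lemma chain_rank_less:
  assumes "sorted \<sigma>" "mset \<sigma> = mset \<beta>"
  shows "chain (<) \<sigma> (rank_word (length \<beta>) (rank (<) \<beta>))"
    "fold swap_parts (rank_word (length \<beta>) (rank (<) \<beta>)) \<sigma> = \<beta>"
  using chain_rank_word[OF transp_on_less asymp_on_less totalp_on_less, of \<sigma> \<beta>] assms
  by (simp_all add: not_less)

lemma mon_prod_superset: "finite A ==> supp \<eta> \<subseteq> A ==> mon \<eta> = (\<Prod>i\<in>A. var i ^ look \<eta> i)"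
  unfolding mon_prod by (intro prod.mono_neutral_left) (auto simp: in_keys_iff)

lemma xpow_prod: "xpow \<alpha> = (\<Prod>l<length \<alpha>. var l ^ (\<alpha> ! l))"
  unfolding xpow_mon by (subst mon_prod_superset[of "{..<length \<alpha>}"])
    (auto simp: look_nth in_keys_iff split: if_splits)

definition ones :: "nat => mono" where
  "ones n = Poly_Mapping.nth (replicate n 1)"

lemma look_ones: "look (ones n) l = (if l < n then 1 else 0)"
  by (auto simp: ones_def look_nth)

lemma mon_ones: "mon (ones n) = (\<Prod>l<n. var l)"
  unfolding ones_def xpow_mon[symmetric] by (simp add: xpow_prod)

definition degree_le :: "nat => nat => cpoly => bool" where
  "degree_le l d p \<longleftrightarrow> (\<forall>\<eta>\<in>supp p. look \<eta> l <= d)"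

lemma degree_le_mult: "degree_le l d p ==> degree_le l e q ==> degree_le l (d + e) (p * q)"
  unfolding degree_le_def using keys_mult[of p q] by (fastforce simp: lookup_add intro: add_mono)

lemma degree_le_add: "degree_le l d p ==> degree_le l d q ==> degree_le l d (p + q)"
  unfolding degree_le_def using keys_add[of p q] by fastforce

lemma degree_le_minus: "degree_le l d p ==> degree_le l d (- p)"
  unfolding degree_le_def by simp

lemma degree_le_diff: "degree_le l d p ==> degree_le l d q ==> degree_le l d (p - q)"
  using degree_le_add[OF _ degree_le_minus, of l d p q] by simp

lemma degree_le_prod:
  "(\<And>x. x \<in> A ==> degree_le l (d x) (f x)) ==> degree_le l (\<Sum>x\<in>A. d x) (\<Prod>x\<in>A. f x)"
proof (induction A rule: infinite_finite_induct)
  case (insert x A)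
  then show ?case using degree_le_mult by simp
qed (auto simp: degree_le_def)

lemma degree_le_sum: "(\<And>x. x \<in> A ==> degree_le l d (f x)) ==> degree_le l d (\<Sum>x\<in>A. f x)"
  by (induction A rule: infinite_finite_induct) (auto intro: degree_le_add simp: degree_le_def[of _ _ 0])

lemma degree_le_mon: "look \<eta> l <= d ==> degree_le l d (mon \<eta>)"
  by (simp add: degree_le_def mon_def)

lemma degree_le_var: "degree_le l (of_bool (l = i)) (var i)"
  using degree_le_mon[of "sing i 1" l] mon_sing[of i 1] by (simp add: lookup_single when_def)

lemma degree_le_of_nat: "degree_le l 0 (of_nat k)"
  by (induction k) (auto simp: degree_le_def[of _ _ 0] degree_le_def[of _ _ 1] intro!: degree_le_add)

lemma degree_le_power: "degree_le l d p ==> degree_le l (k * d) (p ^ k)"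
  by (induction k) (auto simp: degree_le_def[of _ _ 1] intro: degree_le_mult)

locale key_ops = ops "Suc 0" t c for t c
begin

definition geo :: "nat => nat => cpoly" where
  "geo S i = (\<Sum>k<Suc S. (of_nat t * var i) ^ k)"

definition pairs :: "nat => (nat \<times> nat) set" where
  "pairs n = {(i, j). i < j & j < n}"

definition pair_factor :: "nat => nat \<times> nat => cpoly" where
  "pair_factor S = (%(i, j). (var j - var i) * geo S i)"

definition W :: "nat => nat => cpoly" where
  "W S n = (\<Prod>p\<in>pairs n. pair_factor S p)"

lemma finite_pairs: "finite (pairs n)"
  by (rule finite_subset[of _ "{..<n} \<times> {..<n}"]) (auto simp: pairs_def)

lemma geo_telescope: "geo S i * (1 - of_nat t * var i) = 1 - var i ^ Suc S * of_nat (t ^ Suc S)"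
proof -
  have "1 - (of_nat t * var i) ^ Suc S = (1 - of_nat t * var i) * geo S i"
    by (simp only: geo_def one_diff_power_eq)
  moreover have "(of_nat t * var i) ^ Suc S = var i ^ Suc S * of_nat (t ^ Suc S)"
    by (simp add: power_mult_distrib mult.commute del: power_Suc)
  ultimately show ?thesis by (simp add: mult.commute del: power_Suc)
qed

text \<open>
  The factor \<open>W\<close> makes every \<open>T i\<close> self-adjoint for the pairing \<open>(f, g) \<mapsto> [x\<^sup>u] (W f g)\<close>. The truncation
  of the geometric series in \<open>W\<close> is invisible because \<open>look u i <= S\<close>.
\<close>

lemma adjoint_T:
  assumes i: "Suc i < n" and u: "u = sing (Suc i) 1 + u'" "look u' i = look u' (Suc i)" and S: "look u i <= S"
  shows "look (W S n * T (Suc 0) t i f * g) u = look (W S n * f * T (Suc 0) t i g) u"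
proof -
  define C where "C = (\<Prod>p\<in>pairs n - {(i, Suc i)}. pair_factor S p)"
  let ?\<tau> = "transpose i (Suc i)"
  have W: "W S n = - xdiff i * geo S i * C"
  proof -
    have "(i, Suc i) \<in> pairs n" using i by (simp add: pairs_def)
    then show ?thesis unfolding W_def C_def
      by (simp add: prod.remove[OF finite_pairs] pair_factor_def xdiff_def)
  qed
  \<comment> \<open>Apart from the pair \<open>(i, Suc i)\<close>, the two indices occur
    symmetrically, in the differences as well as in the number of their factors
    \<open>geo\<close>.\<close>
  have C: "swap_vars i C = C"
  proof -
    have "swap_vars i C = (\<Prod>p\<in>pairs n - {(i, Suc i)}. pair_factor S (map_prod ?\<tau> ?\<tau> p))"
      unfolding C_def ahom_prod[OF ahom_swap]
      by (intro prod.cong) (auto simp: pair_factor_def geo_def swap_simps ahom_sum[OF ahom_swap] simp del: sum.lessThan_Suc)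
    also have "\<dots> = C" unfolding C_def using i
      by (intro prod.reindex_bij_witness[of _ "map_prod ?\<tau> ?\<tau>" "map_prod ?\<tau> ?\<tau>"])
        (auto simp: pairs_def transpose_def split: if_splits)
    finally show ?thesis .
  qed
  have sw: "swap_mono i u' = u'"
    by (rule poly_mapping_eqI) (auto simp: look_swap_mono transpose_def u(2))
  \<comment> \<open>\<open>u'\<close> and \<open>C\<close> are symmetric, so this coefficient does
    not notice a swap of the remaining factors.\<close>
  have flip: "look (C * (swap_vars i f * g)) u' = look (C * (f * swap_vars i g)) u'" for f g
    using look_swap_vars[of i "C * (f * swap_vars i g)" u'] by (simp add: swap_simps(1-8) C sw)
  have key: "look (W S n * T (Suc 0) t i f * g) u = look (C * (f * swap_vars i g)) u' - look (C * (f * g)) u'" for f g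
  proof -
    let ?h = "var (Suc i) * (C * ((f - swap_vars i f) * g))"
    have "W S n * T (Suc 0) t i f * g = - (geo S i * C) * (xdiff i * T (Suc 0) t i f) * g"
      unfolding W by (simp add: mult_ac)
    also have "\<dots> = - (geo S i * (1 - of_nat t * var i)) * ?h"
      unfolding xdiff_T by (simp add: bfac_def mult_ac)
    also have "\<dots> = var i ^ Suc S * (of_nat (t ^ Suc S) * ?h) - ?h"
      unfolding geo_telescope by (simp add: algebra_simps)
    finally have "look (W S n * T (Suc 0) t i f * g) u = - look ?h u"
      using S by (simp add: lookup_minus look_var_power_mult del: power_Suc)
    also have "look ?h u = look (C * ((f - swap_vars i f) * g)) u'"
      using look_mon_mult[of "sing (Suc i) 1" _ u'] mon_sing[of "Suc i" 1] u(1) by simp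
    also have "\<dots> = look (C * (f * g)) u' - look (C * (swap_vars i f * g)) u'"
      by (simp add: left_diff_distrib right_diff_distrib lookup_minus)
    finally show ?thesis using flip by simp
  qed
  show ?thesis using key[of f g] key[of g f] flip[of f g] by (simp add: mult_ac)
qed

text \<open>Consecutive exponents \<open>N, N + 1, ...\<close>: lowering the one at
  \<open>Suc i\<close> makes it equal to that at \<open>i\<close>, which is what
  \<open>adjoint_T\<close> asks for, here for every \<open>i\<close> at once.\<close>

definition rho :: "nat => nat => mono" where
  "rho N n = Poly_Mapping.nth (map (%k. k + N) [0..<n])"

lemma look_rho: "look (rho N n) l = (if l < n then l + N else 0)"
  by (simp add: rho_def look_nth)

lemma adjoint_E:
  assumes "Suc i < n" "n + N <= S"
  shows "look (W S n * E i f * g) (rho N n) = look (W S n * f * E i g) (rho N n)"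
proof -
  define u' where "u' = rho N n - sing (Suc i) 1"
  have "rho N n = sing (Suc i) 1 + u'" using assms
    by (intro poly_mapping_eqI) (auto simp: u'_def lookup_add lookup_minus look_rho lookup_single when_def)
  moreover have "look u' i = look u' (Suc i)" using assms
    by (auto simp: u'_def lookup_minus look_rho lookup_single when_def)
  moreover have "look (rho N n) i <= S" using assms by (simp add: look_rho)
  ultimately show ?thesis using adjoint_T[OF assms(1), of "rho N n" u' S f g]
    by (simp add: E_def distrib_left distrib_right lookup_add mult_ac)
qed

lemma adjoint_fold:
  assumes "n + N <= S" "\<And>i. i \<in> set ws ==> Suc i < n"
  shows "look (W S n * fold E ws f * g) (rho N n) = look (W S n * f * foldr E ws g) (rho N n)"
  using assms(2) by (induction ws arbitrary: f) (auto simp: adjoint_E[OF _ assms(1)])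

text \<open>\<open>geo\<close> carries the smaller index of its pair, so the last variable enters
  only through the \<open>n\<close> factors \<open>x_n - x_i\<close>.\<close>

lemma degree_W: "degree_le n n (W S (Suc n))"
proof -
  have "degree_le n (of_bool (j = n)) (pair_factor S (i, j))" if "i < j" "j < Suc n" for i j
  proof -
    have "degree_le n 0 (of_nat t * var i)"
      using degree_le_mult[OF degree_le_of_nat[of n t] degree_le_var[of n i]] that by simp
    then have "degree_le n 0 (geo S i)" unfolding geo_def
      using degree_le_power[of n 0] by (intro degree_le_sum) simp
    moreover have "degree_le n (of_bool (j = n)) (var j - var i)"
      using degree_le_var[of n j] degree_le_var[of n i] that
      by (intro degree_le_diff) (auto simp: degree_le_def split: if_splits)
    ultimately show ?thesis using degree_le_mult[of n "of_bool (j = n)" _ 0] by (simp add: pair_factor_def)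
  qed
  then have "degree_le n (\<Sum>p\<in>pairs (Suc n). of_bool (snd p = n)) (W S (Suc n))"
    unfolding W_def by (intro degree_le_prod) (auto simp only: pairs_def mem_Collect_eq prod.case snd_conv)
  moreover have "(\<Sum>p\<in>pairs (Suc n). of_bool (snd p = n)) = card {p \<in> pairs (Suc n). snd p = n}"
    using finite_pairs by (simp add: Int_def)
  moreover have "{p \<in> pairs (Suc n). snd p = n} = (%i. (i, n)) ` {..<n}" by (auto simp: pairs_def)
  moreover have "card ((%i. (i, n)) ` {..<n}) = n" by (subst card_image) (auto simp: inj_on_def)
  ultimately show ?thesis by simp
qed

section \<open>Shifting all parts and setting the first variable to 0\<close>

lemma from_decreasing_map_Suc:
  "from_decreasing E \<alpha> p ==> from_decreasing E (map Suc \<alpha>) (mon (ones (length \<alpha>)) * p)"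
proof (induction rule: from_decreasing.induct)
  case (base \<alpha>)
  have "Poly_Mapping.nth (map Suc \<alpha>) = ones (length \<alpha>) + Poly_Mapping.nth \<alpha>"
    by (rule poly_mapping_eqI) (auto simp: look_nth look_ones lookup_add)
  then have "xpow (map Suc \<alpha>) = mon (ones (length \<alpha>)) * xpow \<alpha>" by (simp add: xpow_mon mon_add)
  moreover have "sorted_wrt (\<ge>) (map Suc \<alpha>)" using base by (simp add: sorted_wrt_map)
  ultimately show ?case using from_decreasing.base[of "map Suc \<alpha>" E] by simp
next
  case (step \<alpha> p i)
  have "swap_mono i (ones (length \<alpha>)) = ones (length \<alpha>)"
    using step.hyps(2) by (intro poly_mapping_eqI) (auto simp: look_swap_mono look_ones transpose_def)
  then have "swap_vars i (mon (ones (length \<alpha>))) = mon (ones (length \<alpha>))" by (simp add: swap_vars_mon)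
  then have "E i (mon (ones (length \<alpha>)) * p) = mon (ones (length \<alpha>)) * E i p" by (rule E_symmetric_mult)
  moreover have "swap_parts i (map Suc \<alpha>) = map Suc (swap_parts i \<alpha>)"
    using step.hyps(2) by (intro nth_equalityI) (auto simp: nth_swap_parts)
  ultimately show ?case using from_decreasing.step[OF step.IH, of i] step.hyps by simp
qed

lemma X_map_Suc: "X (map Suc \<beta>) = mon (ones (length \<beta>)) * X \<beta>"
  by (intro X_eqI from_decreasing_map_Suc from_decreasing_X)

lemma del_0_E: "del 0 (E (Suc i) f) = E i (del 0 f)"
  by (simp add: E_def del_simps del_0_T)

lemma del_0_fold_E: "del 0 (fold E (map Suc ws) f) = fold E ws (del 0 f)"
  by (induction ws arbitrary: f) (auto simp: del_0_E)

lemma supp_pos: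
  "from_decreasing E \<alpha> p ==> k < length \<alpha> ==> \<forall>j\<le>k. \<alpha> ! j > 0 ==> \<eta> \<in> supp p ==> j <= k ==> look \<eta> j > 0"
proof (induction arbitrary: k \<eta> j rule: from_decreasing.induct)
  case (base \<alpha>)
  then show ?case by (auto simp: xpow_mon mon_def look_nth)
next
  case (step \<alpha> p i)
  \<comment> \<open>If the step crosses the end of the prefix, the part that moved inside is the
    smaller of the two and positive, so the positive prefix of \<open>\<alpha>\<close> reaches one
    place further.\<close>
  define k' where "k' = (if i = k then Suc k else k)"
  have k': "k' < length \<alpha>" "k <= k'" using step by (auto simp: k'_def)
  have pos: "\<alpha> ! j > 0" if "j <= k'" for j
  proof -
    have *: "swap_parts i \<alpha> ! l > 0" if "l <= k" for l using step.prems(2) that by blast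
    have sw: "swap_parts i \<alpha> ! l = (if l = i then \<alpha> ! Suc i else if l = Suc i then \<alpha> ! i else \<alpha> ! l)" if "l < length \<alpha>" for l
      using nth_swap_parts step.hyps(2) that by blast
    show ?thesis using that *[of j] *[of i] *[of "Suc i"] sw[of j] sw[of i] sw[of "Suc i"] step.hyps(2,3) k' step.prems(1)
      unfolding k'_def by (auto split: if_splits)
  qed
  have IH: "look \<nu> j > 0" if "\<nu> \<in> supp p" "j <= k'" for \<nu> j using step.IH[OF k'(1) _ that] pos by blast
  show ?case using step.prems(3)
  proof (cases rule: supp_E)
    case 1
    then show ?thesis using IH step.prems(4) k' by auto
  next
    case (2 \<nu>)
    show ?thesis
    proof (cases "j = i | j = Suc i")
      case True
      then have "i <= k'" "Suc i <= k'" using step.prems(4) by (auto simp: k'_def)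
      then have "min (look \<nu> i) (look \<nu> (Suc i)) > 0" using IH[OF 2(1)] by simp
      then show ?thesis using True 2(3,4) by auto
    next
      case False
      then show ?thesis using 2(1,2) IH[OF 2(1), of j] step.prems(4) k' by simp
    qed
  qed
qed

lemma del_0_X_pos: "\<beta> ~= [] ==> \<beta> ! 0 > 0 ==> del 0 (X \<beta>) = 0"
  using supp_pos[OF from_decreasing_X, of 0 \<beta>] by (intro del_pos) auto

text \<open>Each step \<open>E k\<close> meets a polynomial divisible by
  \<open>x_0, ..., x_k\<close>, so the terms with \<open>del k\<close> vanish and by
  \<open>del_T\<close> only \<open>del (Suc k)\<close> survives.\<close>

lemma del_fold_front:
  assumes "\<And>\<eta> j. \<eta> \<in> supp h ==> j < q ==> look \<eta> j > 0" "k <= q"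
  shows "del k (fold E (rev [k..<q]) h) = del q h \<and>
    (\<forall>\<eta>\<in>supp (fold E (rev [k..<q]) h). \<forall>j<k. look \<eta> j > 0)"
  using assms(2)
proof (induction rule: inc_induct)
  case base
  then show ?case using assms(1) by simp
next
  case (step k)
  let ?H = "fold E (rev [Suc k..<q]) h"
  have eq: "fold E (rev [k..<q]) h = E k ?H" using step.hyps by (simp add: upt_conv_Cons)
  have "del k ?H = 0" using step.IH by (intro del_pos) auto
  then have "del k (E k ?H) = del (Suc k) ?H" by (simp add: E_def del_simps del_T_Suc)
  moreover have "look \<eta> j > 0" if "\<eta> \<in> supp (E k ?H)" "j < k" for \<eta> j
    using that(1)
  proof (cases rule: supp_E)
    case 1
    then show ?thesis using step.IH that by auto
  next
    case (2 \<nu>)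
    then show ?thesis using step.IH that 2(2)[of j] by (metis less_Suc_eq less_irrefl not_less_eq Suc_lessD)
  qed
  ultimately show ?case using step.IH eq by simp
qed

text \<open>The swaps that rearrange \<open>\<beta>\<close> avoid place 0 and commute with
  \<open>del 0\<close>, so a decreasing \<open>\<beta>\<close> suffices. There the zero part is
  brought to the front past the positive parts, and \<open>del_fold_front\<close> turns
  \<open>del 0\<close> into the deletion of a variable that does not occur.\<close>

lemma del_0_X_zero: "del 0 (X (0 # \<beta>)) = X \<beta>"
proof -
  define \<sigma> where "\<sigma> = rev (sort \<beta>)"
  define ys where "ys = filter (%x. x > 0) \<sigma>"
  define zs where "zs = filter (%x. \<not> x > 0) \<sigma>"
  have sorted: "sorted_wrt (\<ge>) \<sigma>" by (simp add: \<sigma>_def sorted_wrt_rev)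
  then have \<sigma>: "\<sigma> = ys @ zs" unfolding ys_def zs_def
  proof (induction \<sigma>)
    case (Cons a \<sigma>)
    then show ?case by (cases "a = 0") (auto simp: filter_empty_conv filter_id_conv)
  qed simp
  have zs: "\<forall>z\<in>set zs. z = 0" and ys: "\<forall>y\<in>set ys. y > 0" by (auto simp: zs_def ys_def)
  have ch: "chain (>) (ys @ 0 # zs) (rev [0..<length ys])"
    "fold swap_parts (rev [0..<length ys]) (ys @ 0 # zs) = 0 # \<sigma>"
    using chain_to_front[of ys "(>)" 0 zs] ys \<sigma> by auto
  have "sorted_wrt (\<ge>) (ys @ 0 # zs)" using sorted zs unfolding \<sigma> by (auto simp: sorted_wrt_append)
  then have X0: "X (0 # \<sigma>) = fold E (rev [0..<length ys]) (xpow (ys @ 0 # zs))"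
    using X_chain[OF ch(1)] ch(2) X_sorted by simp
  have "del 0 (X (0 # \<sigma>)) = del (length ys) (xpow (ys @ 0 # zs))"
  proof -
    have "look \<eta> j > 0" if "\<eta> \<in> supp (xpow (ys @ 0 # zs))" "j < length ys" for \<eta> j
      using that ys by (auto simp: xpow_mon mon_def look_nth nth_append)
    from del_fold_front[where q = "length ys" and k = 0, OF this] show ?thesis unfolding X0 by simp
  qed
  also have "xpow (ys @ 0 # zs) = xpow ys"
  proof -
    have "(0 # zs) ! l = 0" if "l < length (0 # zs)" for l using that zs by (auto simp: nth_Cons split: nat.splits)
    then have "Poly_Mapping.nth (ys @ 0 # zs) = Poly_Mapping.nth ys"
      by (intro poly_mapping_eqI) (auto simp: look_nth nth_append)
    then show ?thesis by (simp add: xpow_mon)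
  qed
  also have "del (length ys) (xpow ys) = xpow ys"
    unfolding xpow_prod ahom_prod[OF ahom_del] by (simp add: del_simps)
  also have "xpow ys = xpow \<sigma>"
  proof -
    have "zs ! l = 0" if "l < length zs" for l using that zs by auto
    then have "Poly_Mapping.nth ys = Poly_Mapping.nth \<sigma>"
      unfolding \<sigma> by (intro poly_mapping_eqI) (auto simp: look_nth nth_append)
    then show ?thesis by (simp add: xpow_mon)
  qed
  finally have del: "del 0 (X (0 # \<sigma>)) = xpow \<sigma>" .
  let ?w = "rank_word (length \<beta>) (rank (>) \<beta>)"
  have w: "chain (>) \<sigma> ?w" "fold swap_parts ?w \<sigma> = \<beta>"
    using chain_rank_word[of "(>)" \<sigma> \<beta>] sorted
    by (auto simp: transp_def asymp_on_def totalp_on_def \<sigma>_def not_less)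
  have "X (0 # \<beta>) = fold E (map Suc ?w) (X (0 # \<sigma>))"
    using X_chain[of "0 # \<sigma>" "map Suc ?w"] chain_map_Suc[OF w(1), of 0] w(2) by simp
  then have "del 0 (X (0 # \<beta>)) = fold E ?w (xpow \<sigma>)" by (simp add: del_0_fold_E del)
  then show ?thesis by (simp add: X_rank_word \<sigma>_def)
qed

text \<open>The pairs through index 0 leave the product of all remaining variables. This matches the
  passage from \<open>shifted v\<close> to \<open>shifted (0 # v)\<close>, which raises every later
  exponent by one.\<close>

lemma del_0_W: "del 0 (W S (Suc n)) = mon (ones n) * W S n"
proof -
  have pairs: "pairs (Suc n) = (%j. (0, Suc j)) ` {..<n} \<union> map_prod Suc Suc ` pairs n"
  proof (intro set_eqI iffI)
    fix p assume "p \<in> pairs (Suc n)"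
    then obtain i j where p: "p = (i, Suc j)" "i < Suc j" "j < n" by (cases p; cases "snd p") (auto simp: pairs_def)
    then show "p \<in> (%j. (0, Suc j)) ` {..<n} \<union> map_prod Suc Suc ` pairs n"
      by (cases i) (auto simp: pairs_def image_iff)
  qed (auto simp: pairs_def)
  have g0: "del 0 (geo S 0) = 1"
    unfolding geo_def ahom_sum[OF ahom_del] by (simp add: del_simps sum.lessThan_Suc_shift del: sum.lessThan_Suc)
  have gS: "del 0 (geo S (Suc i)) = geo S i" for i
    unfolding geo_def ahom_sum[OF ahom_del] by (simp add: del_simps del: sum.lessThan_Suc)
  have "del 0 (W S (Suc n)) = (\<Prod>p\<in>(%j. (0, Suc j)) ` {..<n}. del 0 (pair_factor S p)) *
      (\<Prod>p\<in>map_prod Suc Suc ` pairs n. del 0 (pair_factor S p))"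
    unfolding W_def pairs ahom_prod[OF ahom_del] by (rule prod.union_disjoint) (auto simp: finite_pairs)
  also have "(\<Prod>p\<in>(%j. (0, Suc j)) ` {..<n}. del 0 (pair_factor S p)) = mon (ones n)"
    by (subst prod.reindex) (auto simp: inj_on_def pair_factor_def del_simps g0 mon_ones)
  also have "(\<Prod>p\<in>map_prod Suc Suc ` pairs n. del 0 (pair_factor S p)) = W S n"
    unfolding W_def by (subst prod.reindex)
      (auto simp: inj_on_def pair_factor_def del_simps gS intro!: prod.cong split: prod.splits)
  finally show ?thesis .
qed

definition shifted :: "nat list => mono" where
  "shifted v = Poly_Mapping.nth (map (%k. v ! k + k) [0..<length v])"

lemma look_shifted: "look (shifted v) l = (if l < length v then v ! l + l else 0)"
  by (simp add: shifted_def look_nth)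

text \<open>Multiplying by the complementary monomial of \<open>N - v\<close> moves the coefficient
  to \<open>rho N\<close>, where the operators that build \<open>X \<beta>\<close> can be shifted to
  that monomial. They keep its exponents at most \<open>N - v ! 0\<close>, the decreasing
  rearrangement of \<open>\<beta>\<close> ends in 0, and \<open>W\<close> has degree
  \<open>n\<close> in the last variable; so \<open>n + N\<close> is out of reach.\<close>

lemma dual_base_zero:
  assumes v: "length v = Suc n" "sorted v" "\<forall>x\<in>set v. x + Suc n <= S" "v ! 0 > 0"
    and \<beta>: "length \<beta> = Suc n" "0 \<in> set \<beta>"
  shows "look (W S (Suc n) * X \<beta>) (shifted v) = 0"
proof -
  define N where "N = v ! n"
  define \<nu> where "\<nu> = map (%x. N - x) v"
  define \<sigma> where "\<sigma> = rev (sort \<beta>)"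
  let ?w = "rank_word (length \<beta>) (rank (>) \<beta>)"
  let ?g = "foldr E ?w (xpow \<nu>)"
  have "N \<in> set v" using v(1) by (simp add: N_def)
  then have NS: "Suc n + N <= S" using v(3) by (simp add: add.commute)
  have vN: "v ! 0 <= v ! l" "v ! l <= N" if "l < Suc n" for l
    using that v(1,2) by (auto simp: N_def sorted_iff_nth_mono)
  have sh: "rho N (Suc n) = Poly_Mapping.nth \<nu> + shifted v"
    using v(1) vN by (intro poly_mapping_eqI) (auto simp: look_rho lookup_add look_nth look_shifted \<nu>_def)
  have "look (W S (Suc n) * X \<beta>) (shifted v) = look (W S (Suc n) * X \<beta> * xpow \<nu>) (rho N (Suc n))"
    unfolding sh xpow_mon using look_mon_mult[of "Poly_Mapping.nth \<nu>" "W S (Suc n) * X \<beta>" "shifted v"]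
    by (simp add: mult.commute)
  also have "\<dots> = look (W S (Suc n) * xpow \<sigma> * ?g) (rho N (Suc n))"
    unfolding X_rank_word[of \<beta>] \<sigma>_def using NS rank_word_index(1)[of _ \<beta>] \<beta>(1) by (intro adjoint_fold) auto
  also have "\<dots> = 0"
  proof -
    define M where "M = N - v ! 0"
    have "bounded_by (%_. M) (xpow \<nu>)"
      using vN v(1) by (auto simp: bounded_by_def xpow_mon mon_def look_nth \<nu>_def M_def diff_le_mono2)
    then have "bounded_by (%_. M) (foldr E ws (xpow \<nu>))" for ws
      by (induction ws) (auto intro: bounded_by_E)
    then have "degree_le n M ?g" by (simp add: bounded_by_def degree_le_def)
    moreover have "degree_le n 0 (xpow \<sigma>)"
    proof -
      have "sort \<beta> ! 0 = 0"
      proof -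
        obtain l where "l < length (sort \<beta>)" "sort \<beta> ! l = 0" using \<beta>(2) by (metis in_set_conv_nth set_sort)
        then show ?thesis using sorted_nth_mono[OF sorted_sort, of 0 l \<beta>] by simp
      qed
      then have "\<sigma> ! n = 0" using \<beta>(1) by (simp add: \<sigma>_def rev_nth)
      then show ?thesis unfolding xpow_mon by (intro degree_le_mon) (simp add: look_nth)
    qed
    ultimately have "degree_le n (n + 0 + M) (W S (Suc n) * xpow \<sigma> * ?g)"
      using degree_W by (intro degree_le_mult)
    moreover have "look (rho N (Suc n)) n > n + 0 + M"
      using v(4) vN(2)[of 0] by (simp add: look_rho M_def)
    ultimately show ?thesis by (auto simp: degree_le_def in_keys_iff dest!: bspec leD)
  qed
  finally show ?thesis .
qed

text \<open>Induction on the length and then on the smallest part \<open>v ! 0\<close>. If it is 0,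
  setting \<open>x_0 = 0\<close> removes it. Otherwise \<open>dual_base_zero\<close> treats every
  \<open>\<beta>\<close> with a zero part, and for the others the product of all variables splits
  off.\<close>

lemma dual_base:
  assumes "length v = n" "length \<beta> = n" "sorted v" "\<forall>x\<in>set v. x + n <= S"
  shows "look (W S n * X \<beta>) (shifted v) = of_bool (\<beta> = v)"
  using assms
proof (induction n arbitrary: v \<beta>)
  case 0
  have "shifted [] = 0" by (rule poly_mapping_eqI) (simp add: look_shifted)
  moreover have "X [] = 1" by (simp add: X_sorted xpow_prod)
  moreover have "W S 0 = 1" by (simp add: W_def pairs_def)
  ultimately show ?case using 0 by simp
next
  case (Suc n)
  from Suc.prems show ?case
  proof (induction "v ! 0" arbitrary: v \<beta>)
    case 0
    obtain v' where v: "v = 0 # v'" using 0 by (cases v) auto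
    obtain b \<beta>' where \<beta>: "\<beta> = b # \<beta>'" using 0 by (cases \<beta>) auto
    let ?u = "Poly_Mapping.map_key Suc (shifted v)"
    have u: "?u = ones n + shifted v'"
      using 0 v by (intro poly_mapping_eqI) (auto simp: map_key.rep_eq look_shifted look_ones lookup_add)
    have "look (W S (Suc n) * X \<beta>) (shifted v) = look (del 0 (W S (Suc n) * X \<beta>)) ?u"
      using v by (intro look_del_0) (simp add: look_shifted)
    also have "\<dots> = look (W S n * del 0 (X \<beta>)) (shifted v')"
      unfolding u by (simp add: del_simps del_0_W mult.assoc look_mon_mult)
    also have "\<dots> = of_bool (\<beta> = v)"
    proof (cases "b = 0")
      case True
      have "look (W S n * X \<beta>') (shifted v') = of_bool (\<beta>' = v')"
        using 0 v \<beta> by (intro Suc.IH) auto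
      then show ?thesis using True v \<beta> by (simp add: del_0_X_zero)
    next
      case False
      then show ?thesis using del_0_X_pos[of \<beta>] v \<beta> by simp
    qed
    finally show ?case .
  next
    case (Suc k)
    show ?case
    proof (cases "0 \<in> set \<beta>")
      case True
      have "v ~= \<beta>"
      proof
        assume "v = \<beta>"
        then obtain l where "l < length v" "v ! l = 0" using True by (metis in_set_conv_nth)
        then show False using Suc.hyps(2) sorted_nth_mono[OF Suc.prems(3), of 0 l] by simp
      qed
      then show ?thesis using dual_base_zero[of v n S \<beta>] True Suc by auto
    next
      case False
      define \<beta>' v' where "\<beta>' = map (%x. x - 1) \<beta>" and "v' = map (%x. x - 1) v"
      have "x > 0" if "x \<in> set \<beta>" for x using False that by (cases x) auto
      then have \<beta>: "\<beta> = map Suc \<beta>'" by (auto simp: \<beta>'_def comp_def intro!: map_idI[symmetric])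
      have "x > 0" if "x \<in> set v" for x
        using that Suc.hyps(2) sorted_nth_mono[OF Suc.prems(3), of 0] by (metis in_set_conv_nth le_0_eq neq0_conv old.nat.distinct(2) zero_le)
      then have v: "v = map Suc v'" by (auto simp: v'_def comp_def intro!: map_idI[symmetric])
      have len: "length v' = Suc n" "length \<beta>' = Suc n" using Suc.prems by (auto simp: v'_def \<beta>'_def)
      have IH: "look (W S (Suc n) * X \<beta>') (shifted v') = of_bool (\<beta>' = v')"
      proof (rule Suc.hyps(1))
        show "k = v' ! 0" using Suc.hyps(2) len by (simp add: v)
        show "sorted v'" using Suc.prems(3) by (simp add: v sorted_iff_nth_mono)
        show "\<forall>x\<in>set v'. x + Suc n <= S" using Suc.prems(4) by (auto simp: v)
      qed (rule len)+
      have "shifted v = ones (Suc n) + shifted v'"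
        using len by (intro poly_mapping_eqI) (auto simp: look_shifted look_ones lookup_add v)
      then have "look (W S (Suc n) * X \<beta>) (shifted v) = look (W S (Suc n) * X \<beta>') (shifted v')"
        using look_mon_mult[of "ones (Suc n)" "W S (Suc n) * X \<beta>'" "shifted v'"] len
        by (simp add: \<beta> X_map_Suc mult_ac)
      then show ?thesis using IH by (simp add: \<beta> v inj_map_eq_map)
    qed
  qed
qed

definition dual :: "nat => nat => nat list => cpoly => complex" where
  "dual S n \<gamma> f = look (W S n * foldr F (rank_word n (rank (<) \<gamma>)) f) (shifted (sort \<gamma>))"

lemma linfun_dual: "linfun (dual S n \<gamma>)"
  unfolding dual_def
  using linfun_comp[OF linfun_comp[OF linfun_look linmap_mult(1)] linmap_foldr_F] by simp

lemma dual_X: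
  assumes "length \<gamma> = n" "length \<beta> = n" "\<forall>x\<in>set \<gamma>. x + n <= S"
  shows "dual S n \<gamma> (X \<beta>) = of_bool (\<beta> = \<gamma>)"
proof -
  let ?w = "rank_word n (rank (<) \<gamma>)"
  have w: "chain (<) (sort \<gamma>) ?w" "fold swap_parts ?w (sort \<gamma>) = \<gamma>"
    using chain_rank_less[of "sort \<gamma>" \<gamma>] assms(1) by auto
  have "(%f. look (W S n * f) (shifted (sort \<gamma>))) (foldr F ?w (X \<beta>)) = of_bool (\<beta> = fold swap_parts ?w (sort \<gamma>))"
  proof (rule dual_chain[where M = "mset \<beta>"])
    show "linfun (%f. look (W S n * f) (shifted (sort \<gamma>)))" by (rule linfun_comp[OF linfun_look linmap_mult(1)])
    fix \<delta> :: "nat list" assume "mset \<delta> = mset \<beta>"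
    then have "length \<delta> = n" using assms(2) by (metis size_mset)
    then show "look (W S n * X \<delta>) (shifted (sort \<gamma>)) = of_bool (\<delta> = sort \<gamma>)"
      using assms by (intro dual_base) auto
  qed (use w assms in auto)
  then show ?thesis by (simp add: dual_def w(2))
qed

lemma dual_family_X:
  fixes S :: "nat list => nat"
  assumes "\<And>\<gamma>. \<gamma> \<in> comps n ==> \<forall>x\<in>set \<gamma>. x + n <= S \<gamma>"
  shows "dual_family n X (%\<gamma>. dual (S \<gamma>) n \<gamma>)"
proof
  fix \<alpha> assume \<alpha>: "\<alpha> \<in> comps n"
  \<comment> \<open>The box is the cube of exponents up to the largest part; no operator leads out
    of it.\<close>
  define M where "M = Max (insert 0 (set \<alpha>))"
  let ?B = "%l. if l < n then M else 0"
  let ?S = "{\<alpha> \<in> comps n. \<forall>l<n. \<alpha> ! l <= ?B l}"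
  have "X \<beta> \<in> cpoly.span (xpow ` ?S)" if "\<beta> \<in> ?S" for \<beta>
  proof (rule bounded_by_span)
    have "set \<beta> \<subseteq> {..M}" "length \<beta> = n" using that by (auto simp: comps_def in_set_conv_nth)
    then have "rev (sort \<beta>) ! l <= M" if "l < n" for l
      using nth_mem[of l "rev (sort \<beta>)"] that by auto
    then have "bounded_by ?B (xpow (rev (sort \<beta>)))" using \<open>length \<beta> = n\<close>
      by (auto simp: bounded_by_def xpow_mon mon_def look_nth)
    then show "bounded_by ?B (X \<beta>)" using \<open>length \<beta> = n\<close> by (intro bounded_by_X) auto
  qed simp
  moreover have "\<alpha> \<in> ?S" using \<alpha> by (auto simp: M_def comps_def intro!: Max_ge)
  ultimately show "\<exists>S. finite S & \<alpha> \<in> S & S \<subseteq> comps n & X ` S \<subseteq> cpoly.span (xpow ` S)"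
    by (intro exI[of _ ?S]) (auto simp: finite_box)
next
  fix \<beta> \<gamma> assume "\<beta> \<in> comps n" "\<gamma> \<in> comps n"
  then show "dual (S \<gamma>) n \<gamma> (X \<beta>) = of_bool (\<beta> = \<gamma>)"
    using assms[of \<gamma>] by (intro dual_X) (auto simp: comps_def)
qed (rule linfun_dual)

end

section \<open>Permutations as lists and Lehmer codes\<close>

definition list_perm :: "nat => nat list => nat => nat" where
  "list_perm m \<beta> i = (if i < m then \<beta> ! i else i)"

lemma map_longest_perm: "map (longest_perm m) [0..<m] = rev [0..<m]"
  by (rule nth_equalityI) (auto simp: longest_perm_def rev_nth)

lemma map_comp_transpose:
  "Suc i < m ==> map (w \<circ> transpose i (Suc i)) [0..<m] = swap_parts i (map w [0..<m])"
  by (rule nth_equalityI) (auto simp: nth_swap_parts transpose_def)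

text \<open>In one-line notation, right multiplication by an adjacent transposition swaps
  neighbouring entries, so the recursion from the longest permutation is the recursion from a
  decreasing list.\<close>

lemma from_longest_decreasing:
  "from_longest D m w p ==> from_decreasing D (map w [0..<m]) p"
proof (induction rule: from_longest.induct)
  case base
  have "sorted_wrt (\<ge>) (rev [0..<m])" by (simp add: sorted_wrt_rev)
  then show ?case using from_decreasing.base[of "rev [0..<m]" D] by (simp add: map_longest_perm)
next
  case (step w p i)
  then show ?case unfolding map_comp_transpose[OF step.hyps(2)]
    using from_decreasing.step[OF step.IH, of i] by simp
qed

lemma mset_upt_sorted: "mset \<beta> = mset [0..<m] ==> sorted \<beta> ==> \<beta> = [0..<m]"
  by (metis properties_for_sort sorted_sort_id sorted_upt)

lemma decreasing_from_longest:
  "from_decreasing D \<beta> p ==> mset \<beta> = mset [0..<m] ==> from_longest D m (list_perm m \<beta>) p"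
proof (induction rule: from_decreasing.induct)
  case (base \<beta>)
  then have "rev \<beta> = [0..<m]" by (intro mset_upt_sorted) (auto simp: sorted_wrt_rev)
  then have \<beta>: "\<beta> = rev [0..<m]" by (metis rev_rev_ident)
  have "list_perm m \<beta> = longest_perm m" by (auto simp: list_perm_def longest_perm_def \<beta> rev_nth)
  then show ?case using from_longest.base[of D m] \<beta> by simp
next
  case (step \<alpha> p i)
  have len: "length \<alpha> = m" using step.prems by (metis length_swap_parts length_upt minus_nat.diff_0 size_mset)
  have "list_perm m (swap_parts i \<alpha>) = list_perm m \<alpha> \<circ> transpose i (Suc i)"
    using step.hyps len by (auto simp: fun_eq_iff list_perm_def nth_swap_parts transpose_def)
  moreover have "mset \<alpha> = mset [0..<m]" using step.prems step.hyps by (simp add: mset_swap_parts)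
  moreover have "list_perm m \<alpha> (Suc i) < list_perm m \<alpha> i" "Suc i < m" using step.hyps len by (auto simp: list_perm_def)
  ultimately show ?case using from_longest.step[OF step.IH, of i] by (simp only:)
qed

lemma mset_map_permutes: "w permutes {..<m} ==> mset (map w [0..<m]) = mset [0..<m]"
  by (simp add: atLeast0LessThan permutes_image_mset)

lemma list_perm_map: "w permutes {..<m} ==> list_perm m (map w [0..<m]) = w"
  by (auto simp: list_perm_def fun_eq_iff permutes_not_in)

lemma list_perm_permutes: "mset \<beta> = mset [0..<m] ==> list_perm m \<beta> permutes {..<m}"
proof (rule bij_imp_permutes)
  assume *: "mset \<beta> = mset [0..<m]"
  then have "distinct \<beta>" "set \<beta> = {..<m}" "length \<beta> = m"
    by (metis distinct_upt mset_eq_imp_distinct_iff, metis atLeast0LessThan set_mset_mset set_upt,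
        metis length_upt minus_nat.diff_0 size_mset)
  then have "bij_betw (nth \<beta>) {..<m} {..<m}" by (intro bij_betw_nth) auto
  then show "bij_betw (list_perm m \<beta>) {..<m} {..<m}"
    by (rule bij_betw_cong[THEN iffD1, rotated]) (simp add: list_perm_def)
qed (simp add: list_perm_def)

lemma map_list_perm: "mset \<beta> = mset [0..<m] ==> map (list_perm m \<beta>) [0..<m] = \<beta>"
  by (rule nth_equalityI) (auto simp: list_perm_def dest: arg_cong[where f = size])

lemma lehmer_code_rank:
  assumes "w permutes {..<m}"
  shows "lehmer_code w i = (if i < m then rank (<) (map w [0..<m]) i else 0)"
proof (cases "i < m")
  case True
  have "{j. i < j & w j < w i} = {j. i < j & j < length (map w [0..<m]) & map w [0..<m] ! j < map w [0..<m] ! i}"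
  proof -
    have "j < m" if "w j < w i" for j
    proof (rule ccontr)
      assume "\<not> j < m"
      then have "w j = j" using assms by (simp add: permutes_not_in)
      moreover have "w i < m" using permutes_in_image[OF assms, of i] True by simp
      ultimately show False using that \<open>\<not> j < m\<close> by simp
    qed
    then show ?thesis using True by auto
  qed
  then show ?thesis using True by (simp add: lehmer_code_def rank_def)
next
  case False
  then have "{j. i < j & w j < w i} = {}" using assms by (auto simp: permutes_not_in)
  then show ?thesis using False by (simp only: lehmer_code_def card.empty if_False)
qed

text \<open>The usual decoding of a Lehmer code: the first entry is the element of \<open>A\<close>
  with \<open>q 0\<close> smaller ones, and the rest is decoded from the remaining elements.\<close>

lemma rank_list_exists:
  "sorted_wrt (<) A ==> (\<And>k. k < length A ==> q k + k < length A) ==>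
     \<exists>\<beta>. mset \<beta> = mset A & (\<forall>k<length A. rank (<) \<beta> k = q k)"
proof (induction "length A" arbitrary: A q)
  case (Suc m)
  let ?b = "A ! q 0" and ?A = "take (q 0) A @ drop (Suc (q 0)) A"
  have q0: "q 0 < length A" using Suc.prems(2)[of 0] Suc.hyps(2) by linarith
  then have A: "A = take (q 0) A @ ?b # drop (Suc (q 0)) A" by (rule id_take_nth_drop)
  have lenA: "length ?A = m" using q0 Suc.hyps(2) by simp
  have "sorted_wrt (<) ?A" using Suc.prems(1) by (subst (asm) A) (auto simp: sorted_wrt_append)
  moreover have "q (Suc k) + k < length ?A" if "k < length ?A" for k
    using Suc.prems(2)[of "Suc k"] that unfolding lenA Suc.hyps(2)[symmetric] by simp
  ultimately obtain \<beta> where \<beta>: "mset \<beta> = mset ?A" "\<forall>k<m. rank (<) \<beta> k = q (Suc k)"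
    using Suc.hyps(1)[of ?A "%k. q (Suc k)"] unfolding lenA by auto
  have "mset (?b # \<beta>) = mset A" using \<beta>(1) by (subst (2) A) simp
  moreover have "rank (<) (?b # \<beta>) k = q k" if "k < length A" for k
  proof (cases k)
    case 0
    have "length (filter (%x. x < ?b) \<beta>) = length (filter (%x. x < ?b) ?A)"
      using \<beta>(1) by (metis mset_filter size_mset)
    also have "filter (%x. x < ?b) ?A = take (q 0) A"
      using Suc.prems(1) by (subst (asm) A) (auto simp: sorted_wrt_append filter_empty_conv filter_id_conv)
    finally show ?thesis using 0 q0 by (simp add: rank_Cons_0)
  next
    case (Suc k')
    then show ?thesis using \<beta>(2) that Suc.hyps(2) by (simp add: rank_Cons_Suc)
  qed
  ultimately show ?case by blast
qed simp

lemma rank_list_unique: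
  assumes "mset \<beta> = mset [0..<m]" "mset \<beta>' = mset [0..<m]" "\<And>k. k < m ==> rank (<) \<beta> k = rank (<) \<beta>' k"
  shows "\<beta> = \<beta>'"
proof -
  have "fold swap_parts (rank_word m (rank (<) \<beta>)) [0..<m] = \<beta>" if "mset \<beta> = mset [0..<m]" for \<beta>
  proof -
    have "length \<beta> = m" using that by (metis length_upt minus_nat.diff_0 size_mset)
    then show ?thesis using chain_rank_less(2)[of "[0..<m]" \<beta>] that by simp
  qed
  then show ?thesis using assms rank_word_cong[of m "rank (<) \<beta>" "rank (<) \<beta>'"] by metis
qed

text \<open>Ensures that the permutation with this code moves only the first \<open>m\<close>
  points.\<close>

definition code_fits :: "nat => nat list => bool" where
  "code_fits m \<alpha> \<longleftrightarrow> length \<alpha> <= m & (\<forall>k<length \<alpha>. \<alpha> ! k + k < m)"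

definition code_list :: "nat => nat list => nat list" where
  "code_list m \<alpha> = (SOME \<beta>. mset \<beta> = mset [0..<m] & (\<forall>k<m. rank (<) \<beta> k = nth_default 0 \<alpha> k))"

lemma code_list:
  assumes "code_fits m \<alpha>"
  shows "mset (code_list m \<alpha>) = mset [0..<m]" "k < m ==> rank (<) (code_list m \<alpha>) k = nth_default 0 \<alpha> k"
    "length (code_list m \<alpha>) = m" "distinct (code_list m \<alpha>)"
proof -
  have "nth_default 0 \<alpha> k + k < length [0..<m]" if "k < length [0..<m]" for k
    using assms that by (auto simp: code_fits_def nth_default_def)
  then have "\<exists>\<beta>. mset \<beta> = mset [0..<m] & (\<forall>k<m. rank (<) \<beta> k = nth_default 0 \<alpha> k)"
    using rank_list_exists[of "[0..<m]" "nth_default 0 \<alpha>"] by simp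
  from someI_ex[OF this]
  show *: "mset (code_list m \<alpha>) = mset [0..<m]" and "k < m ==> rank (<) (code_list m \<alpha>) k = nth_default 0 \<alpha> k"
    unfolding code_list_def by blast+
  show "length (code_list m \<alpha>) = m" using * by (metis length_upt minus_nat.diff_0 size_mset)
  show "distinct (code_list m \<alpha>)" using * by (metis distinct_upt mset_eq_imp_distinct_iff)
qed

lemma code_list_inj:
  assumes "code_fits m \<alpha>" "code_fits m \<beta>" "length \<alpha> = length \<beta>" "code_list m \<alpha> = code_list m \<beta>"
  shows "\<alpha> = \<beta>"
proof (rule nth_equalityI)
  fix k assume k: "k < length \<alpha>"
  then have "k < m" using assms(1) by (simp add: code_fits_def)
  then have "nth_default 0 \<alpha> k = nth_default 0 \<beta> k" using code_list(2)[OF assms(1)] code_list(2)[OF assms(2)] assms(4) by metis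
  then show "\<alpha> ! k = \<beta> ! k" using k assms(3) by (simp add: nth_default_def)
qed (rule assms(3))

lemma perm_of_code:
  assumes "code_fits m \<alpha>"
  shows "perm_of_code \<alpha> = list_perm m (code_list m \<alpha>)"
  unfolding perm_of_code_def
proof (rule the_equality)
  let ?w = "list_perm m (code_list m \<alpha>)"
  have p: "?w permutes {..<m}" using list_perm_permutes code_list(1)[OF assms] by blast
  have code: "lehmer_code ?w i = nth_default 0 \<alpha> i" for i
  proof (cases "i < m")
    case True
    then show ?thesis using lehmer_code_rank[OF p, of i] code_list(1,2)[OF assms] by (simp add: map_list_perm)
  next
    case False
    then show ?thesis using lehmer_code_rank[OF p, of i] assms by (simp add: nth_default_def code_fits_def)
  qed
  then show "(\<exists>m. ?w permutes {..<m}) & (\<forall>i. lehmer_code ?w i = nth_default 0 \<alpha> i)" using p by blast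
  fix w assume w: "(\<exists>m. w permutes {..<m}) & (\<forall>i. lehmer_code w i = nth_default 0 \<alpha> i)"
  then obtain m' where "w permutes {..<m'}" by blast
  define M where "M = max m m'"
  have pM: "w permutes {..<M}" "?w permutes {..<M}"
    using \<open>w permutes {..<m'}\<close> p by (auto simp: M_def intro: permutes_subset)
  have "map w [0..<M] = map ?w [0..<M]"
  proof (rule rank_list_unique)
    fix k assume "k < M"
    then show "rank (<) (map w [0..<M]) k = rank (<) (map ?w [0..<M]) k"
      using lehmer_code_rank[OF pM(1), of k] lehmer_code_rank[OF pM(2), of k] w code by simp
  qed (rule mset_map_permutes[OF pM(1)], rule mset_map_permutes[OF pM(2)])
  then show "w = ?w" using list_perm_map[OF pM(1)] list_perm_map[OF pM(2)] by metis
qed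

section \<open>Schubert and Grothendieck polynomials\<close>

locale schubert_ops = ops 0 t t for t
begin

lemma E_var_mult:
  assumes "swap_vars i g = g"
  shows "E i (var i * g) = g"
proof -
  have "T 0 t i (var i * g) = g * T 0 t i (var i)"
    using T_symmetric_mult[OF assms, of 0 t "var i"] by (simp add: mult.commute)
  then show ?thesis by (simp add: E_def T_def bfac_def divdiff_var algebra_simps)
qed

text \<open>Stability of the starting point. \<open>L k\<close> is the longest element of the next
  larger group with its top entry moved \<open>k\<close> places to the right, and \<open>P k\<close>
  is the exponent vector reached there. The monomial of \<open>P k\<close> is \<open>x_k\<close>
  times one symmetric in \<open>x_k\<close> and the next variable, so \<open>E_var_mult\<close>
  strips off \<open>x_k\<close>.\<close>

lemma from_decreasing_staircase: "from_decreasing E (rev [0..<m] @ [m]) (xpow (rev [0..<m]))"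
proof -
  define L where "L k = map (%l. if l < k then m - 1 - l else if l = k then m else m - l) [0..<Suc m]" for k
  define P where "P k = Poly_Mapping.nth (map (%l. if l < k then m - 1 - l else m - l) [0..<Suc m])" for k
  have lP: "look (P k) l = (if l < Suc m then if l < k then m - 1 - l else m - l else 0)" for k l
    by (auto simp: P_def look_nth simp del: upt_Suc)
  have "from_decreasing E (L k) (mon (P k))" if "k <= m" for k
    using that
  proof (induction k)
    case 0
    have L0: "L 0 = map (%l. m - l) [0..<Suc m]" by (auto simp: L_def simp del: upt_Suc)
    have "sorted_wrt (\<ge>) (L 0)"
      unfolding L0 decreasing_iff_nth by (auto simp del: upt_Suc)
    moreover have "xpow (L 0) = mon (P 0)" by (simp add: xpow_mon L0 P_def del: upt_Suc)
    ultimately show ?case using from_decreasing.base by metis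
  next
    case (Suc k)
    have s: "swap_parts k (L k) = L (Suc k)"
      using Suc.prems by (intro nth_equalityI) (auto simp: nth_swap_parts L_def simp del: upt_Suc)
    have "P k = sing k 1 + P (Suc k)"
      using Suc.prems by (intro poly_mapping_eqI) (auto simp: lP lookup_add lookup_single when_def)
    then have "mon (P k) = var k * mon (P (Suc k))" using mon_sing[of k 1] by (simp add: mon_add)
    moreover have "swap_mono k (P (Suc k)) = P (Suc k)"
      using Suc.prems by (intro poly_mapping_eqI) (auto simp: look_swap_mono lP transpose_def)
    then have "swap_vars k (mon (P (Suc k))) = mon (P (Suc k))" by (simp add: swap_vars_mon)
    ultimately have "E k (mon (P k)) = mon (P (Suc k))" by (simp add: E_var_mult)
    then show ?case using from_decreasing.step[OF Suc.IH, of k] Suc.prems unfolding s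
      by (simp add: L_def del: upt_Suc)
  qed
  from this[of m] have "from_decreasing E (L m) (mon (P m))" by simp
  moreover have "L m = rev [0..<m] @ [m]"
    by (rule nth_equalityI) (auto simp: L_def nth_append rev_nth simp del: upt_Suc)
  moreover have "P m = Poly_Mapping.nth (rev [0..<m])"
    by (rule poly_mapping_eqI) (auto simp: lP look_nth rev_nth)
  ultimately show ?thesis by (simp add: xpow_mon)
qed

lemma from_decreasing_snoc:
  "from_decreasing E \<beta> p ==> mset \<beta> = mset [0..<m] ==> from_decreasing E (\<beta> @ [m]) p"
proof (induction rule: from_decreasing.induct)
  case (base \<beta>)
  then have "rev \<beta> = [0..<m]" by (intro mset_upt_sorted) (auto simp: sorted_wrt_rev)
  then have "\<beta> = rev [0..<m]" by (metis rev_rev_ident)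
  then show ?case using from_decreasing_staircase by simp
next
  case (step \<alpha> p i)
  have "swap_parts i (\<alpha> @ [m]) = swap_parts i \<alpha> @ [m]"
    using step.hyps(2) by (simp add: swap_parts_def nth_append list_update_append)
  moreover have "mset \<alpha> = mset [0..<m]" using step.prems step.hyps by (simp add: mset_swap_parts)
  ultimately show ?case using from_decreasing.step[OF step.IH, of i] step.hyps by (simp add: nth_append)
qed

lemma X_append:
  assumes "mset \<beta> = mset [0..<m]" "m <= m'"
  shows "X (\<beta> @ [m..<m']) = X \<beta>"
proof -
  have "mset (\<beta> @ [m..<m + k]) = mset [0..<m + k] & X (\<beta> @ [m..<m + k]) = X \<beta>" for k
  proof (induction k)
    case (Suc k)
    then have "X ((\<beta> @ [m..<m + k]) @ [m + k]) = X (\<beta> @ [m..<m + k])"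
      by (intro X_eqI from_decreasing_snoc from_decreasing_X) simp
    then show ?case using Suc by (simp del: mset_upt)
  qed (use assms(1) in simp)
  from this[of "m' - m"] show ?thesis using assms(2) by simp
qed

lemma X_upt: "X [0..<m] = 1"
  using X_append[of "[]" 0 m] by (simp add: X_sorted xpow_prod)

lemma the_from_longest:
  assumes "w permutes {..<m}"
  shows "(THE p. \<exists>m. w permutes {..<m} & from_longest E m w p) = X (map w [0..<m])"
proof (rule the_equality)
  have "from_longest E m (list_perm m (map w [0..<m])) (X (map w [0..<m]))"
    by (intro decreasing_from_longest from_decreasing_X mset_map_permutes assms)
  then show "\<exists>k. w permutes {..<k} & from_longest E k w (X (map w [0..<m]))"
    using assms list_perm_map by metis
  fix p assume "\<exists>m. w permutes {..<m} & from_longest E m w p"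
  then obtain m' where m': "w permutes {..<m'}" "from_longest E m' w p" by blast
  have ext: "X (map w [0..<M]) = X (map w [0..<k])" if "w permutes {..<k}" "k <= M" for k M
  proof -
    have "map w [k..<M] = [k..<M]" using that(1) by (intro map_idI) (simp add: permutes_not_in)
    then have "map w [0..<M] = map w [0..<k] @ [k..<M]"
      using that(2) by (metis le0 le_add_diff_inverse map_append upt_add_eq_append)
    then show ?thesis using X_append[OF mset_map_permutes[OF that(1)] that(2)] by simp
  qed
  have "p = X (map w [0..<m'])" using X_eqI[OF from_longest_decreasing[OF m'(2)]] by simp
  then show "p = X (map w [0..<m])"
    using ext[OF assms, of "max m m'"] ext[OF m'(1), of "max m m'"] by simp
qed

definition Y :: "nat list => cpoly" where
  "Y \<alpha> = (THE p. \<exists>m. perm_of_code \<alpha> permutes {..<m} & from_longest E m (perm_of_code \<alpha>) p)"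

lemma Y_code_list:
  assumes "code_fits m \<alpha>"
  shows "Y \<alpha> = X (code_list m \<alpha>)"
proof -
  have "list_perm m (code_list m \<alpha>) permutes {..<m}" using list_perm_permutes code_list(1)[OF assms] by blast
  from the_from_longest[OF this] show ?thesis
    using map_list_perm[OF code_list(1)[OF assms]] by (simp add: Y_def perm_of_code[OF assms])
qed

lemma length_rank_word: "length (rank_word n q) = (\<Sum>k<n. q k)"
  by (simp add: rank_word_def length_concat comp_def sum_list_sum_nth atLeast0LessThan)

lemma degree_fold_E:
  assumes "\<forall>\<eta>\<in>supp f. d <= (\<Sum>l<m. look \<eta> l)" "\<forall>i\<in>set ws. Suc i < m" "\<theta> \<in> supp (fold E ws f)"
  shows "d <= (\<Sum>l<m. look \<theta> l) + length ws"
  using assms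
proof (induction ws arbitrary: f d)
  case (Cons i ws)
  have "d - 1 <= (\<Sum>l<m. look \<theta> l)" if "\<theta> \<in> supp (E i f)" for \<theta>
    using that
  proof (cases rule: supp_E)
    case 1
    then show ?thesis using Cons.prems(1) by fastforce
  next
    case (2 \<eta>)
    have split: "(\<Sum>l<m. g l) = (\<Sum>l\<in>{..<m} - {i, Suc i}. g l) + (g i + g (Suc i))" for g :: "nat => nat"
      using Cons.prems(2) sum.subset_diff[of "{i, Suc i}" "{..<m}" g] by auto
    have "(\<Sum>l\<in>{..<m} - {i, Suc i}. look \<theta> l) = (\<Sum>l\<in>{..<m} - {i, Suc i}. look \<eta> l)"
      using 2(2) by (intro sum.cong) auto
    moreover have "d <= (\<Sum>l<m. look \<eta> l)" using Cons.prems(1) 2(1) by blast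
    ultimately show ?thesis using 2(7) unfolding split[of "look \<eta>"] split[of "look \<theta>"] by linarith
  qed
  then have "d - 1 <= (\<Sum>l<m. look \<theta> l) + length ws"
    using Cons.prems by (intro Cons.IH[of "E i f"]) auto
  then show ?case by simp
qed auto

text \<open>The staircase has degree \<open>m(m-1)/2\<close>, every operator lowers the degree by at
  most one, and fewer operators than that are applied unless the list is increasing.\<close>

lemma constant_term_X:
  assumes \<beta>: "mset \<beta> = mset [0..<m]"
  shows "look (X \<beta>) 0 = of_bool (\<beta> = [0..<m])"
proof (cases "\<beta> = [0..<m]")
  case True
  then show ?thesis by (simp add: X_upt)
next
  case False
  have len: "length \<beta> = m" using \<beta> by (metis length_upt minus_nat.diff_0 size_mset)
  let ?q = "rank (>) \<beta>"
  have q: "?q k <= m - Suc k" for k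
  proof -
    have "{j. k < j & j < length \<beta> & \<beta> ! j > \<beta> ! k} \<subseteq> {Suc k..<m}" using len by auto
    from card_mono[OF _ this] show ?thesis by (simp add: rank_def)
  qed
  have "\<exists>k<m. ?q k < m - Suc k"
  proof (rule ccontr)
    assume "\<not> ?thesis"
    then have eq: "?q k = m - Suc k" if "k < m" for k using that q[of k] by (meson le_antisym not_less)
    have "\<beta> ! k < \<beta> ! j" if "k < j" "j < m" for k j
    proof -
      let ?J = "{j. k < j & j < length \<beta> & \<beta> ! j > \<beta> ! k}"
      have "?J \<subseteq> {Suc k..<m}" using len by auto
      moreover have "card ?J = card {Suc k..<m}" using eq[of k] that by (simp add: rank_def)
      ultimately have "?J = {Suc k..<m}" by (intro card_subset_eq) auto
      moreover have "j \<in> {Suc k..<m}" using that by simp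
      ultimately have "j \<in> ?J" by (simp only:)
      then show ?thesis by simp
    qed
    then have "sorted \<beta>" using len by (auto simp: sorted_iff_nth_mono_less intro: less_imp_le)
    then show False using False mset_upt_sorted[OF \<beta>] by blast
  qed
  then have lt: "(\<Sum>k<m. ?q k) < (\<Sum>k<m. m - Suc k)" using q by (intro sum_strict_mono_ex1) auto
  have "sort \<beta> = [0..<m]" using \<beta> by (metis sorted_sort_id sorted_upt properties_for_sort mset_sort sorted_sort)
  then have st: "xpow (rev (sort \<beta>)) = mon (Poly_Mapping.nth (rev [0..<m]))" by (simp add: xpow_mon)
  have "0 \<notin> supp (X \<beta>)"
  proof
    assume "0 \<in> supp (X \<beta>)"
    then have "0 \<in> supp (fold E (rank_word (length \<beta>) ?q) (xpow (rev (sort \<beta>))))" by (subst (asm) X_rank_word)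
    moreover have "\<forall>\<eta>\<in>supp (xpow (rev (sort \<beta>))). (\<Sum>k<m. m - Suc k) <= (\<Sum>l<m. look \<eta> l)"
      unfolding st by (auto simp: mon_def look_nth rev_nth intro!: sum_mono)
    ultimately have "(\<Sum>k<m. m - Suc k) <= (\<Sum>l<m. look (0 :: mono) l) + length (rank_word (length \<beta>) ?q)"
      using rank_word_index(1)[of _ \<beta>] len by (intro degree_fold_E) auto
    then show False using lt by (simp add: length_rank_word len)
  qed
  then show ?thesis using False by (simp add: in_keys_iff)
qed

text \<open>The constant term takes the role of the weighted coefficient, since it already separates
  the identity from all other permutations.\<close>

definition dual :: "nat => nat list => cpoly => complex" where
  "dual n \<gamma> f = look (foldr F (rank_word n (%k. \<gamma> ! k)) f) 0"

lemma linfun_dual: "linfun (dual n \<gamma>)"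
  unfolding dual_def using linfun_comp[OF linfun_look linmap_foldr_F] by simp

text \<open>Code entries beyond \<open>\<gamma>\<close> are 0 and yield empty rounds, so the
  functional does not depend on the choice of \<open>m\<close>.\<close>

lemma rank_word_code:
  assumes "code_fits m \<gamma>"
  shows "rank_word m (rank (<) (code_list m \<gamma>)) = rank_word (length \<gamma>) (%k. \<gamma> ! k)"
proof -
  have "rank_word m (rank (<) (code_list m \<gamma>)) = rank_word m (nth_default 0 \<gamma>)"
    using code_list(2)[OF assms] by (rule rank_word_cong)
  also have "\<dots> = rank_word (length \<gamma>) (nth_default 0 \<gamma>)"
  proof -
    have "[0..<m] = [0..<length \<gamma>] @ [length \<gamma>..<m]"
      using assms by (metis code_fits_def le0 le_add_diff_inverse upt_add_eq_append)
    then show ?thesis by (auto simp: rank_word_def nth_default_def)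
  qed
  also have "\<dots> = rank_word (length \<gamma>) (%k. \<gamma> ! k)" by (rule rank_word_cong) (simp add: nth_default_def)
  finally show ?thesis .
qed

lemma dual_Y:
  assumes "length \<gamma> = n" "length \<beta> = n"
  shows "dual n \<gamma> (Y \<beta>) = of_bool (\<beta> = \<gamma>)"
proof -
  define m where "m = Suc (n + sum_list \<gamma> + sum_list \<beta>)"
  have fits: "code_fits m \<gamma>" "code_fits m \<beta>"
  proof -
    have "\<delta> ! k <= sum_list \<delta>" if "k < length \<delta>" for k and \<delta> :: "nat list"
      using that by (intro member_le_sum_list) auto
    then have "\<gamma> ! k + k < m" "\<beta> ! k + k < m" if "k < n" for k
      using that assms add_le_mono[of "\<gamma> ! k" "sum_list \<gamma>" k n] add_le_mono[of "\<beta> ! k" "sum_list \<beta>" k n]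
      by (fastforce simp: m_def)+
    then show "code_fits m \<gamma>" "code_fits m \<beta>" using assms by (auto simp: code_fits_def m_def)
  qed
  let ?g = "code_list m \<gamma>" and ?b = "code_list m \<beta>"
  let ?w = "rank_word m (rank (<) ?g)"
  have w: "chain (<) [0..<m] ?w" "fold swap_parts ?w [0..<m] = ?g"
    using chain_rank_less[of "[0..<m]" ?g] code_list[OF fits(1)] by auto
  have "(%f. look f 0) (foldr F ?w (X ?b)) = of_bool (?b = fold swap_parts ?w [0..<m])"
    using w(1) code_list(1)[OF fits(2)]
    by (intro dual_chain[where M = "mset [0..<m]"]) (auto simp: linfun_look constant_term_X simp del: mset_upt)
  then have "look (foldr F ?w (X ?b)) 0 = of_bool (?b = ?g)" unfolding w(2) .
  moreover have "?b = ?g \<longleftrightarrow> \<beta> = \<gamma>" using code_list_inj[OF fits(2,1)] assms by auto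
  ultimately show ?thesis
    using assms by (simp add: dual_def Y_code_list[OF fits(2)] rank_word_code[OF fits(1)])
qed

text \<open>The permutation has no descent past \<open>length \<alpha>\<close>, so the polynomial is
  symmetric in the variables from there up to index \<open>m - 1\<close>. The last of these is
  excluded by the staircase bound, hence all are.\<close>

lemma bounded_by_Y:
  assumes fits: "code_fits m \<alpha>"
  shows "bounded_by (%l. if l < length \<alpha> then m - Suc l else 0) (Y \<alpha>)"
proof -
  let ?b = "code_list m \<alpha>" and ?n = "length \<alpha>"
  note b = code_list[OF fits]
  have "sort ?b = [0..<m]" using b(1) by (metis properties_for_sort sorted_upt)
  then have "bounded_by (%l. m - Suc l) (xpow (rev (sort ?b)))"
    by (auto simp: bounded_by_def xpow_mon mon_def look_nth rev_nth)
  then have bd: "bounded_by (%l. m - Suc l) (X ?b)" by (rule bounded_by_X) auto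
  have sym: "swap_vars i (X ?b) = X ?b" if "?n <= i" "Suc i < m" for i
  proof -
    have "rank (<) ?b i = 0" using b(2)[of i] that by (simp add: nth_default_def)
    then have "{j. i < j & j < length ?b & ?b ! j < ?b ! i} = {}" by (simp add: rank_def)
    then have "\<not> ?b ! Suc i < ?b ! i" using that b(3) by auto
    moreover have "?b ! Suc i ~= ?b ! i" using b(3,4) that by (simp add: nth_eq_iff_index_eq)
    ultimately have "F i (X ?b) = 0" using that b(3) by (intro F_X_asc) auto
    \<comment> \<open>In this locale \<open>c\<close> is \<open>tau\<close>, so \<open>F\<close> is
      \<open>T\<close> itself.\<close>
    then have "T 0 t i (X ?b) = 0" by (simp add: F_def tau_def)
    then show ?thesis using T_eq_0_iff t by blast
  qed
  have zero: "look \<eta> l = 0" if "?n <= l" "\<eta> \<in> supp (X ?b)" for \<eta> l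
    using that
  proof (induction "m - l" arbitrary: l \<eta>)
    case 0
    have "look \<eta> l <= m - Suc l" using bd 0(3) unfolding bounded_by_def by blast
    then show ?case using 0(1) by simp
  next
    case (Suc k)
    show ?case
    proof (cases "Suc l < m")
      case False
      have "look \<eta> l <= m - Suc l" using bd Suc.prems(2) unfolding bounded_by_def by blast
      then show ?thesis using False by simp
    next
      case True
      have "swap_mono l \<eta> \<in> supp (X ?b)"
        using Suc.prems sym[OF Suc.prems(1) True] look_swap_vars[of l "X ?b" "swap_mono l \<eta>"] by (simp add: in_keys_iff)
      then have "look (swap_mono l \<eta>) (Suc l) = 0" using Suc.hyps(1)[of "Suc l"] Suc.hyps(2) Suc.prems(1) by simp
      then show ?thesis by (simp add: look_swap_mono)
    qed
  qed
  then show ?thesis using bd unfolding Y_code_list[OF fits] bounded_by_def by auto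
qed

lemma dual_family_Y: "dual_family n Y (dual n)"
proof
  fix \<alpha> assume \<alpha>: "\<alpha> \<in> comps n"
  define m where "m = Suc (n + sum_list \<alpha>)"
  let ?B = "%l. if l < n then m - Suc l else 0"
  let ?S = "{\<alpha> \<in> comps n. \<forall>l<n. \<alpha> ! l <= ?B l}"
  have "Y \<beta> \<in> cpoly.span (xpow ` ?S)" if "\<beta> \<in> ?S" for \<beta>
  proof (rule bounded_by_span)
    have "code_fits m \<beta>" using that by (auto simp: code_fits_def comps_def m_def)
    from bounded_by_Y[OF this] show "bounded_by ?B (Y \<beta>)" using that by (simp add: comps_def)
  qed simp
  moreover have "\<alpha> \<in> ?S"
  proof -
    have "\<alpha> ! l <= sum_list \<alpha>" if "l < n" for l using \<alpha> that by (intro member_le_sum_list) (auto simp: comps_def)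
    then show ?thesis using \<alpha> by (fastforce simp: m_def)
  qed
  ultimately show "\<exists>S. finite S & \<alpha> \<in> S & S \<subseteq> comps n & Y ` S \<subseteq> cpoly.span (xpow ` S)"
    by (intro exI[of _ ?S]) (auto simp: finite_box)
qed (auto simp: linfun_dual comps_def dual_Y)

end

section \<open>Bounded sequences with prescribed gaps\<close>

definition gap_seqs :: "nat => (nat => nat) => (nat => nat) => nat list set" where
  "gap_seqs k b g = {c. length c = k & (\<forall>j<k. c ! j <= b j) & (\<forall>j. Suc j < k --> c ! j + g j <= c ! Suc j)}"

definition tight :: "nat => (nat => nat) => (nat => nat) => nat list => bool" where
  "tight k b g m \<longleftrightarrow> m \<in> gap_seqs k b g \<and>
     (\<forall>j<k. m ! j = b j | (Suc j < k & m ! j + g j = m ! Suc j))"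

lemma finite_gap_seqs: "finite (gap_seqs k b g)"
proof (rule finite_subset)
  show "gap_seqs k b g \<subseteq> {c. set c \<subseteq> {..Max (b ` {..<k})} & length c = k}"
  proof (intro subsetI CollectI conjI)
    fix c x assume c: "c \<in> gap_seqs k b g" and "x \<in> set c"
    then obtain j where "j < k" "x = c ! j" by (auto simp: gap_seqs_def in_set_conv_nth)
    then have "x <= b j" "b j <= Max (b ` {..<k})" using c by (auto simp: gap_seqs_def)
    then show "x \<in> {..Max (b ` {..<k})}" by simp
  qed (simp add: gap_seqs_def)
qed (rule finite_lists_length_eq, simp)

text \<open>A sequence of largest sum is tight, because otherwise one of its entries could be raised
  alone.\<close>

lemma tight_exists:
  assumes "gap_seqs k b g ~= {}"
  obtains m where "tight k b g m"
proof -
  have "Max (sum_list ` gap_seqs k b g) \<in> sum_list ` gap_seqs k b g"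
    using assms finite_gap_seqs by (intro Max_in) auto
  then obtain m where m: "m \<in> gap_seqs k b g" "sum_list m = Max (sum_list ` gap_seqs k b g)" by force
  have "m ! j = b j | (Suc j < k & m ! j + g j = m ! Suc j)" if j: "j < k" for j
  proof (rule ccontr)
    assume n: "\<not> ?thesis"
    let ?c = "m[j := Suc (m ! j)]"
    have len: "length m = k" using m(1) by (simp add: gap_seqs_def)
    have 1: "m ! j < b j" "Suc j < k ==> m ! j + g j < m ! Suc j"
      using m(1) n j by (auto simp: gap_seqs_def le_less)
    have "?c \<in> gap_seqs k b g"
      using m(1) 1 j len by (auto simp: gap_seqs_def nth_list_update le_SucI)
    then have "sum_list ?c <= sum_list m" using m(2) finite_gap_seqs by auto
    moreover have "sum_list ?c = Suc (sum_list m)" using j len elem_le_sum_list[of j m]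
      by (simp add: sum_list_update)
    ultimately show False by simp
  qed
  then show ?thesis using that m(1) by (auto simp: tight_def)
qed

text \<open>From the right end inwards: each entry of \<open>m\<close> is either at its bound or
  pinned by its right neighbour.\<close>

lemma tight_max:
  assumes "tight k b g m" "c \<in> gap_seqs k b g" "j < k"
  shows "c ! j <= m ! j"
  using assms(3)
proof (induction "k - j" arbitrary: j rule: less_induct)
  case less
  consider "m ! j = b j" | "Suc j < k" "m ! j + g j = m ! Suc j" using assms(1) less.prems by (auto simp: tight_def)
  then show ?case
  proof cases
    case 1
    then show ?thesis using assms(2) less.prems by (simp add: gap_seqs_def)
  next
    case 2
    then have "c ! Suc j <= m ! Suc j" using less.hyps[of "Suc j"] by simp
    moreover have "c ! j + g j <= c ! Suc j" using assms(2) 2 by (simp add: gap_seqs_def)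
    ultimately show ?thesis using 2 by simp
  qed
qed

lemma tight_unique: "tight k b g m ==> tight k b g m' ==> m = m'"
  by (rule nth_equalityI) (auto simp: tight_def gap_seqs_def intro!: le_antisym tight_max[of k b g m] tight_max[of k b g m'])

text \<open>The bounds matter only through the maximal sequence; this is why a class of monomials
  with arbitrary bounds is a slide polynomial.\<close>

lemma tight_gap_seqs: "tight k b g m ==> gap_seqs k b g = gap_seqs k (%j. m ! j) g"
proof (intro set_eqI iffI)
  assume t: "tight k b g m"
  fix c assume "c \<in> gap_seqs k b g"
  then show "c \<in> gap_seqs k (%j. m ! j) g" using tight_max[OF t] by (auto simp: gap_seqs_def)
next
  assume t: "tight k b g m"
  fix c assume "c \<in> gap_seqs k (%j. m ! j) g"
  then show "c \<in> gap_seqs k b g" using t by (fastforce simp: tight_def gap_seqs_def intro: order_trans)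
qed

section \<open>Words of compositions\<close>

text \<open>The weakly increasing word in which each index is repeated as often as its part says,
  starting at index \<open>k\<close>. On words, dominance becomes an entrywise comparison and
  refinement a condition on strict ascents.\<close>

fun word :: "nat => nat list => nat list" where
  "word k [] = []"
| "word k (a # \<alpha>) = replicate a k @ word (Suc k) \<alpha>"

lemma length_word [simp]: "length (word k \<alpha>) = sum_list \<alpha>"
  by (induction \<alpha> arbitrary: k) auto

lemma set_word: "set (word k \<alpha>) \<subseteq> {k..<k + length \<alpha>}"
  by (induction \<alpha> arbitrary: k) fastforce+

lemma sorted_word: "sorted (word k \<alpha>)"
proof (induction \<alpha> arbitrary: k)
  case (Cons a \<alpha>)
  then show ?case using set_word[of "Suc k" \<alpha>] by (fastforce simp: sorted_append)
qed simp

lemma count_word: "count_list (word k \<alpha>) i = (if k <= i & i < k + length \<alpha> then \<alpha> ! (i - k) else 0)"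
proof (induction \<alpha> arbitrary: k)
  case (Cons a \<alpha>)
  have "count_list (replicate a k) i = (if i = k then a else 0)" by (induction a) auto
  then show ?case using Cons[of "Suc k"] by (auto simp: count_list_append nth_Cons' Suc_diff_le diff_Suc)
qed simp

lemma filter_word: "length (filter (%p. p < k + i) (word k \<alpha>)) = sum_list (take i \<alpha>)"
proof (induction \<alpha> arbitrary: k i)
  case (Cons a \<alpha>)
  show ?case
  proof (cases i)
    case 0
    have "filter (%p. p < k) (word (Suc k) \<alpha>) = []" using set_word[of "Suc k" \<alpha>] by (fastforce simp: filter_empty_conv)
    then show ?thesis using 0 by simp
  next
    case (Suc i')
    then show ?thesis using Cons[of "Suc k" i'] by simp
  qed
qed simp

definition composition :: "nat => nat list => nat list" where
  "composition n c = map (count_list c) [0..<n]"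

lemma composition_word: "length \<alpha> = n ==> composition n (word 0 \<alpha>) = \<alpha>"
  by (rule nth_equalityI) (auto simp: composition_def count_word)

lemma word_composition:
  assumes "sorted c" "set c \<subseteq> {..<n}"
  shows "word 0 (composition n c) = c"
proof -
  have "mset (word 0 (composition n c)) = mset c"
  proof (rule multiset_eqI)
    fix i
    have "count_list c i = 0" if "\<not> i < n" using that assms(2) by (auto simp: count_list_0_iff)
    then show "count (mset (word 0 (composition n c))) i = count (mset c) i"
      by (simp add: count_mset count_word composition_def)
  qed
  then show ?thesis using assms(1) sorted_word by (metis properties_for_sort)
qed

lemma sum_list_composition: "sorted c ==> set c \<subseteq> {..<n} ==> sum_list (composition n c) = length c"
  using word_composition length_word by metis

lemma word_inj: "length \<alpha> = length \<beta> ==> word 0 \<alpha> = word 0 \<beta> ==> \<alpha> = \<beta>"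
  using composition_word by metis

section \<open>Monomials of words\<close>

definition wmon :: "nat list => cpoly" where
  "wmon c = prod_mset (image_mset var (mset c))"

lemma wmon_append: "wmon (c @ d) = wmon c * wmon d"
  by (simp add: wmon_def)

lemma wmon_word: "wmon (word k \<alpha>) = (\<Prod>l<length \<alpha>. var (k + l) ^ (\<alpha> ! l))"
proof (induction \<alpha> arbitrary: k)
  case (Cons a \<alpha>)
  have "wmon (replicate a k) = var k ^ a" by (induction a) (auto simp: wmon_def)
  then show ?case using Cons[of "Suc k"] by (simp add: wmon_append prod.lessThan_Suc_shift del: prod.lessThan_Suc)
qed (simp add: wmon_def)

lemma wmon_word_xpow: "wmon (word 0 \<alpha>) = xpow \<alpha>"
  by (simp add: wmon_word xpow_prod)

lemma sorted_filter_less: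
  "sorted c ==> j < length c ==> j < length (filter (%p. p < i) c) \<longleftrightarrow> c ! j < (i :: nat)"
proof (induction c arbitrary: j)
  case (Cons x c)
  show ?case
  proof (cases "x < i")
    case True
    then show ?thesis using Cons by (cases j) auto
  next
    case False
    then have "\<forall>p\<in>set (x # c). \<not> p < i" using Cons.prems(1) by auto
    then have "filter (%p. p < i) (x # c) = []" "\<not> (x # c) ! j < i"
      using Cons.prems(2) nth_mem by (auto simp only: filter_empty_conv)
    then show ?thesis by simp
  qed
qed simp

text \<open>Partial sums count the letters below a threshold, and comparing these counts at all
  thresholds is the same as comparing two sorted words entry by entry, in the opposite
  direction.\<close>

lemma dominated_word:
  assumes "length \<beta> = length \<alpha>" "sum_list \<beta> = sum_list \<alpha>"
  shows "dominated \<beta> \<alpha> \<longleftrightarrow> (\<forall>j<sum_list \<alpha>. word 0 \<beta> ! j <= word 0 \<alpha> ! j)"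
proof
  let ?a = "word 0 \<alpha>" and ?c = "word 0 \<beta>"
  have f: "sum_list (take i \<delta>) = length (filter (%p. p < i) (word 0 \<delta>))" for i \<delta>
    using filter_word[of 0 i \<delta>] by simp
  {
    assume d: "dominated \<beta> \<alpha>"
    show "\<forall>j<sum_list \<alpha>. ?c ! j <= ?a ! j"
    proof (intro allI impI)
      fix j assume j: "j < sum_list \<alpha>"
      let ?i = "Suc (?a ! j)"
      have "?a ! j \<in> set ?a" using j by (intro nth_mem) simp
      then have "?a ! j < length \<alpha>" using set_word[of 0 \<alpha>] by auto
      then have "length (filter (%p. p < ?i) ?a) <= length (filter (%p. p < ?i) ?c)"
        using d unfolding dominated_def f by simp
      moreover have "j < length (filter (%p. p < ?i) ?a)" using sorted_filter_less[OF sorted_word, of j 0 \<alpha> ?i] j by simp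
      ultimately have "j < length (filter (%p. p < ?i) ?c)" by simp
      then show "?c ! j <= ?a ! j" using sorted_filter_less[OF sorted_word, of j 0 \<beta> ?i] j assms by simp
    qed
  next
    assume le: "\<forall>j<sum_list \<alpha>. ?c ! j <= ?a ! j"
    have "length (filter (%p. p < i) ?a) <= length (filter (%p. p < i) ?c)" for i
    proof (rule ccontr)
      assume neg: "\<not> length (filter (%p. p < i) ?a) <= length (filter (%p. p < i) ?c)"
      define j where "j = length (filter (%p. p < i) ?c)"
      have j: "j < length (filter (%p. p < i) ?a)" using neg by (simp add: j_def)
      then have "j < sum_list \<alpha>" using length_filter_le[of "%p. p < i" ?a] by simp
      then have "?a ! j < i" "?c ! j <= ?a ! j" using sorted_filter_less[OF sorted_word, of j 0 \<alpha> i] j le by auto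
      then have "j < length (filter (%p. p < i) ?c)"
        using sorted_filter_less[OF sorted_word, of j 0 \<beta> i] \<open>j < sum_list \<alpha>\<close> assms by simp
      then show False by (simp add: j_def)
    qed
    then show "dominated \<beta> \<alpha>" using assms unfolding dominated_def f by blast
  }
qed

section \<open>Partial sums and flattenings\<close>

definition psums :: "nat list => nat set" where
  "psums \<alpha> = {sum_list (take i \<alpha>) | i. i <= length \<alpha>}"

lemma psums_Nil [simp]: "psums [] = {0}"
  by (auto simp: psums_def)

lemma psums_Cons: "psums (a # \<alpha>) = insert 0 ((%x. a + x) ` psums \<alpha>)"
proof (intro set_eqI iffI)
  fix x assume "x \<in> psums (a # \<alpha>)"
  then obtain i where "i <= length (a # \<alpha>)" "x = sum_list (take i (a # \<alpha>))" by (auto simp: psums_def)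
  then show "x \<in> insert 0 ((%x. a + x) ` psums \<alpha>)" by (cases i) (auto simp: psums_def)
next
  fix x assume "x \<in> insert 0 ((%x. a + x) ` psums \<alpha>)"
  then consider "x = 0" | i where "i <= length \<alpha>" "x = a + sum_list (take i \<alpha>)" by (auto simp: psums_def)
  then show "x \<in> psums (a # \<alpha>)"
  proof cases
    case 1
    then show ?thesis unfolding psums_def by (intro CollectI exI[of _ 0]) simp
  next
    case 2
    then show ?thesis unfolding psums_def by (intro CollectI exI[of _ "Suc i"]) simp
  qed
qed

lemma zero_psums: "0 \<in> psums \<alpha>"
  by (cases \<alpha>) (auto simp: psums_Cons)

lemma psums_flat: "psums (flat \<alpha>) = psums \<alpha>"
proof (induction \<alpha>)
  case (Cons a \<alpha>)
  then show ?case using zero_psums[of \<alpha>] by (auto simp: flat_def psums_Cons insert_absorb)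
qed (simp add: flat_def)

lemma sum_list_flat: "sum_list (flat \<alpha>) = sum_list \<alpha>"
  by (induction \<alpha>) (auto simp: flat_def)

lemma psums_append: "(%x. sum_list b + x) ` psums \<gamma> \<subseteq> psums (b @ \<gamma>)"
proof (induction b)
  case (Cons a b)
  then have "(%x. a + (sum_list b + x)) ` psums \<gamma> \<subseteq> (%x. a + x) ` psums (b @ \<gamma>)" by blast
  then show ?case by (auto simp: psums_Cons add.assoc)
qed simp

text \<open>A list without zeros is determined by its set of partial sums, and adding consecutive
  parts just drops some of them.\<close>

lemma refines_iff_psums:
  assumes "0 \<notin> set \<gamma>" "0 \<notin> set \<delta>"
  shows "refines \<gamma> \<delta> \<longleftrightarrow> sum_list \<gamma> = sum_list \<delta> & psums \<delta> \<subseteq> psums \<gamma>"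
proof
  assume "refines \<gamma> \<delta>"
  then obtain bs where bs: "concat bs = \<gamma>" "map sum_list bs = \<delta>" by (auto simp: refines_def)
  have sum_concat: "sum_list (concat bs) = sum_list (map sum_list bs)" by (induction bs) auto
  have "psums (map sum_list bs) \<subseteq> psums (concat bs)"
  proof (induction bs)
    case (Cons b bs)
    then have "(%x. sum_list b + x) ` psums (map sum_list bs) \<subseteq> psums (b @ concat bs)"
      using psums_append[of b "concat bs"] by blast
    then show ?case using zero_psums by (simp add: psums_Cons)
  qed simp
  then show "sum_list \<gamma> = sum_list \<delta> & psums \<delta> \<subseteq> psums \<gamma>"
    using bs sum_concat by auto
next
  assume "sum_list \<gamma> = sum_list \<delta> & psums \<delta> \<subseteq> psums \<gamma>"
  then show "refines \<gamma> \<delta>" using assms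
  proof (induction \<delta> arbitrary: \<gamma>)
    case Nil
    then have "\<gamma> = []" by (cases \<gamma>) auto
    then show ?case by (auto simp: refines_def)
  next
    case (Cons d \<delta>)
    have "d \<in> psums (d # \<delta>)" using zero_psums[of \<delta>] by (auto simp: psums_Cons)
    then obtain k where k: "k <= length \<gamma>" "sum_list (take k \<gamma>) = d" using Cons.prems(1) by (auto simp: psums_def)
    let ?b = "take k \<gamma>" and ?\<gamma> = "drop k \<gamma>"
    have sum: "sum_list \<gamma> = d + sum_list ?\<gamma>" using k by (metis append_take_drop_id sum_list_append)
    have "x \<in> psums ?\<gamma>" if x: "x \<in> psums \<delta>" for x
    proof -
      have "d + x \<in> psums \<gamma>" using x Cons.prems(1) by (auto simp: psums_Cons)
      then obtain i where i: "i <= length \<gamma>" "d + x = sum_list (take i \<gamma>)" by (auto simp: psums_def)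
      show ?thesis
      proof (cases "k <= i")
        case True
        then have "take i \<gamma> = ?b @ take (i - k) ?\<gamma>" by (metis le_add_diff_inverse take_add)
        then have "x = sum_list (take (i - k) ?\<gamma>)" using i(2) k(2) by simp
        then show ?thesis unfolding psums_def using i(1) by (intro CollectI exI[of _ "i - k"]) auto
      next
        case False
        then have "take k \<gamma> = take i \<gamma> @ take (k - i) (drop i \<gamma>)" by (metis le_add_diff_inverse nat_le_linear take_add)
        then have "x = 0" using i(2) k(2) by (metis add_cancel_right_right add_is_0 add_left_imp_eq group_cancel.add1 sum_list_append)
        then show ?thesis using zero_psums by simp
      qed
    qed
    then have "refines ?\<gamma> \<delta>" using Cons.prems sum by (intro Cons.IH) (auto dest: in_set_dropD)
    then obtain bs where bs: "[] \<notin> set bs" "concat bs = ?\<gamma>" "map sum_list bs = \<delta>" by (auto simp: refines_def)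
    have "?b ~= []" using k(2) Cons.prems(3) by (metis list.set_intros(1) sum_list.Nil)
    then show ?case unfolding refines_def using bs k by (intro exI[of _ "?b # bs"]) auto
  qed
qed

lemma psums_inj: "0 \<notin> set \<gamma> ==> 0 \<notin> set \<delta> ==> psums \<gamma> = psums \<delta> ==> \<gamma> = \<delta>"
proof (induction \<gamma> arbitrary: \<delta>)
  case Nil
  then show ?case using zero_psums by (cases \<delta>) (auto simp: psums_Cons image_iff)
next
  case (Cons a \<gamma>)
  have a: "a \<in> psums \<delta>" using Cons.prems(3) zero_psums[of \<gamma>] by (auto simp: psums_Cons)
  then obtain b \<delta>' where \<delta>: "\<delta> = b # \<delta>'" using Cons.prems(1) by (cases \<delta>) auto
  have "b \<in> psums (a # \<gamma>)" using Cons.prems(3) zero_psums[of \<delta>'] by (auto simp: psums_Cons \<delta>)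
  then have ab: "a = b" using a Cons.prems(1,2) unfolding \<delta> by (auto simp: psums_Cons)
  have "psums \<gamma> = psums \<delta>'"
  proof -
    have "(%x. a + x) ` psums \<gamma> = psums (a # \<gamma>) - {0}" "(%x. a + x) ` psums \<delta>' = psums (a # \<delta>') - {0}"
      using Cons.prems(1) by (auto simp: psums_Cons)
    then have "(%x. a + x) ` psums \<gamma> = (%x. a + x) ` psums \<delta>'" using Cons.prems(3) \<delta> ab by simp
    then show ?thesis by (simp add: inj_image_eq_iff)
  qed
  then show ?case using Cons.IH[of \<delta>'] Cons.prems \<delta> ab by simp
qed

lemma flat_pos: "0 \<notin> set (flat \<alpha>)"
  by (simp add: flat_def)

lemma flat_eq_iff_psums: "flat \<alpha> = flat \<beta> \<longleftrightarrow> psums \<alpha> = psums \<beta>"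
  using psums_inj[OF flat_pos flat_pos, of \<alpha> \<beta>] psums_flat by metis

text \<open>A partial sum is a place where a run of equal letters ends.\<close>

lemma word_ascent_iff:
  assumes "Suc j < sum_list \<alpha>"
  shows "word 0 \<alpha> ! j < word 0 \<alpha> ! Suc j \<longleftrightarrow> Suc j \<in> psums \<alpha>"
proof -
  let ?a = "word 0 \<alpha>"
  have f: "sum_list (take i \<alpha>) = Suc j \<longleftrightarrow> ?a ! j < i & \<not> ?a ! Suc j < i" for i
    using filter_word[of 0 i \<alpha>] sorted_filter_less[OF sorted_word, of j 0 \<alpha> i] sorted_filter_less[OF sorted_word, of "Suc j" 0 \<alpha> i] assms
    by auto
  have "?a ! Suc j \<in> set ?a" using assms by (intro nth_mem) simp
  then have "?a ! Suc j < length \<alpha>" using set_word[of 0 \<alpha>] by auto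
  moreover have "Suc j \<in> psums \<alpha> \<longleftrightarrow> (\<exists>i\<le>length \<alpha>. ?a ! j < i & i <= ?a ! Suc j)"
    unfolding psums_def mem_Collect_eq not_less[symmetric] f[symmetric] by metis
  ultimately show ?thesis by (metis less_imp_le less_le_trans order_refl)
qed

lemma psums_subset_iff:
  assumes "sum_list \<beta> = sum_list \<alpha>"
  shows "psums \<alpha> \<subseteq> psums \<beta> \<longleftrightarrow>
    (\<forall>j. Suc j < sum_list \<alpha> --> word 0 \<alpha> ! j < word 0 \<alpha> ! Suc j --> word 0 \<beta> ! j < word 0 \<beta> ! Suc j)"
proof -
  have top: "sum_list \<delta> \<in> psums \<delta>" for \<delta> unfolding psums_def by (intro CollectI exI[of _ "length \<delta>"]) simp
  have le: "x <= sum_list \<alpha>" if "x \<in> psums \<alpha>" for x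
  proof -
    obtain i where "x = sum_list (take i \<alpha>)" using \<open>x \<in> psums \<alpha>\<close> by (auto simp: psums_def)
    then show ?thesis by (metis append_take_drop_id le_add1 sum_list_append)
  qed
  show ?thesis
  proof
    assume "psums \<alpha> \<subseteq> psums \<beta>"
    then show "\<forall>j. Suc j < sum_list \<alpha> --> word 0 \<alpha> ! j < word 0 \<alpha> ! Suc j --> word 0 \<beta> ! j < word 0 \<beta> ! Suc j"
      using assms by (auto simp: word_ascent_iff)
  next
    assume *: "\<forall>j. Suc j < sum_list \<alpha> --> word 0 \<alpha> ! j < word 0 \<alpha> ! Suc j --> word 0 \<beta> ! j < word 0 \<beta> ! Suc j"
    show "psums \<alpha> \<subseteq> psums \<beta>"
    proof
      fix x assume x: "x \<in> psums \<alpha>"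
      show "x \<in> psums \<beta>"
      proof (cases x)
        case 0
        then show ?thesis using zero_psums by simp
      next
        case (Suc j)
        show ?thesis
        proof (cases "x = sum_list \<alpha>")
          case True
          then show ?thesis using top[of \<beta>] assms by simp
        next
          case False
          then have "Suc j < sum_list \<alpha>" using le[OF x] Suc by simp
          then show ?thesis using * x Suc assms by (auto simp: word_ascent_iff)
        qed
      qed
    qed
  qed
qed

definition ascent :: "nat list => nat => nat" where
  "ascent a j = of_bool (a ! j < a ! Suc j)"

definition fund_set :: "nat list => nat list set" where
  "fund_set \<alpha> = {\<beta>. dominated \<beta> \<alpha> & refines (flat \<beta>) (flat \<alpha>)}"

lemma gap_seqs_sorted: "c \<in> gap_seqs k b g ==> sorted c"
  unfolding sorted_iff_nth_Suc gap_seqs_def by auto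

lemma bij_fund_set:
  "bij_betw (word 0) (fund_set \<alpha>) (gap_seqs (sum_list \<alpha>) (%j. word 0 \<alpha> ! j) (ascent (word 0 \<alpha>)))"
proof -
  let ?n = "length \<alpha>" and ?d = "sum_list \<alpha>" and ?a = "word 0 \<alpha>"
  have fund: "\<beta> \<in> fund_set \<alpha> \<longleftrightarrow> word 0 \<beta> \<in> gap_seqs ?d (%j. ?a ! j) (ascent ?a)"
    if "length \<beta> = ?n" "sum_list \<beta> = ?d" for \<beta>
  proof -
    have "\<beta> \<in> fund_set \<alpha> \<longleftrightarrow> (\<forall>j<?d. word 0 \<beta> ! j <= ?a ! j) \<and>
      (\<forall>j. Suc j < ?d --> ?a ! j < ?a ! Suc j --> word 0 \<beta> ! j < word 0 \<beta> ! Suc j)"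
      using that by (simp add: fund_set_def dominated_word refines_iff_psums flat_pos psums_flat sum_list_flat psums_subset_iff)
    also have "\<dots> \<longleftrightarrow> word 0 \<beta> \<in> gap_seqs ?d (%j. ?a ! j) (ascent ?a)"
    proof -
      have "word 0 \<beta> ! j <= word 0 \<beta> ! Suc j" if "Suc j < ?d" for j
        using sorted_nth_mono[OF sorted_word, of j "Suc j" 0 \<beta>] that \<open>sum_list \<beta> = ?d\<close> by simp
      then show ?thesis using that(2) by (auto simp: gap_seqs_def ascent_def)
    qed
    finally show ?thesis .
  qed
  have len: "length \<beta> = ?n & sum_list \<beta> = ?d" if "\<beta> \<in> fund_set \<alpha>" for \<beta>
    using that by (simp add: fund_set_def dominated_def)
  show ?thesis
  proof (rule bij_betwI[where g = "composition ?n"])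
    show "word 0 \<in> fund_set \<alpha> \<rightarrow> gap_seqs ?d (%j. ?a ! j) (ascent ?a)" using fund len by blast
    have c: "sorted c & set c \<subseteq> {..<?n} & length c = ?d" if c: "c \<in> gap_seqs ?d (%j. ?a ! j) (ascent ?a)" for c
    proof -
      have "c ! j < ?n" if "j < length c" for j
        using c that set_word[of 0 \<alpha>] nth_mem[of j ?a] by (fastforce simp: gap_seqs_def)
      then have "set c \<subseteq> {..<?n}" by (auto simp: in_set_conv_nth)
      then show ?thesis using gap_seqs_sorted[OF c] c by (simp add: gap_seqs_def)
    qed
    show "composition ?n \<in> gap_seqs ?d (%j. ?a ! j) (ascent ?a) \<rightarrow> fund_set \<alpha>"
    proof
      fix c assume "c \<in> gap_seqs ?d (%j. ?a ! j) (ascent ?a)"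
      with c[OF this] show "composition ?n c \<in> fund_set \<alpha>"
        using fund[of "composition ?n c"] by (simp add: word_composition sum_list_composition) (simp add: composition_def)
    qed
    show "composition ?n (word 0 \<beta>) = \<beta>" if "\<beta> \<in> fund_set \<alpha>" for \<beta> using len[OF that] by (simp add: composition_word)
    show "word 0 (composition ?n c) = c" if "c \<in> gap_seqs ?d (%j. ?a ! j) (ascent ?a)" for c
      using c[OF that] by (simp add: word_composition)
  qed
qed

lemma fundamental_slide_word:
  "fundamental_slide \<alpha> = (\<Sum>c\<in>gap_seqs (sum_list \<alpha>) (%j. word 0 \<alpha> ! j) (ascent (word 0 \<alpha>)). wmon c)"
  unfolding fundamental_slide_def fund_set_def[symmetric]
  using sum.reindex_bij_betw[OF bij_fund_set, of wmon \<alpha>] by (simp add: wmon_word_xpow)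

section \<open>Bases of slide polynomials\<close>

lemma independentI:
  assumes "\<And>A c. finite A ==> A \<subseteq> I ==> (\<Sum>a\<in>A. scale (c a) (B a)) = 0 ==> \<forall>a\<in>A. c a = 0"
  shows "inj_on B I" "cpoly.independent (B ` I)"
proof -
  show inj: "inj_on B I"
  proof (rule inj_onI, rule ccontr)
    fix x y assume xy: "x \<in> I" "y \<in> I" "B x = B y" "x ~= y"
    have "(\<Sum>a\<in>{x, y}. scale (if a = x then 1 else - 1) (B a)) = 0"
      using xy by (simp add: cpoly.scale_minus_left)
    from assms[OF _ _ this] xy show False by simp
  qed
  show "cpoly.independent (B ` I)"
    unfolding cpoly.dependent_explicit
  proof (intro notI, elim exE conjE bexE)
    fix t u v assume t: "finite t" "t \<subseteq> B ` I" "(\<Sum>v\<in>t. scale (u v) v) = 0" "v \<in> t" "u v ~= 0"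
    then obtain A where A: "A \<subseteq> I" "finite A" "t = B ` A" by (meson finite_subset_image)
    have "(\<Sum>a\<in>A. scale (u (B a)) (B a)) = 0"
      using t(3) inj_on_subset[OF inj A(1)] by (simp add: A(3) sum.reindex)
    from assms[OF A(2,1) this] t(4,5) A(3) show False by auto
  qed
qed

text \<open>Independence: among the members with nonzero coefficient, one of largest weight has a
  monomial that occurs in no other of them. Spanning: induction on the weight.\<close>

lemma poly_basis_triangular:
  fixes wt :: "nat list => nat"
  assumes B: "\<And>\<alpha>. \<alpha> \<in> comps n ==> B \<alpha> = (\<Sum>\<beta>\<in>G \<alpha>. xpow \<beta>)"
    and G: "\<And>\<alpha>. \<alpha> \<in> comps n ==> finite (G \<alpha>) & \<alpha> \<in> G \<alpha> & G \<alpha> \<subseteq> comps n"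
    and wt: "\<And>\<alpha> \<beta>. \<alpha> \<in> comps n ==> \<beta> \<in> G \<alpha> ==> \<beta> ~= \<alpha> ==> wt \<beta> < wt \<alpha>"
  shows "poly_basis n B"
proof -
  have "\<forall>\<alpha>\<in>A. c \<alpha> = 0" if A: "finite A" "A \<subseteq> comps n" "(\<Sum>\<alpha>\<in>A. scale (c \<alpha>) (B \<alpha>)) = 0" for A c
  proof (rule ccontr)
    define N where "N = {\<alpha>\<in>A. c \<alpha> ~= 0}"
    assume "\<not> ?thesis"
    then have "N ~= {}" "finite N" using A(1) by (auto simp: N_def)
    then have "Max (wt ` N) \<in> wt ` N" by (intro Max_in) auto
    then obtain \<mu> where \<mu>: "\<mu> \<in> N" "wt \<mu> = Max (wt ` N)" by force
    have max: "wt \<alpha> <= wt \<mu>" if "\<alpha> \<in> N" for \<alpha> using that \<open>finite N\<close> \<mu>(2) by simp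
    have n: "\<mu> \<in> comps n" using \<mu>(1) A(2) by (auto simp: N_def)
    have coeff: "c \<alpha> * look (B \<alpha>) (Poly_Mapping.nth \<mu>) = (if \<alpha> = \<mu> then c \<mu> else 0)" if \<alpha>: "\<alpha> \<in> A" for \<alpha>
    proof (cases "c \<alpha> = 0")
      case False
      then have "\<alpha> \<in> N" "\<alpha> \<in> comps n" using \<alpha> A(2) by (auto simp: N_def)
      have "look (xpow \<beta>) (Poly_Mapping.nth \<mu>) = of_bool (\<beta> = \<mu>)" if "\<beta> \<in> comps n" for \<beta>
        using inj_onD[OF inj_xpow, of \<beta> \<mu> n] that n by (auto simp: xpow_mon look_mon)
      then have "look (B \<alpha>) (Poly_Mapping.nth \<mu>) = (\<Sum>\<beta>\<in>G \<alpha>. of_bool (\<beta> = \<mu>))"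
        unfolding B[OF \<open>\<alpha> \<in> comps n\<close>] lookup_sum using G[OF \<open>\<alpha> \<in> comps n\<close>] by (intro sum.cong) auto
      also have "\<dots> = of_bool (\<mu> \<in> G \<alpha>)"
      proof -
        have "G \<alpha> \<inter> {\<beta>. \<beta> = \<mu>} = (if \<mu> \<in> G \<alpha> then {\<mu>} else {})" by auto
        then show ?thesis using G[OF \<open>\<alpha> \<in> comps n\<close>] by (simp add: sum.If_cases of_bool_def)
      qed
      also have "\<mu> \<in> G \<alpha> \<longleftrightarrow> \<alpha> = \<mu>"
        using wt[OF \<open>\<alpha> \<in> comps n\<close>, of \<mu>] max[OF \<open>\<alpha> \<in> N\<close>] G[OF \<open>\<alpha> \<in> comps n\<close>] by fastforce
      finally show ?thesis by simp
    qed (use \<mu> in \<open>auto simp: N_def\<close>)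
    have "0 = look (\<Sum>\<alpha>\<in>A. scale (c \<alpha>) (B \<alpha>)) (Poly_Mapping.nth \<mu>)" using A(3) by simp
    also have "\<dots> = (\<Sum>\<alpha>\<in>A. if \<alpha> = \<mu> then c \<mu> else 0)"
      unfolding lookup_sum look_scale using coeff by (intro sum.cong) auto
    also have "\<dots> = c \<mu>" using A(1) \<mu>(1) by (simp add: N_def)
    finally show False using \<mu>(1) by (simp add: N_def)
  qed
  note ind = independentI[OF this]
  have "xpow \<alpha> \<in> cpoly.span (B ` comps n)" if "\<alpha> \<in> comps n" for \<alpha>
    using that
  proof (induction "wt \<alpha>" arbitrary: \<alpha> rule: less_induct)
    case less
    note g = G[OF less.prems]
    have "B \<alpha> = xpow \<alpha> + (\<Sum>\<beta>\<in>G \<alpha> - {\<alpha>}. xpow \<beta>)"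
      unfolding B[OF less.prems] using g by (intro sum.remove) auto
    moreover have "(\<Sum>\<beta>\<in>G \<alpha> - {\<alpha>}. xpow \<beta>) \<in> cpoly.span (B ` comps n)"
    proof (rule cpoly.span_sum)
      fix \<beta> assume "\<beta> \<in> G \<alpha> - {\<alpha>}"
      then show "xpow \<beta> \<in> cpoly.span (B ` comps n)" using less.hyps[of \<beta>] wt[OF less.prems, of \<beta>] g by blast
    qed
    moreover have "B \<alpha> \<in> cpoly.span (B ` comps n)" using less.prems by (intro cpoly.span_base) blast
    ultimately show ?case by (metis add_diff_cancel_right' cpoly.span_diff)
  qed
  moreover have "B \<alpha> \<in> cpoly.span (xpow ` comps n)" if "\<alpha> \<in> comps n" for \<alpha>
    unfolding B[OF that] using G[OF that] by (intro cpoly.span_sum cpoly.span_base) blast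
  ultimately have "xpow ` comps n \<subseteq> cpoly.span (B ` comps n)" "B ` comps n \<subseteq> cpoly.span (xpow ` comps n)" by auto
  then have "cpoly.span (B ` comps n) = polys n"
    unfolding polys_eq_span by (meson cpoly.span_minimal cpoly.subspace_span subset_antisym)
  then show ?thesis using ind by (simp add: poly_basis_def)
qed

lemma structure_const_sum:
  assumes b: "poly_basis n B" and \<alpha>: "length \<alpha> = n" and I: "finite I" "g ` I \<subseteq> comps n"
    and prod: "B \<alpha> * B \<beta> = (\<Sum>i\<in>I. B (g i))" and \<gamma>: "\<gamma> \<in> comps n"
  shows "structure_const B \<alpha> \<beta> \<gamma> = of_nat (card {i \<in> I. g i = \<gamma>})"
proof -
  let ?V = "B ` comps n"
  have ind: "cpoly.independent ?V" and inj: "inj_on B (comps n)" using b by (auto simp: poly_basis_def)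
  have "cpoly.representation ?V (\<Sum>i\<in>I. B (g i)) (B \<gamma>) = (\<Sum>i\<in>I. cpoly.representation ?V (B (g i)) (B \<gamma>))"
    using I(2) by (subst cpoly.representation_sum[OF ind]) (auto intro: cpoly.span_base)
  also have "\<dots> = (\<Sum>i\<in>I. if g i = \<gamma> then 1 else 0)"
  proof (rule sum.cong[OF refl])
    fix i assume "i \<in> I"
    then have "g i \<in> comps n" using I(2) by blast
    then show "cpoly.representation ?V (B (g i)) (B \<gamma>) = (if g i = \<gamma> then 1 else 0)"
      using cpoly.representation_basis[OF ind, of "B (g i)"] inj \<gamma> by (auto simp: inj_on_eq_iff)
  qed
  also have "\<dots> = of_nat (card {i \<in> I. g i = \<gamma>})"
    using I(1) by (simp add: sum.If_cases Int_def)
  finally show ?thesis by (simp add: structure_const_def prod \<alpha>)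
qed

definition mono_set :: "nat list => nat list set" where
  "mono_set \<alpha> = {\<beta>. dominated \<beta> \<alpha> & flat \<beta> = flat \<alpha>}"

lemma dominated_refl: "dominated \<alpha> \<alpha>"
  by (simp add: dominated_def)

lemma finite_dominated: "finite {\<beta>. dominated \<beta> \<alpha>}"
proof (rule finite_subset)
  show "{\<beta>. dominated \<beta> \<alpha>} \<subseteq> {\<beta>. set \<beta> \<subseteq> {..sum_list \<alpha>} & length \<beta> = length \<alpha>}"
    using member_le_sum_list by (fastforce simp: dominated_def)
qed (rule finite_lists_length_eq, simp)

lemma dominated_weight:
  assumes "dominated \<beta> \<alpha>" "\<beta> ~= \<alpha>"
  shows "sum_list (word 0 \<beta>) < sum_list (word 0 \<alpha>)"
proof -
  have len: "length \<beta> = length \<alpha>" "sum_list \<beta> = sum_list \<alpha>" using assms(1) by (auto simp: dominated_def)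
  have le: "\<forall>j<sum_list \<alpha>. word 0 \<beta> ! j <= word 0 \<alpha> ! j" using assms(1) dominated_word[OF len] by simp
  have "word 0 \<beta> ~= word 0 \<alpha>" using word_inj len assms(2) by blast
  then have "\<exists>j<sum_list \<alpha>. word 0 \<beta> ! j ~= word 0 \<alpha> ! j" using len by (auto simp: list_eq_iff_nth_eq)
  then have ex: "\<exists>j\<in>{0..<sum_list \<alpha>}. word 0 \<beta> ! j < word 0 \<alpha> ! j" using le by (force simp: le_less)
  have S: "sum_list (word 0 \<delta>) = (\<Sum>j\<in>{0..<sum_list \<delta>}. word 0 \<delta> ! j)" for \<delta>
    using sum_list_sum_nth[of "word 0 \<delta>"] by simp
  show ?thesis unfolding S len(2) using le ex by (intro sum_strict_mono_ex1) auto
qed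

lemma refines_refl: "0 \<notin> set \<gamma> ==> refines \<gamma> \<gamma>"
  by (simp add: refines_iff_psums)

lemma slide_sets:
  assumes "\<alpha> \<in> comps n"
  shows "finite (fund_set \<alpha>) & \<alpha> \<in> fund_set \<alpha> & fund_set \<alpha> \<subseteq> comps n"
    "finite (mono_set \<alpha>) & \<alpha> \<in> mono_set \<alpha> & mono_set \<alpha> \<subseteq> comps n"
  using finite_dominated[of \<alpha>] assms
  by (auto simp: fund_set_def mono_set_def dominated_refl refines_refl flat_pos comps_def dominated_def
      intro: rev_finite_subset[OF finite_dominated[of \<alpha>]])

lemma poly_basis_fundamental_slide: "poly_basis n fundamental_slide"
  by (rule poly_basis_triangular[where G = fund_set and wt = "%\<alpha>. sum_list (word 0 \<alpha>)"])
    (use slide_sets(1) dominated_weight in \<open>auto simp: fund_set_def fundamental_slide_def\<close>)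

lemma poly_basis_monomial_slide: "poly_basis n monomial_slide"
  by (rule poly_basis_triangular[where G = mono_set and wt = "%\<alpha>. sum_list (word 0 \<alpha>)"])
    (use slide_sets(2) dominated_weight in \<open>auto simp: mono_set_def monomial_slide_def\<close>)

section \<open>Products of fundamental slide polynomials\<close>

text \<open>
  A term of the product is a list of pairs \<open>(p, l)\<close>: the variable \<open>p\<close> was chosen for a letter
  with label \<open>l\<close>. Letters of the first factor get even labels and those of the second factor odd
  labels; listing the pairs by increasing \<open>p\<close> and, for equal \<open>p\<close>, by decreasing label turns pairs
  of terms into bounded sequences with gaps prescribed by a shuffle of the labels.
\<close>

definition letter_key :: "nat => nat \<times> nat => nat" where
  "letter_key K z = fst z * Suc K + (K - snd z)"

lemma letter_key_le:
  assumes "snd z <= K" "snd z' <= K"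
  shows "letter_key K z <= letter_key K z' \<longleftrightarrow> fst z < fst z' | (fst z = fst z' & snd z' <= snd z)"
proof -
  have less: "p * Suc K + (K - l) < p' * Suc K + (K - l')" if "p < p'" for p p' l l'
  proof -
    have "Suc p * Suc K <= p' * Suc K" using that by (intro mult_right_mono) auto
    then show ?thesis by simp
  qed
  consider "fst z < fst z'" | "fst z = fst z'" | "fst z' < fst z" by linarith
  then show ?thesis
  proof cases
    case 1
    then show ?thesis using less[of "fst z" "fst z'" "snd z" "snd z'"] by (simp add: letter_key_def)
  next
    case 2
    then show ?thesis using assms by (auto simp: letter_key_def)
  next
    case 3
    then show ?thesis using less[of "fst z'" "fst z" "snd z'" "snd z"] by (simp add: letter_key_def)
  qed
qed

text \<open>The labels \<open>2 i\<close> and \<open>2 i + 1\<close> both stand for a letter with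
  bound \<open>i\<close>, which \<open>div 2\<close> recovers.\<close>

definition placed :: "nat => (nat \<times> nat) list set" where
  "placed K = {Z. sorted (map (letter_key K) Z) & (\<forall>z\<in>set Z. snd z <= K & fst z <= snd z div 2)}"

definition label_seqs :: "nat list => nat list set" where
  "label_seqs C = gap_seqs (length C) (%j. C ! j div 2) (ascent C)"

text \<open>In the order of \<open>letter_key\<close> the labels decrease weakly along equal
  variables, so the variable has to grow strictly precisely at the ascents of the label
  word.\<close>

lemma placed_iff:
  assumes "set C \<subseteq> {..K}" "length m = length C"
  shows "zip m C \<in> placed K \<longleftrightarrow> m \<in> label_seqs C"
proof -
  have C: "C ! j <= K" if "j < length C" for j using assms(1) nth_mem[OF that] by auto
  have "letter_key K (zip m C ! j) <= letter_key K (zip m C ! Suc j) \<longleftrightarrow> m ! j + ascent C j <= m ! Suc j"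
    if "Suc j < length C" for j
  proof -
    have "snd (zip m C ! j) <= K" "snd (zip m C ! Suc j) <= K" using C[of j] C[of "Suc j"] that assms(2) by auto
    note le = letter_key_le[OF this]
    have n: "zip m C ! j = (m ! j, C ! j)" "zip m C ! Suc j = (m ! Suc j, C ! Suc j)" using that assms(2) by auto
    show ?thesis using le unfolding n ascent_def by auto
  qed
  then have "sorted (map (letter_key K) (zip m C)) \<longleftrightarrow> (\<forall>j. Suc j < length C --> m ! j + ascent C j <= m ! Suc j)"
    unfolding sorted_iff_nth_Suc using assms(2) by auto
  moreover have "(\<forall>z\<in>set (zip m C). snd z <= K & fst z <= snd z div 2) \<longleftrightarrow> (\<forall>j<length C. m ! j <= C ! j div 2)"
    using assms(2) C by (auto simp: set_zip)
  ultimately show ?thesis using assms(2) by (auto simp: placed_def label_seqs_def gap_seqs_def)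
qed

lemma bij_placed:
  assumes "set C \<subseteq> {..K}"
  shows "bij_betw (map fst) {Z \<in> placed K. map snd Z = C} (label_seqs C)"
proof (rule bij_betwI[where g = "%m. zip m C"])
  show "map fst \<in> {Z \<in> placed K. map snd Z = C} \<rightarrow> label_seqs C"
  proof
    fix Z assume Z: "Z \<in> {Z \<in> placed K. map snd Z = C}"
    then have "zip (map fst Z) C = Z" using zip_map_fst_snd[of Z] by simp
    then show "map fst Z \<in> label_seqs C" using placed_iff[OF assms, of "map fst Z"] Z by auto
  qed
  show "(%m. zip m C) \<in> label_seqs C \<rightarrow> {Z \<in> placed K. map snd Z = C}"
    using placed_iff[OF assms] by (auto simp: label_seqs_def gap_seqs_def)
  show "zip (map fst Z) C = Z" if "Z \<in> {Z \<in> placed K. map snd Z = C}" for Z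
    using zip_map_fst_snd[of Z] that by auto
  show "map fst (zip m C) = m" if "m \<in> label_seqs C" for m
    using that by (simp add: label_seqs_def gap_seqs_def)
qed

definition label_shuffles :: "nat list => nat list => nat list set" where
  "label_shuffles a b = {C. filter even C = map (%i. 2 * i) a & filter odd C = map (%i. Suc (2 * i)) b}"

lemma length_label_shuffles: "C \<in> label_shuffles a b ==> length C = length a + length b"
  using sum_length_filter_compl[of even C] by (simp add: label_shuffles_def)

lemma set_label_shuffles: "C \<in> label_shuffles a b ==> set C \<subseteq> (%i. 2 * i) ` set a \<union> (%i. Suc (2 * i)) ` set b"
proof
  fix x assume C: "C \<in> label_shuffles a b" and x: "x \<in> set C"
  show "x \<in> (%i. 2 * i) ` set a \<union> (%i. Suc (2 * i)) ` set b"
  proof (cases "even x")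
    case True
    then have "x \<in> set (filter even C)" using x by simp
    moreover have "filter even C = map (%i. 2 * i) a" using C by (simp add: label_shuffles_def)
    ultimately have "x \<in> set (map (%i. 2 * i) a)" by (simp only:)
    then show ?thesis by auto
  next
    case False
    then have "x \<in> set (filter odd C)" using x by simp
    moreover have "filter odd C = map (%i. Suc (2 * i)) b" using C by (simp add: label_shuffles_def)
    ultimately have "x \<in> set (map (%i. Suc (2 * i)) b)" by (simp only:)
    then show ?thesis by auto
  qed
qed

lemma finite_label_shuffles: "finite (label_shuffles a b)"
proof (rule finite_subset)
  show "label_shuffles a b \<subseteq> {C. set C \<subseteq> (%i. 2 * i) ` set a \<union> (%i. Suc (2 * i)) ` set b & length C = length a + length b}"
    using length_label_shuffles set_label_shuffles by blast
qed (rule finite_lists_length_eq, simp)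

lemma wmon_filter: "wmon (map fst (filter P Z)) * wmon (map fst (filter (%z. \<not> P z) Z)) = wmon (map fst Z)"
  by (induction Z) (auto simp: wmon_def ac_simps)

lemma placed_filter: "Z \<in> placed K ==> filter P Z \<in> placed K"
  by (auto simp: placed_def sorted_filter)

lemma inj_letter_key: "inj_on (letter_key K) {z. snd z <= K}"
proof (rule inj_onI)
  fix z z' assume "z \<in> {z. snd z <= K}" "z' \<in> {z. snd z <= K}" "letter_key K z = letter_key K z'"
  then show "z = z'" using letter_key_le[of z K z'] letter_key_le[of z' K z] by (auto simp: prod_eq_iff)
qed

text \<open>Splitting by the parity of labels and merging by \<open>letter_key\<close> are inverse
  to each other, because sorting by an injective key determines a list. Grouping the merged lists by
  their label word gives the right-hand side.\<close>

lemma sum_label_seqs_mult: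
  "(\<Sum>c\<in>label_seqs (map (%i. 2 * i) a). wmon c) * (\<Sum>d\<in>label_seqs (map (%i. Suc (2 * i)) b). wmon d) =
   (\<Sum>C\<in>label_shuffles a b. \<Sum>m\<in>label_seqs C. wmon m)"
proof -
  let ?A = "map (%i. 2 * i) a" and ?B = "map (%i. Suc (2 * i)) b"
  define K where "K = Max (insert 0 (set ?A \<union> set ?B))"
  have K: "set ?A \<subseteq> {..K}" "set ?B \<subseteq> {..K}" unfolding K_def by auto
  have KC: "set C \<subseteq> {..K}" if "C \<in> label_shuffles a b" for C
    using set_label_shuffles[OF that] K by fastforce
  let ?P = "%C. {Z \<in> placed K. map snd Z = C}"
  have fin: "finite (?P C)" if "set C \<subseteq> {..K}" for C
    using bij_betw_finite[OF bij_placed[OF that]] finite_gap_seqs by (simp add: label_seqs_def)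
  let ?S = "{Z \<in> placed K. map snd Z \<in> label_shuffles a b}"
  let ?e = "%z :: nat \<times> nat. even (snd z)"
  have ev: "map snd (filter ?e Z) = filter even (map snd Z)" "map snd (filter (%z. \<not> ?e z) Z) = filter odd (map snd Z)" for Z
    by (simp_all add: filter_map comp_def)
  have bij: "bij_betw (%Z. (filter ?e Z, filter (%z. \<not> ?e z) Z)) ?S (?P ?A \<times> ?P ?B)"
  proof (rule bij_betwI[where g = "%(X, Y). sort_key (letter_key K) (X @ Y)"])
    show "(%Z. (filter ?e Z, filter (%z. \<not> ?e z) Z)) \<in> ?S \<rightarrow> ?P ?A \<times> ?P ?B"
      using ev placed_filter by (auto simp: label_shuffles_def)
    have inv: "filter ?e (sort_key (letter_key K) (X @ Y)) = X & filter (%z. \<not> ?e z) (sort_key (letter_key K) (X @ Y)) = Y"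
      if X: "X \<in> ?P ?A" and Y: "Y \<in> ?P ?B" for X Y
    proof -
      have "set (map snd X) \<subseteq> Collect even" "set (map snd Y) \<subseteq> Collect odd" using X Y by auto
      then have "filter ?e X = X" "filter ?e Y = []" "filter (%z. \<not> ?e z) X = []" "filter (%z. \<not> ?e z) Y = Y"
        by (auto simp: filter_empty_conv filter_id_conv)
      moreover have "sort_key (letter_key K) X = X" "sort_key (letter_key K) Y = Y"
        using X Y by (auto simp: placed_def intro: sort_key_id_if_sorted)
      ultimately show ?thesis by (simp add: filter_sort)
    qed
    show "(%(X, Y). sort_key (letter_key K) (X @ Y)) \<in> ?P ?A \<times> ?P ?B \<rightarrow> ?S"
    proof
      fix XY assume "XY \<in> ?P ?A \<times> ?P ?B"
      then obtain X Y where XY: "XY = (X, Y)" "X \<in> ?P ?A" "Y \<in> ?P ?B" by blast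
      let ?Z = "sort_key (letter_key K) (X @ Y)"
      have "?Z \<in> placed K" using XY(2,3) by (auto simp: placed_def)
      moreover have "map snd ?Z \<in> label_shuffles a b"
        unfolding label_shuffles_def ev[symmetric] mem_Collect_eq using inv[OF XY(2,3)] XY(2,3) by simp
      ultimately show "(case XY of (X, Y) => sort_key (letter_key K) (X @ Y)) \<in> ?S" by (simp add: XY(1))
    qed
    show "(case (filter ?e Z, filter (%z. \<not> ?e z) Z) of (X, Y) => sort_key (letter_key K) (X @ Y)) = Z" if Z: "Z \<in> ?S" for Z
    proof -
      have "sort_key (letter_key K) (filter ?e Z @ filter (%z. \<not> ?e z) Z) = Z"
      proof (rule sort_key_inj_key_eq)
        show "mset (filter ?e Z @ filter (%z. \<not> ?e z) Z) = mset Z" by simp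
        show "inj_on (letter_key K) (set (filter ?e Z @ filter (%z. \<not> ?e z) Z))"
          using Z by (intro inj_on_subset[OF inj_letter_key]) (auto simp: placed_def)
        show "sorted (map (letter_key K) Z)" using Z by (simp add: placed_def)
      qed
      then show ?thesis by simp
    qed
    show "(filter ?e (case XY of (X, Y) => sort_key (letter_key K) (X @ Y)),
        filter (%z. \<not> ?e z) (case XY of (X, Y) => sort_key (letter_key K) (X @ Y))) = XY"
      if XY: "XY \<in> ?P ?A \<times> ?P ?B" for XY
    proof (cases XY)
      case (Pair X Y)
      then show ?thesis using inv[of X Y] XY by simp
    qed
  qed
  have seqs: "(\<Sum>m\<in>label_seqs C. wmon m) = (\<Sum>Z\<in>?P C. wmon (map fst Z))" if "set C \<subseteq> {..K}" for C
    using sum.reindex_bij_betw[OF bij_placed[OF that], of wmon] by simp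
  have "(\<Sum>c\<in>label_seqs ?A. wmon c) * (\<Sum>d\<in>label_seqs ?B. wmon d) =
      (\<Sum>(X, Y)\<in>?P ?A \<times> ?P ?B. wmon (map fst X) * wmon (map fst Y))"
    unfolding seqs[OF K(1)] seqs[OF K(2)] sum_product sum.cartesian_product ..
  also have "\<dots> = (\<Sum>Z\<in>?S. wmon (map fst Z))"
    using sum.reindex_bij_betw[OF bij, of "%(X, Y). wmon (map fst X) * wmon (map fst Y)"]
    by (simp add: wmon_filter)
  also have "\<dots> = (\<Sum>C\<in>label_shuffles a b. \<Sum>Z\<in>{Z \<in> ?S. map snd Z = C}. wmon (map fst Z))"
  proof (rule sum.group[symmetric])
    have "?S \<subseteq> (\<Union>C\<in>label_shuffles a b. ?P C)" by auto
    then show "finite ?S" by (rule finite_subset) (use fin KC finite_label_shuffles in auto)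
  qed (auto simp: finite_label_shuffles)
  also have "\<dots> = (\<Sum>C\<in>label_shuffles a b. \<Sum>m\<in>label_seqs C. wmon m)"
  proof (rule sum.cong[OF refl])
    fix C assume C: "C \<in> label_shuffles a b"
    then have "{Z \<in> ?S. map snd Z = C} = ?P C" by auto
    then show "(\<Sum>Z\<in>{Z \<in> ?S. map snd Z = C}. wmon (map fst Z)) = (\<Sum>m\<in>label_seqs C. wmon m)"
      using seqs[OF KC[OF C]] by simp
  qed
  finally show ?thesis .
qed

lemma gap_seqs_cong:
  assumes "\<And>j. j < k ==> b j = b' j" "\<And>j. Suc j < k ==> g j = g' j"
  shows "gap_seqs k b g = gap_seqs k b' g'"
  using assms by (auto simp: gap_seqs_def)

lemma fundamental_slide_label_seqs:
  "fundamental_slide \<alpha> = (\<Sum>c\<in>label_seqs (map (%i. 2 * i) (word 0 \<alpha>)). wmon c)"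
  "fundamental_slide \<alpha> = (\<Sum>c\<in>label_seqs (map (%i. Suc (2 * i)) (word 0 \<alpha>)). wmon c)"
proof -
  have "label_seqs (map (%i. 2 * i) (word 0 \<alpha>)) = gap_seqs (sum_list \<alpha>) (%j. word 0 \<alpha> ! j) (ascent (word 0 \<alpha>))"
    unfolding label_seqs_def length_map length_word by (rule gap_seqs_cong) (auto simp: ascent_def)
  moreover have "label_seqs (map (%i. Suc (2 * i)) (word 0 \<alpha>)) = gap_seqs (sum_list \<alpha>) (%j. word 0 \<alpha> ! j) (ascent (word 0 \<alpha>))"
    unfolding label_seqs_def length_map length_word by (rule gap_seqs_cong) (auto simp: ascent_def)
  ultimately show "fundamental_slide \<alpha> = (\<Sum>c\<in>label_seqs (map (%i. 2 * i) (word 0 \<alpha>)). wmon c)"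
    "fundamental_slide \<alpha> = (\<Sum>c\<in>label_seqs (map (%i. Suc (2 * i)) (word 0 \<alpha>)). wmon c)"
    by (simp_all add: fundamental_slide_word)
qed

definition label_tight :: "nat list => nat list => bool" where
  "label_tight C m \<longleftrightarrow> tight (length C) (%j. C ! j div 2) (ascent C) m"

lemma label_tight_slide:
  assumes t: "label_tight C m" and C: "\<forall>x\<in>set C. x div 2 < n"
  shows "(\<Sum>c\<in>label_seqs C. wmon c) = fundamental_slide (composition n m)" "word 0 (composition n m) = m"
proof -
  have m: "m \<in> gap_seqs (length C) (%j. C ! j div 2) (ascent C)"
    and t': "\<And>j. j < length C ==> m ! j = C ! j div 2 | (Suc j < length C & m ! j + ascent C j = m ! Suc j)"
    using t by (auto simp: label_tight_def tight_def)
  have len: "length m = length C" using m by (simp add: gap_seqs_def)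
  have "m ! j < n" if "j < length m" for j
    using m C nth_mem[of j C] that len by (fastforce simp: gap_seqs_def)
  then have "set m \<subseteq> {..<n}" by (auto simp: in_set_conv_nth)
  then show wm: "word 0 (composition n m) = m" using word_composition gap_seqs_sorted[OF m] by blast
  then have sum: "sum_list (composition n m) = length C" using len length_word by metis
  \<comment> \<open>Tightness makes the ascents of \<open>m\<close> those of \<open>C\<close>: at a
    non-ascent of \<open>C\<close>, the entry \<open>m ! j\<close> is either at its bound, which is
    at least the bound of its neighbour, or equal to the neighbour.\<close>
  have asc: "ascent C j = ascent m j" if j: "Suc j < length C" for j
  proof -
    have g: "m ! j + ascent C j <= m ! Suc j" "m ! Suc j <= C ! Suc j div 2" using m j by (auto simp: gap_seqs_def)
    show ?thesis
    proof (cases "C ! j < C ! Suc j")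
      case True
      then show ?thesis using g by (simp add: ascent_def)
    next
      case False
      then have "C ! Suc j div 2 <= C ! j div 2" by (intro div_le_mono) simp
      then have "\<not> m ! j < m ! Suc j" using t'[of j] j g False by (auto simp: ascent_def)
      then show ?thesis using False by (simp add: ascent_def)
    qed
  qed
  have "label_seqs C = gap_seqs (length C) (%j. m ! j) (ascent C)"
    unfolding label_seqs_def by (rule tight_gap_seqs) (use t in \<open>simp add: label_tight_def\<close>)
  also have "\<dots> = gap_seqs (length C) (%j. m ! j) (ascent m)" by (rule gap_seqs_cong) (auto simp: asc)
  finally show "(\<Sum>c\<in>label_seqs C. wmon c) = fundamental_slide (composition n m)"
    unfolding fundamental_slide_word wm sum by simp
qed

lemma fundamental_structure_const:
  assumes len: "length \<alpha> = n" "length \<beta> = n" "length \<gamma> = n"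
  shows "structure_const fundamental_slide \<alpha> \<beta> \<gamma> =
    of_nat (card {C \<in> label_shuffles (word 0 \<alpha>) (word 0 \<beta>). label_tight C (word 0 \<gamma>)})"
proof -
  let ?S = "label_shuffles (word 0 \<alpha>) (word 0 \<beta>)"
  \<comment> \<open>Label words that admit no bounded sequence contribute 0 to the product and have
    no tight sequence.\<close>
  define S where "S = {C \<in> ?S. label_seqs C ~= {}}"
  have C: "\<forall>x\<in>set C. x div 2 < n" if "C \<in> ?S" for C
    using set_label_shuffles[OF that] set_word[of 0 \<alpha>] set_word[of 0 \<beta>] len by fastforce
  define f where "f C = (SOME m. label_tight C m)" for C
  have f: "label_tight C (f C)" if "C \<in> S" for C
  proof -
    have "\<exists>m. label_tight C m" using that tight_exists[of "length C" "%j. C ! j div 2" "ascent C"]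
      by (auto simp: S_def label_seqs_def label_tight_def)
    then show ?thesis unfolding f_def by (rule someI_ex)
  qed
  let ?g = "%C. composition n (f C)"
  have fin: "finite S" using finite_label_shuffles by (simp add: S_def)
  have "fundamental_slide \<alpha> * fundamental_slide \<beta> = (\<Sum>C\<in>?S. \<Sum>m\<in>label_seqs C. wmon m)"
    unfolding fundamental_slide_label_seqs(1)[of \<alpha>] fundamental_slide_label_seqs(2)[of \<beta>] by (rule sum_label_seqs_mult)
  also have "\<dots> = (\<Sum>C\<in>S. \<Sum>m\<in>label_seqs C. wmon m)"
    by (rule sum.mono_neutral_right) (auto simp: S_def finite_label_shuffles)
  also have "\<dots> = (\<Sum>C\<in>S. fundamental_slide (?g C))"
    using label_tight_slide(1)[OF f C] by (intro sum.cong) (auto simp: S_def)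
  finally have "structure_const fundamental_slide \<alpha> \<beta> \<gamma> = of_nat (card {C \<in> S. ?g C = \<gamma>})"
    using len fin by (intro structure_const_sum[OF poly_basis_fundamental_slide]) (auto simp: comps_def composition_def)
  also have "{C \<in> S. ?g C = \<gamma>} = {C \<in> ?S. label_tight C (word 0 \<gamma>)}"
  proof (intro set_eqI iffI)
    fix D assume "D \<in> {C \<in> S. ?g C = \<gamma>}"
    then have D: "D \<in> S" "D \<in> ?S" "\<gamma> = ?g D" by (auto simp: S_def)
    then show "D \<in> {C \<in> ?S. label_tight C (word 0 \<gamma>)}" using label_tight_slide(2)[OF f C, of D] f by simp
  next
    fix D assume D: "D \<in> {C \<in> ?S. label_tight C (word 0 \<gamma>)}"
    then have S: "D \<in> S" by (auto simp: S_def label_seqs_def label_tight_def tight_def)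
    then have "f D = word 0 \<gamma>" using f[OF S] D tight_unique by (auto simp: label_tight_def)
    then show "D \<in> {C \<in> S. ?g C = \<gamma>}" using S len by (simp add: composition_word)
  qed
  finally show ?thesis .
qed

section \<open>Products of monomial slide polynomials\<close>

lemma word_Suc: "word (Suc k) \<alpha> = map Suc (word k \<alpha>)"
  by (induction \<alpha> arbitrary: k) (auto simp: map_replicate)

fun positions :: "('a => bool) => nat => 'a list => nat list" where
  "positions P k [] = []"
| "positions P k (z # Z) = (if P z then k # positions P (Suc k) Z else positions P (Suc k) Z)"

lemma length_positions [simp]: "length (positions P k Z) = length (filter P Z)"
  by (induction Z arbitrary: k) auto

lemma set_positions: "p \<in> set (positions P k Z) \<longleftrightarrow> k <= p & p < k + length Z & P (Z ! (p - k))"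
proof (induction Z arbitrary: k)
  case (Cons z Z)
  show ?case
  proof (cases "p = k")
    case True
    then show ?thesis using Cons[of "Suc k"] by simp
  next
    case False
    then have "p - k = Suc (p - Suc k)" if "Suc k <= p" using that by simp
    then show ?thesis using Cons[of "Suc k"] False by auto
  qed
qed simp

lemma positions_bounds: "set (positions P k Z) \<subseteq> {k..<k + length Z}"
  by (auto simp: set_positions)

lemma sorted_positions: "sorted_wrt (<) (positions P k Z)"
proof (induction Z arbitrary: k)
  case (Cons z Z)
  then show ?case using positions_bounds[of P "Suc k" Z] by fastforce
qed simp

lemma map_nth_positions: "map (%p. Z ! (p - k)) (positions P k Z) = filter P Z"
proof (induction Z arbitrary: k)
  case (Cons z Z)
  have "map (%p. (z # Z) ! (p - k)) (positions P (Suc k) Z) = map (%p. Z ! (p - Suc k)) (positions P (Suc k) Z)"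
  proof (rule map_cong[OF refl])
    fix p assume "p \<in> set (positions P (Suc k) Z)"
    then have "Suc k <= p" by (simp add: set_positions)
    then have "p - k = Suc (p - Suc k)" by simp
    then show "(z # Z) ! (p - k) = Z ! (p - Suc k)" by simp
  qed
  then show ?case using Cons by simp
qed simp

lemma positions_map: "positions P k (map f Z) = positions (%z. P (f z)) k Z"
  by (induction Z arbitrary: k) auto

lemma word_positions:
  assumes "\<And>z. \<not> P z ==> f z = 0"
  shows "word k (map f Z) = map (%j. positions P k Z ! j) (word 0 (map f (filter P Z)))"
  by (induction Z arbitrary: k) (auto simp: assms word_Suc comp_def map_replicate)

definition expand :: "'a => nat => nat list => 'a list => 'a list" where
  "expand z0 n c \<tau> = map (%p. case map_of (zip c \<tau>) p of None => z0 | Some z => z) [0..<n]"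

lemma expand_positions:
  assumes c: "length c = length \<tau>" "sorted_wrt (<) c" "set c \<subseteq> {..<n}" and \<tau>: "z0 \<notin> set \<tau>"
  shows "positions (%z. z ~= z0) 0 (expand z0 n c \<tau>) = c" "filter (%z. z ~= z0) (expand z0 n c \<tau>) = \<tau>"
proof -
  let ?Z = "expand z0 n c \<tau>"
  have dc: "distinct c" using c(2) by (simp add: strict_sorted_iff)
  have in_c: "?Z ! (c ! j) = \<tau> ! j" if "j < length c" for j
  proof -
    have "map_of (zip c \<tau>) (c ! j) = Some (\<tau> ! j)" using map_of_zip_nth[OF c(1) dc] that c(1) by simp
    moreover have "c ! j < n" using c(3) nth_mem[OF that] by auto
    ultimately show ?thesis by (simp add: expand_def)
  qed
  have out: "?Z ! p = z0" if "p < n" "p \<notin> set c" for p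
  proof -
    have "map_of (zip c \<tau>) p = None" using that c(1) by (simp add: map_of_zip_is_None)
    then show ?thesis using that by (simp add: expand_def)
  qed
  have len: "length ?Z = n" by (simp add: expand_def)
  have "set (positions (%z. z ~= z0) 0 ?Z) = set c"
  proof (intro set_eqI iffI)
    fix p assume "p \<in> set (positions (%z. z ~= z0) 0 ?Z)"
    then show "p \<in> set c" using out[of p] by (auto simp: set_positions len)
  next
    fix p assume p: "p \<in> set c"
    then obtain j where j: "j < length c" "p = c ! j" by (auto simp: in_set_conv_nth)
    then have "\<tau> ! j ~= z0" using \<tau> c(1) nth_mem[of j \<tau>] by auto
    then show "p \<in> set (positions (%z. z ~= z0) 0 ?Z)" using in_c[OF j(1)] j(2) c(3) p by (auto simp: set_positions len)
  qed
  then show pos: "positions (%z. z ~= z0) 0 ?Z = c"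
    using sorted_positions[of "%z. z ~= z0" 0 ?Z] c(2) by (intro sorted_distinct_set_unique) (auto simp: strict_sorted_iff)
  have "map (%p. ?Z ! p) c = \<tau>" using in_c c(1) by (intro nth_equalityI) auto
  then show "filter (%z. z ~= z0) ?Z = \<tau>" using map_nth_positions[of ?Z 0 "%z. z ~= z0"] by (simp add: pos)
qed

lemma positions_inj:
  assumes "length Z = length Z'" "positions (%z. z ~= z0) 0 Z = positions (%z. z ~= z0) 0 Z'"
    "filter (%z. z ~= z0) Z = filter (%z. z ~= z0) Z'"
  shows "Z = Z'"
proof (rule nth_equalityI[OF assms(1)])
  fix p assume p: "p < length Z"
  let ?c = "positions (%z. z ~= z0) 0 Z"
  have m: "map (%p. Z ! p) ?c = map (%p. Z' ! p) ?c"
    using map_nth_positions[of Z 0 "%z. z ~= z0"] map_nth_positions[of Z' 0 "%z. z ~= z0"] assms(2,3) by simp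
  show "Z ! p = Z' ! p"
  proof (cases "p \<in> set ?c")
    case True
    then show ?thesis using m by simp
  next
    case False
    then have "\<not> Z ! p ~= z0" "\<not> Z' ! p ~= z0"
      using set_positions[of p "%z. z ~= z0" 0 Z] set_positions[of p "%z. z ~= z0" 0 Z'] assms(1,2) p by auto
    then show ?thesis by simp
  qed
qed

lemma gap_seqs_one_sorted:
  assumes "c \<in> gap_seqs k b (%_. 1)"
  shows "sorted_wrt (<) c"
proof -
  have "sorted c" by (rule gap_seqs_sorted[OF assms])
  moreover have "c ! i < c ! j" if "i < j" "j < length c" for i j
  proof -
    have "Suc i < k" using assms that by (simp add: gap_seqs_def)
    then have "c ! i < c ! Suc i" using assms by (simp add: gap_seqs_def Suc_le_eq)
    also have "\<dots> <= c ! j" using sorted_nth_mono[OF \<open>sorted c\<close>, of "Suc i" j] that by simp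
    finally show ?thesis .
  qed
  ultimately show ?thesis by (simp add: sorted_wrt_iff_nth_less)
qed

text \<open>A list with prescribed entries other than \<open>z0\<close> is determined by their
  positions, and a strictly increasing sequence of positions is one with all gaps 1.\<close>

lemma bij_positions:
  assumes \<tau>: "z0 \<notin> set \<tau>" and b: "\<And>j. j < length \<tau> ==> b j < n"
  shows "bij_betw (positions (%z. z ~= z0) 0)
    {Z. length Z = n & filter (%z. z ~= z0) Z = \<tau> & (\<forall>j<length \<tau>. positions (%z. z ~= z0) 0 Z ! j <= b j)}
    (gap_seqs (length \<tau>) b (%_. 1))" (is "bij_betw ?pos ?L ?R")
proof (rule bij_betwI[where g = "%c. expand z0 n c \<tau>"])
  have c: "length c = length \<tau> & sorted_wrt (<) c & set c \<subseteq> {..<n}" if "c \<in> ?R" for c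
  proof -
    have "c ! j < n" if "j < length c" for j
      using b[of j] \<open>c \<in> ?R\<close> that by (auto simp: gap_seqs_def intro: le_less_trans)
    then show ?thesis using gap_seqs_one_sorted[OF that] that by (auto simp: gap_seqs_def in_set_conv_nth)
  qed
  show "?pos \<in> ?L \<rightarrow> ?R"
  proof
    fix Z assume Z: "Z \<in> ?L"
    have "?pos Z ! j < ?pos Z ! Suc j" if "Suc j < length (?pos Z)" for j
      using sorted_wrt_nth_less[OF sorted_positions, of j "Suc j" "%z. z ~= z0" 0 Z] that by simp
    then show "?pos Z \<in> ?R" using Z by (auto simp: gap_seqs_def Suc_le_eq)
  qed
  show "(%c. expand z0 n c \<tau>) \<in> ?R \<rightarrow> ?L"
  proof
    fix x assume x: "x \<in> ?R"
    have "length (expand z0 n x \<tau>) = n" by (simp add: expand_def)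
    then show "expand z0 n x \<tau> \<in> ?L"
      using expand_positions[of x \<tau> n z0] c[OF x] \<tau> x by (simp add: gap_seqs_def)
  qed
  show "?pos (expand z0 n x \<tau>) = x" if x: "x \<in> ?R" for x
    using expand_positions(1)[of x \<tau> n z0] c[OF x] \<tau> by simp
  show "expand z0 n (?pos Z) \<tau> = Z" if Z: "Z \<in> ?L" for Z
  proof (rule positions_inj)
    have *: "length (?pos Z) = length \<tau>" "set (?pos Z) \<subseteq> {..<n}"
      using Z positions_bounds[of "%z. z ~= z0" 0 Z] by auto
    show "length (expand z0 n (?pos Z) \<tau>) = length Z" using Z by (simp add: expand_def)
    show "?pos (expand z0 n (?pos Z) \<tau>) = ?pos Z" by (rule expand_positions(1)[OF *(1) sorted_positions *(2) \<tau>])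
    show "filter (%z. z ~= z0) (expand z0 n (?pos Z) \<tau>) = filter (%z. z ~= z0) Z"
      using expand_positions(2)[OF *(1) sorted_positions *(2) \<tau>] Z by simp
  qed
qed

abbreviation npos :: "nat list => nat list" where "npos \<equiv> positions (%a. a ~= 0) 0"

lemma word_npos: "word 0 \<beta> = map (%j. npos \<beta> ! j) (word 0 (flat \<beta>))"
  using word_positions[of "%a. a ~= 0" "%a. a" 0 \<beta>] by (simp add: flat_def)

lemma word_surj: "j < length xs ==> xs ! j ~= 0 ==> \<exists>u<sum_list xs. word 0 xs ! u = j"
proof -
  assume "j < length xs" "xs ! j ~= 0"
  then have "count_list (word 0 xs) j ~= 0" by (simp add: count_word)
  then have "j \<in> set (word 0 xs)" by (meson count_list_0_iff)
  then show ?thesis by (simp add: in_set_conv_nth)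
qed

lemma word_less: "u < sum_list xs ==> word 0 xs ! u < length xs"
proof -
  assume "u < sum_list xs"
  then have "word 0 xs ! u \<in> set (word 0 xs)" by (intro nth_mem) simp
  then show ?thesis using set_word[of 0 xs] by auto
qed

lemma monomial_slide_positions:
  "monomial_slide \<gamma> = (\<Sum>c\<in>gap_seqs (length (flat \<gamma>)) (%j. npos \<gamma> ! j) (%_. 1).
     wmon (map (%j. c ! j) (word 0 (flat \<gamma>))))"
proof -
  let ?n = "length \<gamma>" and ?\<sigma> = "flat \<gamma>"
  let ?L = "{Z. length Z = ?n & filter (%z. z ~= 0) Z = ?\<sigma> & (\<forall>j<length ?\<sigma>. npos Z ! j <= npos \<gamma> ! j)}"
  have "\<beta> \<in> mono_set \<gamma> \<longleftrightarrow> \<beta> \<in> ?L" for \<beta>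
  proof (cases "length \<beta> = ?n & flat \<beta> = ?\<sigma>")
    case True
    then have sum: "sum_list \<beta> = sum_list \<gamma>" by (metis sum_list_flat)
    have "dominated \<beta> \<gamma> \<longleftrightarrow> (\<forall>u<sum_list \<gamma>. npos \<beta> ! (word 0 ?\<sigma> ! u) <= npos \<gamma> ! (word 0 ?\<sigma> ! u))"
    proof -
      have "word 0 \<beta> ! u = npos \<beta> ! (word 0 ?\<sigma> ! u)" "word 0 \<gamma> ! u = npos \<gamma> ! (word 0 ?\<sigma> ! u)" if "u < sum_list \<gamma>" for u
        using word_npos[of \<beta>] word_npos[of \<gamma>] True that by (simp_all add: sum_list_flat)
      then show ?thesis using dominated_word[OF conjunct1[OF True] sum] by simp
    qed
    also have "\<dots> \<longleftrightarrow> (\<forall>j<length ?\<sigma>. npos \<beta> ! j <= npos \<gamma> ! j)"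
    proof
      assume *: "\<forall>u<sum_list \<gamma>. npos \<beta> ! (word 0 ?\<sigma> ! u) <= npos \<gamma> ! (word 0 ?\<sigma> ! u)"
      show "\<forall>j<length ?\<sigma>. npos \<beta> ! j <= npos \<gamma> ! j"
      proof (intro allI impI)
        fix j assume j: "j < length ?\<sigma>"
        have "?\<sigma> ! j ~= 0" using flat_pos[of \<gamma>] nth_mem[OF j] by metis
        with word_surj[OF j] obtain u where "u < sum_list ?\<sigma>" "word 0 ?\<sigma> ! u = j" by auto
        then show "npos \<beta> ! j <= npos \<gamma> ! j" using * by (auto simp: sum_list_flat)
      qed
    next
      assume "\<forall>j<length ?\<sigma>. npos \<beta> ! j <= npos \<gamma> ! j"
      then show "\<forall>u<sum_list \<gamma>. npos \<beta> ! (word 0 ?\<sigma> ! u) <= npos \<gamma> ! (word 0 ?\<sigma> ! u)"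
        using word_less[of _ ?\<sigma>] by (simp add: sum_list_flat)
    qed
    finally show ?thesis using True by (auto simp: mono_set_def flat_def)
  next
    case False
    then show ?thesis by (auto simp: mono_set_def flat_def dominated_def)
  qed
  then have L: "mono_set \<gamma> = ?L" by blast
  have "npos \<gamma> ! j < ?n" if "j < length ?\<sigma>" for j
  proof -
    have "npos \<gamma> ! j \<in> set (npos \<gamma>)" using that by (intro nth_mem) (simp add: flat_def)
    then show ?thesis using positions_bounds[of "%a. a ~= 0" 0 \<gamma>] by auto
  qed
  then have bij: "bij_betw npos (mono_set \<gamma>) (gap_seqs (length ?\<sigma>) (%j. npos \<gamma> ! j) (%_. 1))"
    unfolding L by (intro bij_positions) (auto simp: flat_def)
  have "monomial_slide \<gamma> = (\<Sum>\<beta>\<in>mono_set \<gamma>. wmon (map (%j. npos \<beta> ! j) (word 0 ?\<sigma>)))"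
    unfolding monomial_slide_def mono_set_def[symmetric]
  proof (rule sum.cong[OF refl])
    fix \<beta> assume "\<beta> \<in> mono_set \<gamma>"
    then have "flat \<beta> = ?\<sigma>" by (simp add: mono_set_def)
    then show "xpow \<beta> = wmon (map (%j. npos \<beta> ! j) (word 0 ?\<sigma>))" by (metis wmon_word_xpow word_npos)
  qed
  also have "\<dots> = (\<Sum>c\<in>gap_seqs (length ?\<sigma>) (%j. npos \<gamma> ! j) (%_. 1). wmon (map (%j. c ! j) (word 0 ?\<sigma>)))"
    by (rule sum.reindex_bij_betw[OF bij, of "%c. wmon (map (%j. c ! j) (word 0 ?\<sigma>))"])
  finally show ?thesis .
qed

section \<open>Pairs of monomials as lists of columns\<close>

definition pair_sum :: "nat \<times> nat => nat" where
  "pair_sum z = fst z + snd z"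

abbreviation nonzero :: "nat \<times> nat => bool" where "nonzero \<equiv> %z. z ~= (0, 0)"

text \<open>A pair of monomials is kept as the list of its columns; what remains after deleting the
  columns \<open>(0, 0)\<close> names its class.\<close>

definition mono_pairs :: "nat list => nat list => (nat \<times> nat) list set" where
  "mono_pairs \<alpha> \<beta> = {Z. map fst Z \<in> mono_set \<alpha> & map snd Z \<in> mono_set \<beta>}"

definition meets :: "nat list => nat list => nat => bool" where
  "meets \<alpha> \<delta> p \<longleftrightarrow> (\<exists>u<sum_list \<alpha>. word 0 \<delta> ! u = p & word 0 \<alpha> ! u = p)"

text \<open>Tightness read off the columns: a nonzero column contains a letter at its bound,
  recorded by \<open>meets\<close>, or is blocked by a nonzero right neighbour.\<close>

definition stuck :: "nat list => nat list => (nat \<times> nat) list => bool" where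
  "stuck \<alpha> \<beta> Z \<longleftrightarrow> (\<forall>p<length Z. nonzero (Z ! p) --> meets \<alpha> (map fst Z) p | meets \<beta> (map snd Z) p \<or>
     (Suc p < length Z & nonzero (Z ! Suc p)))"

lemma xpow_pair_mult:
  assumes "map fst Z \<in> comps n" "map snd Z \<in> comps n"
  shows "xpow (map fst Z) * xpow (map snd Z) = xpow (map pair_sum Z)"
  using assms by (simp add: xpow_prod comps_def pair_sum_def power_add prod.distrib)

context
  fixes \<alpha> \<beta> :: "nat list" and n :: nat
  assumes len: "length \<alpha> = n" "length \<beta> = n"
begin

lemma pair_class:
  assumes \<tau>: "\<tau> \<in> filter nonzero ` mono_pairs \<alpha> \<beta>"
  obtains b where "bij_betw (positions nonzero 0) {Z \<in> mono_pairs \<alpha> \<beta>. filter nonzero Z = \<tau>} (gap_seqs (length \<tau>) b (%_. 1))"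
    "\<And>Z. Z \<in> mono_pairs \<alpha> \<beta> ==> filter nonzero Z = \<tau> ==> stuck \<alpha> \<beta> Z \<longleftrightarrow> tight (length \<tau>) b (%_. 1) (positions nonzero 0 Z)"
proof -
  let ?pos = "positions nonzero 0" and ?k = "length \<tau>"
  let ?f = "word 0 (map fst \<tau>)" and ?s = "word 0 (map snd \<tau>)"
  let ?a = "word 0 \<alpha>" and ?b = "word 0 \<beta>"
  have flatf: "flat (map fst Z) = flat (map fst (filter nonzero Z))" "flat (map snd Z) = flat (map snd (filter nonzero Z))" for Z
    by (induction Z) (auto simp: flat_def)
  obtain Z0 where Z0: "Z0 \<in> mono_pairs \<alpha> \<beta>" "\<tau> = filter nonzero Z0" using \<tau> by blast
  have nz: "(0, 0) \<notin> set \<tau>" by (simp add: Z0(2))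
  have fl: "flat (map fst \<tau>) = flat \<alpha>" "flat (map snd \<tau>) = flat \<beta>"
    using Z0(1) unfolding Z0(2) flatf[symmetric] by (auto simp: mono_pairs_def mono_set_def)
  have sums: "sum_list (map fst \<tau>) = sum_list \<alpha>" "sum_list (map snd \<tau>) = sum_list \<beta>"
    using fl by (metis sum_list_flat)+
  have wf: "word 0 (map fst Z) = map (%j. ?pos Z ! j) ?f" "word 0 (map snd Z) = map (%j. ?pos Z ! j) ?s"
    if "filter nonzero Z = \<tau>" for Z
    using word_positions[of nonzero fst 0 Z] word_positions[of nonzero snd 0 Z] that by auto
  \<comment> \<open>All letters of column \<open>j\<close>, from both factors, move together, so the
    column is bounded by the smallest of their individual bounds.\<close>
  define A where "A j = {?a ! u | u. u < sum_list \<alpha> & ?f ! u = j} \<union> {?b ! u | u. u < sum_list \<beta> & ?s ! u = j}" for j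
  define bd where "bd j = Min (A j)" for j
  have fin: "finite (A j)" for j by (auto simp: A_def)
  have ne: "A j ~= {}" if j: "j < ?k" for j
  proof -
    have "\<tau> ! j ~= (0, 0)" using nz nth_mem[OF j] by auto
    then have "map fst \<tau> ! j ~= 0 | map snd \<tau> ! j ~= 0" using j by (auto simp: prod_eq_iff)
    then have "(\<exists>u<sum_list \<alpha>. ?f ! u = j) | (\<exists>u<sum_list \<beta>. ?s ! u = j)"
      using word_surj[of j "map fst \<tau>"] word_surj[of j "map snd \<tau>"] j unfolding sums by auto
    then show ?thesis by (auto simp: A_def)
  qed
  have bdn: "bd j < n" if j: "j < ?k" for j
  proof -
    have "bd j \<in> A j" unfolding bd_def using fin ne[OF j] by (rule Min_in)
    then show ?thesis using word_less[of _ \<alpha>] word_less[of _ \<beta>] len by (auto simp: A_def)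
  qed
  have fless: "?f ! u < ?k" if "u < sum_list \<alpha>" for u using word_less[of u "map fst \<tau>"] that sums by simp
  have sless: "?s ! u < ?k" if "u < sum_list \<beta>" for u using word_less[of u "map snd \<tau>"] that sums by simp
  have mem: "Z \<in> mono_pairs \<alpha> \<beta> \<longleftrightarrow> length Z = n & (\<forall>j<?k. ?pos Z ! j <= bd j)" if Z: "filter nonzero Z = \<tau>" for Z
  proof (cases "length Z = n")
    case True
    have s: "sum_list (map fst Z) = sum_list \<alpha>" "sum_list (map snd Z) = sum_list \<beta>"
      using flatf[of Z] fl unfolding Z by (metis sum_list_flat)+
    have "map fst Z \<in> mono_set \<alpha> \<longleftrightarrow> (\<forall>u<sum_list \<alpha>. ?pos Z ! (?f ! u) <= ?a ! u)"
      using flatf[of Z] fl dominated_word[OF _ s(1)] True len wf[OF Z] sums by (simp add: mono_set_def Z)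
    moreover have "map snd Z \<in> mono_set \<beta> \<longleftrightarrow> (\<forall>u<sum_list \<beta>. ?pos Z ! (?s ! u) <= ?b ! u)"
      using flatf[of Z] fl dominated_word[OF _ s(2)] True len wf[OF Z] sums by (simp add: mono_set_def Z)
    moreover have "(\<forall>j<?k. ?pos Z ! j <= bd j) \<longleftrightarrow> (\<forall>j<?k. \<forall>x\<in>A j. ?pos Z ! j <= x)"
      unfolding bd_def using fin ne by (simp add: Min_ge_iff)
    moreover have "\<dots> \<longleftrightarrow> (\<forall>u<sum_list \<alpha>. ?pos Z ! (?f ! u) <= ?a ! u) & (\<forall>u<sum_list \<beta>. ?pos Z ! (?s ! u) <= ?b ! u)"
    proof (intro iffI conjI allI impI)
      fix u assume *: "\<forall>j<?k. \<forall>x\<in>A j. ?pos Z ! j <= x"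
      {
        assume u: "u < sum_list \<alpha>"
        then have "?a ! u \<in> A (?f ! u)" by (auto simp: A_def)
        then show "?pos Z ! (?f ! u) <= ?a ! u" using * fless[OF u] by blast
      next
        assume u: "u < sum_list \<beta>"
        then have "?b ! u \<in> A (?s ! u)" by (auto simp: A_def)
        then show "?pos Z ! (?s ! u) <= ?b ! u" using * sless[OF u] by blast
      }
    qed (auto simp: A_def)
    ultimately show ?thesis using True by (simp add: mono_pairs_def)
  next
    case False
    then have "map fst Z \<notin> mono_set \<alpha>" using len by (auto simp: mono_set_def dominated_def)
    then show ?thesis using False by (simp add: mono_pairs_def)
  qed
  have "{Z \<in> mono_pairs \<alpha> \<beta>. filter nonzero Z = \<tau>} =
      {Z. length Z = n & filter nonzero Z = \<tau> & (\<forall>j<?k. ?pos Z ! j <= bd j)}"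
    using mem by blast
  then have bij: "bij_betw ?pos {Z \<in> mono_pairs \<alpha> \<beta>. filter nonzero Z = \<tau>} (gap_seqs ?k bd (%_. 1))"
    using bij_positions[of "(0, 0)" \<tau> bd n, OF nz bdn] by simp
  have "stuck \<alpha> \<beta> Z \<longleftrightarrow> tight ?k bd (%_. 1) (?pos Z)" if Z: "Z \<in> mono_pairs \<alpha> \<beta>" "filter nonzero Z = \<tau>" for Z
  proof -
    define c where "c = ?pos Z"
    have c: "c \<in> gap_seqs ?k bd (%_. 1)" using bij Z by (auto simp: bij_betw_def c_def)
    have lc: "length c = ?k" using c by (simp add: gap_seqs_def)
    have "sorted_wrt (<) c" unfolding c_def by (rule sorted_positions)
    then have d: "c ! i = c ! j \<longleftrightarrow> i = j" if "i < ?k" "j < ?k" for i j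
      using that lc by (simp add: strict_sorted_iff nth_eq_iff_index_eq)
    have setc: "p \<in> set c \<longleftrightarrow> p < length Z & nonzero (Z ! p)" for p by (simp add: c_def set_positions)
    have lenZ: "length Z = n" using mem[OF Z(2)] Z(1) by simp
    have m1: "meets \<alpha> (map fst Z) (c ! j) | meets \<beta> (map snd Z) (c ! j) \<longleftrightarrow> c ! j = bd j" if j: "j < ?k" for j
    proof -
      have "word 0 (map fst Z) ! u = c ! j \<longleftrightarrow> ?f ! u = j" if "u < sum_list \<alpha>" for u
        using wf(1)[OF Z(2)] that sums d[OF fless[OF that] j] by (simp add: c_def)
      moreover have "word 0 (map snd Z) ! u = c ! j \<longleftrightarrow> ?s ! u = j" if "u < sum_list \<beta>" for u
        using wf(2)[OF Z(2)] that sums d[OF sless[OF that] j] by (simp add: c_def)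
      ultimately have "meets \<alpha> (map fst Z) (c ! j) | meets \<beta> (map snd Z) (c ! j) \<longleftrightarrow> c ! j \<in> A j"
        unfolding meets_def A_def by auto
      also have "\<dots> \<longleftrightarrow> c ! j = bd j"
      proof
        assume "c ! j \<in> A j"
        then have "bd j <= c ! j" unfolding bd_def using fin by simp
        then show "c ! j = bd j" using c j by (auto simp: gap_seqs_def intro: antisym)
      next
        assume "c ! j = bd j"
        then show "c ! j \<in> A j" unfolding bd_def using Min_in[OF fin ne[OF j]] by simp
      qed
      finally show ?thesis .
    qed
    have m2: "Suc (c ! j) < length Z & nonzero (Z ! Suc (c ! j)) \<longleftrightarrow> Suc j < ?k & c ! j + 1 = c ! Suc j" if j: "j < ?k" for j
    proof
      assume "Suc (c ! j) < length Z & nonzero (Z ! Suc (c ! j))"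
      then have "Suc (c ! j) \<in> set c" by (simp add: setc)
      then obtain i where i: "i < ?k" "c ! i = Suc (c ! j)" using lc by (auto simp: in_set_conv_nth)
      have "j < i"
      proof (rule ccontr)
        assume "\<not> j < i"
        then have "c ! i <= c ! j" using sorted_nth_mono[OF gap_seqs_sorted[OF c], of i j] j lc by simp
        then show False using i by simp
      qed
      moreover have "\<not> Suc j < i"
      proof
        assume "Suc j < i"
        then have "c ! Suc j < c ! i" "c ! j < c ! Suc j"
          using sorted_wrt_nth_less[OF \<open>sorted_wrt (<) c\<close>, of "Suc j" i]
            sorted_wrt_nth_less[OF \<open>sorted_wrt (<) c\<close>, of j "Suc j"] \<open>Suc j < i\<close> i(1) lc by auto
        then show False using i by simp
      qed
      ultimately have "i = Suc j" by simp
      then show "Suc j < ?k & c ! j + 1 = c ! Suc j" using i by simp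
    next
      assume *: "Suc j < ?k & c ! j + 1 = c ! Suc j"
      then have "c ! Suc j \<in> set c" using lc by simp
      then show "Suc (c ! j) < length Z & nonzero (Z ! Suc (c ! j))" using * by (simp add: setc)
    qed
    have "stuck \<alpha> \<beta> Z \<longleftrightarrow> (\<forall>p\<in>set c. meets \<alpha> (map fst Z) p | meets \<beta> (map snd Z) p | (Suc p < length Z & nonzero (Z ! Suc p)))"
      unfolding stuck_def using setc by blast
    also have "\<dots> \<longleftrightarrow> (\<forall>j<?k. c ! j = bd j | (Suc j < ?k & c ! j + 1 = c ! Suc j))"
      unfolding all_set_conv_all_nth lc using m1 m2 by blast
    finally show ?thesis using c by (simp add: tight_def c_def)
  qed
  then show ?thesis using that bij by blast
qed

lemma finite_mono_pairs: "finite (mono_pairs \<alpha> \<beta>)"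
proof (rule finite_subset)
  show "mono_pairs \<alpha> \<beta> \<subseteq> (%(x, y). zip x y) ` (mono_set \<alpha> \<times> mono_set \<beta>)"
  proof
    fix Z assume "Z \<in> mono_pairs \<alpha> \<beta>"
    then show "Z \<in> (%(x, y). zip x y) ` (mono_set \<alpha> \<times> mono_set \<beta>)"
      using zip_map_fst_snd[of Z] by (auto simp: mono_pairs_def intro!: rev_image_eqI[of "(map fst Z, map snd Z)"])
  qed
  show "finite ((%(x, y). zip x y) ` (mono_set \<alpha> \<times> mono_set \<beta>))"
    using slide_sets(2)[of \<alpha> n] slide_sets(2)[of \<beta> n] len by (simp add: comps_def)
qed

text \<open>A column sum is 0 only for the column \<open>(0, 0)\<close>, so all members of a class
  have sums with the same flattening and differ only in the positions. These form one set of gap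
  sequences, and its tight member is the stuck pair.\<close>

lemma pair_class_sum:
  assumes \<tau>: "\<tau> \<in> filter nonzero ` mono_pairs \<alpha> \<beta>"
  shows "(\<Sum>Z | Z \<in> mono_pairs \<alpha> \<beta> & filter nonzero Z = \<tau>. xpow (map pair_sum Z)) =
    (\<Sum>Z | Z \<in> {Z \<in> mono_pairs \<alpha> \<beta>. stuck \<alpha> \<beta> Z} & filter nonzero Z = \<tau>. monomial_slide (map pair_sum Z))"
proof -
  let ?pos = "positions nonzero 0" and ?k = "length \<tau>" and ?C = "{Z \<in> mono_pairs \<alpha> \<beta>. filter nonzero Z = \<tau>}"
  let ?\<sigma> = "map pair_sum \<tau>"
  obtain b where bij: "bij_betw ?pos ?C (gap_seqs ?k b (%_. 1))"
    and st: "\<And>Z. Z \<in> mono_pairs \<alpha> \<beta> ==> filter nonzero Z = \<tau> ==> stuck \<alpha> \<beta> Z \<longleftrightarrow> tight ?k b (%_. 1) (?pos Z)"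
    using pair_class[OF \<tau>] by blast
  have "?C ~= {}" using \<tau> by blast
  then have "gap_seqs ?k b (%_. 1) ~= {}" using bij by (auto simp: bij_betw_def)
  then obtain m where m: "tight ?k b (%_. 1) m" by (rule tight_exists)
  then have "m \<in> ?pos ` ?C" using bij by (simp add: tight_def bij_betw_def)
  then obtain Z where Z: "Z \<in> ?C" "?pos Z = m" by blast
  have uniq: "Z' = Z" if "Z' \<in> ?C" "stuck \<alpha> \<beta> Z'" for Z'
  proof -
    have "tight ?k b (%_. 1) (?pos Z')" using st[of Z'] that by simp
    then have "?pos Z' = ?pos Z" using m tight_unique Z(2) by blast
    then show ?thesis using bij that(1) Z(1) by (auto simp: bij_betw_def dest: inj_onD)
  qed
  have "stuck \<alpha> \<beta> Z" using st[of Z] Z m by simp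
  then have one: "{Z. Z \<in> {Z \<in> mono_pairs \<alpha> \<beta>. stuck \<alpha> \<beta> Z} & filter nonzero Z = \<tau>} = {Z}" using uniq Z(1) by blast
  have ps: "(%z. pair_sum z ~= 0) = nonzero" by (auto simp: pair_sum_def fun_eq_iff)
  have wp: "word 0 (map pair_sum Y) = map (%j. ?pos Y ! j) (word 0 ?\<sigma>)" if "filter nonzero Y = \<tau>" for Y
    using word_positions[of nonzero pair_sum 0 Y] that by (auto simp: pair_sum_def)
  have np: "npos (map pair_sum Z) = m" by (simp only: positions_map ps Z(2))
  have fl: "flat (map pair_sum Z) = ?\<sigma>" unfolding flat_def filter_map comp_def ps using Z(1) by simp
  have "(\<Sum>Y | Y \<in> mono_pairs \<alpha> \<beta> & filter nonzero Y = \<tau>. xpow (map pair_sum Y)) =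
      (\<Sum>Y\<in>?C. wmon (map (%j. ?pos Y ! j) (word 0 ?\<sigma>)))"
    by (rule sum.cong) (auto simp: wp wmon_word_xpow[symmetric])
  also have "\<dots> = (\<Sum>c\<in>gap_seqs ?k b (%_. 1). wmon (map (%j. c ! j) (word 0 ?\<sigma>)))"
    by (rule sum.reindex_bij_betw[OF bij, of "%c. wmon (map (%j. c ! j) (word 0 ?\<sigma>))"])
  also have "\<dots> = monomial_slide (map pair_sum Z)"
    unfolding monomial_slide_positions fl np tight_gap_seqs[OF m] by simp
  finally show ?thesis unfolding one by simp
qed

lemma monomial_slide_mult:
  "monomial_slide \<alpha> * monomial_slide \<beta> = (\<Sum>Z\<in>{Z \<in> mono_pairs \<alpha> \<beta>. stuck \<alpha> \<beta> Z}. monomial_slide (map pair_sum Z))"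
proof -
  let ?P = "mono_pairs \<alpha> \<beta>" and ?Q = "{Z \<in> mono_pairs \<alpha> \<beta>. stuck \<alpha> \<beta> Z}"
  have L: "length x = n" if "x \<in> mono_set \<alpha> | x \<in> mono_set \<beta>" for x
    using that len by (auto simp: mono_set_def dominated_def)
  have bij: "bij_betw (%Z. (map fst Z, map snd Z)) ?P (mono_set \<alpha> \<times> mono_set \<beta>)"
    by (rule bij_betwI[where g = "%(x, y). zip x y"]) (auto simp: mono_pairs_def zip_map_fst_snd L)
  have "monomial_slide \<alpha> * monomial_slide \<beta> = (\<Sum>(x, y)\<in>mono_set \<alpha> \<times> mono_set \<beta>. xpow x * xpow y)"
    unfolding monomial_slide_def mono_set_def[symmetric] sum_product sum.cartesian_product ..
  also have "\<dots> = (\<Sum>Z\<in>?P. xpow (map fst Z) * xpow (map snd Z))"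
    using sum.reindex_bij_betw[OF bij, of "%(x, y). xpow x * xpow y"] by simp
  also have "\<dots> = (\<Sum>Z\<in>?P. xpow (map pair_sum Z))"
  proof (rule sum.cong[OF refl])
    fix Z assume "Z \<in> ?P"
    then show "xpow (map fst Z) * xpow (map snd Z) = xpow (map pair_sum Z)"
      using L[of "map fst Z"] L[of "map snd Z"] by (intro xpow_pair_mult[of _ n]) (simp_all add: mono_pairs_def comps_def)
  qed
  also have "\<dots> = (\<Sum>\<tau>\<in>filter nonzero ` ?P. \<Sum>Z | Z \<in> ?P & filter nonzero Z = \<tau>. xpow (map pair_sum Z))"
    by (rule sum.image_gen[OF finite_mono_pairs])
  also have "\<dots> = (\<Sum>\<tau>\<in>filter nonzero ` ?P. \<Sum>Z | Z \<in> ?Q & filter nonzero Z = \<tau>. monomial_slide (map pair_sum Z))"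
    by (rule sum.cong[OF refl]) (rule pair_class_sum)
  also have "\<dots> = (\<Sum>Z\<in>?Q. monomial_slide (map pair_sum Z))"
    by (rule sum.group) (auto simp: finite_mono_pairs)
  finally show ?thesis .
qed

text \<open>The first entries of the columns are the whole witness, since the second ones are forced
  by the column sums \<open>\<gamma>\<close>.\<close>

lemma monomial_structure_const:
  assumes \<gamma>: "length \<gamma> = n"
  shows "structure_const monomial_slide \<alpha> \<beta> \<gamma> =
    of_nat (card {\<delta>. length \<delta> = n & (\<forall>i<n. \<delta> ! i <= \<gamma> ! i) \<and>
      (let \<epsilon> = map (%i. \<gamma> ! i - \<delta> ! i) [0..<n] in \<delta> \<in> mono_set \<alpha> & \<epsilon> \<in> mono_set \<beta> \<and>
         (\<forall>p<n. \<gamma> ! p ~= 0 --> meets \<alpha> \<delta> p | meets \<beta> \<epsilon> p | (Suc p < n & \<gamma> ! Suc p ~= 0)))})"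
    (is "_ = of_nat (card ?D)")
proof -
  let ?Q = "{Z \<in> mono_pairs \<alpha> \<beta>. stuck \<alpha> \<beta> Z}"
  have L: "length Z = n" if "Z \<in> ?Q" for Z
  proof -
    have "map fst Z \<in> mono_set \<alpha>" using that by (simp add: mono_pairs_def)
    then show ?thesis using len by (auto simp: mono_set_def dominated_def)
  qed
  have "structure_const monomial_slide \<alpha> \<beta> \<gamma> = of_nat (card {Z \<in> ?Q. map pair_sum Z = \<gamma>})"
    by (rule structure_const_sum[OF poly_basis_monomial_slide _ _ _ monomial_slide_mult])
      (use len \<gamma> L finite_mono_pairs in \<open>auto simp: comps_def\<close>)
  also have "card {Z \<in> ?Q. map pair_sum Z = \<gamma>} = card ?D"
  proof (rule bij_betw_same_card, rule bij_betwI[where g = "%\<delta>. zip \<delta> (map (%i. \<gamma> ! i - \<delta> ! i) [0..<n])"])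
    have eps: "map (%i. \<gamma> ! i - map fst Z ! i) [0..<n] = map snd Z" if "length Z = n" "map pair_sum Z = \<gamma>" for Z
      using that by (intro nth_equalityI) (auto simp: pair_sum_def)
    have nz: "nonzero (Z ! p) \<longleftrightarrow> \<gamma> ! p ~= 0" if "map pair_sum Z = \<gamma>" "p < length Z" for Z p
      using that by (auto simp: pair_sum_def prod_eq_iff)
    show "map fst \<in> {Z \<in> ?Q. map pair_sum Z = \<gamma>} \<rightarrow> ?D"
    proof
      fix Z assume Z: "Z \<in> {Z \<in> ?Q. map pair_sum Z = \<gamma>}"
      then have l: "length Z = n" using L by blast
      have g: "map pair_sum Z = \<gamma>" using Z by simp
      have "map fst Z ! i <= \<gamma> ! i" if "i < n" for i using that l by (simp add: g[symmetric] pair_sum_def)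
      then show "map fst Z \<in> ?D"
        unfolding mem_Collect_eq Let_def eps[OF l g] using Z l nz[OF g] by (auto simp: mono_pairs_def stuck_def)
    qed
    show "(%\<delta>. zip \<delta> (map (%i. \<gamma> ! i - \<delta> ! i) [0..<n])) \<in> ?D \<rightarrow> {Z \<in> ?Q. map pair_sum Z = \<gamma>}"
    proof
      fix \<delta> assume \<delta>: "\<delta> \<in> ?D"
      define \<epsilon> where "\<epsilon> = map (%i. \<gamma> ! i - \<delta> ! i) [0..<n]"
      define Z where "Z = zip \<delta> \<epsilon>"
      have le: "length \<epsilon> = n" "length \<delta> = n" using \<delta> by (auto simp: \<epsilon>_def)
      have Z: "map fst Z = \<delta>" "map snd Z = \<epsilon>" "length Z = n" using le by (auto simp: Z_def)
      have g: "map pair_sum Z = \<gamma>"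
        using \<delta> \<gamma> le by (intro nth_equalityI) (auto simp: Z_def pair_sum_def \<epsilon>_def)
      have "Z \<in> ?Q" using \<delta> nz[OF g] unfolding mem_Collect_eq Let_def \<epsilon>_def[symmetric] mono_pairs_def stuck_def Z by auto
      then show "zip \<delta> (map (%i. \<gamma> ! i - \<delta> ! i) [0..<n]) \<in> {Z \<in> ?Q. map pair_sum Z = \<gamma>}"
        using g by (simp add: Z_def \<epsilon>_def)
    qed
    show "zip (map fst Z) (map (%i. \<gamma> ! i - map fst Z ! i) [0..<n]) = Z" if "Z \<in> {Z \<in> ?Q. map pair_sum Z = \<gamma>}" for Z
    proof -
      have "length Z = n" "map pair_sum Z = \<gamma>" using that L by auto
      then show ?thesis unfolding eps[OF \<open>length Z = n\<close> \<open>map pair_sum Z = \<gamma>\<close>] by (rule_tac zip_map_fst_snd)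
    qed
    show "map fst (zip \<delta> (map (%i. \<gamma> ! i - \<delta> ! i) [0..<n])) = \<delta>" if "\<delta> \<in> ?D" for \<delta>
      using that by simp
  qed
  finally show ?thesis .
qed

end

section \<open>Programs of elementary operators\<close>

text \<open>
  An instruction \<open>(o, i, j)\<close> is a linear operator whose matrix on monomials has entries in
  \<open>{-1, 0, 1}\<close>; the coefficients of the result of a program are signed counts of paths.
\<close>

fun instr :: "nat => nat \<times> nat \<times> nat => cpoly => cpoly" where
  "instr S (x, i, j) f =
     (if x = 1 then divdiff i f
      else if x = 2 then var i * f
      else if x = 3 then (1 - var i) * f
      else if x = 4 then (var j - var i) * f
      else if x = 5 then (\<Sum>k<Suc S. var i ^ k) * f
      else if x = 6 then subst (%l. if l = i then var j else var l) f
      else f)"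

fun valid_instr :: "nat => nat \<times> nat \<times> nat => bool" where
  "valid_instr N (x, i, j) \<longleftrightarrow> (x = 1 --> Suc i < N) & (x = 2 | x = 3 | x = 5 --> i < N) \<and>
     (x = 4 | x = 6 --> i < N & j < N & i ~= j)"

definition agree :: "nat => nat => nat => (nat => nat) => (nat => nat) => bool" where
  "agree N i j a b \<longleftrightarrow> (\<forall>l<N. l ~= i & l ~= j --> b l = a l)"

text \<open>\<open>a\<close> holds the exponents of the source monomial and \<open>b\<close> those
  of the target. In case 1 the order of the two exponents of \<open>a\<close> decides the sign, so
  that positive and negative entries exclude each other.\<close>

definition plus_entry :: "nat => nat => nat => nat => nat => (nat => nat) => (nat => nat) => bool" where
  "plus_entry S N x i j a b \<longleftrightarrow>
     (if x = 1 then agree N i (Suc i) a b & Suc (b i + b (Suc i)) = a i + a (Suc i) \<and>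
        a (Suc i) <= b i & b i < a i
      else if x = 2 then agree N i i a b & b i = Suc (a i)
      else if x = 3 then agree N i i a b & b i = a i
      else if x = 4 then agree N i j a b & b i = a i & b j = Suc (a j)
      else if x = 5 then agree N i i a b & a i <= b i & b i <= a i + S
      else if x = 6 then agree N i j a b & b i = 0 & b j = a i + a j
      else \<forall>l<N. b l = a l)"

definition minus_entry :: "nat => nat => nat => nat => (nat => nat) => (nat => nat) => bool" where
  "minus_entry N x i j a b \<longleftrightarrow>
     (if x = 1 then agree N i (Suc i) a b & Suc (b i + b (Suc i)) = a i + a (Suc i) \<and>
        a i <= b i & b i < a (Suc i)
      else if x = 3 then agree N i i a b & b i = Suc (a i)
      else if x = 4 then agree N i j a b & b i = Suc (a i) & b j = a j
      else False)"

fun entry :: "nat => nat => nat \<times> nat \<times> nat => (nat => nat) => (nat => nat) => int" where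
  "entry S N (x, i, j) a b = of_bool (plus_entry S N x i j a b) - of_bool (minus_entry N x i j a b)"

lemma plus_minus_entry: "\<not> (plus_entry S N x i j a b & minus_entry N x i j a b)"
  by (auto simp: plus_entry_def minus_entry_def)

lemma linmap_instr: "linmap (instr S ins)"
proof (cases ins)
  case (fields x i j)
  have "instr S (x, i, j) =
     (if x = 1 then divdiff i
      else if x = 2 then (%f. var i * f)
      else if x = 3 then (%f. (1 - var i) * f)
      else if x = 4 then (%f. (var j - var i) * f)
      else if x = 5 then (%f. (\<Sum>k<Suc S. var i ^ k) * f)
      else if x = 6 then subst (%l. if l = i then var j else var l)
      else (%f. f))" by (rule ext) simp
  then show ?thesis unfolding fields
    by (simp add: linmap_divdiff linmap_mult ahom_linmap[OF ahom_subst] linmap_id del: sum.lessThan_Suc)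
qed

lemma set2_agree:
  assumes "Suc i < N"
  shows "(\<forall>l<N. b l = look (set2 i \<eta> p q) l) \<longleftrightarrow> agree N i (Suc i) (look \<eta>) b & b i = p & b (Suc i) = q"
proof
  assume L: "\<forall>l<N. b l = look (set2 i \<eta> p q) l"
  have "b i = p" "b (Suc i) = q" using L[rule_format, of i] L[rule_format, of "Suc i"] assms by (simp_all add: look_set2)
  moreover have "agree N i (Suc i) (look \<eta>) b" unfolding agree_def using L by (simp add: look_set2)
  ultimately show "agree N i (Suc i) (look \<eta>) b & b i = p & b (Suc i) = q" by blast
next
  assume R: "agree N i (Suc i) (look \<eta>) b & b i = p & b (Suc i) = q"
  show "\<forall>l<N. b l = look (set2 i \<eta> p q) l"
  proof (intro allI impI)
    fix l assume "l < N"
    then show "b l = look (set2 i \<eta> p q) l"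
      using R by (cases "l = i"; cases "l = Suc i") (simp_all add: look_set2 agree_def)
  qed
qed

definition vanish :: "nat => mono => bool" where
  "vanish N \<eta> \<longleftrightarrow> (\<forall>l\<ge>N. look \<eta> l = 0)"

lemma look_mon_vanish:
  assumes "vanish N \<mu>" "vanish N \<theta>"
  shows "look (mon \<mu>) \<theta> = of_bool (\<forall>l<N. look \<theta> l = look \<mu> l)"
proof -
  have "\<mu> = \<theta> \<longleftrightarrow> (\<forall>l<N. look \<theta> l = look \<mu> l)"
  proof
    assume *: "\<forall>l<N. look \<theta> l = look \<mu> l"
    have "look \<mu> l = look \<theta> l" for l using * assms by (cases "l < N") (auto simp: vanish_def)
    then show "\<mu> = \<theta>" by (intro poly_mapping_eqI)
  qed simp
  then show ?thesis by (simp add: look_mon)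
qed

lemma subst_move_mon:
  "i ~= j ==> subst (%l. if l = i then var j else var l) (mon \<eta>) =
     mon (Poly_Mapping.update i 0 \<eta> + sing j (look \<eta> i))"
proof -
  assume "i ~= j"
  let ?\<phi> = "%l. if l = i then var j else var l" and ?\<theta> = "Poly_Mapping.update i 0 \<eta>"
  have \<eta>: "\<eta> = sing i (look \<eta> i) + ?\<theta>"
    by (rule poly_mapping_eqI) (auto simp: lookup_add lookup_update lookup_single when_def)
  have "subst ?\<phi> (mon ?\<theta>) = mon ?\<theta>"
    unfolding mon_prod ahom_prod[OF ahom_subst]
    by (intro prod.cong) (auto simp: ahom_simps[OF ahom_subst] subst_var in_keys_iff lookup_update)
  moreover have "subst ?\<phi> (mon \<eta>) = subst ?\<phi> (var i ^ look \<eta> i) * subst ?\<phi> (mon ?\<theta>)"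
    by (subst \<eta>) (simp add: mon_add mon_sing ahom_simps[OF ahom_subst])
  ultimately show ?thesis
    by (simp add: ahom_simps[OF ahom_subst] subst_var mon_add mon_sing mult.commute)
qed

lemma sum_of_bool_unique:
  fixes d :: nat
  assumes "\<And>k. k < d ==> P k \<longleftrightarrow> k = k0 & Q"
  shows "(\<Sum>k<d. of_bool (P k)) = (of_bool (k0 < d & Q) :: complex)"
proof -
  have "(\<Sum>k<d. of_bool (P k)) = (\<Sum>k<d. if k = k0 then of_bool Q else (0 :: complex))"
    using assms by (intro sum.cong) auto
  then show ?thesis by simp
qed

lemma instr_mon:
  assumes v: "valid_instr N (x, i, j)" and \<eta>: "vanish N \<eta>"
  shows "look (instr S (x, i, j) (mon \<eta>)) \<theta> =
    (if vanish N \<theta> then of_int (entry S N (x, i, j) (look \<eta>) (look \<theta>)) else 0)"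
proof -
  let ?a = "look \<eta>" and ?b = "look \<theta>"
  have not: "look (mon \<mu>) \<theta> = 0" if "vanish N \<mu>" "\<not> vanish N \<theta>" for \<mu> using that by (auto simp: look_mon)
  have add: "vanish N (\<eta> + sing l k)" "vanish N (sing l k + \<eta>)" if "l < N" for l k
    using \<eta> that by (auto simp: vanish_def lookup_add lookup_single when_def)
  have var: "var l * mon \<eta> = mon (sing l 1 + \<eta>)" for l using mon_sing[of l 1] by (simp add: mon_add)
  consider "x = 1" | "x = 2" | "x = 3" | "x = 4" | "x = 5" | "x = 6" | "x \<notin> {1, 2, 3, 4, 5, 6}" by blast
  then show ?thesis
  proof cases
    case 1
    then have i: "Suc i < N" using v by simp
    let ?A = "?a i" and ?B = "?a (Suc i)"
    define m where "m = min ?A ?B"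
    define d where "d = max ?A ?B - m"
    let ?mu = "%k. set2 i \<eta> (m + k) (m + (d - Suc k))"
    have vs: "vanish N (?mu k)" for k using \<eta> i by (auto simp: vanish_def look_set2)
    define Q where "Q \<longleftrightarrow> agree N i (Suc i) ?a ?b & Suc (?b i + ?b (Suc i)) = ?A + ?B & m <= ?b i"
    have sum: "look (\<Sum>k<d. mon (?mu k)) \<theta> = of_bool (?b i - m < d & Q)" if "vanish N \<theta>"
      unfolding lookup_sum look_mon_vanish[OF vs that]
    proof (rule sum_of_bool_unique)
      fix k assume k: "k < d"
      have md: "m + m + d = ?A + ?B" by (auto simp: m_def d_def)
      have "(\<forall>l<N. ?b l = look (?mu k) l) \<longleftrightarrow> agree N i (Suc i) ?a ?b & ?b i = m + k & ?b (Suc i) = m + (d - Suc k)"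
        using i by (rule set2_agree)
      also have "\<dots> \<longleftrightarrow> k = ?b i - m & Q" using k md by (auto simp: Q_def)
      finally show "(\<forall>l<N. ?b l = look (?mu k) l) \<longleftrightarrow> k = ?b i - m & Q" .
    qed
    have dd: "divdiff i (mon \<eta>) = (if ?B <= ?A then \<Sum>k<d. mon (?mu k) else - (\<Sum>k<d. mon (?mu k)))"
      by (simp add: divdiff_mon_eq divdiff_mon_def Let_def m_def d_def)
    show ?thesis
    proof (cases "vanish N \<theta>")
      case True
      then show ?thesis using 1 sum[OF True]
        by (auto simp: dd plus_entry_def minus_entry_def Q_def m_def d_def of_bool_def split: if_splits)
    next
      case False
      then have "look (\<Sum>k<d. mon (?mu k)) \<theta> = 0"
        unfolding lookup_sum using not[OF vs False] by (intro sum.neutral) blast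
      then show ?thesis using 1 False by (simp add: dd)
    qed
  next
    case 2
    then show ?thesis using v add(2)[of i 1] not[OF add(2)[of i 1]] look_mon_vanish[OF add(2)[of i 1], of \<theta>]
      by (auto simp: var plus_entry_def minus_entry_def agree_def lookup_add lookup_single when_def split: if_splits)
  next
    case 3
    have "(1 - var i) * mon \<eta> = mon \<eta> - mon (sing i 1 + \<eta>)" by (simp add: left_diff_distrib var)
    then show ?thesis using 3 v not[OF \<eta>] not[OF add(2)[of i 1]] look_mon_vanish[OF \<eta>, of \<theta>] look_mon_vanish[OF add(2)[of i 1], of \<theta>]
      by (auto simp: lookup_minus plus_entry_def minus_entry_def agree_def lookup_add lookup_single when_def split: if_splits)
  next
    case 4
    have "(var j - var i) * mon \<eta> = mon (sing j 1 + \<eta>) - mon (sing i 1 + \<eta>)" by (simp add: left_diff_distrib var)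
    then show ?thesis using 4 v not[OF add(2)[of j 1]] not[OF add(2)[of i 1]]
        look_mon_vanish[OF add(2)[of j 1], of \<theta>] look_mon_vanish[OF add(2)[of i 1], of \<theta>]
      by (auto simp: lookup_minus plus_entry_def minus_entry_def agree_def lookup_add lookup_single when_def split: if_splits)
  next
    case 5
    then have i: "i < N" using v by simp
    have eq: "(\<Sum>k<Suc S. var i ^ k) * mon \<eta> = (\<Sum>k<Suc S. mon (sing i k + \<eta>))"
      by (simp add: sum_distrib_right mon_add mon_sing del: sum.lessThan_Suc)
    show ?thesis
    proof (cases "vanish N \<theta>")
      case True
      have "look (\<Sum>k<Suc S. mon (sing i k + \<eta>)) \<theta> = of_bool (?b i - ?a i < Suc S & (agree N i i ?a ?b & ?a i <= ?b i))"
        unfolding lookup_sum look_mon_vanish[OF add(2)[OF i] True]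
      proof (rule sum_of_bool_unique)
        fix k
        show "(\<forall>l<N. ?b l = look (sing i k + \<eta>) l) \<longleftrightarrow> k = ?b i - ?a i & agree N i i ?a ?b & ?a i <= ?b i"
          using i by (auto simp: agree_def lookup_add lookup_single when_def)
      qed
      then show ?thesis using 5 True by (auto simp: eq plus_entry_def minus_entry_def simp del: sum.lessThan_Suc)
    next
      case False
      then have "look (\<Sum>k<Suc S. mon (sing i k + \<eta>)) \<theta> = 0" using not[OF add(2)[OF i] False] by (simp add: lookup_sum del: sum.lessThan_Suc)
      then show ?thesis using 5 False by (simp add: eq del: sum.lessThan_Suc)
    qed
  next
    case 6
    then have ij: "i < N" "j < N" "i ~= j" using v by auto
    let ?\<mu> = "Poly_Mapping.update i 0 \<eta> + sing j (?a i)"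
    have vs: "vanish N ?\<mu>" using \<eta> ij by (auto simp: vanish_def lookup_add lookup_update lookup_single when_def)
    show ?thesis using 6 ij not[OF vs] look_mon_vanish[OF vs, of \<theta>]
      by (auto simp: subst_move_mon plus_entry_def minus_entry_def agree_def lookup_add lookup_update lookup_single when_def split: if_splits)
  next
    case 7
    then show ?thesis using not[OF \<eta>] look_mon_vanish[OF \<eta>, of \<theta>]
      by (auto simp: plus_entry_def minus_entry_def)
  qed
qed

text \<open>\<open>Suc S\<close> covers both the truncated geometric series, which adds at most
  \<open>S\<close>, and all other instructions, which add at most 1.\<close>

lemma entry_degree:
  assumes "valid_instr N (x, i, j)" "entry S N (x, i, j) a b ~= 0"
  shows "(\<Sum>l<N. b l) <= (\<Sum>l<N. a l) + Suc S"
proof -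
  have e: "plus_entry S N x i j a b | minus_entry N x i j a b" using assms(2) by (auto split: if_splits)
  have one: "(\<Sum>l<N. b l) <= (\<Sum>l<N. a l) + Suc S" if "agree N i i a b" "b i <= a i + Suc S" "i < N"
  proof -
    have "(\<Sum>l\<in>{..<N} - {i}. b l) = (\<Sum>l\<in>{..<N} - {i}. a l)" using that(1) by (intro sum.cong) (auto simp: agree_def)
    then show ?thesis using that(2,3) by (simp add: sum.remove[of "{..<N}" i])
  qed
  have two: "(\<Sum>l<N. b l) <= (\<Sum>l<N. a l) + Suc S"
    if "agree N i k a b" "b i + b k <= a i + a k + Suc S" "i < N" "k < N" "i ~= k" for k
  proof -
    have "(\<Sum>l\<in>{..<N} - {i} - {k}. b l) = (\<Sum>l\<in>{..<N} - {i} - {k}. a l)"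
      using that(1) by (intro sum.cong) (auto simp: agree_def)
    moreover have "(\<Sum>l<N. g l) = g i + (g k + (\<Sum>l\<in>{..<N} - {i} - {k}. g l))" for g :: "nat => nat"
      using that(3-5) by (simp add: sum.remove[of "{..<N}" i] sum.remove[of "{..<N} - {i}" k])
    ultimately show ?thesis using that(2) by simp
  qed
  consider "x = 1" | "x = 2" | "x = 3" | "x = 4" | "x = 5" | "x = 6" | "x \<notin> {1, 2, 3, 4, 5, 6}" by blast
  then show ?thesis
  proof cases
    case 1
    then show ?thesis using e assms(1) by (intro two[of "Suc i"]) (auto simp: plus_entry_def minus_entry_def)
  next
    case 4
    then show ?thesis using e assms(1) by (intro two[of j]) (auto simp: plus_entry_def minus_entry_def)
  next
    case 6
    then show ?thesis using e assms(1) by (intro two[of j]) (auto simp: plus_entry_def minus_entry_def)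
  next
    case 7
    then have "(\<Sum>l<N. b l) = (\<Sum>l<N. a l)" using e by (intro sum.cong) (auto simp: plus_entry_def minus_entry_def)
    then show ?thesis by simp
  next
    case 2
    then show ?thesis using e assms(1) by (intro one) (auto simp: plus_entry_def minus_entry_def)
  next
    case 3
    then show ?thesis using e assms(1) by (intro one) (auto simp: plus_entry_def minus_entry_def)
  next
    case 5
    then show ?thesis using e assms(1) by (intro one) (auto simp: plus_entry_def minus_entry_def)
  qed
qed

section \<open>Coefficients as sums over paths\<close>

lemma finite_tables: "finite (tables l M)"
  using finite_lists_length_eq[of "{..M}" l] by (simp add: tables_def conj_commute)

lemma sum_tables_append:
  "(\<Sum>t\<in>tables (a + b) M. f t) = (\<Sum>t\<in>tables a M. \<Sum>u\<in>tables b M. f (t @ u))"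
proof -
  have "(\<Sum>t\<in>tables a M. \<Sum>u\<in>tables b M. f (t @ u)) = (\<Sum>(t, u)\<in>tables a M \<times> tables b M. f (t @ u))"
    by (rule sum.cartesian_product)
  also have "\<dots> = (\<Sum>t\<in>tables (a + b) M. f t)"
    by (rule sum.reindex_bij_witness[of _ "%t. (take a t, drop a t)" "%(t, u). t @ u"])
      (auto simp: tables_def dest: in_set_takeD in_set_dropD)
  finally show ?thesis by simp
qed

text \<open>The degree is bounded rather than fixed: only variables below \<open>N\<close> occur, in
  total degree at most \<open>D\<close>.\<close>

definition homog :: "nat => nat => cpoly => bool" where
  "homog N D p \<longleftrightarrow> (\<forall>\<eta>\<in>supp p. vanish N \<eta> & (\<Sum>l<N. look \<eta> l) <= D)"

lemma look_instr:
  assumes v: "valid_instr N ins" and h: "homog N M p" and \<theta>: "vanish N \<theta>"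
  shows "look (instr S ins p) \<theta> =
    (\<Sum>t\<in>tables N M. of_int (entry S N ins (%l. t ! l) (look \<theta>)) * look p (Poly_Mapping.nth t))"
proof -
  obtain x i j where ins: "ins = (x, i, j)" by (cases ins)
  have rows: "supp p \<subseteq> Poly_Mapping.nth ` tables N M"
  proof
    fix \<eta> assume "\<eta> \<in> supp p"
    then have \<eta>: "vanish N \<eta>" "(\<Sum>l<N. look \<eta> l) <= M" using h by (auto simp: homog_def)
    have "look \<eta> l <= M" if "l < N" for l
      using member_le_sum[of l "{..<N}" "look \<eta>"] that \<eta>(2) by simp
    then have "map (look \<eta>) [0..<N] \<in> tables N M" by (auto simp: tables_def)
    moreover have "\<eta> = Poly_Mapping.nth (map (look \<eta>) [0..<N])"
      using \<eta>(1) by (intro poly_mapping_eqI) (auto simp: look_nth vanish_def)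
    ultimately show "\<eta> \<in> Poly_Mapping.nth ` tables N M" by blast
  qed
  have inj: "inj_on Poly_Mapping.nth (tables N M)"
  proof (rule inj_onI)
    fix s t :: "nat list" assume st: "s \<in> tables N M" "t \<in> tables N M" "Poly_Mapping.nth s = Poly_Mapping.nth t"
    show "s = t"
    proof (rule nth_equalityI)
      fix l assume "l < length s"
      then show "s ! l = t ! l" using st(1,2) arg_cong[OF st(3), of "%p. look p l"] by (simp add: look_nth tables_def)
    qed (use st in \<open>auto simp: tables_def\<close>)
  qed
  have "look (instr S ins p) \<theta> = (\<Sum>\<eta>\<in>supp p. look p \<eta> * look (instr S ins (mon \<eta>)) \<theta>)"
    by (subst linmap_expand[OF linmap_instr]) (simp add: lookup_sum look_scale)
  also have "\<dots> = (\<Sum>\<eta>\<in>Poly_Mapping.nth ` tables N M. look p \<eta> * look (instr S ins (mon \<eta>)) \<theta>)"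
    using rows by (intro sum.mono_neutral_left) (auto simp: finite_tables in_keys_iff)
  also have "\<dots> = (\<Sum>t\<in>tables N M. look p (Poly_Mapping.nth t) * look (instr S ins (mon (Poly_Mapping.nth t))) \<theta>)"
    using inj by (simp add: sum.reindex)
  also have "\<dots> = (\<Sum>t\<in>tables N M. of_int (entry S N ins (%l. t ! l) (look \<theta>)) * look p (Poly_Mapping.nth t))"
  proof (rule sum.cong[OF refl])
    fix t assume t: "t \<in> tables N M"
    then have vt: "vanish N (Poly_Mapping.nth t)" by (auto simp: vanish_def look_nth tables_def)
    have eq: "entry S N (x, i, j) (look (Poly_Mapping.nth t)) b = entry S N (x, i, j) (%l. t ! l) b" for b
      using t v unfolding ins by (auto simp: plus_entry_def minus_entry_def agree_def look_nth tables_def)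
    show "look p (Poly_Mapping.nth t) * look (instr S ins (mon (Poly_Mapping.nth t))) \<theta> =
        of_int (entry S N ins (%l. t ! l) (look \<theta>)) * look p (Poly_Mapping.nth t)"
      using instr_mon[OF v[unfolded ins] vt, of S \<theta>] \<theta> unfolding ins eq by (simp only: if_True mult.commute)
  qed
  finally show ?thesis .
qed

lemma homog_instr:
  assumes v: "valid_instr N ins" and h: "homog N D p"
  shows "homog N (D + Suc S) (instr S ins p)"
  unfolding homog_def
proof (intro ballI)
  obtain x i j where ins: "ins = (x, i, j)" by (cases ins)
  fix \<theta> assume "\<theta> \<in> supp (instr S ins p)"
  from supp_linmap[OF linmap_instr this] obtain \<eta> where \<eta>: "\<eta> \<in> supp p" "look (instr S ins (mon \<eta>)) \<theta> ~= 0"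
    by (auto simp: in_keys_iff)
  have vh: "vanish N \<eta>" "(\<Sum>l<N. look \<eta> l) <= D" using h \<eta>(1) by (auto simp: homog_def)
  have "vanish N \<theta>" "entry S N (x, i, j) (look \<eta>) (look \<theta>) ~= 0"
    using \<eta>(2) unfolding ins instr_mon[OF v[unfolded ins] vh(1)] by (auto simp del: entry.simps split: if_splits)
  moreover from this(2) have "(\<Sum>l<N. look \<theta> l) <= (\<Sum>l<N. look \<eta> l) + Suc S"
    using entry_degree[OF v[unfolded ins]] by blast
  ultimately show "vanish N \<theta> & (\<Sum>l<N. look \<theta> l) <= D + Suc S" using vh by simp
qed

text \<open>\<open>t\<close> is read as a matrix with rows of length \<open>N\<close>, and row
  \<open>r\<close> holds the exponents after \<open>r\<close> instructions.\<close>

definition path_weight :: "nat => nat => (nat \<times> nat \<times> nat) list => (nat => nat) => (nat => nat) => int" where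
  "path_weight S N is a t = of_bool (\<forall>l<N. t l = a l) *
     (\<Prod>r<length is. entry S N (is ! r) (%l. t (r * N + l)) (%l. t (Suc r * N + l)))"

lemma entry_cong:
  assumes "valid_instr N (x, i, j)" "\<And>l. l < N ==> a l = a' l" "\<And>l. l < N ==> b l = b' l"
  shows "entry S N (x, i, j) a b = entry S N (x, i, j) a' b'"
proof -
  have ag: "agree N k l a b = agree N k l a' b'" for k l using assms(2,3) by (simp add: agree_def)
  have eq: "k < N ==> a k = a' k & b k = b' k" for k using assms(2,3) by simp
  have all: "(\<forall>l<N. b l = a l) = (\<forall>l<N. b' l = a' l)" using assms(2,3) by simp
  have "plus_entry S N x i j a b = plus_entry S N x i j a' b'"
    unfolding plus_entry_def ag all by (intro if_cong refl; use assms(1) eq[of i] eq[of j] eq[of "Suc i"] in simp)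
  moreover have "minus_entry N x i j a b = minus_entry N x i j a' b'"
    unfolding minus_entry_def ag by (intro if_cong refl; use assms(1) eq[of i] eq[of j] eq[of "Suc i"] in simp)
  ultimately show ?thesis by simp
qed

text \<open>Matrix multiplication: a coefficient of a composition is a sum over the intermediate
  monomials, and the degree bound keeps their exponents within \<open>M\<close>. The final row is
  \<open>b\<close> and is not summed over.\<close>

lemma run_path_sum:
  assumes "\<forall>ins\<in>set is. valid_instr N ins" "homog N D (mon a)" "D + length is * Suc S <= M" "b \<in> tables N M"
  shows "look (fold (instr S) is (mon a)) (Poly_Mapping.nth b) =
      of_int (\<Sum>t\<in>tables (length is * N) M. path_weight S N is (look a) (%j. (t @ b) ! j))
    & homog N (D + length is * Suc S) (fold (instr S) is (mon a))"
  using assms(1,3,4)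
proof (induction "is" arbitrary: b rule: rev_induct)
  case Nil
  have va: "vanish N a" using assms(2) by (auto simp: homog_def mon_def)
  moreover have "vanish N (Poly_Mapping.nth b)" using Nil by (auto simp: vanish_def look_nth tables_def)
  ultimately have "look (mon a) (Poly_Mapping.nth b) = of_bool (\<forall>l<N. b ! l = look a l)"
    using Nil by (auto simp: look_mon_vanish look_nth tables_def)
  moreover have "tables 0 M = {[]}" by (auto simp: tables_def)
  ultimately show ?case using assms(2) by (simp add: path_weight_def)
next
  case (snoc ins "is")
  let ?R = "length is"
  let ?p = "fold (instr S) is (mon a)"
  have v: "valid_instr N ins" "\<forall>ins\<in>set is. valid_instr N ins" using snoc.prems(1) by auto
  have M: "D + ?R * Suc S <= M" using snoc.prems(2) by simp
  note IH = snoc.IH[OF v(2) M]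
  have b: "length b = N" using snoc.prems(3) by (simp add: tables_def)
  have "replicate N 0 \<in> tables N M" by (auto simp: tables_def)
  with IH have hp: "homog N (D + ?R * Suc S) ?p" by blast
  then have hM: "homog N M ?p" using M by (auto simp: homog_def)
  have vb: "vanish N (Poly_Mapping.nth b)" using b by (auto simp: vanish_def look_nth)
  have len: "length (is @ [ins]) * N = ?R * N + N" by simp
  obtain x i j where ins: "ins = (x, i, j)" by (cases ins)
  have "look (fold (instr S) (is @ [ins]) (mon a)) (Poly_Mapping.nth b) =
      (\<Sum>t\<in>tables N M. of_int (entry S N ins (%l. t ! l) (look (Poly_Mapping.nth b))) * look ?p (Poly_Mapping.nth t))"
    using look_instr[OF v(1) hM vb] by simp
  also have "\<dots> = (\<Sum>t\<in>tables N M. \<Sum>u\<in>tables (?R * N) M.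
      of_int (path_weight S N (is @ [ins]) (look a) (%j. (u @ t @ b) ! j)))"
  proof (rule sum.cong[OF refl])
    fix t assume t: "t \<in> tables N M"
    then have lt: "length t = N" by (simp add: tables_def)
    have "look ?p (Poly_Mapping.nth t) =
        of_int (\<Sum>u\<in>tables (?R * N) M. path_weight S N is (look a) (%j. (u @ t) ! j))"
      using IH t by blast
    moreover have "path_weight S N (is @ [ins]) (look a) (%j. (u @ t @ b) ! j) =
        entry S N ins (%l. t ! l) (look (Poly_Mapping.nth b)) * path_weight S N is (look a) (%j. (u @ t) ! j)"
      if u: "u \<in> tables (?R * N) M" for u
    proof -
      have lu: "length u = ?R * N" using u by (simp add: tables_def)
      have low: "(u @ t @ b) ! j = (u @ t) ! j" if "j < Suc ?R * N" for j
        using that lu lt nth_append[of "u @ t" b j] by simp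
      have e1: "entry S N ins (%l. (u @ t @ b) ! (?R * N + l)) (%l. (u @ t @ b) ! (Suc ?R * N + l)) =
          entry S N ins (%l. t ! l) (look (Poly_Mapping.nth b))"
        unfolding ins by (rule entry_cong[OF v(1)[unfolded ins]]) (use lu lt b in \<open>auto simp: nth_append look_nth\<close>)
      have e2: "entry S N (is ! r) (%l. (u @ t @ b) ! (r * N + l)) (%l. (u @ t @ b) ! (Suc r * N + l)) =
          entry S N (is ! r) (%l. (u @ t) ! (r * N + l)) (%l. (u @ t) ! (Suc r * N + l))" if r: "r < ?R" for r
      proof -
        obtain x' i' j' where ir: "is ! r = (x', i', j')" by (cases "is ! r")
        have "valid_instr N (x', i', j')" using v(2) r ir by (metis nth_mem)
        moreover have "r * N + l < Suc ?R * N" "Suc r * N + l < Suc ?R * N" if "l < N" for l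
        proof -
          have "Suc (Suc r) * N <= Suc ?R * N" using r by (intro mult_right_mono) auto
          then show "r * N + l < Suc ?R * N" "Suc r * N + l < Suc ?R * N" using that by auto
        qed
        ultimately show ?thesis unfolding ir using low by (intro entry_cong) auto
      qed
      have e3: "(\<forall>l<N. (u @ t @ b) ! l = look a l) \<longleftrightarrow> (\<forall>l<N. (u @ t) ! l = look a l)"
        using low by simp
      have "(\<Prod>r<length (is @ [ins]). entry S N ((is @ [ins]) ! r) (%l. (u @ t @ b) ! (r * N + l)) (%l. (u @ t @ b) ! (Suc r * N + l)))
          = entry S N ins (%l. t ! l) (look (Poly_Mapping.nth b)) *
            (\<Prod>r<?R. entry S N (is ! r) (%l. (u @ t) ! (r * N + l)) (%l. (u @ t) ! (Suc r * N + l)))"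
      proof -
        have "(\<Prod>r<length (is @ [ins]). h ((is @ [ins]) ! r) r) = h ins ?R * (\<Prod>r<?R. h (is ! r) r)"
          for h :: "nat \<times> nat \<times> nat => nat => int"
        proof -
          have "(\<Prod>r<?R. h ((is @ [ins]) ! r) r) = (\<Prod>r<?R. h (is ! r) r)"
            by (intro prod.cong) (auto simp: nth_append)
          then show ?thesis by (simp add: mult.commute)
        qed
        from this[of "%i r. entry S N i (%l. (u @ t @ b) ! (r * N + l)) (%l. (u @ t @ b) ! (Suc r * N + l))"]
        show ?thesis using e1 e2 by (simp only:) (intro arg_cong2[where f = "(*)"] prod.cong; simp only: lessThan_iff)
      qed
      then show ?thesis unfolding path_weight_def e3 by (simp only: mult.left_commute)
    qed
    ultimately show "of_int (entry S N ins (%l. t ! l) (look (Poly_Mapping.nth b))) * look ?p (Poly_Mapping.nth t) =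
        (\<Sum>u\<in>tables (?R * N) M. of_int (path_weight S N (is @ [ins]) (look a) (%j. (u @ t @ b) ! j)))"
      by (simp add: sum_distrib_left)
  qed
  also have "\<dots> = of_int (\<Sum>t\<in>tables (length (is @ [ins]) * N) M.
      path_weight S N (is @ [ins]) (look a) (%j. (t @ b) ! j))"
    unfolding len sum_tables_append by (subst sum.swap) (simp only: of_int_sum append_assoc)
  finally have "look (fold (instr S) (is @ [ins]) (mon a)) (Poly_Mapping.nth b) = \<dots>" .
  moreover have "homog N (D + length (is @ [ins]) * Suc S) (fold (instr S) (is @ [ins]) (mon a))"
    using homog_instr[OF v(1) hp, of S] by (simp add: ac_simps)
  ultimately show ?case by blast
qed

section \<open>Programs for products and dual functionals\<close>

lemma fold_concat_map: "fold f (concat (map g xs)) = fold (%x. fold f (g x)) xs"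
  by (induction xs) (auto simp: fun_eq_iff)

lemma fold_if_filter: "fold (%x. if P x then f x else id) xs = fold f (filter P xs)"
  by (induction xs) auto

lemma filter_less_upt: "q <= n ==> filter (%j. j < q) [0..<n] = [0..<q]"
proof (induction n)
  case (Suc n)
  then show ?case by (cases "q = Suc n") (auto simp: filter_id_conv)
qed simp

lemma vanish_nth: "length \<alpha> <= m ==> vanish m (Poly_Mapping.nth \<alpha>)"
  by (auto simp: vanish_def look_nth)

lemma homog_fold:
  assumes "\<forall>ins\<in>set is. valid_instr m ins" "homog m D p"
  shows "\<exists>D'. homog m D' (fold (instr S) is p)"
  using assms
proof (induction "is" arbitrary: p D)
  case (Cons ins "is")
  then show ?case using homog_instr[of m ins D p S] by fastforce
qed auto

lemma linmap_agree:
  assumes "linmap F" "linmap G" "\<And>\<eta>. \<eta> \<in> supp p ==> F (mon \<eta>) = G (mon \<eta>)"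
  shows "F p = G p"
  unfolding linmap_expand[OF assms(1), of p] linmap_expand[OF assms(2), of p] using assms(3) by simp

lemma subst_homog:
  assumes "homog m D p" "\<And>i. i < m ==> \<phi> i = var i"
  shows "subst \<phi> p = p"
proof (rule linmap_agree[where G = "%p. p"])
  fix \<eta> assume "\<eta> \<in> supp p"
  then have "vanish m \<eta>" using assms(1) by (simp add: homog_def)
  then have "look \<eta> i = 0" if "\<not> i < m" for i using that by (simp add: vanish_def)
  then have "i < m" if "i \<in> supp \<eta>" for i using that by (metis in_keys_iff)
  then show "subst \<phi> (mon \<eta>) = mon \<eta>"
    unfolding mon_prod ahom_prod[OF ahom_subst] using assms(2)
    by (intro prod.cong) (auto simp: ahom_simps[OF ahom_subst] subst_var)
qed (auto intro: ahom_linmap[OF ahom_subst] linmap_id)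

lemma swap_homog:
  assumes "homog m D p" "m <= i"
  shows "swap_vars i p = p"
proof (rule linmap_agree[where G = "%p. p"])
  fix \<eta> assume "\<eta> \<in> supp p"
  then have "vanish m \<eta>" using assms(1) by (simp add: homog_def)
  then have "swap_mono i \<eta> = \<eta>"
    using assms(2) by (intro poly_mapping_eqI) (auto simp: look_swap_mono vanish_def transpose_def)
  then show "swap_vars i (mon \<eta>) = mon \<eta>" by (simp add: swap_vars_mon)
qed (auto intro: ahom_linmap[OF ahom_swap] linmap_id)

section \<open>A second copy of the variables\<close>

definition shift :: "nat => cpoly => cpoly" where
  "shift m = subst (%i. var (m + i))"

lemma ahom_shift: "ahom (shift m)"
  unfolding shift_def by (rule ahom_subst)

lemma shift_var: "shift m (var i) = var (m + i)"
  by (simp add: shift_def subst_var)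

lemma swap_shift: "swap_vars (m + i) (shift m h) = shift m (swap_vars i h)"
  by (rule ahom_eqI[OF ahom_comp[OF ahom_swap ahom_shift] ahom_comp[OF ahom_shift ahom_swap]])
    (auto simp: shift_var swap_vars_var transpose_def)

lemma swap_shift_below: "Suc i < m ==> swap_vars i (shift m h) = shift m h"
  by (rule ahom_eqI[OF ahom_comp[OF ahom_swap ahom_shift] ahom_shift])
    (auto simp: shift_var swap_vars_var transpose_def)

lemma divdiff_shift: "divdiff (m + i) (shift m h) = shift m (divdiff i h)"
proof (rule divdiff_eqI)
  have "shift m (xdiff i * divdiff i h) = shift m (h - swap_vars i h)" by (simp add: xdiff_divdiff)
  then show "xdiff (m + i) * shift m (divdiff i h) = shift m h - swap_vars (m + i) (shift m h)"
    by (simp add: ahom_simps[OF ahom_shift] swap_shift xdiff_def shift_var)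
qed

lemma xpow_append: "xpow (\<alpha> @ \<beta>) = xpow \<alpha> * shift (length \<alpha>) (xpow \<beta>)"
proof -
  have "xpow (\<alpha> @ \<beta>) = (\<Prod>l<length \<alpha> + length \<beta>. var l ^ ((\<alpha> @ \<beta>) ! l))" by (simp add: xpow_prod)
  also have "\<dots> = (\<Prod>l<length \<alpha>. var l ^ ((\<alpha> @ \<beta>) ! l)) * (\<Prod>l<length \<beta>. var (length \<alpha> + l) ^ ((\<alpha> @ \<beta>) ! (length \<alpha> + l)))"
  proof -
    have "(\<Prod>l<p + q. g l) = (\<Prod>l<p. g l) * (\<Prod>l<q. g (p + l))" for g :: "nat => cpoly" and p q
      by (induction q) (auto simp: mult.assoc)
    then show ?thesis .
  qed
  also have "\<dots> = xpow \<alpha> * shift (length \<alpha>) (xpow \<beta>)"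
    unfolding xpow_prod ahom_prod[OF ahom_shift]
    by (intro arg_cong2[where f = "(*)"] prod.cong) (auto simp: nth_append ahom_simps[OF ahom_shift] shift_var)
  finally show ?thesis .
qed

text \<open>Multiplying before the divided difference, with the two variables of \<open>bfac\<close>
  exchanged, gives the complementary operator \<open>T + tau\<close>. The order of the elementary
  instructions thus selects between the two operators.\<close>

lemma divdiff_T:
  assumes "s <= 1"
  shows "divdiff i (bfac s t (Suc i) i * f) = T s t i f + of_nat (tau s t) * f"
proof -
  have "divdiff i (swap_vars i g) = - divdiff i g" for g
    by (rule divdiff_eqI) (simp add: xdiff_divdiff)
  then have "divdiff i (swap_vars i (bfac s t i (Suc i)) * f) = - divdiff i (bfac s t i (Suc i)) * f + bfac s t i (Suc i) * divdiff i f"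
    by (subst divdiff_mult) simp
  then show ?thesis using assms by (simp add: swap_bfac divdiff_bfac T_def)
qed

text \<open>\<open>d\<close> selects \<open>T + tau\<close> instead of \<open>T\<close>. Absent
  factors and inactive steps are padded with identity instructions (code 0), so every step has
  length 3 and any instruction of a program is located by division with remainder.\<close>

definition step_prog :: "nat => nat => bool => bool => nat => (nat \<times> nat \<times> nat) list" where
  "step_prog s t d act i =
    (if d then [(if act & s = 1 then 2 else 0, i, 0), (if act & t = 1 then 3 else 0, Suc i, 0), (if act then 1 else 0, i, 0)]
     else [(if act then 1 else 0, i, 0), (if act & s = 1 then 2 else 0, Suc i, 0), (if act & t = 1 then 3 else 0, i, 0)])"

lemma step_prog_inactive: "fold (instr S) (step_prog s t d False i) = id"
  by (auto simp: step_prog_def fun_eq_iff)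

lemma step_prog_active:
  assumes "s <= 1" "t <= 1"
  shows "fold (instr S) (step_prog s t d True i) f = T s t i f + of_nat (if d then tau s t else 0) * f"
proof -
  have st: "s = 0 | s = 1" "t = 0 | t = 1" using assms by auto
  have "fold (instr S) (step_prog s t False True i) f = T s t i f"
    using st by (auto simp: step_prog_def T_def bfac_def algebra_simps)
  moreover have "fold (instr S) (step_prog s t True True i) f = divdiff i (bfac s t (Suc i) i * f)"
    using st by (auto simp: step_prog_def bfac_def algebra_simps)
  ultimately show ?thesis using divdiff_T[OF assms(1)] by simp
qed

lemma step_prog_valid: "(act ==> Suc i < N) ==> \<forall>ins\<in>set (step_prog s t d act i). valid_instr N ins"
  by (auto simp: step_prog_def split: if_splits)

lemma length_step_prog [simp]: "length (step_prog s t d act i) = 3"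
  by (simp add: step_prog_def)

text \<open>Both loops have the fixed length \<open>m\<close>. The test
  \<open>m - Suc j < q k\<close> cuts out a round of \<open>rank_word\<close>, running through its
  letters in decreasing order; \<open>off\<close> chooses the set of variables.\<close>

definition up_prog :: "nat => nat => bool => nat => nat => (nat => nat) => (nat \<times> nat \<times> nat) list" where
  "up_prog s t d m off q = concat (map (%k. concat (map (%j.
     step_prog s t d (m - Suc j < q k) (off + (k + (m - Suc j)))) [0..<m])) [0..<m])"

text \<open>The rounds come in reverse and each of them increases, because \<open>foldr\<close>
  applies the last letter of a word first.\<close>

definition down_prog :: "nat => nat => bool => nat => nat => (nat => nat) => (nat \<times> nat \<times> nat) list" where
  "down_prog s t d n m p = concat (map (%k. concat (map (%j.
     step_prog s t d (j < p (n - Suc k)) (n - Suc k + j)) [0..<m])) [0..<n])"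

definition move_prog :: "nat => (nat \<times> nat \<times> nat) list" where
  "move_prog m = concat (map (%k. [(6, m + k, k)]) [0..<m])"

definition weight_prog :: "nat => nat => (nat \<times> nat \<times> nat) list" where
  "weight_prog t n = concat (map (%i. concat (map (%j.
     [(if i < j then 4 else 0, i, j), (if i < j & t = 1 then 5 else 0, i, 0)]) [0..<n])) [0..<n])"

lemma map_diff_Suc_upt: "map (%j. m - Suc j) [0..<m] = rev [0..<m]"
  by (rule nth_equalityI) (auto simp: rev_nth)

lemma up_prog_valid:
  assumes "\<And>k. k < m ==> k + q k < m"
  shows "\<forall>ins\<in>set (up_prog s t d m off q). valid_instr (off + m) ins"
proof
  fix ins assume "ins \<in> set (up_prog s t d m off q)"
  then obtain k j where kj: "k < m" "j < m" "ins \<in> set (step_prog s t d (m - Suc j < q k) (off + (k + (m - Suc j))))"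
    by (auto simp: up_prog_def)
  have "Suc (off + (k + (m - Suc j))) < off + m" if "m - Suc j < q k" using assms[OF kj(1)] that by simp
  with step_prog_valid kj(3) show "valid_instr (off + m) ins" by blast
qed

lemma down_prog_valid:
  assumes "\<And>k. k < n ==> k + p k < N"
  shows "\<forall>ins\<in>set (down_prog s t d n m p). valid_instr N ins"
proof
  fix ins assume "ins \<in> set (down_prog s t d n m p)"
  then obtain k j where kj: "k < n" "j < m" "ins \<in> set (step_prog s t d (j < p (n - Suc k)) (n - Suc k + j))"
    by (auto simp: down_prog_def)
  have "Suc (n - Suc k + j) < N" if "j < p (n - Suc k)" using assms[of "n - Suc k"] kj(1) that by simp
  with step_prog_valid kj(3) show "valid_instr N ins" by blast
qed

lemma move_prog_valid: "\<forall>ins\<in>set (move_prog m). valid_instr (2 * m) ins"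
  by (auto simp: move_prog_def)

lemma weight_prog_valid: "n <= N ==> \<forall>ins\<in>set (weight_prog t n). valid_instr N ins"
  by (auto simp: weight_prog_def split: if_splits)

lemma valid_instr_mono: "valid_instr N ins ==> N <= N' ==> valid_instr N' ins"
  by (cases ins) auto

context ops
begin

abbreviation dE :: bool where "dE \<equiv> c ~= 0"
abbreviation dF :: bool where "dF \<equiv> c = 0"

lemma step_prog_E: "fold (instr S) (step_prog s t dE act i) = (if act then E i else id)"
  using c step_prog_active[OF s t, of S dE i] step_prog_inactive
  by (cases act) (auto simp: fun_eq_iff E_def)

lemma step_prog_F: "fold (instr S) (step_prog s t dF act i) = (if act then F i else id)"
  using c step_prog_active[OF s t, of S dF i] step_prog_inactive
  by (cases act) (auto simp: fun_eq_iff F_def)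

lemma up_prog_fold:
  assumes "\<And>k. k < m ==> q k <= m"
  shows "fold (instr S) (up_prog s t dE m off q) = fold (%i. E (off + i)) (rank_word m q)"
proof -
  have inner: "fold (instr S) (concat (map (%j. step_prog s t dE (m - Suc j < q k) (off + (k + (m - Suc j)))) [0..<m]))
      = fold (%i. E (off + i)) (map (%j. k + j) (rev [0..<q k]))" if k: "k < m" for k
  proof -
    have "fold (instr S) (concat (map (%j. step_prog s t dE (m - Suc j < q k) (off + (k + (m - Suc j)))) [0..<m]))
        = fold (%j. if m - Suc j < q k then E (off + (k + (m - Suc j))) else id) [0..<m]"
      unfolding fold_concat_map step_prog_E ..
    also have "\<dots> = fold (%j. if j < q k then E (off + (k + j)) else id) (map (%j. m - Suc j) [0..<m])"
      unfolding fold_map comp_def ..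
    also have "\<dots> = fold (%j. E (off + (k + j))) (rev [0..<q k])"
      unfolding map_diff_Suc_upt fold_if_filter rev_filter[symmetric] filter_less_upt[OF assms[OF k]] ..
    finally show ?thesis by (simp add: fold_map comp_def)
  qed
  have "fold (instr S) (up_prog s t dE m off q) = fold (%k. fold (instr S)
      (concat (map (%j. step_prog s t dE (m - Suc j < q k) (off + (k + (m - Suc j)))) [0..<m]))) [0..<m]"
    unfolding up_prog_def by (rule fold_concat_map)
  also have "\<dots> = fold (%k. fold (%i. E (off + i)) (map (%j. k + j) (rev [0..<q k]))) [0..<m]"
    by (rule ext, rule fold_cong[OF refl refl inner]) simp
  also have "\<dots> = fold (%i. E (off + i)) (rank_word m q)"
    unfolding rank_word_def by (rule fold_concat_map[symmetric])
  finally show ?thesis .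
qed

lemma down_prog_fold:
  assumes "\<And>k. k < n ==> p k <= m"
  shows "fold (instr S) (down_prog s t dF n m p) = foldr F (rank_word n p)"
proof -
  have inner: "fold (instr S) (concat (map (%j. step_prog s t dF (j < p k) (k + j)) [0..<m]))
      = fold F (map (%j. k + j) [0..<p k])" if k: "k < n" for k
  proof -
    have "fold (instr S) (concat (map (%j. step_prog s t dF (j < p k) (k + j)) [0..<m]))
        = fold (%j. if j < p k then F (k + j) else id) [0..<m]"
      unfolding fold_concat_map step_prog_F ..
    also have "\<dots> = fold (%j. F (k + j)) [0..<p k]"
      unfolding fold_if_filter filter_less_upt[OF assms[OF k]] ..
    finally show ?thesis by (simp add: fold_map comp_def)
  qed
  have rw: "rev (rank_word n p) = concat (map (%k. map (%j. k + j) [0..<p k]) (rev [0..<n]))"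
    unfolding rank_word_def rev_concat by (simp add: rev_map comp_def)
  have "foldr F (rank_word n p) = fold (%k. fold F (map (%j. k + j) [0..<p k])) (rev [0..<n])"
    unfolding foldr_conv_fold rw fold_concat_map ..
  also have "\<dots> = fold (%k. fold F (map (%j. n - Suc k + j) [0..<p (n - Suc k)])) [0..<n]"
    unfolding map_diff_Suc_upt[symmetric] fold_map comp_def ..
  also have "\<dots> = fold (instr S) (down_prog s t dF n m p)"
  proof -
    have "fold (instr S) (down_prog s t dF n m p) = fold (%k. fold (instr S)
        (concat (map (%j. step_prog s t dF (j < p (n - Suc k)) (n - Suc k + j)) [0..<m]))) [0..<n]"
      unfolding down_prog_def by (rule fold_concat_map)
    also have "\<dots> = fold (%k. fold F (map (%j. n - Suc k + j) [0..<p (n - Suc k)])) [0..<n]"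
      by (rule ext, rule fold_cong[OF refl refl inner]) auto
    finally show ?thesis by (rule sym)
  qed
  finally show ?thesis by (rule sym)
qed

lemma E_shift: "E (m + i) (shift m h) = shift m (E i h)"
  by (simp add: E_def T_def bfac_def divdiff_shift ahom_simps[OF ahom_shift] shift_var)

lemma fold_E_below:
  assumes "\<And>i. i \<in> set w ==> Suc i < m"
  shows "fold E w (f * shift m h) = fold E w f * shift m h"
  using assms
proof (induction w arbitrary: f)
  case (Cons i w)
  have "E i (f * shift m h) = E i f * shift m h"
    using E_symmetric_mult[OF swap_shift_below[of i m h], of f] Cons.prems by (simp add: mult.commute)
  then show ?case using Cons by simp
qed simp

lemma fold_E_above:
  assumes "homog m D f"
  shows "fold (%i. E (m + i)) w (f * shift m h) = f * shift m (fold E w h)"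
proof (induction w arbitrary: h)
  case (Cons i w)
  have "E (m + i) (f * shift m h) = f * shift m (E i h)"
    using E_symmetric_mult[OF swap_homog[OF assms, of "m + i"], of "shift m h"] by (simp add: E_shift)
  then show ?case using Cons by simp
qed simp

lemma move_prog_fold:
  assumes f: "homog m D f" and h: "homog m D' h"
  shows "fold (instr S) (move_prog m) (f * shift m h) = f * h"
proof -
  define G where "G k = fold (instr S) (concat (map (%k. [(6, m + k, k)]) [0..<k]))" for k
  have Suc: "G (Suc k) p = subst (%l. if l = m + k then var k else var l) (G k p)" for k p
    by (simp add: G_def)
  have "ahom (G k)" for k
  proof (induction k)
    case 0
    then show ?case by (simp add: G_def id_def ahom_id)
  next
    case (Suc k)
    have "G (Suc k) = (%p. subst (%l. if l = m + k then var k else var l) (G k p))"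
      using \<open>\<And>p k. G (Suc k) p = _ k p\<close> by (rule_tac ext) (simp add: G_def)
    then show ?case using ahom_comp[OF ahom_subst Suc] by simp
  qed
  have var: "k <= m ==> G k (var l) = (if m <= l & l < m + k then var (l - m) else var l)" for k l
  proof (induction k)
    case 0
    then show ?case by (auto simp: G_def)
  next
    case (Suc k)
    then have "G k (var l) = (if m <= l & l < m + k then var (l - m) else var l)" by simp
    then show ?case using Suc.prems by (auto simp: \<open>\<And>p k. G (Suc k) p = _ k p\<close> subst_var)
  qed
  have G: "G m p = subst (%l. if m <= l & l < m + m then var (l - m) else var l) p" for p
    by (rule ahom_eqI[OF \<open>ahom (G m)\<close> ahom_subst]) (simp add: var subst_var)
  have "G m f = f" unfolding G by (rule subst_homog[OF f]) simp
  moreover have "G m (shift m h) = h"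
  proof -
    have "G m (shift m h) = subst (%i. if i < m then var i else var (m + i)) h"
      by (rule ahom_eqI[OF ahom_comp[OF \<open>ahom (G m)\<close> ahom_shift] ahom_subst]) (simp add: var shift_var subst_var)
    also have "\<dots> = h" by (rule subst_homog[OF h]) simp
    finally show ?thesis .
  qed
  moreover have "fold (instr S) (move_prog m) = G m" by (simp add: G_def move_prog_def)
  ultimately show ?thesis using ahom_simps(6)[OF \<open>ahom (G m)\<close>] by simp
qed

text \<open>The operators on one set of variables are linear over polynomials in the other set, so
  the second factor can be built without disturbing the first. The final substitution identifies
  both sets.\<close>

lemma product_prog:
  assumes len: "length a = m" "length b = m"
    and q: "\<And>k. k < m ==> k + q k < m" and q': "\<And>k. k < m ==> k + q' k < m"
  shows "fold (instr S) (up_prog s t dE m 0 q @ up_prog s t dE m m q' @ move_prog m) (xpow (a @ b)) =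
    fold E (rank_word m q) (xpow a) * fold E (rank_word m q') (xpow b)"
proof -
  have ql: "q k <= m" "q' k <= m" if "k < m" for k using q[OF that] q'[OF that] by auto
  have idx: "Suc i < m" if i: "i \<in> set (rank_word m q)" for i
  proof -
    obtain k where "k < m" "i < q k + k" using i by (auto simp: rank_word_def)
    then show ?thesis using q[of k] by simp
  qed
  have xp: "\<exists>D. homog m D (xpow x)" if "length x = m" for x
    using vanish_nth[of x m] that by (auto simp: homog_def xpow_mon mon_def)
  have up: "fold E (rank_word m r) p = fold (instr S) (up_prog s t dE m 0 r) p" if "\<And>k. k < m ==> r k <= m" for r p
    using up_prog_fold[of m r S 0] that by simp
  let ?f = "fold E (rank_word m q) (xpow a)" and ?h = "fold E (rank_word m q') (xpow b)"
  have hf: "\<exists>D. homog m D (fold E (rank_word m r) (xpow x))"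
    if r: "\<And>k. k < m ==> k + r k < m" and x: "length x = m" for r x
  proof -
    have rl: "r k <= m" if "k < m" for k using r[OF that] by simp
    obtain D where D: "homog m D (xpow x)" using xp[OF x] by blast
    have v: "\<forall>ins\<in>set (up_prog s t dE m 0 r). valid_instr m ins" using up_prog_valid[of m r s t dE 0] r by simp
    show ?thesis using homog_fold[OF v D, of S] up[of r "xpow x", OF rl] by simp
  qed
  obtain D where D: "homog m D ?f" using hf[OF q len(1)] by blast
  obtain D' where D': "homog m D' ?h" using hf[OF q' len(2)] by blast
  have "fold (instr S) (up_prog s t dE m 0 q) (xpow (a @ b)) = ?f * shift m (xpow b)"
    using fold_E_below[where w = "rank_word m q" and m = m and f = "xpow a" and h = "xpow b", OF idx] up[of q "xpow (a @ b)", OF ql(1)]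
    by (simp add: xpow_append len)
  moreover have "fold (instr S) (up_prog s t dE m m q') (?f * shift m (xpow b)) = ?f * shift m ?h"
    using up_prog_fold[of m q' S m] ql(2) fold_E_above[OF D, of "rank_word m q'" "xpow b"] by simp
  moreover have "fold (instr S) (move_prog m) (?f * shift m ?h) = ?f * ?h"
    by (rule move_prog_fold[OF D D'])
  ultimately show ?thesis by simp
qed

end

context key_ops
begin

lemma weight_prog_fold: "fold (instr S) (weight_prog t n) f = W S n * f"
proof -
  define g where "g i j = (if i < j then pair_factor S (i, j) else 1)" for i j
  have geo: "geo S i = (if t = 1 then \<Sum>k<Suc S. var i ^ k else 1)" for i
  proof -
    have "(\<Sum>k<Suc S. (0 :: cpoly) ^ k) = 1" by (simp add: sum.lessThan_Suc_shift del: sum.lessThan_Suc)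
    moreover have "t = 0 | t = 1" using t by auto
    ultimately show ?thesis by (auto simp: geo_def simp del: sum.lessThan_Suc)
  qed
  have one: "fold (instr S) [(if i < j then 4 else 0, i, j), (if i < j & t = 1 then 5 else 0, i, 0)] p = g i j * p" for i j p
    unfolding g_def pair_factor_def geo by (simp add: mult_ac del: sum.lessThan_Suc)
  have mult: "fold (%j p. h j * p) [0..<k] p = (\<Prod>j<k. h j) * p" for h :: "nat => cpoly" and k p
    by (induction k arbitrary: p) (auto simp: mult_ac)
  have row: "fold (instr S) (concat (map (%j. [(if i < j then 4 else 0, i, j), (if i < j & t = 1 then 5 else 0, i, 0)]) [0..<n]))
      = (%p. (\<Prod>j<n. g i j) * p)" for i
  proof -
    have "fold (instr S) [(if i < j then 4 else 0, i, j), (if i < j & t = 1 then 5 else 0, i, 0)] = (%p. g i j * p)" for j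
      using one by (rule ext)
    then show ?thesis unfolding fold_concat_map by (intro ext) (simp only: mult)
  qed
  have "fold (instr S) (weight_prog t n) = fold (%i. fold (instr S) (concat (map (%j.
      [(if i < j then 4 else 0, i, j), (if i < j & t = 1 then 5 else 0, i, 0)]) [0..<n]))) [0..<n]"
    unfolding weight_prog_def by (rule fold_concat_map)
  then have "fold (instr S) (weight_prog t n) f = (\<Prod>i<n. \<Prod>j<n. g i j) * f"
    unfolding row by (simp only: mult)
  also have "(\<Prod>i<n. \<Prod>j<n. g i j) = (\<Prod>p\<in>{..<n} \<times> {..<n}. g (fst p) (snd p))"
    by (simp add: prod.cartesian_product case_prod_unfold)
  also have "\<dots> = (\<Prod>p\<in>pairs n. g (fst p) (snd p))"
    by (rule prod.mono_neutral_right) (auto simp: pairs_def g_def)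
  also have "\<dots> = W S n" unfolding W_def by (rule prod.cong) (auto simp: pairs_def g_def)
  finally show ?thesis .
qed

end

section \<open>Programs computable in polynomial time\<close>

text \<open>Weakening below two binders.\<close>

lemma pc_skip2:
  assumes "pc (%x :: nat \<times> nat \<times> 'e::env. g (fst x) (fst (snd x)) (snd (snd x)))"
  shows "pc (%x :: nat \<times> nat \<times> nat \<times> 'e. g (fst x) (fst (snd x)) (snd (snd (snd x))))"
proof -
  obtain C and p :: "nat poly" where *: "\<And>(e :: nat \<times> nat \<times> 'e) rs b s. layout e rs b s ==>
     g (fst e) (fst (snd e)) (snd (snd e)) <= poly p (env_size e) \<and>
     runs e (C rs b) s (poly p (env_size e)) (s(b := g (fst e) (fst (snd e)) (snd (snd e))))"
    using assms unfolding pc_def by blast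
  show ?thesis
  proof (rule pcI[where C = "%rs b. C (hd rs # hd (tl rs) # tl (tl (tl rs))) b" and p = p and q = p])
    fix e :: "nat \<times> nat \<times> nat \<times> 'e" and rs b s assume l: "layout e rs b s"
    obtain i k r e' where e: "e = (i, k, r, e')" by (cases e) auto
    from l obtain a a' a'' rs' where rs: "rs = a # a' # a'' # rs'"
      unfolding e layout_def vals_prod_def by (cases rs; cases "tl rs"; cases "tl (tl rs)") auto
    have "layout (i, k, e') (hd rs # hd (tl rs) # tl (tl (tl rs))) b s"
      using l unfolding e rs by (auto simp: layout_def vals_prod_def)
    note * = *[OF this]
    have m: "poly p (env_size (i, k, e')) <= poly p (env_size e)" by (simp add: e poly_nat_mono)
    show "g (fst e) (fst (snd e)) (snd (snd (snd e))) <= poly p (env_size e)" using * m by (simp add: e)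
    show "runs e (C (hd rs # hd (tl rs) # tl (tl (tl rs))) b) s (poly p (env_size e))
        (s(b := g (fst e) (fst (snd e)) (snd (snd (snd e)))))"
      using * m unfolding e by (auto intro: runs_mono)
  qed
qed

lemma pc_apply2:
  assumes "pc h" "pc k" "pc (%z :: nat \<times> nat \<times> 'e::env. x (fst z) (fst (snd z)) (snd (snd z)))"
  shows "pc (%e :: 'e. x (h e) (k e) e)"
proof -
  have "pc (%y :: nat \<times> 'e. x (h (snd y)) (fst y) (snd y))"
    using pc_let[OF pc_snd[OF assms(1)], of "%r y. x r (fst y) (snd y)"] assms(3) by simp
  from pc_let[OF assms(2), of "%r e. x (h e) r e"] this show ?thesis by simp
qed

definition field :: "nat => nat \<times> nat \<times> nat => nat" where
  "field k ins = (if k = 0 then fst ins else if k = 1 then fst (snd ins) else snd (snd ins))"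

abbreviation fetch :: "(nat \<times> nat \<times> nat) list => nat => nat \<times> nat \<times> nat" where
  "fetch is r \<equiv> nth_default (0, 0, 0) is r"

text \<open>A program depends on the input and is not itself a number, so it is represented by its
  length and by random access to the fields of its instructions.\<close>

definition pcprog :: "('e::env => (nat \<times> nat \<times> nat) list) => bool" where
  "pcprog P \<longleftrightarrow> pc (%e. length (P e)) & (\<forall>k. pc (%z. field k (fetch (P (snd z)) (fst z))))"

lemma pcprog_append:
  assumes "pcprog P" "pcprog Q"
  shows "pcprog (%e. P e @ Q e)"
proof -
  have l: "pc (%e. length (P e))" "pc (%e. length (Q e))" using assms by (auto simp: pcprog_def)
  have "pc (%z. field k (fetch (P (snd z) @ Q (snd z)) (fst z)))" for k
  proof -
    have p: "pc (%z. field k (fetch (P (snd z)) (fst z)))" and q: "pc (%z. field k (fetch (Q (snd z)) (fst z)))"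
      using assms by (auto simp: pcprog_def)
    have q': "pc (%z. field k (fetch (Q (snd z)) (fst z - length (P (snd z)))))"
      by (rule pc_let[where g = "%r z. field k (fetch (Q (snd z)) r)", OF pc_diff[OF pc_var(1) pc_snd[OF l(1)]]])
        (rule pc_skip[OF q])
    have "pc (%z. if fst z < length (P (snd z)) then field k (fetch (P (snd z)) (fst z))
        else field k (fetch (Q (snd z)) (fst z - length (P (snd z)))))"
      by (intro pc_if pcb_less pc_var(1) pc_snd l p q')
    moreover have "fetch (xs @ ys) r = (if r < length xs then fetch xs r else fetch ys (r - length xs))" for xs ys r
      by (simp add: nth_default_append) (simp add: nth_default_def)
    ultimately show ?thesis by (simp add: if_distrib[of "field k"])
  qed
  then show ?thesis using pc_add[OF l] by (simp add: pcprog_def)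
qed

lemma pcprog_Nil: "pcprog (%e. [])"
  by (simp add: pcprog_def pc_const)

lemma pcprog_Cons:
  assumes "pc x" "pc i" "pc j" "pcprog P"
  shows "pcprog (%e. (x e, i e, j e) # P e)"
proof -
  have "pc (%z. field k (fetch [(x (snd z), i (snd z), j (snd z))] (fst z)))" for k
  proof -
    have "pc (%z :: nat \<times> _. if fst z = 0 then (if k = 0 then x (snd z) else if k = 1 then i (snd z) else j (snd z)) else 0)"
      by (intro pc_if pcb_eq pcb_const pc_const pc_var(1) pc_snd assms)
    moreover have "field k (fetch [(a, b, d)] r) = (if r = 0 then (if k = 0 then a else if k = 1 then b else d) else 0)" for a b d r
      by (auto simp: field_def nth_default_def)
    ultimately show ?thesis by simp
  qed
  then have "pcprog (%e. [(x e, i e, j e)])" by (simp add: pcprog_def pc_const)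
  from pcprog_append[OF this assms(4)] show ?thesis by simp
qed

lemma fetch_concat:
  assumes "\<And>k. length (Q k) = l"
  shows "fetch (concat (map Q [0..<n])) r = (if r < n * l then fetch (Q (r div l)) (r mod l) else (0, 0, 0))"
    "length (concat (map Q [0..<n])) = n * l"
proof -
  show len: "length (concat (map Q [0..<n])) = n * l" for n by (induction n) (auto simp: assms)
  show "fetch (concat (map Q [0..<n])) r = (if r < n * l then fetch (Q (r div l)) (r mod l) else (0, 0, 0))"
  proof (induction n)
    case (Suc n)
    consider "r < n * l" | "n * l <= r" "r < Suc n * l" | "Suc n * l <= r" by linarith
    then show ?case
    proof cases
      case 1
      then show ?thesis using Suc len[of n] by (simp add: nth_default_append) (simp add: nth_default_def)
    next
      case 2
      then have "r div l = n" by (auto intro!: div_nat_eqI simp: mult.commute)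
      moreover from this have "r mod l = r - n * l" using minus_div_mult_eq_mod[of r l] by simp
      ultimately show ?thesis using 2 len[of n] by (simp add: nth_default_append)
    next
      case 3
      then show ?thesis using len[of "Suc n"] by (simp add: nth_default_beyond del: upt_Suc)
    qed
  qed simp
qed

lemma pcprog_concat:
  assumes n: "pc n" and l: "pc l" and Q: "pcprog (%z. Q (fst z) (snd z))" and len: "\<And>k e. length (Q k e) = l e"
  shows "pcprog (%e. concat (map (%k. Q k e) [0..<n e]))"
proof -
  have "pc (%z. field k (fetch (concat (map (%k. Q k (snd z)) [0..<n (snd z)])) (fst z)))" for k
  proof -
    have "pc (%z. field k (fetch (Q (fst (snd z)) (snd (snd z))) (fst z)))" using Q by (simp add: pcprog_def)
    from pc_skip2[of "%r i e. field k (fetch (Q i e) r)", OF this]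
    have s: "pc (%z :: nat \<times> nat \<times> nat \<times> _. field k (fetch (Q (fst (snd z)) (snd (snd (snd z)))) (fst z)))" .
    have "pc (%z. field k (fetch (Q (fst z div l (snd z)) (snd z)) (fst z mod l (snd z))))"
      by (rule pc_apply2[where x = "%r i z. field k (fetch (Q i (snd z)) r)" and h = "%z. fst z mod l (snd z)" and k = "%z. fst z div l (snd z)"])
        (intro pc_div pc_mod pc_var(1) pc_snd l s)+
    then have "pc (%z. if fst z < n (snd z) * l (snd z) then field k (fetch (Q (fst z div l (snd z)) (snd z)) (fst z mod l (snd z))) else 0)"
      by (intro pc_if pcb_less pc_mult pc_var(1) pc_snd pc_const n l)
    moreover have "field k (fetch (concat (map (%k. Q k (snd z)) [0..<n (snd z)])) (fst z)) =
        (if fst z < n (snd z) * l (snd z) then field k (fetch (Q (fst z div l (snd z)) (snd z)) (fst z mod l (snd z))) else 0)" for z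
      using fetch_concat(1)[of "%k. Q k (snd z)" "l (snd z)" "n (snd z)" "fst z"] len by (simp add: field_def)
    ultimately show ?thesis by simp
  qed
  moreover have "pc (%e. length (concat (map (%k. Q k e) [0..<n e])))"
    using pc_mult[OF n l] fetch_concat(2)[of "%k. Q k _"] len by simp
  ultimately show ?thesis by (simp add: pcprog_def)
qed

lemma pcprog_step: "pcb act ==> pc i ==> pcprog (%e. step_prog s t d (act e) (i e))"
  unfolding step_prog_def
  by (cases d) (simp_all only: if_True if_False, (intro pcprog_Cons pcprog_Nil pc_if pcb_conj pcb_const pc_const pc_Suc; assumption)+)

lemma length_concat_map_const: "(\<And>k. length (g k) = l) ==> length (concat (map g [0..<n])) = n * l"
  by (induction n) auto

lemma pcprog_up:
  assumes m: "pc m" and off: "pc off" and q: "pc (%z. q (fst z) (snd z))"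
  shows "pcprog (%e. up_prog s t d (m e) (off e) (%k. q k e))"
  unfolding up_prog_def
proof (rule pcprog_concat[where l = "%e. m e * 3"])
  show "pcprog (%z. concat (map (%j. step_prog s t d (m (snd z) - Suc j < q (fst z) (snd z))
      (off (snd z) + (fst z + (m (snd z) - Suc j)))) [0..<m (snd z)]))"
    by (rule pcprog_concat[where l = "%e. 3"])
      (intro pcprog_step pcb_less pc_diff pc_add pc_Suc pc_var pc_const pc_snd[OF pc_snd[OF m]] pc_snd[OF pc_snd[OF off]]
        pc_snd[OF q] pc_snd[OF m] | simp)+
qed (auto intro: m pc_mult pc_const length_concat_map_const)

lemma pcprog_down:
  assumes n: "pc n" and m: "pc m" and p: "pc (%z. p (fst z) (snd z))"
  shows "pcprog (%e. down_prog s t d (n e) (m e) (%k. p k e))"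
  unfolding down_prog_def
proof (rule pcprog_concat[where l = "%e. m e * 3"])
  have "pc (%z. p (n (snd z) - Suc (fst z)) (snd z))"
    by (rule pc_let[where g = "%r z. p r (snd z)", OF pc_diff[OF pc_snd[OF n] pc_Suc[OF pc_var(1)]]]) (rule pc_skip[OF p])
  note p' = pc_snd[OF this]
  show "pcprog (%z. concat (map (%j. step_prog s t d (j < p (n (snd z) - Suc (fst z)) (snd z))
      (n (snd z) - Suc (fst z) + j)) [0..<m (snd z)]))"
    by (rule pcprog_concat[where l = "%e. 3"])
      (intro pcprog_step pcb_less pc_diff pc_add pc_Suc pc_var pc_const pc_snd[OF pc_snd[OF n]] p' pc_snd[OF m] | simp)+
qed (auto intro: n m pc_mult pc_const length_concat_map_const)

lemma pcprog_move: "pc m ==> pcprog (%e. move_prog (m e))"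
  unfolding move_prog_def
  by (rule pcprog_concat[where l = "%e. 1"])
    (auto intro!: pcprog_Cons pcprog_Nil pc_add pc_const pc_var(1) pc_snd)

lemma pcprog_weight:
  assumes n: "pc n"
  shows "pcprog (%e. weight_prog t (n e))"
  unfolding weight_prog_def
proof (rule pcprog_concat[where l = "%e. n e * 2"])
  show "pcprog (%z. concat (map (%j. [(if fst z < j then 4 else 0, fst z, j), (if fst z < j & t = 1 then 5 else 0, fst z, 0)])
      [0..<n (snd z)]))"
    by (rule pcprog_concat[where l = "%e. 2"])
      (intro pcprog_Cons pcprog_Nil pc_if pcb_conj pcb_less pcb_const pc_var pc_const pc_snd[OF n] | simp)+
qed (auto intro: n pc_mult pc_const length_concat_map_const)

section \<open>Signed path counts\<close>

lemma pcb_entry: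
  assumes "pc S" "pc N" "pc x" "pc i" "pc j" and a: "pc (%z. a (fst z) (snd z))" and b: "pc (%z. b (fst z) (snd z))"
  shows "pcb (%e. plus_entry (S e) (N e) (x e) (i e) (j e) (%l. a l e) (%l. b l e))"
    "pcb (%e. minus_entry (N e) (x e) (i e) (j e) (%l. a l e) (%l. b l e))"
proof -
  have ai: "pc (%e. a (i e) e)" "pc (%e. a (Suc (i e)) e)" "pc (%e. a (j e) e)"
    "pc (%e. b (i e) e)" "pc (%e. b (Suc (i e)) e)" "pc (%e. b (j e) e)"
    by (rule pc_let[OF assms(4) a] pc_let[OF pc_Suc[OF assms(4)] a] pc_let[OF assms(5) a]
        pc_let[OF assms(4) b] pc_let[OF pc_Suc[OF assms(4)] b] pc_let[OF assms(5) b])+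
  have agree: "pcb (%e. agree (N e) (f e) (g e) (%l. a l e) (%l. b l e))" if "pc f" "pc g" for f g
    unfolding agree_def by (intro pcb_all pcb_imp pcb_conj pcb_not pcb_eq a b pc_var(1) pc_snd that assms(2))
  have all: "pcb (%e. \<forall>l<N e. b l e = a l e)" by (intro pcb_all pcb_eq a b assms(2))
  show "pcb (%e. plus_entry (S e) (N e) (x e) (i e) (j e) (%l. a l e) (%l. b l e))"
    unfolding plus_entry_def
    by (intro pcb_if pcb_conj pcb_eq pcb_le pcb_less agree all pc_add pc_Suc pc_const ai assms)
  show "pcb (%e. minus_entry (N e) (x e) (i e) (j e) (%l. a l e) (%l. b l e))"
    unfolding minus_entry_def
    by (intro pcb_if pcb_conj pcb_eq pcb_le pcb_less pcb_const agree pc_add pc_Suc pc_const ai assms)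
qed

definition plus_at :: "nat => nat => (nat \<times> nat \<times> nat) list => (nat => nat) => nat => bool" where
  "plus_at S N is tb r \<longleftrightarrow> plus_entry S N (field 0 (fetch is r)) (field 1 (fetch is r)) (field 2 (fetch is r))
     (%l. tb (r * N + l)) (%l. tb (Suc r * N + l))"

definition minus_at :: "nat => (nat \<times> nat \<times> nat) list => (nat => nat) => nat => bool" where
  "minus_at N is tb r \<longleftrightarrow> minus_entry N (field 0 (fetch is r)) (field 1 (fetch is r)) (field 2 (fetch is r))
     (%l. tb (r * N + l)) (%l. tb (Suc r * N + l))"

text \<open>The sign of a path is the parity of its negative entries; \<open>par\<close> selects the
  paths that count positively (0) or negatively (1).\<close>

definition signed_path :: "nat => nat => (nat \<times> nat \<times> nat) list => (nat => nat) => nat => (nat => nat) => bool" where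
  "signed_path S N is a par tb \<longleftrightarrow> (\<forall>l<N. tb l = a l) \<and>
     (\<forall>r<length is. plus_at S N is tb r | minus_at N is tb r) \<and>
     (\<Sum>r<length is. of_bool (minus_at N is tb r) :: nat) mod 2 = par"

lemma prod_signs:
  fixes p q :: "nat => bool"
  assumes "\<And>r. \<not> (p r & q r)"
  shows "(\<Prod>r<n. of_bool (p r) - of_bool (q r) :: int) =
    (if \<forall>r<n. p r | q r then (- 1) ^ (\<Sum>r<n. of_bool (q r)) else 0)"
proof (induction n)
  case (Suc n)
  have "(of_bool (p n) - of_bool (q n) :: int) = (if p n | q n then (- 1) ^ of_bool (q n) else 0)"
    using assms[of n] by auto
  then show ?case unfolding prod.lessThan_Suc Suc sum.lessThan_Suc power_add by (auto simp: less_Suc_eq)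
qed simp

lemma path_weight_signed:
  "path_weight S N is a tb = of_bool (signed_path S N is a 0 tb) - of_bool (signed_path S N is a 1 tb)"
proof -
  have e: "entry S N (is ! r) (%l. tb (r * N + l)) (%l. tb (Suc r * N + l)) = of_bool (plus_at S N is tb r) - of_bool (minus_at N is tb r)"
    if "r < length is" for r
    using that by (cases "is ! r") (simp add: plus_at_def minus_at_def field_def nth_default_def)
  have "(\<Prod>r<length is. entry S N (is ! r) (%l. tb (r * N + l)) (%l. tb (Suc r * N + l))) =
      (\<Prod>r<length is. of_bool (plus_at S N is tb r) - of_bool (minus_at N is tb r))"
    using e by (intro prod.cong) auto
  also have "\<dots> = (if \<forall>r<length is. plus_at S N is tb r | minus_at N is tb r
      then (- 1) ^ (\<Sum>r<length is. of_bool (minus_at N is tb r)) else 0)"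
    by (rule prod_signs) (simp add: plus_at_def minus_at_def plus_minus_entry)
  finally have *: "(\<Prod>r<length is. entry S N (is ! r) (%l. tb (r * N + l)) (%l. tb (Suc r * N + l))) = \<dots>" .
  have pow: "(- 1 :: int) ^ k = of_bool (k mod 2 = 0) - of_bool (k mod 2 = 1)" for k :: nat
    by (cases "even k") (auto simp: even_iff_mod_2_eq_zero odd_iff_mod_2_eq_one)
  show ?thesis unfolding path_weight_def * pow signed_path_def by auto
qed

lemma GapP_run:
  fixes prog :: "bool list => (nat \<times> nat \<times> nat) list" and N S :: "bool list => nat" and a b :: "bool list => nat => nat"
  assumes prog: "pcprog (%e :: inp. prog (Wof e))" and N: "pc (%e :: inp. N (Wof e))" and S: "pc (%e :: inp. S (Wof e))"
    and a: "pc (%z :: nat \<times> inp. a (Wof (snd z)) (fst z))" and b: "pc (%z :: nat \<times> inp. b (Wof (snd z)) (fst z))"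
  obtains f where "f \<in> GapP" "\<And>w. (\<forall>ins\<in>set (prog w). valid_instr (N w) ins) ==>
    look (fold (instr (S w)) (prog w) (xpow (map (a w) [0..<N w]))) (Poly_Mapping.nth (map (b w) [0..<N w])) = of_int (f w)"
proof -
  define R where "R w = length (prog w)" for w
  define l where "l w = R w * N w" for w
  define D where "D w = (\<Sum>k<N w. a w k)" for w
  \<comment> \<open>Degree of the start plus \<open>Suc (S w)\<close> per instruction bounds the
    exponents on every path; the last sum makes room for the target row.\<close>
  define M where "M w = D w + R w * Suc (S w) + (\<Sum>k<N w. b w k)" for w
  \<comment> \<open>Below \<open>l w\<close> the table is the witness; behind it the fixed target
    monomial is appended as last row.\<close>
  define tb where "tb w t j = (if j < l w then t j else b w (j - l w))" for w and t :: "nat => nat" and j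
  have pR: "pc (%e :: inp. R (Wof e))" using prog by (simp add: pcprog_def R_def)
  have pl: "pc (%e :: inp. l (Wof e))" unfolding l_def by (intro pc_mult pR N)
  have pM: "pc (%e :: inp. M (Wof e))" unfolding M_def D_def
    by (intro pc_add pc_mult pc_Suc pc_sum pR N S a b)
  have pT: "pc (%z :: nat \<times> inp. tb (Wof (snd z)) (table_entry (M (Wof (snd z))) (Uof (snd z))) (fst z))"
  proof -
    have "pc (%z :: nat \<times> inp. b (Wof (snd z)) (fst z - l (Wof (snd z))))"
      by (rule pc_let[where g = "%r z. b (Wof (snd z)) r", OF pc_diff[OF pc_var(1) pc_snd[OF pl]]]) (rule pc_skip[OF b])
    then show ?thesis unfolding tb_def
      by (intro pc_if pcb_less pc_var(1) pc_snd[OF pl] pc_table_entry at_U_intros pc_snd[OF pM])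
  qed
  have row: "pc (%z :: nat \<times> nat \<times> inp. tb (Wof (snd (snd z))) (table_entry (M (Wof (snd (snd z)))) (Uof (snd (snd z)))) (h (fst (snd z)) * N (Wof (snd (snd z))) + fst z))"
    if h: "pc (%z :: nat \<times> nat \<times> inp. h (fst (snd z)))" for h
    by (rule pc_let[where g = "%r z. tb (Wof (snd (snd z))) (table_entry (M (Wof (snd (snd z)))) (Uof (snd (snd z)))) r",
          OF pc_add[OF pc_mult[OF h pc_snd[OF pc_snd[OF N]]] pc_var(1)]])
      (rule pc_skip[OF pc_skip[OF pT]])
  have fields: "pc (%z :: nat \<times> inp. field k (fetch (prog (Wof (snd z))) (fst z)))" for k
    using prog by (simp add: pcprog_def)
  have row0: "pc (%z :: nat \<times> nat \<times> inp. tb (Wof (snd (snd z))) (table_entry (M (Wof (snd (snd z)))) (Uof (snd (snd z)))) (fst (snd z) * N (Wof (snd (snd z))) + fst z))"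
    using row[of "%r. r"] pc_var(2) by blast
  have row1: "pc (%z :: nat \<times> nat \<times> inp. tb (Wof (snd (snd z))) (table_entry (M (Wof (snd (snd z)))) (Uof (snd (snd z)))) (Suc (fst (snd z)) * N (Wof (snd (snd z))) + fst z))"
    using row[of Suc] pc_Suc[OF pc_var(2)] by blast
  have plus: "pcb (%z :: nat \<times> inp. plus_at (S (Wof (snd z))) (N (Wof (snd z))) (prog (Wof (snd z)))
      (tb (Wof (snd z)) (table_entry (M (Wof (snd z))) (Uof (snd z)))) (fst z))"
    unfolding plus_at_def by (rule pcb_entry(1)[OF pc_snd[OF S] pc_snd[OF N] fields fields fields row0 row1])
  have minus: "pcb (%z :: nat \<times> inp. minus_at (N (Wof (snd z))) (prog (Wof (snd z)))
      (tb (Wof (snd z)) (table_entry (M (Wof (snd z))) (Uof (snd z)))) (fst z))"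
    unfolding minus_at_def by (rule pcb_entry(2)[OF pc_snd[OF S] pc_snd[OF N] fields fields fields row0 row1])
  have sp: "pcb (%e :: inp. signed_path (S (Wof e)) (N (Wof e)) (prog (Wof e)) (a (Wof e)) par
      (tb (Wof e) (table_entry (M (Wof e)) (Uof e))))" for par
    unfolding signed_path_def R_def[symmetric]
    by (intro pcb_conj pcb_all pcb_eq pcb_disj pc_mod pc_sum pc_of_bool pc_const N pR pT a plus minus)
  have cong: "signed_path (S w) (N w) (prog w) (a w) par (tb w t) = signed_path (S w) (N w) (prog w) (a w) par (tb w t')"
    if "\<And>j. j < l w ==> t j = t' j" for w t t' par
  proof -
    have "tb w t = tb w t'" using that by (auto simp: tb_def)
    then show ?thesis by simp
  qed
  define g where "g par w = card {t \<in> tables (l w) (M w). signed_path (S w) (N w) (prog w) (a w) par (tb w (%j. t ! j))}" for par w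
  have g: "g par \<in> sharpP" for par
    unfolding g_def[abs_def] by (rule tables_in_sharpP[OF pl pM sp cong])
  show ?thesis
  proof (rule that[of "%w. int (g 0 w) - int (g 1 w)"])
    show "(%w. int (g 0 w) - int (g 1 w)) \<in> GapP" using g by (auto simp: GapP_def)
    fix w assume v: "\<forall>ins\<in>set (prog w). valid_instr (N w) ins"
    let ?a = "map (a w) [0..<N w]" and ?b = "map (b w) [0..<N w]"
    have h: "homog (N w) (D w) (mon (Poly_Mapping.nth ?a))"
      by (auto simp: homog_def mon_def vanish_def look_nth D_def)
    have bb: "?b \<in> tables (N w) (M w)"
    proof -
      have "b w k <= M w" if "k < N w" for k
        using member_le_sum[of k "{..<N w}" "b w"] that by (simp add: M_def)
      then show ?thesis by (auto simp: tables_def)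
    qed
    have "look (fold (instr (S w)) (prog w) (xpow ?a)) (Poly_Mapping.nth ?b) =
        of_int (\<Sum>t\<in>tables (l w) (M w). path_weight (S w) (N w) (prog w) (look (Poly_Mapping.nth ?a)) (%j. (t @ ?b) ! j))"
      using run_path_sum[OF v h _ bb, of "S w"] by (simp add: xpow_mon l_def R_def M_def)
    also have "(\<Sum>t\<in>tables (l w) (M w). path_weight (S w) (N w) (prog w) (look (Poly_Mapping.nth ?a)) (%j. (t @ ?b) ! j)) =
        (\<Sum>t\<in>tables (l w) (M w). of_bool (signed_path (S w) (N w) (prog w) (a w) 0 (tb w (%j. t ! j))) -
          of_bool (signed_path (S w) (N w) (prog w) (a w) 1 (tb w (%j. t ! j))))"
    proof (rule sum.cong[OF refl])
      fix t assume "t \<in> tables (l w) (M w)"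
      then have lt: "length t = l w" by (simp add: tables_def)
      have Teq: "(t @ ?b) ! j = tb w (%j. t ! j) j" if "j < Suc (R w) * N w" for j
      proof (cases "j < l w")
        case False
        then have "j - l w < N w" using that by (simp add: l_def)
        then show ?thesis using False by (simp add: tb_def nth_append lt)
      qed (simp add: tb_def nth_append lt)
      have "path_weight (S w) (N w) (prog w) (look (Poly_Mapping.nth ?a)) (%j. (t @ ?b) ! j) =
          path_weight (S w) (N w) (prog w) (a w) (tb w (%j. t ! j))"
      proof -
        have "entry (S w) (N w) (prog w ! r) (%i. (t @ ?b) ! (r * N w + i)) (%i. (t @ ?b) ! (Suc r * N w + i)) =
            entry (S w) (N w) (prog w ! r) (%i. tb w (%j. t ! j) (r * N w + i)) (%i. tb w (%j. t ! j) (Suc r * N w + i))"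
          if r: "r < length (prog w)" for r
        proof -
          obtain x i j where p: "prog w ! r = (x, i, j)" by (cases "prog w ! r")
          have "Suc (Suc r) * N w <= Suc (R w) * N w" using r by (intro mult_right_mono) (auto simp: R_def)
          then have k: "r * N w + k < Suc (R w) * N w" "Suc r * N w + k < Suc (R w) * N w" if "k < N w" for k using that by auto
          have vr: "valid_instr (N w) (x, i, j)" using v r p by (metis nth_mem)
          show ?thesis unfolding p by (rule entry_cong[OF vr]) (use k in \<open>simp_all only: Teq\<close>)
        qed
        moreover have "(\<forall>k<N w. (t @ ?b) ! k = look (Poly_Mapping.nth ?a) k) \<longleftrightarrow> (\<forall>k<N w. tb w (%j. t ! j) k = a w k)"
          using Teq by (simp add: look_nth)
        ultimately show ?thesis unfolding path_weight_def by (simp cong: prod.cong_simp)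
      qed
      then show "path_weight (S w) (N w) (prog w) (look (Poly_Mapping.nth ?a)) (%j. (t @ ?b) ! j) =
          of_bool (signed_path (S w) (N w) (prog w) (a w) 0 (tb w (%j. t ! j))) -
          of_bool (signed_path (S w) (N w) (prog w) (a w) 1 (tb w (%j. t ! j)))"
        by (simp only: path_weight_signed)
    qed
    also have "\<dots> = int (g 0 w) - int (g 1 w)"
      using finite_tables[of "l w" "M w"] by (simp add: sum_subtractf g_def Int_def)
    finally show "look (fold (instr (S w)) (prog w) (xpow ?a)) (Poly_Mapping.nth ?b) = of_int (int (g 0 w) - int (g 1 w))" .
  qed
qed

section \<open>Slide polynomials: structure constants in the counting class\<close>

definition pre :: "(nat => nat) => nat => nat" where
  "pre f i = (\<Sum>l<i. f l)"

text \<open>The letter at place \<open>u\<close> of the word is the number of parts that end at or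
  before \<open>u\<close>.\<close>

definition word_at :: "(nat => nat) => nat => nat => nat" where
  "word_at f n u = (\<Sum>i<n. of_bool (pre f (Suc i) <= u))"

lemma pre_take: "i <= length \<alpha> ==> (\<And>l. l < length \<alpha> ==> f l = \<alpha> ! l) ==> pre f i = sum_list (take i \<alpha>)"
  by (induction i) (auto simp: pre_def take_Suc_conv_app_nth)

lemma sum_of_bool_less: "v <= n ==> (\<Sum>i<n. of_bool (i < v)) = (v :: nat)"
proof -
  assume "v <= n"
  then have "{..<n} \<inter> {i. i < v} = {..<v}" by auto
  then show ?thesis by simp
qed

lemma word_at_word:
  assumes "length \<alpha> = n" "\<And>l. l < n ==> f l = \<alpha> ! l" "u < sum_list \<alpha>"
  shows "word_at f n u = word 0 \<alpha> ! u"
proof -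
  have "pre f (Suc i) <= u \<longleftrightarrow> i < word 0 \<alpha> ! u" if "i < n" for i
  proof -
    have "pre f (Suc i) = length (filter (%p. p < Suc i) (word 0 \<alpha>))"
      using pre_take[of "Suc i" \<alpha> f] filter_word[of 0 "Suc i" \<alpha>] that assms by simp
    then show ?thesis using sorted_filter_less[OF sorted_word, of u 0 \<alpha> "Suc i"] assms(3) by auto
  qed
  then have "word_at f n u = (\<Sum>i<n. of_bool (i < word 0 \<alpha> ! u))"
    unfolding word_at_def by (intro sum.cong) auto
  then show ?thesis using sum_of_bool_less[of "word 0 \<alpha> ! u" n] word_less[OF assms(3)] assms(1) by simp
qed

lemma pc_pre:
  assumes "pc i" "pc (%z. f (fst z) (snd z))"
  shows "pc (%e. pre (%l. f l e) (i e))"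
  unfolding pre_def by (rule pc_sum[OF assms])

lemma pc_word_at:
  assumes n: "pc n" and u: "pc u" and f: "pc (%z. f (fst z) (snd z))"
  shows "pc (%e. word_at (%l. f l e) (n e) (u e))"
  unfolding word_at_def
  by (intro pc_sum pc_of_bool pcb_le n pc_snd[OF u] pc_pre[where f = "%l z. f l (snd z)", OF pc_Suc[OF pc_var(1)] pc_skip[OF f]])

text \<open>Turns an equation between filtered lists into a test at each place, which bounded
  quantifiers and counting sums can express.\<close>

lemma filter_eq_iff_nth:
  "filter P C = xs \<longleftrightarrow> length (filter P C) = length xs \<and>
     (\<forall>j<length C. P (C ! j) --> C ! j = xs ! length (filter P (take j C)))"
proof (induction C arbitrary: xs)
  case (Cons c C)
  show ?case
  proof (cases "P c")
    case True
    show ?thesis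
    proof (cases xs)
      case (Cons x ys)
      have "filter P (c # C) = xs \<longleftrightarrow> c = x & filter P C = ys" using True Cons by simp
      also have "\<dots> \<longleftrightarrow> c = x & length (filter P C) = length ys \<and>
          (\<forall>j<length C. P (C ! j) --> C ! j = ys ! length (filter P (take j C)))" using Cons.IH by simp
      finally show ?thesis using True Cons by (simp add: All_less_Suc2) blast
    qed (use True in simp)
  next
    case False
    then show ?thesis using Cons.IH[of xs] by (simp add: All_less_Suc2)
  qed
qed auto

lemma length_filter_take: "j <= length C ==> length (filter P (take j C)) = (\<Sum>i<j. of_bool (P (C ! i)))"
  by (induction j) (auto simp: take_Suc_conv_app_nth simp del: sum_of_bool_eq)

definition count_mod :: "nat => (nat => nat) => nat => nat" where
  "count_mod r t j = (\<Sum>i<j. of_bool (t i mod 2 = r))"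

text \<open>The witness is the label word. Sizes are compared first; the two parity clauses say that
  it is a shuffle, and the remaining ones that the word of the third composition is its tight
  sequence.\<close>

definition fund_witness :: "bool list => (nat => nat) => bool" where
  "fund_witness w t \<longleftrightarrow>
    (let n = num_parts w; L = pre (part w 0) n + pre (part w 1) n; m = word_at (part w 2) n in
     pre (part w 2) n = L & count_mod 0 t L = pre (part w 0) n \<and>
     (\<forall>j<L. (t j mod 2 = 0 --> t j = 2 * word_at (part w 0) n (count_mod 0 t j)) \<and>
        (t j mod 2 = 1 --> t j = Suc (2 * word_at (part w 1) n (count_mod 1 t j))) \<and>
        m j <= t j div 2 \<and>
        (Suc j < L --> m j + of_bool (t j < t (Suc j)) <= m (Suc j)) \<and>
        (m j = t j div 2 | (Suc j < L & m j + of_bool (t j < t (Suc j)) = m (Suc j)))))"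

lemma pre_all: "length \<alpha> = n ==> (\<And>l. l < n ==> f l = \<alpha> ! l) ==> pre f n = sum_list \<alpha>"
  using pre_take[of n \<alpha> f] by simp

lemma fund_witness_iff:
  assumes len: "length \<alpha> = n" "length \<beta> = n" "length \<gamma> = n"
    and C: "length C = sum_list \<alpha> + sum_list \<beta>"
  shows "fund_witness (encode3 \<alpha> \<beta> \<gamma>) (%j. C ! j) \<longleftrightarrow>
    C \<in> label_shuffles (word 0 \<alpha>) (word 0 \<beta>) & label_tight C (word 0 \<gamma>)"
proof -
  let ?w = "encode3 \<alpha> \<beta> \<gamma>"
  let ?a = "word 0 \<alpha>" and ?b = "word 0 \<beta>" and ?c = "word 0 \<gamma>" and ?L = "sum_list \<alpha> + sum_list \<beta>"
  have n: "num_parts ?w = n" by (rule num_parts_encode3[OF len])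
  note parts = part_encode3[OF len] part_encode3(2)[OF len, unfolded One_nat_def]
  have pr: "pre (part ?w 0) n = sum_list \<alpha>" "pre (part ?w 1) n = sum_list \<beta>" "pre (part ?w 2) n = sum_list \<gamma>"
    by (rule pre_all; simp add: len parts)+
  have wa: "u < sum_list \<alpha> ==> word_at (part ?w 0) n u = ?a ! u" "u < sum_list \<beta> ==> word_at (part ?w 1) n u = ?b ! u"
    "u < sum_list \<gamma> ==> word_at (part ?w 2) n u = ?c ! u" for u
    by (rule word_at_word; simp add: len parts)+
  have par: "even x \<longleftrightarrow> x mod 2 = 0" "odd x \<longleftrightarrow> x mod 2 = 1" for x :: nat by presburger+
  have cnt: "length (filter even (take j C)) = count_mod 0 (%j. C ! j) j" "length (filter odd (take j C)) = count_mod 1 (%j. C ! j) j"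
    if "j <= length C" for j
    unfolding count_mod_def length_filter_take[OF that]
    by (rule sum.cong[OF refl], rule arg_cong[where f = of_bool], rule par)+
  have both: "length (filter even C) + length (filter odd C) = length C" by (rule sum_length_filter_compl)
  have all: "length (filter even C) = count_mod 0 (%j. C ! j) ?L" using cnt(1)[of ?L] C by simp
  have mono: "length (filter P (take j C)) < length (filter P C)" if "j < length C" "P (C ! j)" for P j
  proof -
    have "C = take j C @ C ! j # drop (Suc j) C" using that(1) by (rule id_take_nth_drop)
    then have "length (filter P C) = length (filter P (take j C @ C ! j # drop (Suc j) C))" by simp
    then show ?thesis using that(2) by simp
  qed
  define m where "m = word_at (part ?w 2) n"
  define shj where "shj j \<longleftrightarrow> (C ! j mod 2 = 0 --> C ! j = 2 * word_at (part ?w 0) n (count_mod 0 (%j. C ! j) j)) \<and>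
      (C ! j mod 2 = 1 --> C ! j = Suc (2 * word_at (part ?w 1) n (count_mod 1 (%j. C ! j) j)))" for j
  define bound where "bound x y j \<longleftrightarrow> x <= C ! j div 2 & (Suc j < ?L --> x + of_bool (C ! j < C ! Suc j) <= y) \<and>
      (x = C ! j div 2 | (Suc j < ?L & x + of_bool (C ! j < C ! Suc j) = y))" for x y :: nat and j
  have fw: "fund_witness ?w (%j. C ! j) \<longleftrightarrow> sum_list \<gamma> = ?L & length (filter even C) = sum_list \<alpha> \<and>
      (\<forall>j<?L. shj j & bound (m j) (m (Suc j)) j)"
    unfolding fund_witness_def n pr Let_def all[symmetric] shj_def bound_def m_def conj_assoc ..
  have ti: "label_tight C ?c \<longleftrightarrow> (\<forall>j<?L. bound (m j) (m (Suc j)) j)" if g: "sum_list \<gamma> = ?L"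
  proof -
    have merge: "((\<forall>j<k. P j) & (\<forall>j. Suc j < k --> Q j)) & (\<forall>j<k. R j) \<longleftrightarrow> (\<forall>j<k. P j & (Suc j < k --> Q j) & R j)"
      for P Q R :: "nat => bool" and k
      using Suc_lessD by blast
    have "label_tight C ?c \<longleftrightarrow> (\<forall>j<?L. bound (?c ! j) (?c ! Suc j) j)"
      unfolding label_tight_def tight_def gap_seqs_def ascent_def mem_Collect_eq length_word g C bound_def merge[symmetric] by blast
    also have "\<dots> \<longleftrightarrow> (\<forall>j<?L. bound (m j) (m (Suc j)) j)"
    proof (intro all_cong1 imp_cong refl)
      fix j assume "j < ?L"
      then show "bound (?c ! j) (?c ! Suc j) j = bound (m j) (m (Suc j)) j"
        using wa(3)[of j] wa(3)[of "Suc j"] g by (cases "Suc j < ?L") (simp_all add: bound_def m_def)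
    qed
    finally show ?thesis .
  qed
  show ?thesis
  proof (cases "length (filter even C) = sum_list \<alpha> & sum_list \<gamma> = ?L")
    case True
    then have odd: "length (filter odd C) = sum_list \<beta>" using both C by simp
    have "C \<in> label_shuffles ?a ?b \<longleftrightarrow>
        (\<forall>j<?L. even (C ! j) --> C ! j = map (%i. 2 * i) ?a ! length (filter even (take j C))) \<and>
        (\<forall>j<?L. odd (C ! j) --> C ! j = map (%i. Suc (2 * i)) ?b ! length (filter odd (take j C)))"
      unfolding label_shuffles_def mem_Collect_eq filter_eq_iff_nth[of even] filter_eq_iff_nth[of odd]
      using True odd C by simp
    also have "\<dots> \<longleftrightarrow> (\<forall>j<?L. (C ! j mod 2 = 0 --> C ! j = 2 * word_at (part ?w 0) n (count_mod 0 (%j. C ! j) j)) \<and>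
        (C ! j mod 2 = 1 --> C ! j = Suc (2 * word_at (part ?w 1) n (count_mod 1 (%j. C ! j) j))))"
    proof -
      have "even (C ! j) ==> map (%i. 2 * i) ?a ! length (filter even (take j C)) = 2 * word_at (part ?w 0) n (count_mod 0 (%j. C ! j) j)"
        "odd (C ! j) ==> map (%i. Suc (2 * i)) ?b ! length (filter odd (take j C)) = Suc (2 * word_at (part ?w 1) n (count_mod 1 (%j. C ! j) j))"
        if "j < ?L" for j
        using that C True odd mono[of j even] mono[of j odd] wa cnt[of j] by simp_all
      then show ?thesis unfolding par[symmetric] by auto
    qed
    finally have sh: "C \<in> label_shuffles ?a ?b \<longleftrightarrow> \<dots>" .
    show ?thesis unfolding fw sh shj_def[symmetric] ti[OF conjunct2[OF True]] using True by blast
  next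
    case False
    have "\<not> (C \<in> label_shuffles ?a ?b & label_tight C ?c)"
      using False C by (auto simp: label_shuffles_def label_tight_def tight_def gap_seqs_def)
    then show ?thesis unfolding fw using False by blast
  qed
qed

lemma pc_parts: "pc (%e :: inp. num_parts (Wof e))" "pc (%z :: nat \<times> inp. part (Wof (snd z)) c (fst z))"
  by (intro pc_num_parts pc_part pc_const pc_var at_W_intros)+

lemma fundamental_in_sharpP: "constants_in_sharpP fundamental_slide"
proof -
  let ?n = "%w. num_parts w"
  define L where "L w = pre (part w 0) (?n w) + pre (part w 1) (?n w)" for w
  define M where "M w = 2 * ?n w" for w
  have pn: "pc (%e :: inp. ?n (Wof e))" by (rule pc_parts)
  have pp: "pc (%e :: inp. pre (part (Wof e) c) (?n (Wof e)))" for c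
    by (rule pc_pre[where f = "%l e. part (Wof e) c l", OF pn pc_parts(2)])
  have pL: "pc (%e :: inp. L (Wof e))" unfolding L_def by (intro pc_add pp)
  have pM: "pc (%e :: inp. M (Wof e))" unfolding M_def by (intro pc_mult pc_const pn)
  let ?t = "%e :: inp. table_entry (M (Wof e)) (Uof e)"
  have pt: "pc (%z :: nat \<times> inp. ?t (snd z) (fst z))"
    by (intro pc_table_entry at_U_intros pc_snd[OF pM] pc_var)
  have pts: "pc (%z :: nat \<times> inp. ?t (snd z) (Suc (fst z)))"
    by (rule pc_let[where g = "%r z. ?t (snd z) r", OF pc_Suc[OF pc_var(1)] pc_skip[OF pt]])
  have pc0: "pc (%e :: inp. count_mod r (?t e) (L (Wof e)))" for r
    unfolding count_mod_def by (intro pc_sum pL pc_of_bool pcb_eq pc_mod pt pc_const)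
  have pcj: "pc (%z :: nat \<times> inp. count_mod r (?t (snd z)) (fst z))" for r
    unfolding count_mod_def by (intro pc_sum pc_var(1) pc_of_bool pcb_eq pc_mod pc_skip[OF pt] pc_const)
  have pw: "pc (%z :: nat \<times> inp. word_at (part (Wof (snd z)) c) (?n (Wof (snd z))) (u z))" if "pc u" for c u
    by (rule pc_word_at[where f = "%l z. part (Wof (snd z)) c l", OF pc_snd[OF pn] that pc_skip[OF pc_parts(2)]])
  have P: "pcb (%e :: inp. fund_witness (Wof e) (?t e))"
    unfolding fund_witness_def Let_def L_def[symmetric]
    by (intro pcb_conj pcb_all pcb_imp pcb_disj pcb_eq pcb_le pcb_less pc_add pc_mult pc_Suc pc_mod pc_div pc_of_bool
        pp pL pc_snd[OF pL] pt pts pc0 pcj pw pc_const pc_var(1))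
  have cong: "fund_witness w t = fund_witness w t'" if "\<And>j. j < L w ==> t j = t' j" for w t t'
  proof -
    have c: "count_mod r t j = count_mod r t' j" if "j <= L w" for r j
      unfolding count_mod_def using that \<open>\<And>j. j < L w ==> t j = t' j\<close> by (intro sum.cong) auto
    show ?thesis
      unfolding fund_witness_def Let_def L_def[symmetric]
      by (intro conj_cong refl all_cong1 imp_cong disj_cong arg_cong2[where f = "(=)"]; use c that in \<open>simp add: less_imp_le\<close>)
  qed
  have "(%w. card {t \<in> tables (L w) (M w). fund_witness w (%j. t ! j)}) \<in> sharpP"
    by (rule tables_in_sharpP[OF pL pM P cong])
  moreover have "structure_const fundamental_slide \<alpha> \<beta> \<gamma> =
      of_nat (card {t \<in> tables (L w) (M w). fund_witness w (%j. t ! j)})"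
    if abc: "\<alpha> \<in> comps n" "\<beta> \<in> comps n" "\<gamma> \<in> comps n" and w: "w = encode3 \<alpha> \<beta> \<gamma>" for n \<alpha> \<beta> \<gamma> w
  proof -
    have len: "length \<alpha> = n" "length \<beta> = n" "length \<gamma> = n" using abc by (auto simp: comps_def)
    have n: "num_parts w = n" unfolding w by (rule num_parts_encode3[OF len])
    have L: "L w = sum_list \<alpha> + sum_list \<beta>"
      unfolding L_def n unfolding w
      by (intro arg_cong2[where f = "(+)"] pre_all len) (simp_all add: part_encode3[OF len] part_encode3(2)[OF len, unfolded One_nat_def])
    have "t \<in> tables (L w) (M w)" if t: "t \<in> label_shuffles (word 0 \<alpha>) (word 0 \<beta>)" for t
      using length_label_shuffles[OF t] set_label_shuffles[OF t] set_word[of 0 \<alpha>] set_word[of 0 \<beta>]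
      by (fastforce simp: tables_def L M_def n len)
    then have "{t \<in> tables (L w) (M w). fund_witness w (%j. t ! j)} =
        {C \<in> label_shuffles (word 0 \<alpha>) (word 0 \<beta>). label_tight C (word 0 \<gamma>)}"
      using fund_witness_iff[OF len] L w by (auto simp: tables_def)
    then show ?thesis by (simp add: fundamental_structure_const[OF len])
  qed
  ultimately show ?thesis unfolding constants_in_sharpP_def
    by (intro bexI[of _ "%w. card {t \<in> tables (L w) (M w). fund_witness w (%j. t ! j)}"] allI ballI) blast+
qed

text \<open>Flattenings agree exactly if the sets of partial sums do, and this can be tested with
  bounded quantifiers.\<close>

definition slides_to :: "nat => (nat => nat) => (nat => nat) => bool" where
  "slides_to n f g \<longleftrightarrow> pre f n = pre g n & (\<forall>i<Suc n. pre f i <= pre g i) \<and>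
     (\<forall>i<Suc n. \<exists>j<Suc n. pre f i = pre g j) & (\<forall>i<Suc n. \<exists>j<Suc n. pre g i = pre f j)"

definition meets_at :: "nat => (nat => nat) => (nat => nat) => nat => bool" where
  "meets_at n f g p \<longleftrightarrow> (\<exists>u<pre f n. word_at g n u = p & word_at f n u = p)"

lemma psums_pre: "length \<alpha> = n ==> (\<And>l. l < n ==> f l = \<alpha> ! l) ==> psums \<alpha> = {pre f i | i. i < Suc n}"
  unfolding psums_def using pre_take[of _ \<alpha> f] by (auto simp: less_Suc_eq_le) metis

lemma slides_to_iff:
  assumes "length \<alpha> = n" "length \<delta> = n" "\<And>l. l < n ==> f l = \<alpha> ! l" "\<And>l. l < n ==> g l = \<delta> ! l"
  shows "slides_to n f g \<longleftrightarrow> \<delta> \<in> mono_set \<alpha>"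
proof -
  have p: "pre f i = sum_list (take i \<alpha>)" "pre g i = sum_list (take i \<delta>)" if "i <= n" for i
    using pre_take[of i \<alpha> f] pre_take[of i \<delta> g] assms that by auto
  have "flat \<delta> = flat \<alpha> \<longleftrightarrow> {pre g i | i. i < Suc n} = {pre f i | i. i < Suc n}"
    unfolding flat_eq_iff_psums using psums_pre[of \<alpha> n f] psums_pre[of \<delta> n g] assms by simp
  also have "\<dots> \<longleftrightarrow> (\<forall>i<Suc n. \<exists>j<Suc n. pre f i = pre g j) & (\<forall>i<Suc n. \<exists>j<Suc n. pre g i = pre f j)"
    by (auto simp: set_eq_iff)
  finally have fl: "flat \<delta> = flat \<alpha> \<longleftrightarrow> \<dots>" .
  have "dominated \<delta> \<alpha> \<longleftrightarrow> pre f n = pre g n & (\<forall>i<Suc n. pre f i <= pre g i)"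
    unfolding dominated_def using assms(1,2) p by (auto simp: less_Suc_eq_le)
  then show ?thesis unfolding slides_to_def mono_set_def mem_Collect_eq fl by blast
qed

lemma meets_at_iff:
  assumes "length \<alpha> = n" "length \<delta> = n" "\<And>l. l < n ==> f l = \<alpha> ! l" "\<And>l. l < n ==> g l = \<delta> ! l"
    "sum_list \<delta> = sum_list \<alpha>"
  shows "meets_at n f g p \<longleftrightarrow> meets \<alpha> \<delta> p"
proof -
  have "word_at f n u = word 0 \<alpha> ! u" "word_at g n u = word 0 \<delta> ! u" if "u < sum_list \<alpha>" for u
    using word_at_word[of \<alpha> n f u] word_at_word[of \<delta> n g u] assms that by auto
  moreover have "pre f n = sum_list \<alpha>" by (rule pre_all) (use assms in auto)
  ultimately show ?thesis unfolding meets_at_def meets_def by auto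
qed

lemma pcb_slides_to:
  assumes n: "pc n" and f: "pc (%z. f (fst z) (snd z))" and g: "pc (%z. g (fst z) (snd z))"
  shows "pcb (%e. slides_to (n e) (%l. f l e) (%l. g l e))"
proof -
  have 1: "pc (%e. pre (%l. h l e) (n e))" "pc (%z :: nat \<times> 'a. pre (%l. h l (snd z)) (fst z))"
    "pc (%z :: nat \<times> nat \<times> 'a. pre (%l. h l (snd (snd z))) (fst z))"
    "pc (%z :: nat \<times> nat \<times> 'a. pre (%l. h l (snd (snd z))) (fst (snd z)))"
    if h: "pc (%z :: nat \<times> 'a. h (fst z) (snd z))" for h
    by (rule pc_pre[OF n h] pc_pre[where f = "%l z. h l (snd z)", OF pc_var(1) pc_skip[OF h]]
        pc_pre[where f = "%l z. h l (snd (snd z))", OF pc_var(1) pc_skip[OF pc_skip[OF h]]]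
        pc_pre[where f = "%l z. h l (snd (snd z))", OF pc_var(2) pc_skip[OF pc_skip[OF h]]])+
  show ?thesis unfolding slides_to_def
    by (intro pcb_conj pcb_all pcb_ex pcb_eq pcb_le pc_Suc n pc_snd[OF n] 1[OF f] 1[OF g])
qed

lemma pcb_meets_at:
  assumes n: "pc n" and p: "pc p" and f: "pc (%z. f (fst z) (snd z))" and g: "pc (%z. g (fst z) (snd z))"
  shows "pcb (%e. meets_at (n e) (%l. f l e) (%l. g l e) (p e))"
  unfolding meets_at_def
  by (intro pcb_ex pcb_conj pcb_eq pc_pre[OF n f] pc_snd[OF p]
      pc_word_at[where f = "%l z. f l (snd z)", OF pc_snd[OF n] pc_var(1) pc_skip[OF f]]
      pc_word_at[where f = "%l z. g l (snd z)", OF pc_snd[OF n] pc_var(1) pc_skip[OF g]])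

definition mono_witness :: "bool list => (nat => nat) => bool" where
  "mono_witness w t \<longleftrightarrow> (\<forall>i<num_parts w. t i <= part w 2 i) \<and>
     slides_to (num_parts w) (part w 0) t & slides_to (num_parts w) (part w 1) (%i. part w 2 i - t i) \<and>
     (\<forall>p<num_parts w. part w 2 p ~= 0 --> meets_at (num_parts w) (part w 0) t p \<or>
        meets_at (num_parts w) (part w 1) (%i. part w 2 i - t i) p | (Suc p < num_parts w & part w 2 (Suc p) ~= 0))"

lemma pre_cong: "(\<And>l. l < n ==> f l = g l) ==> i <= n ==> pre f i = pre g i"
  unfolding pre_def by (intro sum.cong) auto

lemma mono_witness_cong:
  assumes "\<And>j. j < num_parts w ==> t j = t' j"
  shows "mono_witness w t = mono_witness w t'"
proof -
  let ?n = "num_parts w"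
  have p: "pre g i = pre g' i" if "i < Suc ?n" "\<And>j. j < ?n ==> g j = g' j" for i g g'
    using pre_cong[of ?n g g' i] that by simp
  have s: "slides_to ?n f g = slides_to ?n f g'" if "\<And>j. j < ?n ==> g j = g' j" for f g g'
  proof -
    have pe: "pre g i = pre g' i" if "i < Suc ?n" for i using p[of i g g'] \<open>\<And>j. j < ?n ==> g j = g' j\<close> that by blast
    show ?thesis unfolding slides_to_def by (simp add: pe cong: conj_cong)
  qed
  have wa: "word_at g ?n u = word_at g' ?n u" if "\<And>j. j < ?n ==> g j = g' j" for g g' u
    unfolding word_at_def using p[of _ g g'] that by (intro sum.cong) auto
  have m: "meets_at ?n f g q = meets_at ?n f g' q" if "\<And>j. j < ?n ==> g j = g' j" for f g g' q
    unfolding meets_at_def using wa[of g g', OF that] by simp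
  have d: "part w 2 j - t j = part w 2 j - t' j" if "j < ?n" for j using assms[OF that] by simp
  have e: "slides_to ?n f t = slides_to ?n f t'" "meets_at ?n f t k = meets_at ?n f t' k"
    "slides_to ?n f (%i. part w 2 i - t i) = slides_to ?n f (%i. part w 2 i - t' i)"
    "meets_at ?n f (%i. part w 2 i - t i) k = meets_at ?n f (%i. part w 2 i - t' i) k" for f k
    using s[of t t'] m[of t t'] s[of "%i. part w 2 i - t i" "%i. part w 2 i - t' i"]
      m[of "%i. part w 2 i - t i" "%i. part w 2 i - t' i"] assms d by blast+
  show ?thesis unfolding mono_witness_def e using assms by simp
qed

lemma monomial_in_sharpP: "constants_in_sharpP monomial_slide"
proof -
  let ?n = "%w. num_parts w"
  have pn: "pc (%e :: inp. ?n (Wof e))" by (rule pc_parts)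
  have pM: "pc (%e :: inp. length (Wof e))" by (intro pc_length disjI1 at_W_intros)
  let ?t = "%e :: inp. table_entry (length (Wof e)) (Uof e)"
  have pt: "pc (%z :: nat \<times> inp. ?t (snd z) (fst z))"
    by (intro pc_table_entry at_U_intros pc_snd[OF pM] pc_var)
  note pp = pc_parts(2)
  have pd: "pc (%z :: nat \<times> inp. part (Wof (snd z)) 2 (fst z) - ?t (snd z) (fst z))" by (intro pc_diff pp pt)
  have ps: "pc (%z :: nat \<times> inp. part (Wof (snd z)) 2 (Suc (fst z)))"
    by (intro pc_part pc_const pc_Suc pc_var at_W_intros)
  have sl: "pcb (%e :: inp. slides_to (?n (Wof e)) (part (Wof e) 0) (?t e))"
    "pcb (%e :: inp. slides_to (?n (Wof e)) (part (Wof e) 1) (%i. part (Wof e) 2 i - ?t e i))"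
    by (rule pcb_slides_to[OF pn pp pt] pcb_slides_to[OF pn pp pd])+
  have me: "pcb (%z :: nat \<times> inp. meets_at (?n (Wof (snd z))) (part (Wof (snd z)) 0) (?t (snd z)) (fst z))"
    "pcb (%z :: nat \<times> inp. meets_at (?n (Wof (snd z))) (part (Wof (snd z)) 1) (%i. part (Wof (snd z)) 2 i - ?t (snd z) i) (fst z))"
    by (rule pcb_meets_at[OF pc_snd[OF pn] pc_var(1) pc_skip[OF pp] pc_skip[OF pt]]
        pcb_meets_at[OF pc_snd[OF pn] pc_var(1) pc_skip[OF pp] pc_skip[OF pd]])+
  have P: "pcb (%e :: inp. mono_witness (Wof e) (?t e))"
    unfolding mono_witness_def
    by (intro pcb_conj pcb_all pcb_imp pcb_not pcb_disj pcb_eq pcb_le pcb_less pc_Suc sl me pn pc_snd[OF pn] pt pp ps pc_const pc_var(1))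
  have "(%w. card {t \<in> tables (?n w) (length w). mono_witness w (%j. t ! j)}) \<in> sharpP"
    by (rule tables_in_sharpP[OF pn pM P mono_witness_cong])
  moreover have "structure_const monomial_slide \<alpha> \<beta> \<gamma> =
      of_nat (card {t \<in> tables (?n w) (length w). mono_witness w (%j. t ! j)})"
    if abc: "\<alpha> \<in> comps n" "\<beta> \<in> comps n" "\<gamma> \<in> comps n" and w: "w = encode3 \<alpha> \<beta> \<gamma>" for n \<alpha> \<beta> \<gamma> w
  proof -
    have len: "length \<alpha> = n" "length \<beta> = n" "length \<gamma> = n" using abc by (auto simp: comps_def)
    have n: "num_parts w = n" unfolding w by (rule num_parts_encode3[OF len])
    have parts: "i < n ==> part w 0 i = \<alpha> ! i" "i < n ==> part w 1 i = \<beta> ! i" "i < n ==> part w 2 i = \<gamma> ! i" for i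
      unfolding w using part_encode3[OF len] by auto
    have gw: "\<gamma> ! i <= length w" if "i < n" for i
      using elem_le_sum_list[of i \<gamma>] length_encode3_ge[OF len] that len w by simp
    let ?e = "%\<delta>. map (%i. \<gamma> ! i - \<delta> ! i) [0..<n]"
    let ?P = "%\<delta>. (\<forall>i<n. \<delta> ! i <= \<gamma> ! i) & \<delta> \<in> mono_set \<alpha> & ?e \<delta> \<in> mono_set \<beta> \<and>
         (\<forall>p<n. \<gamma> ! p ~= 0 --> meets \<alpha> \<delta> p | meets \<beta> (?e \<delta>) p | (Suc p < n & \<gamma> ! Suc p ~= 0))"
    have iff: "mono_witness w (%j. \<delta> ! j) \<longleftrightarrow> ?P \<delta>" if \<delta>: "length \<delta> = n" for \<delta>
    proof -
      have s1: "slides_to n (part w 0) (%j. \<delta> ! j) \<longleftrightarrow> \<delta> \<in> mono_set \<alpha>"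
        by (rule slides_to_iff) (use len \<delta> parts in auto)
      have s2: "slides_to n (part w 1) (%i. part w 2 i - \<delta> ! i) \<longleftrightarrow> ?e \<delta> \<in> mono_set \<beta>"
        by (rule slides_to_iff) (use len \<delta> parts in auto)
      have m1: "meets_at n (part w 0) (%j. \<delta> ! j) p \<longleftrightarrow> meets \<alpha> \<delta> p" if "\<delta> \<in> mono_set \<alpha>" for p
        by (rule meets_at_iff) (use len \<delta> parts that in \<open>auto simp: mono_set_def dominated_def\<close>)
      have m2: "meets_at n (part w 1) (%i. part w 2 i - \<delta> ! i) p \<longleftrightarrow> meets \<beta> (?e \<delta>) p" if "?e \<delta> \<in> mono_set \<beta>" for p
        by (rule meets_at_iff) (use len \<delta> parts that in \<open>auto simp: mono_set_def dominated_def\<close>)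
      show ?thesis
      proof (cases "\<delta> \<in> mono_set \<alpha> & ?e \<delta> \<in> mono_set \<beta>")
        case True
        then show ?thesis unfolding mono_witness_def n s1 s2 m1[OF conjunct1[OF True]] m2[OF conjunct2[OF True]]
          using parts by auto
      next
        case False
        then show ?thesis unfolding mono_witness_def n s1 s2 by blast
      qed
    qed
    have "\<delta> \<in> tables n (length w)" if "length \<delta> = n" "\<forall>i<n. \<delta> ! i <= \<gamma> ! i" for \<delta>
    proof -
      have "\<delta> ! i <= length w" if "i < n" for i using gw[OF that] \<open>\<forall>i<n. \<delta> ! i <= \<gamma> ! i\<close> that by (meson order_trans)
      then show ?thesis using that(1) by (auto simp: tables_def in_set_conv_nth)
    qed
    then have "{t \<in> tables (?n w) (length w). mono_witness w (%j. t ! j)} = {\<delta>. length \<delta> = n & ?P \<delta>}"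
      unfolding n using iff by (auto simp: tables_def)
    then show ?thesis by (simp add: monomial_structure_const[OF len] Let_def)
  qed
  ultimately show ?thesis unfolding constants_in_sharpP_def
    by (intro bexI[of _ "%w. card {t \<in> tables (?n w) (length w). mono_witness w (%j. t ! j)}"] allI ballI) blast+
qed

section \<open>Structure constants of the operator families\<close>

text \<open>Sorting by counting: the \<open>k\<close>-th smallest part, counted from 0, is the
  number of values \<open>a\<close> such that at most \<open>k\<close> parts are at most
  \<open>a\<close>. The input length bounds all parts.\<close>

definition sorted_part :: "bool list => nat => nat => nat" where
  "sorted_part w c k = (\<Sum>a<length w. of_bool (\<not> k < (\<Sum>j<num_parts w. of_bool (part w c j <= a))))"

lemma pc_sorted_part: "at_W g ==> pc k ==> pc (%e. sorted_part (g e) c (k e))"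
  unfolding sorted_part_def
  by (intro pc_sum pc_of_bool pcb_not pcb_less pcb_le pc_length disjI1 pc_num_parts pc_part at_W_intros pc_const pc_snd pc_var)

lemma sorted_part_sort:
  assumes "length \<alpha> = n" "num_parts w = n" "\<And>i. i < n ==> part w c i = \<alpha> ! i"
    "sum_list \<alpha> <= length w" "k < n"
  shows "sorted_part w c k = sort \<alpha> ! k"
proof -
  have cnt: "(\<Sum>j<num_parts w. of_bool (part w c j <= a)) = length (filter (%p. p < Suc a) (sort \<alpha>))" for a
  proof -
    have "(\<Sum>j<num_parts w. of_bool (part w c j <= a)) = (\<Sum>j<n. of_bool (\<alpha> ! j < Suc a))"
      unfolding assms(2) using assms(3) by (intro sum.cong) auto
    also have "\<dots> = length (filter (%p. p < Suc a) \<alpha>)"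
      using length_filter_take[of n \<alpha> "%p. p < Suc a"] assms(1) by (simp del: sum_of_bool_eq)
    also have "\<dots> = length (filter (%p. p < Suc a) (sort \<alpha>))"
      by (metis mset_filter mset_sort size_mset)
    finally show ?thesis .
  qed
  have "sorted_part w c k = (\<Sum>a<length w. of_bool (a < sort \<alpha> ! k))"
    unfolding sorted_part_def cnt
  proof (rule sum.cong[OF refl])
    fix a
    show "of_bool (\<not> k < length (filter (%p. p < Suc a) (sort \<alpha>))) = (of_bool (a < sort \<alpha> ! k) :: nat)"
      using sorted_filter_less[OF sorted_sort, of k \<alpha> "Suc a"] assms(1,5) by auto
  qed
  moreover have "sort \<alpha> ! k \<in> set (sort \<alpha>)" using assms(1,5) by (intro nth_mem) simp
  then have "sort \<alpha> ! k <= length w" using member_le_sum_list[of "sort \<alpha> ! k" \<alpha>] assms(4) by simp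
  ultimately show ?thesis using sum_of_bool_less[of "sort \<alpha> ! k" "length w"] by simp
qed

lemma rank_sum: "length \<beta> = n ==> rank r \<beta> k = (\<Sum>j<n. of_bool (k < j & r (\<beta> ! j) (\<beta> ! k)))"
proof -
  assume "length \<beta> = n"
  then have "{j. k < j & j < length \<beta> & r (\<beta> ! j) (\<beta> ! k)} = {..<n} \<inter> {j. k < j & r (\<beta> ! j) (\<beta> ! k)}" by auto
  then show ?thesis by (simp add: rank_def)
qed

lemma rank_less: "k < length \<beta> ==> k + rank r \<beta> k < length \<beta>"
proof -
  assume k: "k < length \<beta>"
  have "rank r \<beta> k <= card {Suc k..<length \<beta>}" unfolding rank_def by (rule card_mono) auto
  then show ?thesis using k by simp
qed

lemma map_rev_append:
  assumes "length xs = m" "length ys = m"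
    and "\<And>l. l < m ==> a l = xs ! (m - Suc l)" "\<And>l. l < m ==> a (m + l) = ys ! (m - Suc l)"
  shows "map a [0..<2 * m] = rev xs @ rev ys"
proof (rule nth_equalityI)
  fix l assume "l < length (map a [0..<2 * m])"
  then have l: "l < 2 * m" by simp
  show "map a [0..<2 * m] ! l = (rev xs @ rev ys) ! l"
  proof (cases "l < m")
    case True
    then show ?thesis using assms by (simp add: nth_append rev_nth)
  next
    case False
    then have "a l = ys ! (m - Suc (l - m))" using assms(4)[of "l - m"] l by simp
    then show ?thesis using False l assms(1,2) by (simp add: nth_append rev_nth)
  qed
qed (use assms in simp)

context key_ops
begin

lemma constants_in_GapP_X: "constants_in_GapP X"
proof -
  let ?n = "%w. num_parts w"
  define q where "q c w k = (\<Sum>j<?n w. of_bool (k < j & part w c k < part w c j) :: nat)" for c w and k :: nat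
  define p where "p w k = (\<Sum>j<?n w. of_bool (k < j & part w 2 j < part w 2 k) :: nat)" for w and k :: nat
  define prog where "prog w = up_prog (Suc 0) t dE (?n w) 0 (q 0 w) @ up_prog (Suc 0) t dE (?n w) (?n w) (q 1 w) @
    move_prog (?n w) @ down_prog (Suc 0) t dF (?n w) (?n w) (p w) @ weight_prog t (?n w)" for w
  \<comment> \<open>The start monomial has the decreasing rearrangements of the first two
    compositions side by side; the target \<open>b\<close> below is \<open>shifted\<close> of the
    sorted third one, with zeros on the second set of variables.\<close>
  define a where "a w l = (if l < ?n w then sorted_part w 0 (?n w - Suc l) else sorted_part w 1 (?n w - Suc (l - ?n w)))" for w l
  define b where "b w l = (if l < ?n w then sorted_part w 2 l + l else 0)" for w l
  have pn: "pc (%e :: inp. ?n (Wof e))" by (rule pc_parts)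
  have pns: "pc (%z :: nat \<times> inp. ?n (Wof (snd z)))" by (rule pc_snd[OF pn])
  have pp: "pc (%z :: nat \<times> nat \<times> inp. part (Wof (snd (snd z))) c (fst z))"
    "pc (%z :: nat \<times> nat \<times> inp. part (Wof (snd (snd z))) c (fst (snd z)))" for c
    by (intro pc_part pc_const pc_var at_W_intros)+
  have pq: "pc (%z :: nat \<times> inp. q c (Wof (snd z)) (fst z))" for c
    unfolding q_def by (intro pc_sum pc_of_bool pcb_conj pcb_less pns pp pc_var)
  have pp': "pc (%z :: nat \<times> inp. p (Wof (snd z)) (fst z))"
    unfolding p_def by (intro pc_sum pc_of_bool pcb_conj pcb_less pns pp pc_var)
  have prog: "pcprog (%e :: inp. prog (Wof e))" unfolding prog_def
    by (intro pcprog_append pcprog_up pcprog_move pcprog_down pcprog_weight pn pc_const pq pp')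
  have N: "pc (%e :: inp. 2 * ?n (Wof e))" by (intro pc_mult pc_const pn)
  have S: "pc (%e :: inp. length (Wof e))" by (intro pc_length disjI1 at_W_intros)
  have pa: "pc (%z :: nat \<times> inp. a (Wof (snd z)) (fst z))" unfolding a_def
    by (intro pc_if pcb_less pc_sorted_part pc_diff pc_Suc pns pc_var(1) at_W_intros)
  have pb: "pc (%z :: nat \<times> inp. b (Wof (snd z)) (fst z))" unfolding b_def
    by (intro pc_if pcb_less pc_sorted_part pc_add pns pc_var(1) pc_const at_W_intros)
  obtain f where f: "f \<in> GapP" "\<And>w. (\<forall>ins\<in>set (prog w). valid_instr (2 * ?n w) ins) ==>
    look (fold (instr (length w)) (prog w) (xpow (map (a w) [0..<2 * ?n w]))) (Poly_Mapping.nth (map (b w) [0..<2 * ?n w])) = of_int (f w)"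
    using GapP_run[OF prog N S pa pb] by blast
  have "structure_const X \<alpha> \<beta> \<gamma> = of_int (f (encode3 \<alpha> \<beta> \<gamma>))"
    if abc: "\<alpha> \<in> comps n" "\<beta> \<in> comps n" "\<gamma> \<in> comps n" for n \<alpha> \<beta> \<gamma>
  proof -
    define w where "w = encode3 \<alpha> \<beta> \<gamma>"
    have len: "length \<alpha> = n" "length \<beta> = n" "length \<gamma> = n" using abc by (auto simp: comps_def)
    have n: "?n w = n" unfolding w_def by (rule num_parts_encode3[OF len])
    have parts: "i < n ==> part w 0 i = \<alpha> ! i" "i < n ==> part w 1 i = \<beta> ! i" "i < n ==> part w 2 i = \<gamma> ! i" for i
      unfolding w_def using part_encode3[OF len] by auto
    note parts = parts parts(2)[unfolded One_nat_def]
    have size: "sum_list \<alpha> <= length w" "sum_list \<beta> <= length w" "sum_list \<gamma> + n <= length w"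
      using length_encode3_ge[OF len] by (auto simp: w_def)
    have qr: "q 0 w k = rank (>) \<alpha> k" "q 1 w k = rank (>) \<beta> k" "p w k = rank (<) \<gamma> k" if "k < n" for k
      unfolding q_def p_def n using that len by (auto simp: rank_sum parts simp del: sum_of_bool_eq intro!: sum.cong)
    have rl: "k + rank r \<alpha> k < n" "k + rank r \<beta> k < n" "k + rank r \<gamma> k < n" if "k < n" for r k
      using rank_less[of k \<alpha> r] rank_less[of k \<beta> r] rank_less[of k \<gamma> r] that len by auto
    have valid: "\<forall>ins\<in>set (prog w). valid_instr (2 * n) ins"
    proof -
      have "\<forall>ins\<in>set (up_prog (Suc 0) t dE n 0 (q 0 w)). valid_instr (0 + n) ins"
        by (rule up_prog_valid) (use qr rl in simp)
      moreover have "\<forall>ins\<in>set (up_prog (Suc 0) t dE n n (q 1 w)). valid_instr (n + n) ins"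
        by (rule up_prog_valid) (use qr rl in simp)
      moreover have "\<forall>ins\<in>set (down_prog (Suc 0) t dF n n (p w)). valid_instr n ins"
        by (rule down_prog_valid) (use qr rl in simp)
      moreover have "\<forall>ins\<in>set (weight_prog t n). valid_instr n ins" by (rule weight_prog_valid) simp
      ultimately show ?thesis unfolding prog_def n using move_prog_valid[of n]
        by (auto intro: valid_instr_mono simp: mult_2)
    qed
    have init: "map (a w) [0..<2 * n] = rev (sort \<alpha>) @ rev (sort \<beta>)"
    proof (rule map_rev_append)
      fix l assume l: "l < n"
      show "a w l = sort \<alpha> ! (n - Suc l)"
        using sorted_part_sort[of \<alpha> n w 0 "n - Suc l"] len n parts size l by (simp add: a_def)
      show "a w (n + l) = sort \<beta> ! (n - Suc l)"
        using sorted_part_sort[of \<beta> n w 1 "n - Suc l"] len n parts size l by (simp add: a_def)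
    qed (use len in auto)
    have target: "Poly_Mapping.nth (map (b w) [0..<2 * n]) = shifted (sort \<gamma>)"
    proof (rule poly_mapping_eqI)
      fix l
      show "look (Poly_Mapping.nth (map (b w) [0..<2 * n])) l = look (shifted (sort \<gamma>)) l"
        using sorted_part_sort[of \<gamma> n w 2 l] len n parts size by (auto simp: look_nth look_shifted b_def)
    qed
    have rw: "rank_word n (q 0 w) = rank_word n (rank (>) \<alpha>)" "rank_word n (q 1 w) = rank_word n (rank (>) \<beta>)"
      "rank_word n (p w) = rank_word n (rank (<) \<gamma>)"
      by (rule rank_word_cong, erule qr)+
    have "fold (instr (length w)) (up_prog (Suc 0) t dE n 0 (q 0 w) @ up_prog (Suc 0) t dE n n (q 1 w) @ move_prog n)
        (xpow (rev (sort \<alpha>) @ rev (sort \<beta>))) = X \<alpha> * X \<beta>"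
      unfolding X_rank_word[of \<alpha>] X_rank_word[of \<beta>] len rw[symmetric]
      by (rule product_prog) (use len qr rl in auto)
    moreover have "fold (instr (length w)) (down_prog (Suc 0) t dF n n (p w)) = foldr F (rank_word n (rank (<) \<gamma>))"
      unfolding rw(3)[symmetric] by (rule down_prog_fold) (use qr rl(3)[of _ "(<)"] in \<open>force simp: less_imp_le\<close>)
    ultimately have run: "fold (instr (length w)) (prog w) (xpow (rev (sort \<alpha>) @ rev (sort \<beta>))) =
        W (length w) n * foldr F (rank_word n (rank (<) \<gamma>)) (X \<alpha> * X \<beta>)"
      unfolding prog_def n by (simp add: weight_prog_fold)
    \<comment> \<open>The program truncates at the input length, which is large enough for this
      \<open>\<gamma>\<close>; every other index gets a degree that suffices for itself, so that the
      functionals form a dual family.\<close>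
    define S where "S \<delta> = (if \<delta> = \<gamma> then length w else sum_list \<delta> + n)" for \<delta>
    have "dual_family n X (%\<gamma>. dual (S \<gamma>) n \<gamma>)"
    proof (rule dual_family_X, rule ballI)
      fix \<delta> :: "nat list" and x assume "x \<in> set \<delta>"
      then have "x <= sum_list \<delta>" by (intro member_le_sum_list) auto
      then show "x + n <= S \<delta>" using size(3) by (auto simp: S_def)
    qed
    from dual_family.structure_const[OF this abc]
    have "structure_const X \<alpha> \<beta> \<gamma> = dual (length w) n \<gamma> (X \<alpha> * X \<beta>)" by (simp add: S_def)
    also have "\<dots> = of_int (f w)"
      using f(2)[of w] valid unfolding n init target run dual_def by simp
    finally show ?thesis by (simp add: w_def)
  qed
  with f(1) show ?thesis unfolding constants_in_GapP_def by blast
qed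

lemma poly_basis_X: "poly_basis n X"
proof -
  have "x + n <= sum_list \<gamma> + n" if "x \<in> set \<gamma>" for x and \<gamma> :: "nat list" using member_le_sum_list[OF that] by simp
  then show ?thesis using dual_family.poly_basis[OF dual_family_X[of n "%\<gamma>. sum_list \<gamma> + n"]] by blast
qed

end

text \<open>Without ties every later entry is either smaller or larger, so the word that builds a
  Schubert polynomial can be computed from the code without decoding the permutation.\<close>

lemma rank_greater_distinct:
  assumes "distinct \<beta>" "length \<beta> = m" "k < m"
  shows "rank (>) \<beta> k = m - Suc k - rank (<) \<beta> k"
proof -
  let ?A = "{j. k < j & j < length \<beta> & \<beta> ! j > \<beta> ! k}" and ?B = "{j. k < j & j < length \<beta> & \<beta> ! j < \<beta> ! k}"
  have *: "\<beta> ! j < \<beta> ! k | \<beta> ! k < \<beta> ! j" if "k < j" "j < length \<beta>" for j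
    using that assms by (simp add: nth_eq_iff_index_eq flip: neq_iff)
  have "{Suc k..<m} = ?A \<union> ?B"
  proof (rule set_eqI)
    fix x show "x \<in> {Suc k..<m} \<longleftrightarrow> x \<in> ?A \<union> ?B" using *[of x] assms(2) by (auto simp: Suc_le_eq)
  qed
  moreover have "card (?A \<union> ?B) = card ?A + card ?B" by (rule card_Un_disjoint) auto
  ultimately have "card ?A + card ?B = m - Suc k" by (metis card_atLeastLessThan)
  then show ?thesis by (simp add: rank_def)
qed

context schubert_ops
begin

lemma constants_in_GapP_Y: "constants_in_GapP Y"
proof -
  \<comment> \<open>The input length serves as the size of the symmetric group: it exceeds the sum
    of the parts plus \<open>n\<close> for each of the three compositions, so their codes
    fit.\<close>
  let ?n = "%w. num_parts w" and ?m = "%w :: bool list. length w"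
  define q where "q c w k = ?m w - Suc k - (if k < ?n w then part w c k else 0)" for c w k
  define prog where "prog w = up_prog 0 t dE (?m w) 0 (q 0 w) @ up_prog 0 t dE (?m w) (?m w) (q 1 w) @
    move_prog (?m w) @ down_prog 0 t dF (?n w) (?m w) (part w 2)" for w
  define a where "a w l = (if l < ?m w then ?m w - Suc l else ?m w - Suc (l - ?m w))" for w and l :: nat
  define b where "b w l = (0 :: nat)" for w :: "bool list" and l :: nat
  have pn: "pc (%e :: inp. ?n (Wof e))" by (rule pc_parts)
  have pm: "pc (%e :: inp. ?m (Wof e))" by (intro pc_length disjI1 at_W_intros)
  note pns = pc_snd[OF pn] and pms = pc_snd[OF pm]
  have pq: "pc (%z :: nat \<times> inp. q c (Wof (snd z)) (fst z))" for c
    unfolding q_def by (intro pc_diff pc_if pcb_less pc_Suc pns pms pc_parts(2) pc_var(1) pc_const)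
  have prog: "pcprog (%e :: inp. prog (Wof e))" unfolding prog_def
    by (intro pcprog_append pcprog_up pcprog_move pcprog_down pn pm pc_const pq pc_parts(2))
  have N: "pc (%e :: inp. 2 * ?m (Wof e))" by (intro pc_mult pc_const pm)
  have pa: "pc (%z :: nat \<times> inp. a (Wof (snd z)) (fst z))" unfolding a_def
    by (intro pc_if pcb_less pc_diff pc_Suc pms pc_var(1))
  have pb: "pc (%z :: nat \<times> inp. b (Wof (snd z)) (fst z))" unfolding b_def by (rule pc_const)
  obtain f where f: "f \<in> GapP" "\<And>w. (\<forall>ins\<in>set (prog w). valid_instr (2 * ?m w) ins) ==>
    look (fold (instr (length w)) (prog w) (xpow (map (a w) [0..<2 * ?m w]))) (Poly_Mapping.nth (map (b w) [0..<2 * ?m w])) = of_int (f w)"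
    using GapP_run[OF prog N pm pa pb] by blast
  have "structure_const Y \<alpha> \<beta> \<gamma> = of_int (f (encode3 \<alpha> \<beta> \<gamma>))"
    if abc: "\<alpha> \<in> comps n" "\<beta> \<in> comps n" "\<gamma> \<in> comps n" for n \<alpha> \<beta> \<gamma>
  proof -
    define w where "w = encode3 \<alpha> \<beta> \<gamma>"
    define m where "m = length w"
    have len: "length \<alpha> = n" "length \<beta> = n" "length \<gamma> = n" using abc by (auto simp: comps_def)
    have n: "?n w = n" unfolding w_def by (rule num_parts_encode3[OF len])
    have parts: "i < n ==> part w 0 i = \<alpha> ! i" "i < n ==> part w 1 i = \<beta> ! i" "i < n ==> part w 2 i = \<gamma> ! i" for i
      unfolding w_def using part_encode3[OF len] by auto
    note parts = parts parts(2)[unfolded One_nat_def]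
    have size: "sum_list \<alpha> + n < m" "sum_list \<beta> + n < m" "sum_list \<gamma> + n < m"
      using length_encode3_ge[OF len] by (auto simp: w_def m_def)
    have small: "\<delta> ! k + k < m" if "length \<delta> = n" "sum_list \<delta> + n < m" "k < n" for \<delta> k
      using elem_le_sum_list[of k \<delta>] that by simp
    have fits: "code_fits m \<alpha>" "code_fits m \<beta>"
      using small[OF len(1) size(1)] small[OF len(2) size(2)] len size by (auto simp: code_fits_def)
    note ca = code_list[OF fits(1)] and cb = code_list[OF fits(2)]
    let ?a = "code_list m \<alpha>" and ?b = "code_list m \<beta>"
    have qr: "q 0 w k = rank (>) ?a k" "q 1 w k = rank (>) ?b k" if "k < m" for k
      unfolding q_def n m_def[symmetric] rank_greater_distinct[OF ca(4,3) that] rank_greater_distinct[OF cb(4,3) that]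
        ca(2)[OF that] cb(2)[OF that]
      using len by (auto simp: nth_default_def parts)
    have rl: "k + rank r ?a k < m" "k + rank r ?b k < m" if "k < m" for r k
      using rank_less[of k ?a r] rank_less[of k ?b r] that ca(3) cb(3) by auto
    have pl: "k + part w 2 k < m" if "k < n" for k using small[OF len(3) size(3) that] parts(3)[OF that] by simp
    have valid: "\<forall>ins\<in>set (prog w). valid_instr (2 * m) ins"
    proof -
      have "\<forall>ins\<in>set (up_prog 0 t dE m 0 (q 0 w)). valid_instr (0 + m) ins"
        by (rule up_prog_valid) (use qr rl in simp)
      moreover have "\<forall>ins\<in>set (up_prog 0 t dE m m (q 1 w)). valid_instr (m + m) ins"
        by (rule up_prog_valid) (use qr rl in simp)
      moreover have "\<forall>ins\<in>set (down_prog 0 t dF n m (part w 2)). valid_instr m ins"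
        by (rule down_prog_valid) (rule pl)
      ultimately show ?thesis unfolding prog_def n m_def[symmetric] using move_prog_valid[of m]
        by (auto intro: valid_instr_mono simp: mult_2)
    qed
    have init: "map (a w) [0..<2 * m] = rev [0..<m] @ rev [0..<m]"
      by (rule map_rev_append) (auto simp: a_def m_def[symmetric])
    have target: "Poly_Mapping.nth (map (b w) [0..<2 * m]) = 0"
      by (rule poly_mapping_eqI) (simp add: look_nth b_def)
    have rw: "rank_word m (q 0 w) = rank_word m (rank (>) ?a)" "rank_word m (q 1 w) = rank_word m (rank (>) ?b)"
      "rank_word n (part w 2) = rank_word n (%k. \<gamma> ! k)"
      by (rule rank_word_cong, erule qr parts)+
    have sort: "sort ?a = [0..<m]" "sort ?b = [0..<m]"
      using ca(1) cb(1) by (metis properties_for_sort sorted_upt)+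
    have "fold (instr m) (up_prog 0 t dE m 0 (q 0 w) @ up_prog 0 t dE m m (q 1 w) @ move_prog m)
        (xpow (rev [0..<m] @ rev [0..<m])) = Y \<alpha> * Y \<beta>"
      unfolding Y_code_list[OF fits(1)] Y_code_list[OF fits(2)] X_rank_word[of ?a] X_rank_word[of ?b] ca(3) cb(3) rw[symmetric] sort
      by (rule product_prog) (use qr rl in auto)
    moreover have "fold (instr m) (down_prog 0 t dF n m (part w 2)) = foldr F (rank_word n (%k. \<gamma> ! k))"
      unfolding rw(3)[symmetric] by (rule down_prog_fold) (use pl in \<open>force simp: less_imp_le\<close>)
    ultimately have run: "fold (instr m) (prog w) (xpow (rev [0..<m] @ rev [0..<m])) =
        foldr F (rank_word n (%k. \<gamma> ! k)) (Y \<alpha> * Y \<beta>)"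
      unfolding prog_def n m_def[symmetric] by simp
    have "structure_const Y \<alpha> \<beta> \<gamma> = dual n \<gamma> (Y \<alpha> * Y \<beta>)"
      by (rule dual_family.structure_const[OF dual_family_Y abc])
    also have "\<dots> = of_int (f w)"
      using f(2)[of w] valid unfolding m_def[symmetric] init target run dual_def by simp
    finally show ?thesis by (simp add: w_def)
  qed
  with f(1) show ?thesis unfolding constants_in_GapP_def by blast
qed

end

text \<open>The right-hand sides keep the literal shape of \<open>E\<close> for each choice of
  \<open>s\<close>, \<open>t\<close>, \<open>c\<close>, so that rewriting with them identifies the
  families with the locale constants by reflexivity.\<close>

lemma key_operators:
  "divdiff i (var i * f) = T (Suc 0) 0 i f + of_nat 1 * f"
  "divdiff i (var i * f) - f = T (Suc 0) 0 i f + of_nat 0 * f"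
  "divdiff i (var i * (1 - var (Suc i)) * f) = T (Suc 0) 1 i f + of_nat 1 * f"
  "divdiff i f = T 0 0 i f + of_nat 0 * f"
  "divdiff i ((1 - var (Suc i)) * f) = T 0 1 i f + of_nat 1 * f"
  using divdiff_T[of "Suc 0" i 0 f] divdiff_T[of "Suc 0" i 1 f] divdiff_T[of 0 i 0 f] divdiff_T[of 0 i 1 f]
  by (simp_all add: bfac_def tau_def)

interpretation key: key_ops 0 1 by unfold_locales (auto simp: tau_def)
interpretation atom: key_ops 0 0 by unfold_locales (auto simp: tau_def)
interpretation lascoux: key_ops 1 1 by unfold_locales (auto simp: tau_def)
interpretation schubert: schubert_ops 0 by unfold_locales (auto simp: tau_def)
interpretation grothendieck: schubert_ops 1 by unfold_locales (auto simp: tau_def)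

lemma families:
  "key_poly = key.X" "demazure_atom = atom.X" "lascoux_poly = lascoux.X"
  "schubert_poly = schubert.Y" "grothendieck_poly = grothendieck.Y"
  unfolding key_poly_def[abs_def] demazure_atom_def[abs_def] lascoux_poly_def[abs_def] schubert_poly_def[abs_def]
    grothendieck_poly_def[abs_def] schubert_perm_def grothendieck_perm_def
    key.X_def[abs_def] atom.X_def[abs_def] lascoux.X_def[abs_def] schubert.Y_def[abs_def] grothendieck.Y_def[abs_def]
    key.E_def[abs_def] atom.E_def[abs_def] lascoux.E_def[abs_def] schubert.E_def[abs_def] grothendieck.E_def[abs_def]
    key_operators[symmetric] by (rule refl)+

theorem theorem1p4:
  shows "((\<forall>n. poly_basis n monomial_slide) \<and> constants_in_sharpP monomial_slide) \<and>
    ((\<forall>n. poly_basis n fundamental_slide) \<and> constants_in_sharpP fundamental_slide) \<and>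
    ((\<forall>n. poly_basis n demazure_atom) \<and> constants_in_GapP demazure_atom) \<and>
    ((\<forall>n. poly_basis n key_poly) \<and> constants_in_GapP key_poly) \<and>
    ((\<forall>n. poly_basis n schubert_poly) \<and> constants_in_GapP schubert_poly) \<and>
    ((\<forall>n. poly_basis n lascoux_poly) \<and> constants_in_GapP lascoux_poly) \<and>
    ((\<forall>n. poly_basis n grothendieck_poly) \<and> constants_in_GapP grothendieck_poly)"
  unfolding families
  using poly_basis_monomial_slide monomial_in_sharpP poly_basis_fundamental_slide fundamental_in_sharpP
    atom.poly_basis_X atom.constants_in_GapP_X key.poly_basis_X key.constants_in_GapP_X
    lascoux.poly_basis_X lascoux.constants_in_GapP_X
    dual_family.poly_basis[OF schubert.dual_family_Y] schubert.constants_in_GapP_Y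
    dual_family.poly_basis[OF grothendieck.dual_family_Y] grothendieck.constants_in_GapP_Y
  by blast

end
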